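(* Let $(Q,W)$ be a quiver with finite potential whose cyclic derivatives generate an admissible ideal of $kQ$, let $\Lambda=\mathcal P(Q,W)$, and let a finite cyclic group $G=\langle g\rangle$ of order $n$ act on $(Q,W)$ such that assumptions (A1)–(A7) of the context hold. Let $\eta\in\Lambda G$ be the idempotent defined in the context, let the dual group $\hat G$ act on $\eta(\Lambda G)\eta$ as in the context, and let $\theta=\sum_{s\in\mathcal E_G}s\otimes1\in(\eta(\Lambda G)\eta)\hat G$. Then the isomorphism of quivers $\phi:(Q_G)_{\hat G}\to Q$ defined in the context induces an isomorphism of algebras $$\theta\big((\eta(\Lambda G)\eta)\hat G\big)\theta\cong\Lambda .$$
   Context: **Conventions.** $k$ is a field. Quivers are finite and connected; $Q_0,Q_1$ are the vertices and arrows, $\mathfrak s(\alpha),\mathfrak t(\alpha)$ the start and target of an arrow. Arrows are composed right to left (as functions). A vertex is identified with its idempotent (trivial path). If a finite group $G$ acts on an algebra $A$ by automorphisms, the skew group algebra $AG$ is $A\otimes_k kG$ with $(\lambda\otimes g)(\mu\otimes h)=\lambda g(\mu)\otimes gh$. **Quivers with potential.** $\widehat{kQ}$ is the completion of $kQ$ in the $\langle Q_1\rangle$-adic topology, $\mathrm{com}_Q=\overline{[\widehat{kQ},\widehat{kQ}]}$. A potential is an element $W\in\langle Q_1\rangle^3/(\langle Q_1\rangle^3\cap\mathrm{com}_Q)$, i.e. a (possibly infinite) linear combination of cycles of length at least 3, taken up to cyclic permutation; it is finite if it can be written as a finite linear combination. The cyclic derivative $\partial_\alpha$ ($\alpha\in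 Q_1$) is the continuous linear map with $\partial_\alpha(\alpha_1\cdots\alpha_l)=\sum_{m:\alpha_m=\alpha}\alpha_{m+1}\cdots\alpha_l\alpha_1\cdots\alpha_{m-1}$. The Jacobian algebra is $\mathcal P(Q,W)=\widehat{kQ}/\overline{\langle\partial_\alpha W\mid\alpha\in Q_1\rangle}$. Write $W=\sum_c a(c)c$; the cycles appearing in $W$ are those with $a(c)\ne0$. **Assumptions.** $G$ is cyclic of order $n$ with generator $g$, acting on $kQ$ by automorphisms. A vertex is "fixed" if it is fixed by $G$. (A1) $k$ contains a primitive $n$-th root of unity $\zeta$ (in particular $n\ne0$ in $k$). (A2) $G$ permutes the vertices of $Q$ and maps every arrow to a scalar multiple of an arrow. (A3) Every vertex which is not fixed has an orbit of cardinality $n$. (A4) $GW=W$ in $\widehat{kQ}/\mathrm{com}_Q$ (so $G$ acts on $\Lambda$). (A5) If $\alpha$ is an arrow between two fixed vertices, then $g(\alpha)=\zeta^{b(\alpha)}\alpha$ for an integer $b(\alpha)$. (A6) Arrows with at least one non-fixed end are sent to arrows by $G$. (A7) Every cycle $c$ appearing in $W$ is of one of the types: (i) $c$ goes through no fixed vertex; (ii) $c$ goes through exactly one (counted with multiplicity) fixed vertex; (iii) $c$ goes through exactly one (counted with multiplicity) non-fixed vertex; (iv) $c$ goes only through fixed vertices. Integers used as indices or exponents of $g,\zeta$ are read modulo $n$. The action $*$ of $G$ on $Q$ is $g*v=g(v)$ on vertices, and $g*\alpha=\beta$ if $\beta$ is the arrow of which $g(\alpha)$ is a scalar multiple; it extends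 to cycles arrow by arrow. **Idempotents.** $e_\mu=\frac1n\sum_{i=0}^{n-1}\zeta^{i\mu}g^i\in kG$, $\mu=0,\dots,n-1$. Fix a set $\mathcal E\subseteq Q_0$ of representatives of the $G$-orbits of vertices, $\mathcal E=\mathcal E'\sqcup\mathcal E''$, with $\mathcal E'$ the non-fixed ones (orbits of size $n$) and $\mathcal E''$ the fixed ones. Put $\eta^\varepsilon=\varepsilon\otimes1$ for $\varepsilon\in\mathcal E'$, $\eta^\varepsilon_\mu=\varepsilon\otimes e_\mu$ for $\varepsilon\in\mathcal E''$, and $\eta=\sum_{\varepsilon\in\mathcal E'}\eta^\varepsilon+\sum_{\varepsilon\in\mathcal E''}\sum_\mu\eta^\varepsilon_\mu$. **The quiver $Q_G$.** Its vertices are the $\eta^\varepsilon$ ($\varepsilon\in\mathcal E'$) and $\eta^\varepsilon_\mu$ ($\varepsilon\in\mathcal E''$, $0\le\mu\le n-1$). Its arrows are the following elements (with $0\le\mu\le n-1$): - type (1): for each arrow $\alpha:g^t(\varepsilon)\to\varepsilon'$ of $Q$ with $\varepsilon,\varepsilon'\in\mathcal E'$, $\tilde\alpha=\alpha\otimes g^t:\eta^\varepsilon\to\eta^{\varepsilon'}$; put $t(\alpha)=t$; - type (2): for each $\alpha:\varepsilon\to\varepsilon'$ with $\varepsilon\in\mathcal E',\varepsilon'\in\mathcal E''$, $\tilde\alpha^\mu=(1\otimes e_\mu)(\alpha\otimes1):\eta^\varepsilon\to\eta^{\varepsilon'}_\mu$; - type (3): for each $\alpha:\varepsilon\to\varepsilon'$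 with $\varepsilon\in\mathcal E'',\varepsilon'\in\mathcal E'$, $\tilde\alpha^\mu=\alpha\otimes e_\mu:\eta^\varepsilon_\mu\to\eta^{\varepsilon'}$; - type (4): for each $\alpha:\varepsilon\to\varepsilon'$ with $\varepsilon,\varepsilon'\in\mathcal E''$, $\tilde\alpha^\mu=\alpha\otimes e_\mu:\eta^\varepsilon_\mu\to\eta^{\varepsilon'}_{\mu-b(\alpha)}$. For types (2),(3),(4) put $t(\alpha)=0$. **The potential $W_G$.** For each cycle $c$ of $W$ one picks $\hat c$ in the orbit $G*c$ (the same for all cycles in the orbit), written up to cyclic permutation as $\hat c=\alpha_1\,g^{t_1}(\alpha_2)\,g^{t_1+t_2}(\alpha_3)\cdots g^{t_1+\dots+t_{l-1}}(\alpha_l)$ with $\alpha_i:g^{t_i}(\varepsilon_i)\to\varepsilon_{i-1}$, $\varepsilon_i\in\mathcal E$, $\varepsilon_0=\varepsilon_l$, as follows. (i) $c$ of type (i): any $\hat c\in G*c$ through a vertex of $\mathcal E'$, all $\varepsilon_i\in\mathcal E'$; each $\alpha_i$ has type (1), $t_i=t(\alpha_i)$. Put $\tilde c=\tilde\alpha_1\cdots\tilde\alpha_l$. (ii) $c$ of type (ii): the unique $\hat c$ with $\varepsilon_1\in\mathcal E''$, $\varepsilon_i\in\mathcal E'$ for $i\ne1$, $t_1=0$. Then $\alpha_1$ has type (3), $g^{-t_2}(\alpha_2)$ has type (2), and $\alpha_i$ has type (1) with $t_i=t(\alpha_i)$ for $i\ge3$. Put $p(c)=t_2$ and $\tilde c^\mu=\tilde\alpha_1^\mu\,\widetilde{g^{-t_2}(\alpha_2)}^\mu\,\tilde\alpha_3\cdots\tilde\alpha_l$.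 (iii) $c$ of type (iii): the unique $\hat c$ with $\varepsilon_1\in\mathcal E'$, $\varepsilon_i\in\mathcal E''$ for $i\neq1$, all $t_i=0$. Then $\alpha_1,\alpha_2$ have types (2),(3) and $\alpha_i$ has type (4) for $i\ge3$. With $b_i=b(\alpha_i)+\dots+b(\alpha_l)$ for $i\ge3$, put $q(c)=b_3$ and $\tilde c^\mu=\tilde\alpha_1^\mu\tilde\alpha_2^{\mu-b_3}\tilde\alpha_3^{\mu-b_4}\cdots\tilde\alpha_{l-1}^{\mu-b_l}\tilde\alpha_l^\mu$. (iv) $c$ of type (iv): $\hat c=c=\alpha_1\cdots\alpha_l$, all $\varepsilon_i\in\mathcal E''$, all $t_i=0$, all $\alpha_i$ of type (4). With $b_i=b(\alpha_i)+\dots+b(\alpha_l)$, put $\tilde c^\mu=\tilde\alpha_1^{\mu-b_2}\tilde\alpha_2^{\mu-b_3}\cdots\tilde\alpha_{l-1}^{\mu-b_l}\tilde\alpha_l^\mu$. Let $\mathcal C(x)=\{\hat c\mid c\text{ a cycle of }W\text{ of type }x\}$ for $x=$ (i),…,(iv), and $$W_G=\sum_{c\in\mathcal C(\mathrm i)}a(c)\frac{|Gc|}{n}\tilde c+\sum_{c\in\mathcal C(\mathrm{ii})}a(c)\sum_{\mu=0}^{n-1}\zeta^{-p(c)\mu}\tilde c^\mu+\sum_{c\in\mathcal C(\mathrm{iii})\cup\mathcal C(\mathrm{iv})}a(c)\sum_{\mu=0}^{n-1}\tilde c^\mu .$$ **Dual group action and second construction.** $\hat G=\mathrm{Hom}(G,k^*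 )$ is cyclic of order $n$ with generator $\chi$, $\chi(g)=\zeta$. It acts on $\Lambda G$ by $\chi(\lambda\otimes h)=\chi(h)\lambda\otimes h$; this restricts to an action on $\eta(\Lambda G)\eta\cong\mathcal P(Q_G,W_G)$, given on $Q_G$ by $\chi(\eta^\varepsilon)=\eta^\varepsilon$, $\chi(\eta^\varepsilon_\mu)=\eta^\varepsilon_{\mu+1}$, $\chi(\tilde\alpha)=\zeta^{t(\alpha)}\tilde\alpha$ for $\alpha$ of type (1), and $\chi(\tilde\alpha^\mu)=\tilde\alpha^{\mu+1}$ for $\alpha$ of type (2),(3),(4). This action on $(Q_G,W_G)$ again satisfies (A1)–(A7) (with generator $\chi$ and the same $\zeta$). Apply to it the construction which produces the quiver with potential $(Q_G,W_G)$ from $(Q,W)$, $G=\langle g\rangle$ and $\mathcal E=\mathcal E'\sqcup\mathcal E''$, with $(Q,W)$, $G$, $g$ replaced by $(Q_G,W_G)$, $\hat G$, $\chi$, using the orbit representatives $\mathcal E_G=\mathcal E'_G\sqcup\mathcal E''_G$, $\mathcal E'_G=\{\eta^\varepsilon_0\mid\varepsilon\in\mathcal E''\}$ (non-fixed), $\mathcal E''_G=\{\eta^\varepsilon\mid\varepsilon\in\mathcal E'\}$ (fixed) in place of $\mathcal E,\mathcal E',\mathcal E''$; the result is $((Q_G)_{\hat G},(W_G)_{\hat G})$. With respect to $\hat G$ and $\mathcal E_G$, the arrow $\tilde\alpha^{b(\alpha)}$ of $Q_G$ has type (1) with $t(\tilde\alpha^{b(\alpha)})=b(\alpha)$ if $\alpha$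 has type (4) in $Q$; $\tilde\alpha^0$ has type (2), resp. (3), if $\alpha$ has type (3), resp. (2), in $Q$; and $\tilde\alpha$ has type (4) with $b(\tilde\alpha)=t(\alpha)$ if $\alpha$ has type (1) in $Q$. Writing $W_G=\sum_d a(d)d$, and defining $\hat d$, $\tilde d$, $\tilde d^\nu$, $p(d)$ and the sets $\mathcal C_G(x)=\{\hat d\mid d\text{ a cycle of }W_G\text{ of type }x\}$ for the cycles $d$ of $W_G$ in the same way as $\hat c$, $\tilde c$, $\tilde c^\mu$, $p(c)$ and $\mathcal C(x)$ are defined for the cycles $c$ of $W$ (with these replacements), the potential is $$(W_G)_{\hat G}=\sum_{d\in\mathcal C_G(\mathrm i)}a(d)\frac{|\hat Gd|}{n}\tilde d+\sum_{d\in\mathcal C_G(\mathrm{ii})}a(d)\sum_{\nu=0}^{n-1}\zeta^{-p(d)\nu}\tilde d^\nu+\sum_{d\in\mathcal C_G(\mathrm{iii})\cup\mathcal C_G(\mathrm{iv})}a(d)\sum_{\nu=0}^{n-1}\tilde d^\nu .$$ The vertices of $(Q_G)_{\hat G}$ are $\eta^\varepsilon_0\otimes1$ ($\varepsilon\in\mathcal E''$) and $\eta^\varepsilon\otimes e_\nu$ ($\varepsilon\in\mathcal E'$, $0\le\nu\le n-1$), where here $e_\nu=\frac1n\sum_i\zeta^{i\nu}\chi^i\in k\hat G$; its arrows are $\tilde\beta$ with $\beta=\tilde\alpha^{b(\alpha)}$ for $\alpha$ of type (4) in $Q$; $\tilde\beta^\nu$ with $\beta=\tilde\alpha^0$ for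 $\alpha$ of type (3) or (2) in $Q$; and $\tilde\beta^\nu$ with $\beta=\tilde\alpha$ for $\alpha$ of type (1) in $Q$. **The isomorphism $\phi$.** $\phi:(Q_G)_{\hat G}\to Q$ is given by $\phi(\eta^\varepsilon_0\otimes1)=\varepsilon$ ($\varepsilon\in\mathcal E''$); $\phi(\eta^\varepsilon\otimes e_\mu)=g^\mu(\varepsilon)$ ($\varepsilon\in\mathcal E'$); $\phi(\tilde\beta)=\alpha$ for $\beta=\tilde\alpha^{b(\alpha)}$, $\alpha$ of type (4); $\phi(\tilde\beta^\nu)=g^\nu(\alpha)$ for $\beta=\tilde\alpha^0$, $\alpha$ of type (3) or (2); $\phi(\tilde\beta^\nu)=g^{\nu-t(\alpha)}(\alpha)$ for $\beta=\tilde\alpha$, $\alpha$ of type (1).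
   Formalization: The induced isomorphism sends each vertex x to φ(x) and each arrow x to φ(x), except that arrows coming from type (2) arrows of Q go to (1/n)φ(x); with the arrows being the elements given in the context, the version without the factor 1/n is false in general. *)

theory Defs
  imports
    "HOL-Algebra.Algebra"
    "Graph_Theory.Graph_Theory"
begin

section \<open>Algebras over a field\<close>

text \<open>
  A (unital, not necessarily commutative) algebra over the field \<open>'k\<close> is a record of type
  \<open>('k, 'x) module\<close>, used as a ring together with a scalar multiplication.
\<close>

definition alg_iso :: "('k::field, 'x, 'm) module_scheme \<Rightarrow> ('k, 'y, 'p) module_scheme \<Rightarrow> ('x \<Rightarrow> 'y) set" where
  "alg_iso A B = {F \<in> ring_iso A B. \<forall>c. \<forall>x\<in>carrier A. F (c \<odot>\<^bsub>A\<^esub> x) = c \<odot>\<^bsub>B\<^esub> F x}"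

definition quot_alg :: "('k::field, 'x) module \<Rightarrow> 'x set \<Rightarrow> ('k, 'x set) module" where
  "quot_alg A I =
    \<lparr>carrier = carrier (A Quot I), monoid.mult = monoid.mult (A Quot I), monoid.one = monoid.one (A Quot I),
     ring.zero = ring.zero (A Quot I), ring.add = ring.add (A Quot I),
     smult = (\<lambda>c C. \<Union>x\<in>C. I +>\<^bsub>A\<^esub> (c \<odot>\<^bsub>A\<^esub> x))\<rparr>"

definition corner_alg :: "('k::field, 'x) module \<Rightarrow> 'x \<Rightarrow> ('k, 'x) module" where
  "corner_alg A e = A\<lparr>carrier := {e \<otimes>\<^bsub>A\<^esub> x \<otimes>\<^bsub>A\<^esub> e | x. x \<in> carrier A}, monoid.one := e\<rparr>"

definition algebra_action ::
    "('g, 'm) monoid_scheme \<Rightarrow> ('k::field, 'x) module \<Rightarrow> ('g \<Rightarrow> 'x \<Rightarrow> 'x) \<Rightarrow> bool" where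
  "algebra_action G A \<rho> \<longleftrightarrow>
     group_action G (carrier A) \<rho> \<and> (\<forall>h\<in>carrier G. \<rho> h \<in> alg_iso A A)"


section \<open>Path algebras and their completions\<close>

text \<open>
  A quiver is a \<^locale>\<open>fin_digraph\<close>.  A path \<open>\<alpha>\<^sub>1 \<cdots> \<alpha>\<^sub>l\<close> is composed right to left, i.e.
  \<open>tail \<alpha>\<^sub>i = head \<alpha>\<^sub>i\<^sub>+\<^sub>1\<close>; it is stored as the triple of its target, the list
  \<open>[\<alpha>\<^sub>1, \<dots>, \<alpha>\<^sub>l]\<close> and its source.  The library's walks list the arcs in the
  order in which they are traversed, hence the \<^const>\<open>rev\<close>.
\<close>

type_synonym ('v, 'a) qpath = "'v \<times> 'a list \<times> 'v"

definition p_tgt :: "('v, 'a) qpath \<Rightarrow> 'v" where "p_tgt p = fst p"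
definition p_arrs :: "('v, 'a) qpath \<Rightarrow> 'a list" where "p_arrs p = fst (snd p)"
definition p_src :: "('v, 'a) qpath \<Rightarrow> 'v" where "p_src p = snd (snd p)"
definition p_len :: "('v, 'a) qpath \<Rightarrow> nat" where "p_len p = length (p_arrs p)"

definition qpaths :: "('v, 'a) pre_digraph \<Rightarrow> ('v, 'a) qpath set" where
  "qpaths Q = {p. pre_digraph.awalk Q (p_src p) (rev (p_arrs p)) (p_tgt p)}"

definition qcycles :: "('v, 'a) pre_digraph \<Rightarrow> ('v, 'a) qpath set" where
  "qcycles Q = {p \<in> qpaths Q. p_src p = p_tgt p \<and> p_len p \<ge> 1}"

text \<open>
  An element of the completed path algebra is the function giving its coefficients;
  it vanishes on triples which are not paths, and is otherwise arbitrary.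
\<close>

definition cpath_alg :: "('v, 'a) pre_digraph \<Rightarrow> ('k::field, ('v, 'a) qpath \<Rightarrow> 'k) module" where
  "cpath_alg Q =
    \<lparr>carrier = {f. \<forall>p. p \<notin> qpaths Q \<longrightarrow> f p = 0},
     monoid.mult = (\<lambda>f h p. \<Sum>(q, r) | q \<in> qpaths Q \<and> r \<in> qpaths Q \<and> p_src q = p_tgt r \<and>
                              p = (p_tgt q, p_arrs q @ p_arrs r, p_src r). f q * h r),
     monoid.one = (\<lambda>p. if p \<in> qpaths Q \<and> p_len p = 0 then 1 else 0),
     ring.zero = (\<lambda>p. 0),
     ring.add = (\<lambda>f h p. f p + h p),
     smult = (\<lambda>c f p. c * f p)\<rparr>"

definition path_alg :: "('v, 'a) pre_digraph \<Rightarrow> ('k::field, ('v, 'a) qpath \<Rightarrow> 'k) module" where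
  "path_alg Q = (cpath_alg Q)\<lparr>carrier := {f \<in> carrier (cpath_alg Q). finite {p. f p \<noteq> 0}}\<rparr>"

definition path_elt :: "('v, 'a) qpath \<Rightarrow> ('v, 'a) qpath \<Rightarrow> 'k::field" where
  "path_elt p = (\<lambda>q. if q = p then 1 else 0)"

definition vertex_elt :: "'v \<Rightarrow> ('v, 'a) qpath \<Rightarrow> 'k::field" where
  "vertex_elt v = path_elt (v, [], v)"

definition arrow_elt :: "('v, 'a) pre_digraph \<Rightarrow> 'a \<Rightarrow> ('v, 'a) qpath \<Rightarrow> 'k::field" where
  "arrow_elt Q \<alpha> = path_elt (head Q \<alpha>, [\<alpha>], tail Q \<alpha>)"

text \<open>The power \<open>\<langle>Q\<^sub>1\<rangle>\<^sup>m\<close> of the arrow ideal of \<open>kQ\<close> is spanned by the paths of length at least \<open>m\<close>.\<close>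

definition arrow_ideal_pow :: "('v, 'a) pre_digraph \<Rightarrow> nat \<Rightarrow> (('v, 'a) qpath \<Rightarrow> 'k::field) set" where
  "arrow_ideal_pow Q m = {f \<in> carrier (path_alg Q). \<forall>p. p_len p < m \<longrightarrow> f p = 0}"

definition admissible_ideal :: "('v, 'a) pre_digraph \<Rightarrow> (('v, 'a) qpath \<Rightarrow> 'k::field) set \<Rightarrow> bool" where
  "admissible_ideal Q I \<longleftrightarrow>
     ideal I (path_alg Q) \<and> (\<exists>m\<ge>2. arrow_ideal_pow Q m \<subseteq> I) \<and> I \<subseteq> arrow_ideal_pow Q 2"

definition adic_closure ::
    "('v, 'a) pre_digraph \<Rightarrow> (('v, 'a) qpath \<Rightarrow> 'k::field) set \<Rightarrow> (('v, 'a) qpath \<Rightarrow> 'k) set" where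
  "adic_closure Q S =
     {f \<in> carrier (cpath_alg Q). \<forall>m. \<exists>s\<in>S. \<forall>p. p_len p < m \<longrightarrow> f p = s p}"

text \<open>The commutators are stable under scalars, so the additive group they generate is their span.\<close>

definition com_closure :: "('v, 'a) pre_digraph \<Rightarrow> (('v, 'a) qpath \<Rightarrow> 'k::field) set" where
  "com_closure Q = adic_closure Q
     (generate (add_monoid (cpath_alg Q))
        {x \<otimes>\<^bsub>cpath_alg Q\<^esub> y \<ominus>\<^bsub>cpath_alg Q\<^esub> y \<otimes>\<^bsub>cpath_alg Q\<^esub> x | x y.
           x \<in> carrier (cpath_alg Q) \<and> y \<in> carrier (cpath_alg Q)})"


section \<open>Potentials and Jacobian algebras\<close>

text \<open>
  A finite potential is given by a representative, a finite linear combination of cycles of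
  length at least 3.  Everything below depends only on its class up to cyclic permutation:
  the coefficient of a cycle \<open>c\<close>, taken up to cyclic permutation, is \<open>cyc_coeff W c\<close>.
\<close>

definition finite_potential :: "('v, 'a) pre_digraph \<Rightarrow> (('v, 'a) qpath \<Rightarrow> 'k::field) \<Rightarrow> bool" where
  "finite_potential Q W \<longleftrightarrow>
     finite {c. W c \<noteq> 0} \<and> (\<forall>c. W c \<noteq> 0 \<longrightarrow> c \<in> qcycles Q \<and> p_len c \<ge> 3)"

definition cyc_class :: "('v, 'a) pre_digraph \<Rightarrow> ('v, 'a) qpath \<Rightarrow> ('v, 'a) qpath set" where
  "cyc_class Q c = {d \<in> qcycles Q. \<exists>i. p_arrs d = rotate i (p_arrs c)}"

definition cyc_coeff ::
    "('v, 'a) pre_digraph \<Rightarrow> (('v, 'a) qpath \<Rightarrow> 'k::field) \<Rightarrow> ('v, 'a) qpath \<Rightarrow> 'k" where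
  "cyc_coeff Q W c = (\<Sum>d\<in>cyc_class Q c. W d)"

text \<open>
  The coefficient of \<open>r\<close> in \<open>\<partial>\<^sub>\<alpha> W\<close> collects the coefficients of all cycles
  \<open>\<alpha>\<^sub>1 \<cdots> \<alpha>\<^sub>l\<close> over all positions \<open>m\<close> with \<open>\<alpha>\<^sub>m = \<alpha>\<close> and
  \<open>\<alpha>\<^sub>m\<^sub>+\<^sub>1 \<cdots> \<alpha>\<^sub>l \<alpha>\<^sub>1 \<cdots> \<alpha>\<^sub>m\<^sub>-\<^sub>1 = r\<close> (positions are counted from 0 in lists).
\<close>

definition cyc_deriv ::
    "('v, 'a) pre_digraph \<Rightarrow> 'a \<Rightarrow> (('v, 'a) qpath \<Rightarrow> 'k::field) \<Rightarrow> (('v, 'a) qpath \<Rightarrow> 'k)" where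
  "cyc_deriv Q \<alpha> W = (\<lambda>r. \<Sum>(c, m) | c \<in> qcycles Q \<and> m < p_len c \<and> p_arrs c ! m = \<alpha> \<and>
       r = (tail Q \<alpha>, drop (Suc m) (p_arrs c) @ take m (p_arrs c), head Q \<alpha>). W c)"

definition jacobian_ideal ::
    "('v, 'a) pre_digraph \<Rightarrow> (('v, 'a) qpath \<Rightarrow> 'k::field) \<Rightarrow> (('v, 'a) qpath \<Rightarrow> 'k) set" where
  "jacobian_ideal Q W = adic_closure Q (Idl\<^bsub>cpath_alg Q\<^esub> {cyc_deriv Q \<alpha> W | \<alpha>. \<alpha> \<in> arcs Q})"

definition jacobian_alg ::
    "('v, 'a) pre_digraph \<Rightarrow> (('v, 'a) qpath \<Rightarrow> 'k::field) \<Rightarrow>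
     ('k, (('v, 'a) qpath \<Rightarrow> 'k) set) module" where
  "jacobian_alg Q W = quot_alg (cpath_alg Q) (jacobian_ideal Q W)"

definition jac_class ::
    "('v, 'a) pre_digraph \<Rightarrow> (('v, 'a) qpath \<Rightarrow> 'k::field) \<Rightarrow> (('v, 'a) qpath \<Rightarrow> 'k) \<Rightarrow>
     (('v, 'a) qpath \<Rightarrow> 'k) set" where
  "jac_class Q W f = jacobian_ideal Q W +>\<^bsub>cpath_alg Q\<^esub> f"

text \<open>
  The continuous extension to \<open>cpath_alg Q\<close> of an action on \<open>path_alg Q\<close> which preserves the
  length of paths: the coefficient at \<open>q\<close> of the image of \<open>f\<close> depends only on the part of \<open>f\<close>
  of length at most that of \<open>q\<close>.
\<close>

definition completed_action ::
    "('v, 'a) pre_digraph \<Rightarrow> ('g \<Rightarrow> (('v, 'a) qpath \<Rightarrow> 'k::field) \<Rightarrow> (('v, 'a) qpath \<Rightarrow> 'k)) \<Rightarrow>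
     'g \<Rightarrow> (('v, 'a) qpath \<Rightarrow> 'k) \<Rightarrow> (('v, 'a) qpath \<Rightarrow> 'k)" where
  "completed_action Q \<rho> h = (\<lambda>f\<in>carrier (cpath_alg Q). \<lambda>q.
      \<rho> h (\<lambda>p. if p_len p \<le> p_len q then f p else 0) q)"

definition jacobian_action ::
    "('v, 'a) pre_digraph \<Rightarrow> (('v, 'a) qpath \<Rightarrow> 'k::field) \<Rightarrow>
     ('g \<Rightarrow> (('v, 'a) qpath \<Rightarrow> 'k) \<Rightarrow> (('v, 'a) qpath \<Rightarrow> 'k)) \<Rightarrow>
     'g \<Rightarrow> (('v, 'a) qpath \<Rightarrow> 'k) set \<Rightarrow> (('v, 'a) qpath \<Rightarrow> 'k) set" where
  "jacobian_action Q W \<rho> h =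
     (\<lambda>C\<in>carrier (jacobian_alg Q W). completed_action Q \<rho> h ` C)"


section \<open>Skew group algebras and the dual group\<close>

text \<open>
  For finite \<open>G\<close>, an element of \<open>A \<otimes> kG\<close> is the function \<open>f\<close> with
  \<open>f = \<Sum>h. f h \<otimes> h\<close>.  The product is determined by
  \<open>(a \<otimes> y)(b \<otimes> z) = a y(b) \<otimes> y z\<close>.
\<close>

definition skew_alg ::
    "('k::field, 'x) module \<Rightarrow> ('g, 'm) monoid_scheme \<Rightarrow> ('g \<Rightarrow> 'x \<Rightarrow> 'x) \<Rightarrow> ('k, 'g \<Rightarrow> 'x) module" where
  "skew_alg A G \<rho> =
    \<lparr>carrier = carrier G \<rightarrow>\<^sub>E carrier A,
     monoid.mult = (\<lambda>f h. \<lambda>x\<in>carrier G.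
        \<Oplus>\<^bsub>A\<^esub>y\<in>carrier G. f y \<otimes>\<^bsub>A\<^esub> \<rho> y (h (inv\<^bsub>G\<^esub> y \<otimes>\<^bsub>G\<^esub> x))),
     monoid.one = (\<lambda>x\<in>carrier G. if x = \<one>\<^bsub>G\<^esub> then \<one>\<^bsub>A\<^esub> else \<zero>\<^bsub>A\<^esub>),
     ring.zero = (\<lambda>x\<in>carrier G. \<zero>\<^bsub>A\<^esub>),
     ring.add = (\<lambda>f h. \<lambda>x\<in>carrier G. f x \<oplus>\<^bsub>A\<^esub> h x),
     smult = (\<lambda>c f. \<lambda>x\<in>carrier G. c \<odot>\<^bsub>A\<^esub> f x)\<rparr>"

text \<open>\<open>skew_tensor A G a u\<close> is \<open>a \<otimes> u\<close>, where \<open>u \<in> kG\<close> is given by its coefficients.\<close>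

definition skew_tensor ::
    "('k::field, 'x) module \<Rightarrow> ('g, 'm) monoid_scheme \<Rightarrow> 'x \<Rightarrow> ('g \<Rightarrow> 'k) \<Rightarrow> 'g \<Rightarrow> 'x" where
  "skew_tensor A G a u = (\<lambda>x\<in>carrier G. u x \<odot>\<^bsub>A\<^esub> a)"

definition grp_elt :: "'g \<Rightarrow> 'g \<Rightarrow> 'k::field" where
  "grp_elt h = (\<lambda>x. if x = h then 1 else 0)"

definition grp_idem :: "('g, 'm) monoid_scheme \<Rightarrow> 'g \<Rightarrow> nat \<Rightarrow> 'k::field \<Rightarrow> nat \<Rightarrow> 'g \<Rightarrow> 'k" where
  "grp_idem G g n \<zeta> \<mu> =
     (\<lambda>x. inverse (of_nat n) * (\<Sum>i<n. \<zeta> ^ (i * \<mu>) * grp_elt (g [^]\<^bsub>G\<^esub> i) x))"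

definition dual_group :: "('g, 'm) monoid_scheme \<Rightarrow> ('g \<Rightarrow> 'k::field) monoid" where
  "dual_group G =
    \<lparr>carrier = {\<chi> \<in> carrier G \<rightarrow>\<^sub>E UNIV - {0}.
                  \<forall>x\<in>carrier G. \<forall>y\<in>carrier G. \<chi> (x \<otimes>\<^bsub>G\<^esub> y) = \<chi> x * \<chi> y},
     monoid.mult = (\<lambda>\<chi> \<psi>. \<lambda>x\<in>carrier G. \<chi> x * \<psi> x),
     monoid.one = (\<lambda>x\<in>carrier G. 1)\<rparr>"

definition dual_gen :: "('g, 'm) monoid_scheme \<Rightarrow> 'g \<Rightarrow> 'k::field \<Rightarrow> 'g \<Rightarrow> 'k" where
  "dual_gen G g \<zeta> = (THE \<chi>. \<chi> \<in> carrier (dual_group G) \<and> \<chi> g = \<zeta>)"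

text \<open>The action \<open>\<chi>(a \<otimes> h) = \<chi>(h) a \<otimes> h\<close>, restricted to a subset \<open>S\<close> of \<open>A \<otimes> kG\<close>.\<close>

definition dual_action ::
    "('k::field, 'x) module \<Rightarrow> ('g, 'm) monoid_scheme \<Rightarrow> ('g \<Rightarrow> 'x) set \<Rightarrow>
     ('g \<Rightarrow> 'k) \<Rightarrow> ('g \<Rightarrow> 'x) \<Rightarrow> ('g \<Rightarrow> 'x)" where
  "dual_action A G S \<chi> = (\<lambda>f\<in>S. \<lambda>h\<in>carrier G. \<chi> h \<odot>\<^bsub>A\<^esub> f h)"


section \<open>The quiver \<open>Q\<^sub>G\<close>\<close>

text \<open>
  The data from which \<open>Q\<^sub>G\<close> is built, so that the construction can be applied to \<open>Q\<close> and to
  \<open>Q\<^sub>G\<close> itself: a quiver, the action of the chosen generator \<open>g\<close>, given by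
  \<open>g(v) = gen_v v\<close> and \<open>g(\<alpha>) = gen_c \<alpha> \<cdot> gen_a \<alpha>\<close>, and the sets \<open>\<E>'\<close> (\<open>reps_free\<close>) and
  \<open>\<E>''\<close> (\<open>reps_fixed\<close>) of orbit representatives.
\<close>

record ('v, 'a, 'k) gquiver =
  quiver :: "('v, 'a) pre_digraph"
  gen_v :: "'v \<Rightarrow> 'v"
  gen_a :: "'a \<Rightarrow> 'a"
  gen_c :: "'a \<Rightarrow> 'k"
  reps_free :: "'v set"
  reps_fixed :: "'v set"

text \<open>
  Labels for the vertices \<open>\<eta>\<^sup>\<epsilon>\<close>, \<open>\<eta>\<^sup>\<epsilon>\<^sub>\<mu>\<close> and the arrows
  \<open>\<alpha>~\<close>, \<open>\<alpha>~\<^sup>\<mu>\<close> of \<open>Q\<^sub>G\<close>; the index \<open>\<mu>\<close> ranges over \<open>{0..<n}\<close>.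
\<close>

datatype 'v skew_vert = Eta 'v | EtaMu 'v nat
datatype 'a skew_arr = Til 'a | TilMu 'a nat

text \<open>
  The arrows of \<open>Q\<close> which give rise to arrows of \<open>Q\<^sub>G\<close> are of four types: \<open>arr1\<close>
  (\<open>g\<^sup>t(\<epsilon>) \<rightarrow> \<epsilon>'\<close> with \<open>\<epsilon>, \<epsilon>' \<in> \<E>'\<close>), \<open>arr2\<close> (from \<open>\<E>'\<close> to \<open>\<E>''\<close>),
  \<open>arr3\<close> (from \<open>\<E>''\<close> to \<open>\<E>'\<close>) and \<open>arr4\<close> (within \<open>\<E>''\<close>).
\<close>

definition src_index :: "nat \<Rightarrow> ('v, 'a, 'k) gquiver \<Rightarrow> 'a \<Rightarrow> 'v \<Rightarrow> nat \<Rightarrow> bool" where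
  "src_index n D \<alpha> \<epsilon> t \<longleftrightarrow>
     \<epsilon> \<in> reps_free D \<and> t < n \<and> tail (quiver D) \<alpha> = (gen_v D ^^ t) \<epsilon>"

definition arr1 :: "nat \<Rightarrow> ('v, 'a, 'k) gquiver \<Rightarrow> 'a set" where
  "arr1 n D = {\<alpha> \<in> arcs (quiver D). (\<exists>\<epsilon> t. src_index n D \<alpha> \<epsilon> t) \<and> head (quiver D) \<alpha> \<in> reps_free D}"

definition arr2 :: "('v, 'a, 'k) gquiver \<Rightarrow> 'a set" where
  "arr2 D = {\<alpha> \<in> arcs (quiver D). tail (quiver D) \<alpha> \<in> reps_free D \<and> head (quiver D) \<alpha> \<in> reps_fixed D}"

definition arr3 :: "('v, 'a, 'k) gquiver \<Rightarrow> 'a set" where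
  "arr3 D = {\<alpha> \<in> arcs (quiver D). tail (quiver D) \<alpha> \<in> reps_fixed D \<and> head (quiver D) \<alpha> \<in> reps_free D}"

definition arr4 :: "('v, 'a, 'k) gquiver \<Rightarrow> 'a set" where
  "arr4 D = {\<alpha> \<in> arcs (quiver D). tail (quiver D) \<alpha> \<in> reps_fixed D \<and> head (quiver D) \<alpha> \<in> reps_fixed D}"

text \<open>\<open>t(\<alpha>)\<close> and the representative of the source, for \<open>\<alpha>\<close> of type (1).\<close>

definition t_ind :: "nat \<Rightarrow> ('v, 'a, 'k) gquiver \<Rightarrow> 'a \<Rightarrow> nat" where
  "t_ind n D \<alpha> = (THE t. \<exists>\<epsilon>. src_index n D \<alpha> \<epsilon> t)"

definition src_rep :: "nat \<Rightarrow> ('v, 'a, 'k) gquiver \<Rightarrow> 'a \<Rightarrow> 'v" where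
  "src_rep n D \<alpha> = (THE \<epsilon>. \<exists>t. src_index n D \<alpha> \<epsilon> t)"

text \<open>\<open>b(\<alpha>)\<close>, for \<open>\<alpha>\<close> of type (4).\<close>

definition b_ind :: "nat \<Rightarrow> 'k::field \<Rightarrow> ('v, 'a, 'k) gquiver \<Rightarrow> 'a \<Rightarrow> nat" where
  "b_ind n \<zeta> D \<alpha> = (THE b. b < n \<and> gen_c D \<alpha> = \<zeta> ^ b)"

definition skew_quiver ::
    "nat \<Rightarrow> 'k::field \<Rightarrow> ('v, 'a, 'k) gquiver \<Rightarrow> ('v skew_vert, 'a skew_arr) pre_digraph" where
  "skew_quiver n \<zeta> D =
    \<lparr>verts = Eta ` reps_free D \<union> {EtaMu \<epsilon> \<mu> | \<epsilon> \<mu>. \<epsilon> \<in> reps_fixed D \<and> \<mu> < n},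
     arcs = Til ` arr1 n D \<union> {TilMu \<alpha> \<mu> | \<alpha> \<mu>. \<alpha> \<in> arr2 D \<union> arr3 D \<union> arr4 D \<and> \<mu> < n},
     tail = (\<lambda>x. case x of
         Til \<alpha> \<Rightarrow> Eta (src_rep n D \<alpha>)
       | TilMu \<alpha> \<mu> \<Rightarrow> (if \<alpha> \<in> arr2 D then Eta (tail (quiver D) \<alpha>) else EtaMu (tail (quiver D) \<alpha>) \<mu>)),
     head = (\<lambda>x. case x of
         Til \<alpha> \<Rightarrow> Eta (head (quiver D) \<alpha>)
       | TilMu \<alpha> \<mu> \<Rightarrow>
          (if \<alpha> \<in> arr2 D then EtaMu (head (quiver D) \<alpha>) \<mu>
           else if \<alpha> \<in> arr3 D then Eta (head (quiver D) \<alpha>)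
           else EtaMu (head (quiver D) \<alpha>) (nat ((int \<mu> - int (b_ind n \<zeta> D \<alpha>)) mod int n))))\<rparr>"

text \<open>\<open>Q\<^sub>G\<close> with the action of the generator \<open>\<chi>\<close> of the dual group and the representatives \<open>\<E>\<^sub>G\<close>.\<close>

definition skew_gquiver ::
    "nat \<Rightarrow> 'k::field \<Rightarrow> ('v, 'a, 'k) gquiver \<Rightarrow> ('v skew_vert, 'a skew_arr, 'k) gquiver" where
  "skew_gquiver n \<zeta> D =
    \<lparr>quiver = skew_quiver n \<zeta> D,
     gen_v = (\<lambda>x. case x of Eta \<epsilon> \<Rightarrow> Eta \<epsilon> | EtaMu \<epsilon> \<mu> \<Rightarrow> EtaMu \<epsilon> (Suc \<mu> mod n)),
     gen_a = (\<lambda>x. case x of Til \<alpha> \<Rightarrow> Til \<alpha> | TilMu \<alpha> \<mu> \<Rightarrow> TilMu \<alpha> (Suc \<mu> mod n)),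
     gen_c = (\<lambda>x. case x of Til \<alpha> \<Rightarrow> \<zeta> ^ t_ind n D \<alpha> | TilMu \<alpha> \<mu> \<Rightarrow> 1),
     reps_free = {EtaMu \<epsilon> 0 | \<epsilon>. \<epsilon> \<in> reps_fixed D},
     reps_fixed = Eta ` reps_free D\<rparr>"

text \<open>
  The vertices and arrows of \<open>Q\<^sub>G\<close> as elements of the skew group algebra \<open>AG\<close>, where
  \<open>rv\<close> and \<open>ra\<close> send the vertices and arrows of \<open>Q\<close> to elements of \<open>A\<close>.
\<close>

definition skew_vert_elt ::
    "('k::field, 'x) module \<Rightarrow> ('g, 'm) monoid_scheme \<Rightarrow> 'g \<Rightarrow> nat \<Rightarrow> 'k \<Rightarrow> ('v \<Rightarrow> 'x) \<Rightarrow>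
     'v skew_vert \<Rightarrow> 'g \<Rightarrow> 'x" where
  "skew_vert_elt A G g n \<zeta> rv x = (case x of
       Eta \<epsilon> \<Rightarrow> skew_tensor A G (rv \<epsilon>) (grp_elt \<one>\<^bsub>G\<^esub>)
     | EtaMu \<epsilon> \<mu> \<Rightarrow> skew_tensor A G (rv \<epsilon>) (grp_idem G g n \<zeta> \<mu>))"

definition skew_arr_elt ::
    "('k::field, 'x) module \<Rightarrow> ('g, 'm) monoid_scheme \<Rightarrow> ('g \<Rightarrow> 'x \<Rightarrow> 'x) \<Rightarrow> 'g \<Rightarrow> nat \<Rightarrow> 'k \<Rightarrow>
     ('v, 'a, 'k) gquiver \<Rightarrow> ('a \<Rightarrow> 'x) \<Rightarrow> 'a skew_arr \<Rightarrow> 'g \<Rightarrow> 'x" where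
  "skew_arr_elt A G \<rho> g n \<zeta> D ra x = (case x of
       Til \<alpha> \<Rightarrow> skew_tensor A G (ra \<alpha>) (grp_elt (g [^]\<^bsub>G\<^esub> t_ind n D \<alpha>))
     | TilMu \<alpha> \<mu> \<Rightarrow>
        (if \<alpha> \<in> arr2 D
         then skew_tensor A G \<one>\<^bsub>A\<^esub> (grp_idem G g n \<zeta> \<mu>) \<otimes>\<^bsub>skew_alg A G \<rho>\<^esub>
              skew_tensor A G (ra \<alpha>) (grp_elt \<one>\<^bsub>G\<^esub>)
         else skew_tensor A G (ra \<alpha>) (grp_idem G g n \<zeta> \<mu>)))"


section \<open>The isomorphism \<open>\<phi> : (Q\<^sub>G)\<^sub>G\<^sub>^ \<rightarrow> Q\<close>\<close>

fun phi_v :: "('v, 'a, 'k) gquiver \<Rightarrow> 'v skew_vert skew_vert \<Rightarrow> 'v" where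
  "phi_v D (Eta (EtaMu \<epsilon> \<mu>)) = \<epsilon>"
| "phi_v D (EtaMu (Eta \<epsilon>) \<nu>) = (gen_v D ^^ \<nu>) \<epsilon>"

fun phi_a :: "nat \<Rightarrow> ('v, 'a, 'k) gquiver \<Rightarrow> 'a skew_arr skew_arr \<Rightarrow> 'a" where
  "phi_a n D (Til (TilMu \<alpha> \<mu>)) = \<alpha>"
| "phi_a n D (TilMu (TilMu \<alpha> \<mu>) \<nu>) = (gen_a D ^^ \<nu>) \<alpha>"
| "phi_a n D (TilMu (Til \<alpha>) \<nu>) = (gen_a D ^^ nat ((int \<nu> - int (t_ind n D \<alpha>)) mod int n)) \<alpha>"

definition quiver_iso ::
    "('v, 'a) pre_digraph \<Rightarrow> ('w, 'b) pre_digraph \<Rightarrow> ('v \<Rightarrow> 'w) \<Rightarrow> ('a \<Rightarrow> 'b) \<Rightarrow> bool" where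
  "quiver_iso Q R fv fa \<longleftrightarrow>
     bij_betw fv (verts Q) (verts R) \<and> bij_betw fa (arcs Q) (arcs R) \<and>
     (\<forall>a\<in>arcs Q. tail R (fa a) = fv (tail Q a) \<and> head R (fa a) = fv (head Q a))"

text \<open>
  With the given generators of the two skew group algebras, the isomorphism induced by \<open>\<phi>\<close>
  involves a factor \<open>1/n\<close> on the arrows coming from arrows of type (2) of \<open>Q\<close>.  It
  cannot be avoided in general: if \<open>\<alpha>\<close>, \<open>\<beta>\<close> have types (3) and (2) and
  \<open>x = (\<alpha> \<otimes> e\<^sub>0)((1 \<otimes> e\<^sub>0)(\<beta> \<otimes> 1))\<close>, then the product of the corresponding arrows of
  \<open>(Q\<^sub>G)\<^sub>G\<^sub>^\<close> is \<open>e\<^sub>0 x e\<^sub>0\<close> (here the outer \<open>e\<^sub>0\<close> belongs to the dual group), which is the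
  invariant part \<open>(1/n) \<alpha>\<beta> \<otimes> 1\<close> of \<open>x\<close> times \<open>e\<^sub>0\<close>, whereas \<open>\<phi>\<close> sends these arrows to \<open>\<alpha>\<close> and \<open>\<beta>\<close>.
  A relation of \<open>\<Lambda>\<close> which involves \<open>\<alpha>\<beta>\<close> together with a path through no fixed vertex is not
  preserved by dropping the factor.
\<close>

fun phi_scale :: "nat \<Rightarrow> ('v, 'a, 'k::field) gquiver \<Rightarrow> 'a skew_arr skew_arr \<Rightarrow> 'k" where
  "phi_scale n D (TilMu (TilMu \<alpha> \<mu>) \<nu>) = (if \<alpha> \<in> arr2 D then inverse (of_nat n) else 1)"
| "phi_scale n D _ = 1"


section \<open>Group actions on quivers with potential\<close>

definition act_v ::
    "('v, 'a) pre_digraph \<Rightarrow> ('g \<Rightarrow> (('v, 'a) qpath \<Rightarrow> 'k::field) \<Rightarrow> (('v, 'a) qpath \<Rightarrow> 'k)) \<Rightarrow>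
     'g \<Rightarrow> 'v \<Rightarrow> 'v" where
  "act_v Q \<rho> h v = (THE w. w \<in> verts Q \<and> \<rho> h (vertex_elt v) = vertex_elt w)"

definition act_a ::
    "('v, 'a) pre_digraph \<Rightarrow> ('g \<Rightarrow> (('v, 'a) qpath \<Rightarrow> 'k::field) \<Rightarrow> (('v, 'a) qpath \<Rightarrow> 'k)) \<Rightarrow>
     'g \<Rightarrow> 'a \<Rightarrow> 'a" where
  "act_a Q \<rho> h \<alpha> = (THE \<beta>. \<beta> \<in> arcs Q \<and>
     (\<exists>c. \<rho> h (arrow_elt Q \<alpha>) = c \<odot>\<^bsub>path_alg Q\<^esub> arrow_elt Q \<beta>))"

definition act_c ::
    "('v, 'a) pre_digraph \<Rightarrow> ('g \<Rightarrow> (('v, 'a) qpath \<Rightarrow> 'k::field) \<Rightarrow> (('v, 'a) qpath \<Rightarrow> 'k)) \<Rightarrow>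
     'g \<Rightarrow> 'a \<Rightarrow> 'k" where
  "act_c Q \<rho> h \<alpha> =
     (THE c. \<rho> h (arrow_elt Q \<alpha>) = c \<odot>\<^bsub>path_alg Q\<^esub> arrow_elt Q (act_a Q \<rho> h \<alpha>))"

locale cyclic_qp_action =
  fixes Q :: "('v, 'a) pre_digraph"
    and W :: "('v, 'a) qpath \<Rightarrow> 'k::field"
    and G :: "('g, 'm) monoid_scheme"
    and g :: 'g
    and n :: nat
    and \<rho> :: "'g \<Rightarrow> (('v, 'a) qpath \<Rightarrow> 'k) \<Rightarrow> (('v, 'a) qpath \<Rightarrow> 'k)"
    and \<zeta> :: 'k
    and \<E> :: "'v set"
  assumes quiver: "fin_digraph Q" "Digraph_Component.connected Q"
    and potential: "finite_potential Q W"
    and cyclic_group: "group G" "finite (carrier G)" "order G = n"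
          "g \<in> carrier G" "generate G {g} = carrier G"
    and action: "algebra_action G (path_alg Q) \<rho>"
    and A1: "\<zeta> ^ n = 1" "\<And>m. 0 < m \<Longrightarrow> m < n \<Longrightarrow> \<zeta> ^ m \<noteq> 1"
    and A2: "\<And>h v. h \<in> carrier G \<Longrightarrow> v \<in> verts Q \<Longrightarrow> \<exists>w\<in>verts Q. \<rho> h (vertex_elt v) = vertex_elt w"
            "\<And>h \<alpha>. h \<in> carrier G \<Longrightarrow> \<alpha> \<in> arcs Q \<Longrightarrow>
               \<exists>\<beta>\<in>arcs Q. \<exists>c. \<rho> h (arrow_elt Q \<alpha>) = c \<odot>\<^bsub>path_alg Q\<^esub> arrow_elt Q \<beta>"
    and A3: "\<And>v. v \<in> verts Q \<Longrightarrow> \<exists>h\<in>carrier G. act_v Q \<rho> h v \<noteq> v \<Longrightarrow>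
               card ((\<lambda>h. act_v Q \<rho> h v) ` carrier G) = n"
    and A4: "\<And>h. h \<in> carrier G \<Longrightarrow> \<rho> h W \<ominus>\<^bsub>cpath_alg Q\<^esub> W \<in> com_closure Q"
    and A5: "\<And>\<alpha>. \<alpha> \<in> arcs Q \<Longrightarrow> \<forall>h\<in>carrier G. act_v Q \<rho> h (tail Q \<alpha>) = tail Q \<alpha> \<Longrightarrow>
               \<forall>h\<in>carrier G. act_v Q \<rho> h (head Q \<alpha>) = head Q \<alpha> \<Longrightarrow>
               \<exists>b. \<rho> g (arrow_elt Q \<alpha>) = \<zeta> ^ b \<odot>\<^bsub>path_alg Q\<^esub> arrow_elt Q \<alpha>"
    and A6: "\<And>h \<alpha>. h \<in> carrier G \<Longrightarrow> \<alpha> \<in> arcs Q \<Longrightarrow>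
               \<exists>h'\<in>carrier G. act_v Q \<rho> h' (tail Q \<alpha>) \<noteq> tail Q \<alpha> \<or> act_v Q \<rho> h' (head Q \<alpha>) \<noteq> head Q \<alpha> \<Longrightarrow>
               \<exists>\<beta>\<in>arcs Q. \<rho> h (arrow_elt Q \<alpha>) = arrow_elt Q \<beta>"
    and A7: "\<And>c. c \<in> qcycles Q \<Longrightarrow> cyc_coeff Q W c \<noteq> 0 \<Longrightarrow>
               (let vs = map (tail Q) (p_arrs c);
                    fixed = (\<lambda>v. \<forall>h\<in>carrier G. act_v Q \<rho> h v = v);
                    n_fixed = length (filter fixed vs);
                    n_free = length (filter (\<lambda>v. \<not> fixed v) vs)
                in n_fixed = 0 \<or> n_fixed = 1 \<or> n_free = 1 \<or> n_free = 0)"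
    and representatives: "\<E> \<subseteq> verts Q"
          "\<And>v. v \<in> verts Q \<Longrightarrow> \<exists>!\<epsilon>. \<epsilon> \<in> \<E> \<and> (\<exists>h\<in>carrier G. act_v Q \<rho> h \<epsilon> = v)"

definition gquiver_of ::
    "('v, 'a) pre_digraph \<Rightarrow> ('g, 'm) monoid_scheme \<Rightarrow> 'g \<Rightarrow>
     ('g \<Rightarrow> (('v, 'a) qpath \<Rightarrow> 'k::field) \<Rightarrow> (('v, 'a) qpath \<Rightarrow> 'k)) \<Rightarrow> 'v set \<Rightarrow>
     ('v, 'a, 'k) gquiver" where
  "gquiver_of Q G g \<rho> \<E> =
    \<lparr>quiver = Q, gen_v = act_v Q \<rho> g, gen_a = act_a Q \<rho> g, gen_c = act_c Q \<rho> g,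
     reps_free = {\<epsilon> \<in> \<E>. \<exists>h\<in>carrier G. act_v Q \<rho> h \<epsilon> \<noteq> \<epsilon>},
     reps_fixed = {\<epsilon> \<in> \<E>. \<forall>h\<in>carrier G. act_v Q \<rho> h \<epsilon> = \<epsilon>}\<rparr>"

end

theory Submission
  imports
    "HOL-Computational_Algebra.Formal_Power_Series"
    "HOL-Computational_Algebra.Polynomial"
    Defs
begin

text \<open>
  Left multiplication by \<open>\<Lambda>G\<close> together with the automorphisms \<open>\<psi>(\<lambda> \<otimes> h) = \<psi>(h) \<lambda> \<otimes> h\<close> makes
  the skew group algebra of \<open>\<Lambda>G\<close> and the dual group act on \<open>\<Lambda>G\<close> by right \<open>\<Lambda>\<close>-linear maps
  (\<open>T f\<close> below), and Fourier inversion on \<open>G\<close> shows that every right \<open>\<Lambda>\<close>-linear map arises in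
  exactly one way.  The idempotent \<open>\<theta>\<close> acts as left multiplication by
  \<open>t = \<Sum>\<epsilon> \<otimes> 1 + \<Sum>\<epsilon> \<otimes> e\<^sub>0\<close> (sums over \<open>\<E>'\<close> and \<open>\<E>''\<close>).  For a fixed vertex
  \<open>(\<epsilon> \<otimes> e\<^sub>0)\<Lambda>G\<close> is isomorphic to \<open>\<epsilon>\<Lambda>\<close>, for a free one \<open>(\<epsilon> \<otimes> 1)\<Lambda>G\<close> is isomorphic to
  \<open>\<Oplus>\<^sub>h h(\<epsilon>)\<Lambda>\<close>; so \<open>t\<Lambda>G\<close> is a free right module of rank one, generated by the sum \<open>w\<close> of all
  \<open>\<epsilon> \<otimes> h\<close> with \<open>\<epsilon> \<in> \<E>\<close> and \<open>h \<in> G\<close>, and \<open>P\<close> is the coordinate map.  Hence \<open>f \<mapsto> \<lambda>\<close> with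
  \<open>T f w = w \<lambda>\<close> is the required isomorphism.  On the summand of a fixed vertex \<open>w\<close> is
  \<open>n\<close> times the idempotent \<open>\<epsilon> \<otimes> e\<^sub>0\<close>, which is the origin of the scalars \<open>phi_scale\<close>.

  The potential matters only for \<open>G\<close> to act on \<open>\<Lambda>\<close>: cyclic derivatives are equivariant up to
  nonzero scalars and vanish on the closure of the commutators, so the Jacobian ideal is stable.
\<close>

section \<open>Skew group algebras\<close>

text \<open>The values of the isomorphism on all vertices and arrows of the second quiver are
  prescribed, so a purely categorical duality does not suffice and every map is explicit. The
  coefficient of the product of \<open>w\<close> and \<open>a\<close> at a group element
  \<open>x\<close> is \<open>e\<close> times the translate of \<open>a\<close> by \<open>x\<close>.
  Hence \<open>F f = a\<close> can be checked coefficient by coefficient, with one short computation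
  for each type of arrow. The generator \<open>w\<close> is determined only up to a unit of
  \<Lambda>. Dividing its summand at the fixed vertices by \<open>n\<close> conjugates the
  isomorphism by such a unit: the factor 1/n then moves from the arrows of type (2) to those of type
  (3), and the product of such a pair still carries it. The action on \<Lambda> comes from a
  completion, whose elements are infinite sums of paths, while the assumptions speak of the path
  algebra. The bridge is the formula \<open>\<tau>\<close> on coefficient functions, built from a
  permutation of paths and a scalar for each path.\<close>

lemma (in abelian_monoid) finsum_swap:
  assumes "finite I" "finite J" "\<And>i j. i \<in> I \<Longrightarrow> j \<in> J \<Longrightarrow> f i j \<in> carrier G"
  shows "(\<Oplus>i\<in>I. \<Oplus>j\<in>J. f i j) = (\<Oplus>j\<in>J. \<Oplus>i\<in>I. f i j)"
  using assms(1,3)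
proof (induction I rule: finite_induct)
  case empty
  then show ?case using finsum_zero by simp
next
  case (insert i I)
  have "(\<Oplus>i\<in>insert i I. \<Oplus>j\<in>J. f i j) = (\<Oplus>j\<in>J. f i j) \<oplus> (\<Oplus>j\<in>J. \<Oplus>i\<in>I. f i j)"
    using insert by (subst finsum_insert) (auto intro!: finsum_closed)
  also have "\<dots> = (\<Oplus>j\<in>J. f i j \<oplus> (\<Oplus>i\<in>I. f i j))"
    using insert.prems by (intro finsum_addf[symmetric]) (auto intro!: finsum_closed)
  also have "\<dots> = (\<Oplus>j\<in>J. \<Oplus>i\<in>insert i I. f i j)"
    using insert by (intro finsum_cong') (auto intro!: finsum_closed simp: finsum_insert)
  finally show ?case .
qed

lemma (in abelian_monoid) finsum_delta:
  assumes "finite I" "i \<in> I" "f i \<in> carrier G"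
  shows "(\<Oplus>j\<in>I. if j = i then f j else \<zero>) = f i"
proof -
  have "(\<Oplus>j\<in>I. if j = i then f j else \<zero>) = (\<Oplus>j\<in>I. if i = j then f i else \<zero>)"
    using assms by (intro finsum_cong') auto
  then show ?thesis using finsum_singleton[of i I "\<lambda>_. f i"] assms by simp
qed

lemma additive_finsum:
  assumes A: "abelian_monoid A" and B: "abelian_monoid B"
    and h: "\<And>x. x \<in> carrier A \<Longrightarrow> h x \<in> carrier B"
      "\<And>x y. x \<in> carrier A \<Longrightarrow> y \<in> carrier A \<Longrightarrow> h (x \<oplus>\<^bsub>A\<^esub> y) = h x \<oplus>\<^bsub>B\<^esub> h y"
      "h \<zero>\<^bsub>A\<^esub> = \<zero>\<^bsub>B\<^esub>"
    and f: "\<And>i. i \<in> I \<Longrightarrow> f i \<in> carrier A"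
  shows "h (\<Oplus>\<^bsub>A\<^esub>i\<in>I. f i) = (\<Oplus>\<^bsub>B\<^esub>i\<in>I. h (f i))"
\<comment> \<open>Over an infinite index set \<open>finsum\<close> is zero by convention, on both
  sides.\<close>
proof (cases "finite I")
  case False
  then show ?thesis by (simp add: finsum_def finprod_def h)
next
  case True
  then show ?thesis using f
  proof (induction I rule: finite_induct)
    case empty
    then show ?case by (simp add: abelian_monoid.finsum_empty[OF A] abelian_monoid.finsum_empty[OF B] h(3))
  next
    case (insert i I)
    then have "(\<Oplus>\<^bsub>A\<^esub>i\<in>I. f i) \<in> carrier A"
      by (intro abelian_monoid.finsum_closed[OF A]) auto
    then have "h (\<Oplus>\<^bsub>A\<^esub>i\<in>insert i I. f i) = h (f i) \<oplus>\<^bsub>B\<^esub> h (\<Oplus>\<^bsub>A\<^esub>i\<in>I. f i)"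
      using insert h by (simp add: abelian_monoid.finsum_insert[OF A] Pi_def)
    then show ?case
      using insert h by (simp add: abelian_monoid.finsum_insert[OF B] Pi_def)
  qed
qed

section \<open>Algebras over a field type and their corners\<close>

locale kalg = ring A for A :: "('k::field, 'x) module" (structure) +
  assumes smult_closed [simp, intro]: "x \<in> carrier A \<Longrightarrow> c \<odot> x \<in> carrier A"
    and smult_one [simp]: "x \<in> carrier A \<Longrightarrow> 1 \<odot> x = x"
    and smult_assoc: "x \<in> carrier A \<Longrightarrow> c \<odot> (d \<odot> x) = (c * d) \<odot> x"
    and smult_r_distr: "x \<in> carrier A \<Longrightarrow> y \<in> carrier A \<Longrightarrow> c \<odot> (x \<oplus> y) = c \<odot> x \<oplus> c \<odot> y"
    and smult_l_distr: "x \<in> carrier A \<Longrightarrow> (c + d) \<odot> x = c \<odot> x \<oplus> d \<odot> x"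
    and smult_mult_left: "x \<in> carrier A \<Longrightarrow> y \<in> carrier A \<Longrightarrow> (c \<odot> x) \<otimes> y = c \<odot> (x \<otimes> y)"
    and smult_mult_right: "x \<in> carrier A \<Longrightarrow> y \<in> carrier A \<Longrightarrow> x \<otimes> (c \<odot> y) = c \<odot> (x \<otimes> y)"
begin

lemma smult_zero_left [simp]: "x \<in> carrier A \<Longrightarrow> 0 \<odot> x = \<zero>"
  using smult_l_distr[of x 0 0] by (metis add.l_cancel_one add_0 smult_closed)

lemma smult_zero_right [simp]: "c \<odot> \<zero> = \<zero>"
  using smult_r_distr[of \<zero> \<zero> c] by (metis add.l_cancel_one smult_closed zero_closed l_zero)

lemma smult_finsum:
  assumes "\<And>i. i \<in> I \<Longrightarrow> f i \<in> carrier A"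
  shows "c \<odot> (\<Oplus>i\<in>I. f i) = (\<Oplus>i\<in>I. c \<odot> f i)"
  by (rule additive_finsum) (use assms in \<open>auto intro: smult_r_distr abelian_monoid_axioms\<close>)

lemma sum_smult:
  assumes "finite I" "x \<in> carrier A"
  shows "(\<Sum>i\<in>I. c i) \<odot> x = (\<Oplus>i\<in>I. c i \<odot> x)"
  using assms by (induction I rule: finite_induct) (simp_all add: smult_l_distr finsum_insert)

text \<open>For an idempotent \<open>e\<close> the shape e y e is equivalent to two equations, and
  these, unlike the shape, are visibly stable under all operations.\<close>

lemma corner:
  assumes e: "e \<in> carrier A" "e \<otimes> e = e"
  shows "kalg (corner_alg A e)"
    and "carrier (corner_alg A e) = {x \<in> carrier A. e \<otimes> x = x \<and> x \<otimes> e = x}"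
proof -
  show c: "carrier (corner_alg A e) = {x \<in> carrier A. e \<otimes> x = x \<and> x \<otimes> e = x}"
  proof (intro equalityI subsetI)
    fix x assume "x \<in> carrier (corner_alg A e)"
    then obtain y where y: "y \<in> carrier A" "x = e \<otimes> y \<otimes> e" by (auto simp: corner_alg_def)
    then have "e \<otimes> x = x" "x \<otimes> e = x" using e by (metis m_assoc m_closed)+
    with y e show "x \<in> {x \<in> carrier A. e \<otimes> x = x \<and> x \<otimes> e = x}" by simp
  next
    fix x assume "x \<in> {x \<in> carrier A. e \<otimes> x = x \<and> x \<otimes> e = x}"
    then show "x \<in> carrier (corner_alg A e)" by (auto simp: corner_alg_def intro!: exI[of _ x])
  qed
  have ops: "monoid.mult (corner_alg A e) = monoid.mult A" "monoid.one (corner_alg A e) = e"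
    "ring.add (corner_alg A e) = ring.add A" "ring.zero (corner_alg A e) = ring.zero A"
    "module.smult (corner_alg A e) = module.smult A"
    by (simp_all add: corner_alg_def)
  have ag: "abelian_group (corner_alg A e)"
  proof (rule abelian_groupI, unfold ops c)
    fix x assume x: "x \<in> {x \<in> carrier A. e \<otimes> x = x \<and> x \<otimes> e = x}"
    then have "\<ominus> x \<in> {x \<in> carrier A. e \<otimes> x = x \<and> x \<otimes> e = x}"
      using e by (simp add: r_minus l_minus)
    moreover have "\<ominus> x \<oplus> x = \<zero>" using x by (simp add: l_neg)
    ultimately show "\<exists>y\<in>{x \<in> carrier A. e \<otimes> x = x \<and> x \<otimes> e = x}. y \<oplus> x = \<zero>" by blast
  qed (use e in \<open>auto simp: r_distr l_distr a_assoc a_comm a_lcomm\<close>)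
  have r: "ring (corner_alg A e)"
  proof (rule ringI[OF ag])
    show "Group.monoid (corner_alg A e)"
    proof (rule monoidI, unfold ops c)
      fix x y
      assume x: "x \<in> {x \<in> carrier A. e \<otimes> x = x \<and> x \<otimes> e = x}"
        and y: "y \<in> {x \<in> carrier A. e \<otimes> x = x \<and> x \<otimes> e = x}"
      then have "e \<otimes> (x \<otimes> y) = x \<otimes> y" "x \<otimes> y \<otimes> e = x \<otimes> y"
        using e by (simp_all flip: m_assoc) (simp add: m_assoc)
      then show "x \<otimes> y \<in> {x \<in> carrier A. e \<otimes> x = x \<and> x \<otimes> e = x}" using x y by simp
    qed (use e in \<open>auto simp: m_assoc\<close>)
  qed (unfold ops c, auto simp: l_distr r_distr)
  show "kalg (corner_alg A e)"
    unfolding kalg_def kalg_axioms_def ops c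
    using r e by (auto simp: smult_assoc smult_r_distr smult_l_distr smult_mult_left smult_mult_right)
qed

text \<open>The value of \<open>finsum\<close> is defined through the carrier of its structure, so
  the two sums are not equal by definition; they agree because the inclusion is additive.\<close>

lemma corner_finsum:
  assumes e: "e \<in> carrier A" "e \<otimes> e = e" and f: "\<And>i. i \<in> I \<Longrightarrow> f i \<in> carrier (corner_alg A e)"
  shows "(\<Oplus>\<^bsub>corner_alg A e\<^esub>i\<in>I. f i) = (\<Oplus>i\<in>I. f i)"
proof -
  interpret C: kalg "corner_alg A e" by (rule corner(1)[OF e])
  show ?thesis
  proof (rule additive_finsum[where h = "\<lambda>x. x", OF C.abelian_monoid_axioms abelian_monoid_axioms])
    show "x \<in> carrier A" if "x \<in> carrier (corner_alg A e)" for x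
      using that corner(2)[OF e] by blast
  qed (simp_all add: f, simp_all add: corner_alg_def)
qed

end

section \<open>The skew group algebra of a finite group\<close>

locale kalg_act = kalg A + G: group G
  for A :: "('k::field, 'x) module" (structure) and G :: "('g, 'm) monoid_scheme" (structure) +
  fixes \<rho> :: "'g \<Rightarrow> 'x \<Rightarrow> 'x"
  assumes fin: "finite (carrier G)"
    and act_closed [simp, intro]: "h \<in> carrier G \<Longrightarrow> x \<in> carrier A \<Longrightarrow> \<rho> h x \<in> carrier A"
    and act_add: "h \<in> carrier G \<Longrightarrow> x \<in> carrier A \<Longrightarrow> y \<in> carrier A \<Longrightarrow> \<rho> h (x \<oplus> y) = \<rho> h x \<oplus> \<rho> h y"
    and act_mult: "h \<in> carrier G \<Longrightarrow> x \<in> carrier A \<Longrightarrow> y \<in> carrier A \<Longrightarrow> \<rho> h (x \<otimes> y) = \<rho> h x \<otimes> \<rho> h y"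
    and act_one [simp]: "h \<in> carrier G \<Longrightarrow> \<rho> h \<one> = \<one>"
    and act_smult: "h \<in> carrier G \<Longrightarrow> x \<in> carrier A \<Longrightarrow> \<rho> h (c \<odot> x) = c \<odot> \<rho> h x"
    and act_comp: "h \<in> carrier G \<Longrightarrow> h' \<in> carrier G \<Longrightarrow> x \<in> carrier A \<Longrightarrow>
      \<rho> (h \<otimes>\<^bsub>G\<^esub> h') x = \<rho> h (\<rho> h' x)"
    and act_id [simp]: "x \<in> carrier A \<Longrightarrow> \<rho> \<one>\<^bsub>G\<^esub> x = x"
begin

abbreviation S where "S \<equiv> skew_alg A G \<rho>"

lemma act_zero [simp]: "h \<in> carrier G \<Longrightarrow> \<rho> h \<zero> = \<zero>"
  using act_smult[of h \<zero> 0] by simp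

lemma act_inv [simp]: "h \<in> carrier G \<Longrightarrow> x \<in> carrier A \<Longrightarrow> \<rho> h (\<rho> (inv\<^bsub>G\<^esub> h) x) = x"
  "h \<in> carrier G \<Longrightarrow> x \<in> carrier A \<Longrightarrow> \<rho> (inv\<^bsub>G\<^esub> h) (\<rho> h x) = x"
  by (simp_all flip: act_comp)

lemma act_finsum:
  assumes "h \<in> carrier G" "\<And>i. i \<in> I \<Longrightarrow> f i \<in> carrier A"
  shows "\<rho> h (\<Oplus>i\<in>I. f i) = (\<Oplus>i\<in>I. \<rho> h (f i))"
  by (rule additive_finsum) (use assms in \<open>auto intro: act_add abelian_monoid_axioms\<close>)

lemma skew_carrier: "carrier S = carrier G \<rightarrow>\<^sub>E carrier A"
  by (simp add: skew_alg_def)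

lemma skew_app [simp, intro]: "f \<in> carrier S \<Longrightarrow> x \<in> carrier G \<Longrightarrow> f x \<in> carrier A"
  by (auto simp: skew_carrier)

lemma skew_ext:
  assumes "f \<in> carrier S" "f' \<in> carrier S" "\<And>x. x \<in> carrier G \<Longrightarrow> f x = f' x"
  shows "f = f'"
  using assms unfolding skew_carrier by (rule PiE_ext)

lemma skew_mult_app:
  "x \<in> carrier G \<Longrightarrow> (f \<otimes>\<^bsub>S\<^esub> h) x = (\<Oplus>y\<in>carrier G. f y \<otimes> \<rho> y (h (inv\<^bsub>G\<^esub> y \<otimes>\<^bsub>G\<^esub> x)))"
  by (simp add: skew_alg_def)

lemma skew_add_app: "x \<in> carrier G \<Longrightarrow> (f \<oplus>\<^bsub>S\<^esub> h) x = f x \<oplus> h x"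
  by (simp add: skew_alg_def)

lemma skew_one_app: "x \<in> carrier G \<Longrightarrow> \<one>\<^bsub>S\<^esub> x = (if x = \<one>\<^bsub>G\<^esub> then \<one> else \<zero>)"
  by (simp add: skew_alg_def)

lemma skew_zero_app: "x \<in> carrier G \<Longrightarrow> \<zero>\<^bsub>S\<^esub> x = \<zero>"
  by (simp add: skew_alg_def)

lemma skew_smult_app: "x \<in> carrier G \<Longrightarrow> (c \<odot>\<^bsub>S\<^esub> f) x = c \<odot> f x"
  by (simp add: skew_alg_def)

lemmas skew_apps = skew_add_app skew_one_app skew_zero_app skew_smult_app

lemma skew_mult_closed: "f \<in> carrier S \<Longrightarrow> h \<in> carrier S \<Longrightarrow> f \<otimes>\<^bsub>S\<^esub> h \<in> carrier S"
  by (subst skew_carrier, rule PiE_I) (simp_all add: skew_mult_app Pi_def, simp add: skew_alg_def)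

lemma skew_add_closed: "f \<in> carrier S \<Longrightarrow> h \<in> carrier S \<Longrightarrow> f \<oplus>\<^bsub>S\<^esub> h \<in> carrier S"
  by (auto simp: skew_alg_def)

lemma skew_smult_closed: "f \<in> carrier S \<Longrightarrow> c \<odot>\<^bsub>S\<^esub> f \<in> carrier S"
  by (auto simp: skew_alg_def)

lemma skew_zero_closed: "\<zero>\<^bsub>S\<^esub> \<in> carrier S"
  by (auto simp: skew_alg_def)

lemma skew_one_closed: "\<one>\<^bsub>S\<^esub> \<in> carrier S"
  by (auto simp: skew_alg_def)

lemmas skew_closed = skew_mult_closed skew_add_closed skew_smult_closed skew_zero_closed skew_one_closed

lemma skew_mult_assoc:
  assumes [simp]: "f \<in> carrier S" "h \<in> carrier S" "k \<in> carrier S"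
  shows "(f \<otimes>\<^bsub>S\<^esub> h) \<otimes>\<^bsub>S\<^esub> k = f \<otimes>\<^bsub>S\<^esub> (h \<otimes>\<^bsub>S\<^esub> k)"
proof (rule skew_ext)
  fix x assume x [simp]: "x \<in> carrier G"
  let ?t = "\<lambda>y z. f y \<otimes> (\<rho> y (h (inv\<^bsub>G\<^esub> y \<otimes>\<^bsub>G\<^esub> z)) \<otimes> \<rho> z (k (inv\<^bsub>G\<^esub> z \<otimes>\<^bsub>G\<^esub> x)))"
  have "((f \<otimes>\<^bsub>S\<^esub> h) \<otimes>\<^bsub>S\<^esub> k) x = (\<Oplus>z\<in>carrier G. \<Oplus>y\<in>carrier G. ?t y z)"
    unfolding skew_mult_app[OF x]
    by (intro finsum_cong')
      (auto simp: skew_mult_app finsum_ldistr[OF fin] m_assoc Pi_def intro!: finsum_closed finsum_cong')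
  also have "\<dots> = (\<Oplus>y\<in>carrier G. \<Oplus>z\<in>carrier G. ?t y z)"
    by (rule finsum_swap[OF fin fin]) simp
  also have "\<dots> = (f \<otimes>\<^bsub>S\<^esub> (h \<otimes>\<^bsub>S\<^esub> k)) x"
    unfolding skew_mult_app[OF x]
  proof (intro finsum_cong')
    fix y assume y [simp]: "y \<in> carrier G"
    let ?r = "\<lambda>u. h u \<otimes> \<rho> u (k (inv\<^bsub>G\<^esub> u \<otimes>\<^bsub>G\<^esub> (inv\<^bsub>G\<^esub> y \<otimes>\<^bsub>G\<^esub> x)))"
    \<comment> \<open>Substitute z = y u in the inner sum. Left translation permutes the group, and
      the action of \<open>y\<close> can then be pulled out of the sum.\<close>
    have inj: "inj_on (\<lambda>u. y \<otimes>\<^bsub>G\<^esub> u) (carrier G)" and im: "(\<lambda>u. y \<otimes>\<^bsub>G\<^esub> u) ` carrier G = carrier G"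
      by (simp_all add: G.inj_on_cmult G.surj_const_mult)
    have "(\<Oplus>z\<in>carrier G. ?t y z) = (\<Oplus>z\<in>(\<lambda>u. y \<otimes>\<^bsub>G\<^esub> u) ` carrier G. ?t y z)" by (simp add: im)
    also have "\<dots> = (\<Oplus>u\<in>carrier G. ?t y (y \<otimes>\<^bsub>G\<^esub> u))"
      by (rule finsum_reindex) (use inj in auto)
    also have "\<dots> = (\<Oplus>u\<in>carrier G. f y \<otimes> \<rho> y (?r u))"
      by (intro finsum_cong') (simp_all add: act_mult act_comp G.inv_mult_group G.m_assoc[symmetric])
    also have "\<dots> = f y \<otimes> (\<Oplus>u\<in>carrier G. \<rho> y (?r u))"
      by (rule finsum_rdistr[OF fin, symmetric]) auto
    also have "(\<Oplus>u\<in>carrier G. \<rho> y (?r u)) = \<rho> y (\<Oplus>u\<in>carrier G. ?r u)"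
      by (rule act_finsum[symmetric]) auto
    finally show "(\<Oplus>z\<in>carrier G. ?t y z) = f y \<otimes> \<rho> y ((h \<otimes>\<^bsub>S\<^esub> k) (inv\<^bsub>G\<^esub> y \<otimes>\<^bsub>G\<^esub> x))"
      by (simp add: skew_mult_app)
  qed (simp_all add: skew_mult_closed Pi_def)
  finally show "((f \<otimes>\<^bsub>S\<^esub> h) \<otimes>\<^bsub>S\<^esub> k) x = (f \<otimes>\<^bsub>S\<^esub> (h \<otimes>\<^bsub>S\<^esub> k)) x" .
qed (simp_all add: skew_mult_closed)

lemma skew_tensor_closed [intro]: "a \<in> carrier A \<Longrightarrow> skew_tensor A G a u \<in> carrier S"
  by (auto simp: skew_tensor_def skew_carrier)

lemma skew_tensor_app: "x \<in> carrier G \<Longrightarrow> skew_tensor A G a u x = u x \<odot> a"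
  by (simp add: skew_tensor_def)

lemma skew_tensor_mult_app:
  assumes [simp]: "x \<in> carrier G" "a \<in> carrier A" "f \<in> carrier S"
  shows "(skew_tensor A G a u \<otimes>\<^bsub>S\<^esub> f) x =
    a \<otimes> (\<Oplus>y\<in>carrier G. u y \<odot> \<rho> y (f (inv\<^bsub>G\<^esub> y \<otimes>\<^bsub>G\<^esub> x)))"
proof -
  have "(skew_tensor A G a u \<otimes>\<^bsub>S\<^esub> f) x = (\<Oplus>y\<in>carrier G. a \<otimes> (u y \<odot> \<rho> y (f (inv\<^bsub>G\<^esub> y \<otimes>\<^bsub>G\<^esub> x))))"
    unfolding skew_mult_app[OF assms(1)]
    by (intro finsum_cong') (auto simp: skew_tensor_app smult_mult_left smult_mult_right)
  then show ?thesis by (simp add: finsum_rdistr[OF fin] Pi_def)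
qed

lemma grp_elt_mult_app:
  assumes [simp]: "x \<in> carrier G" "a \<in> carrier A" "f \<in> carrier S" "z \<in> carrier G"
  shows "(skew_tensor A G a (grp_elt z) \<otimes>\<^bsub>S\<^esub> f) x = a \<otimes> \<rho> z (f (inv\<^bsub>G\<^esub> z \<otimes>\<^bsub>G\<^esub> x))"
proof -
  have "(\<Oplus>y\<in>carrier G. grp_elt z y \<odot> \<rho> y (f (inv\<^bsub>G\<^esub> y \<otimes>\<^bsub>G\<^esub> x))) =
    (\<Oplus>y\<in>carrier G. if y = z then \<rho> y (f (inv\<^bsub>G\<^esub> y \<otimes>\<^bsub>G\<^esub> x)) else \<zero>)"
    by (intro finsum_cong') (auto simp: grp_elt_def)
  also have "\<dots> = \<rho> z (f (inv\<^bsub>G\<^esub> z \<otimes>\<^bsub>G\<^esub> x))"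
    by (rule finsum_delta[OF fin]) auto
  finally show ?thesis by (simp add: skew_tensor_mult_app)
qed

text \<open>Only the term y = x z^-1 of the convolution survives, and the twist of the product lets
  this element act on \<open>a\<close>.\<close>

lemma mult_grp_elt_app:
  assumes [simp]: "x \<in> carrier G" "a \<in> carrier A" "f \<in> carrier S" "z \<in> carrier G"
  shows "(f \<otimes>\<^bsub>S\<^esub> skew_tensor A G a (grp_elt z)) x =
    f (x \<otimes>\<^bsub>G\<^esub> inv\<^bsub>G\<^esub> z) \<otimes> \<rho> (x \<otimes>\<^bsub>G\<^esub> inv\<^bsub>G\<^esub> z) a"
proof -
  have eq: "inv\<^bsub>G\<^esub> y \<otimes>\<^bsub>G\<^esub> x = z \<longleftrightarrow> y = x \<otimes>\<^bsub>G\<^esub> inv\<^bsub>G\<^esub> z" if "y \<in> carrier G" for y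
  proof
    assume "inv\<^bsub>G\<^esub> y \<otimes>\<^bsub>G\<^esub> x = z"
    then show "y = x \<otimes>\<^bsub>G\<^esub> inv\<^bsub>G\<^esub> z"
      using that by (auto simp: G.inv_mult_group simp flip: G.m_assoc)
  qed (use that in \<open>simp add: G.inv_mult_group G.m_assoc\<close>)
  have "(f \<otimes>\<^bsub>S\<^esub> skew_tensor A G a (grp_elt z)) x =
    (\<Oplus>y\<in>carrier G. if y = x \<otimes>\<^bsub>G\<^esub> inv\<^bsub>G\<^esub> z then f y \<otimes> \<rho> y a else \<zero>)"
    unfolding skew_mult_app[OF assms(1)]
    by (intro finsum_cong') (auto simp: skew_tensor_app grp_elt_def eq)
  also have "\<dots> = f (x \<otimes>\<^bsub>G\<^esub> inv\<^bsub>G\<^esub> z) \<otimes> \<rho> (x \<otimes>\<^bsub>G\<^esub> inv\<^bsub>G\<^esub> z) a"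
    by (rule finsum_delta[OF fin]) auto
  finally show ?thesis .
qed

lemma skew_one_eq: "\<one>\<^bsub>S\<^esub> = skew_tensor A G \<one> (grp_elt \<one>\<^bsub>G\<^esub>)"
  by (rule skew_ext) (auto intro: skew_closed simp: skew_apps skew_tensor_app grp_elt_def)

lemma skew_kalg: "kalg S"
proof -
  have ag: "abelian_group S"
  proof (rule abelian_groupI)
    fix f assume f: "f \<in> carrier S"
    show "\<exists>h\<in>carrier S. h \<oplus>\<^bsub>S\<^esub> f = \<zero>\<^bsub>S\<^esub>"
      by (rule bexI[of _ "\<lambda>x\<in>carrier G. \<ominus> f x"])
        (use f in \<open>auto intro!: skew_ext[OF skew_add_closed skew_zero_closed] simp: skew_apps l_neg skew_carrier\<close>)
  qed (auto intro!: skew_ext intro: skew_closed simp: skew_apps a_ac)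
  \<comment> \<open>With the unit written as 1 \<otimes> 1, both unit laws are instances of the
    formulas for products with a single group element.\<close>
  have mon: "Group.monoid S"
    by (rule monoidI) (auto intro: skew_closed simp: skew_mult_assoc intro!: skew_ext
        simp: skew_one_eq grp_elt_mult_app mult_grp_elt_app skew_tensor_closed)
  have "ring S"
    by (rule ringI[OF ag mon])
     (auto intro!: skew_ext finsum_cong' skew_closed
        simp: skew_apps skew_mult_app l_distr r_distr act_add Pi_def simp flip: finsum_addf)
  moreover have "kalg_axioms S"
    by unfold_locales
     (auto intro!: skew_ext finsum_cong' intro: skew_closed
        simp: skew_closed skew_apps skew_mult_app smult_assoc smult_r_distr smult_l_distr smult_finsum smult_mult_left smult_mult_right act_smult)
  ultimately show ?thesis by (simp add: kalg_def)
qed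

sublocale S: kalg S by (rule skew_kalg)

lemma skew_finsum_app:
  assumes "x \<in> carrier G" "\<And>i. i \<in> I \<Longrightarrow> f i \<in> carrier S"
  shows "(\<Oplus>\<^bsub>S\<^esub>i\<in>I. f i) x = (\<Oplus>i\<in>I. f i x)"
  by (rule additive_finsum[where h = "\<lambda>f. f x", OF S.abelian_monoid_axioms abelian_monoid_axioms])
    (use assms in \<open>auto simp: skew_apps\<close>)

end

section \<open>Characters of a finite cyclic group\<close>

locale cyclic_char = G: group G for G :: "('g, 'm) monoid_scheme" (structure) +
  fixes g :: 'g and n :: nat and \<zeta> :: "'k::field"
  assumes fin_G: "finite (carrier G)" and order_n: "order G = n"
    and g_closed [simp, intro]: "g \<in> carrier G" and gen_g: "generate G {g} = carrier G"
    and \<zeta>_n: "\<zeta> ^ n = 1" and \<zeta>_prim: "\<And>m. 0 < m \<Longrightarrow> m < n \<Longrightarrow> \<zeta> ^ m \<noteq> 1"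
begin

abbreviation Gd where "Gd \<equiv> dual_group G :: ('g \<Rightarrow> 'k) monoid"
abbreviation \<chi> where "\<chi> \<equiv> dual_gen G g \<zeta>"

lemma n_pos: "0 < n"
  using fin_G order_n G.order_gt_0_iff_finite by auto

lemma ord_g: "G.ord g = n"
  using G.generate_pow_card[OF g_closed] gen_g order_n by (simp add: order_def)

lemma g_pow_n: "g [^] n = \<one>"
  using G.pow_ord_eq_1[OF g_closed] ord_g by simp

lemma g_pow_add_n: "g [^] (a + n * b) = g [^] a"
  by (simp add: G.nat_pow_pow[symmetric] g_pow_n flip: G.nat_pow_mult)

lemma g_pow_mod: "g [^] (a mod n) = g [^] a"
  using g_pow_add_n[of "a mod n" "a div n"] by simp

lemma \<zeta>_pow_mod: "\<zeta> ^ (a mod n) = \<zeta> ^ a"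
  by (metis \<zeta>_n mod_mult_div_eq mult_1_right power_add power_mult power_one)

lemma \<zeta>_nonzero [simp]: "\<zeta> \<noteq> 0"
  using \<zeta>_n n_pos by (auto simp: power_0_left split: if_splits)

lemma g_pow_inj: "inj_on (\<lambda>i::nat. g [^] i) {..<n}"
proof -
  have "{..<n} = {0..G.ord g - 1}" using n_pos ord_g by auto
  then show ?thesis using G.ord_inj[OF g_closed] by simp
qed

lemma g_pow_bij: "bij_betw (\<lambda>i::nat. g [^] i) {..<n} (carrier G)"
proof -
  have "(\<lambda>i::nat. g [^] i) ` {..<n} = carrier G"
    by (rule card_subset_eq[OF fin_G]) (use g_pow_inj order_n in \<open>auto simp: card_image order_def\<close>)
  then show ?thesis using g_pow_inj by (simp add: bij_betw_def)
qed

lemma g_pow_exhaust: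
  assumes "h \<in> carrier G" obtains i :: nat where "i < n" "h = g [^] i"
  using g_pow_bij assms unfolding bij_betw_def by (metis imageE lessThan_iff)

lemma g_pow_eq_iff: "g [^] (a::nat) = g [^] (b::nat) \<longleftrightarrow> a mod n = b mod n"
  using g_pow_inj n_pos by (metis g_pow_mod inj_onD lessThan_iff mod_less_divisor)

lemma \<zeta>_pow_eq_iff: "\<zeta> ^ a = \<zeta> ^ b \<longleftrightarrow> a mod n = b mod n"
proof
  have *: "a mod n = b mod n" if "\<zeta> ^ a = \<zeta> ^ b" "a mod n \<le> b mod n" for a b
  proof (rule ccontr)
    assume ne: "a mod n \<noteq> b mod n"
    have "\<zeta> ^ (a mod n) * \<zeta> ^ (b mod n - a mod n) = \<zeta> ^ (b mod n)"
      using that by (simp flip: power_add)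
    then have "\<zeta> ^ (b mod n - a mod n) = 1"
      using that by (simp add: \<zeta>_pow_mod)
    moreover have "0 < b mod n - a mod n" "b mod n - a mod n < n"
      using ne that n_pos by (auto simp: less_imp_diff_less)
    ultimately show False using \<zeta>_prim by blast
  qed
  show "a mod n = b mod n" if "\<zeta> ^ a = \<zeta> ^ b"
    using *[of a b] *[of b a] that by (metis nat_le_linear)
  show "\<zeta> ^ a = \<zeta> ^ b" if "a mod n = b mod n"
    using that by (metis \<zeta>_pow_mod)
qed

text \<open>The geometric sum times x - 1 is x^n - 1, which vanishes.\<close>

lemma sum_powers_root:
  assumes "x ^ n = (1::'k)" shows "(\<Sum>i<n. x ^ i) = (if x = 1 then of_nat n else 0)"
  using power_diff_1_eq[of x n] assms by auto

text \<open>The powers of \<zeta> are already n distinct roots of X^n - 1, which has at most n. This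
  is what makes every character a power of \<chi>.\<close>

lemma root_of_unity:
  assumes "x ^ n = (1::'k)" shows "\<exists>j<n. x = \<zeta> ^ j"
proof -
  define p where "p = Polynomial.monom (1::'k) n - 1"
  have deg: "Polynomial.degree p \<le> n"
    unfolding p_def by (intro degree_diff_le) (auto simp: Polynomial.degree_monom_le)
  have "Polynomial.coeff p 0 = - 1"
    using n_pos by (simp add: p_def coeff_monom)
  then have p0: "p \<noteq> 0" by auto
  have roots: "{x. poly p x = 0} = {x. x ^ n = 1}"
    by (auto simp: p_def poly_monom)
  have sub: "(\<lambda>j. \<zeta> ^ j) ` {..<n} \<subseteq> {x. x ^ n = 1}"
    by (auto simp flip: power_mult) (metis \<zeta>_n mult.commute power_mult power_one)
  have "inj_on (\<lambda>j. \<zeta> ^ j) {..<n}"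
    by (auto simp: inj_on_def \<zeta>_pow_eq_iff)
  then have "card ((\<lambda>j. \<zeta> ^ j) ` {..<n}) = n" by (simp add: card_image)
  moreover have "card {x. x ^ n = (1::'k)} \<le> n" "finite {x. x ^ n = (1::'k)}"
    using card_poly_roots_bound[OF p0] poly_roots_finite[OF p0] deg unfolding roots by auto
  ultimately have "(\<lambda>j. \<zeta> ^ j) ` {..<n} = {x. x ^ n = 1}"
    by (intro card_seteq sub) auto
  then show ?thesis using assms by blast
qed

text \<open>If n vanished in the field, the polynomial 1 + X + ... + X^(n-1) would also vanish at 1,
  where its value is n. It would then have all n powers of \<zeta> as roots, although its degree is
  below n.\<close>

lemma n_nonzero [simp]: "(of_nat n :: 'k) \<noteq> 0"
proof
  assume n0: "(of_nat n :: 'k) = 0"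
  define p where "p = (\<Sum>i<n. Polynomial.monom (1::'k) i)"
  have deg: "Polynomial.degree p \<le> n - 1"
    unfolding p_def by (intro degree_sum_le) (auto simp: Polynomial.degree_monom_eq)
  have "Polynomial.coeff p 0 = 1"
    using n_pos by (simp add: p_def coeff_sum coeff_monom sum.delta)
  then have p0: "p \<noteq> 0" by auto
  have sub: "(\<lambda>j. \<zeta> ^ j) ` {..<n} \<subseteq> {x. poly p x = 0}"
  proof safe
    fix j
    have "(\<zeta> ^ j) ^ n = 1" by (metis \<zeta>_n mult.commute power_mult power_one)
    then show "poly p (\<zeta> ^ j) = 0"
      using sum_powers_root[of "\<zeta> ^ j"] n0 by (simp add: p_def poly_sum poly_monom)
  qed
  have "inj_on (\<lambda>j. \<zeta> ^ j) {..<n}"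
    by (auto simp: inj_on_def \<zeta>_pow_eq_iff)
  then have "n = card ((\<lambda>j. \<zeta> ^ j) ` {..<n})" by (simp add: card_image)
  also have "\<dots> \<le> card {x. poly p x = 0}"
    by (rule card_mono[OF poly_roots_finite[OF p0] sub])
  also have "\<dots> \<le> n - 1" using card_poly_roots_bound[OF p0] deg by simp
  finally show False using n_pos by simp
qed

lemma dual_group: "group Gd"
proof (rule groupI)
  fix \<psi> assume \<psi>: "\<psi> \<in> carrier Gd"
  show "\<exists>\<phi>\<in>carrier Gd. \<phi> \<otimes>\<^bsub>Gd\<^esub> \<psi> = \<one>\<^bsub>Gd\<^esub>"
    by (rule bexI[of _ "\<lambda>x\<in>carrier G. inverse (\<psi> x)"])
      (use \<psi> in \<open>auto simp: dual_group_def fun_eq_iff PiE_iff\<close>)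
qed (auto simp: dual_group_def PiE_iff fun_eq_iff restrict_def extensional_def)

sublocale Gd: group Gd by (rule dual_group)

lemma dual_mult_app: "h \<in> carrier G \<Longrightarrow> (\<psi> \<otimes>\<^bsub>Gd\<^esub> \<phi>) h = \<psi> h * \<phi> h"
  by (simp add: dual_group_def)

lemma dual_one_app [simp]: "h \<in> carrier G \<Longrightarrow> \<one>\<^bsub>Gd\<^esub> h = 1"
  by (simp add: dual_group_def)

lemma dual_hom: "\<psi> \<in> carrier Gd \<Longrightarrow> h \<in> carrier G \<Longrightarrow> h' \<in> carrier G \<Longrightarrow> \<psi> (h \<otimes> h') = \<psi> h * \<psi> h'"
  by (simp add: dual_group_def)

lemma dual_nonzero: "\<psi> \<in> carrier Gd \<Longrightarrow> h \<in> carrier G \<Longrightarrow> \<psi> h \<noteq> 0"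
  by (auto simp: dual_group_def)

lemma dual_ext:
  assumes "\<psi> \<in> carrier Gd" "\<phi> \<in> carrier Gd" "\<And>h. h \<in> carrier G \<Longrightarrow> \<psi> h = \<phi> h"
  shows "\<psi> = \<phi>"
  using assms by (auto simp: dual_group_def intro: PiE_ext)

lemma dual_at_one [simp]: "\<psi> \<in> carrier Gd \<Longrightarrow> \<psi> \<one> = 1"
  using dual_hom[of \<psi> \<one> \<one>] dual_nonzero[of \<psi> \<one>] by simp

lemma dual_at_inv: "\<psi> \<in> carrier Gd \<Longrightarrow> h \<in> carrier G \<Longrightarrow> \<psi> (inv h) = inverse (\<psi> h)"
  using dual_hom[of \<psi> "inv h" h] dual_nonzero[of \<psi> h] by (simp add: field_simps)

lemma dual_at_pow: "\<psi> \<in> carrier Gd \<Longrightarrow> h \<in> carrier G \<Longrightarrow> \<psi> (h [^] (i::nat)) = \<psi> h ^ i"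
  by (induction i) (simp_all add: dual_hom)

text \<open>The description defining \<chi> needs a unique witness. The discrete logarithm
  \<open>e\<close> to the base \<open>g\<close> provides one, and two characters that agree at the
  generator \<open>g\<close> agree everywhere.\<close>

lemma dual_gen: "\<chi> \<in> carrier Gd" "\<chi> g = \<zeta>"
proof -
  define e where "e h = (THE i. i < n \<and> h = g [^] i)" for h
  have e: "e (g [^] i) mod n = i mod n" for i :: nat
  proof -
    have "e (g [^] i) = i mod n"
      unfolding e_def using n_pos by (intro the_equality) (auto simp: g_pow_mod g_pow_eq_iff)
    then show ?thesis by simp
  qed
  let ?\<psi> = "\<lambda>h\<in>carrier G. \<zeta> ^ e h"
  have app: "?\<psi> (g [^] i) = \<zeta> ^ i" for i :: nat
    using e by (simp add: \<zeta>_pow_eq_iff)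
  have in_dual: "?\<psi> \<in> carrier Gd"
  proof -
    have "?\<psi> (h \<otimes> h') = ?\<psi> h * ?\<psi> h'" if "h \<in> carrier G" "h' \<in> carrier G" for h h'
      using that
      by (elim g_pow_exhaust) (simp only: G.nat_pow_mult[OF g_closed] app power_add)
    then show ?thesis by (simp add: dual_group_def)
  qed
  moreover have "?\<psi> g = \<zeta>" using app[of 1] by simp
  moreover have "\<psi> = \<phi>" if "\<psi> \<in> carrier Gd" "\<psi> g = \<zeta>" "\<phi> \<in> carrier Gd" "\<phi> g = \<zeta>" for \<psi> \<phi>
    using that by (intro dual_ext) (auto simp: dual_at_pow elim!: g_pow_exhaust)
  ultimately have "\<exists>!\<psi>. \<psi> \<in> carrier Gd \<and> \<psi> g = \<zeta>" by blast
  from theI'[OF this] show "\<chi> \<in> carrier Gd" "\<chi> g = \<zeta>" by (simp_all add: dual_gen_def)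
qed

lemma dual_pow_app: "\<psi> \<in> carrier Gd \<Longrightarrow> h \<in> carrier G \<Longrightarrow> (\<psi> [^]\<^bsub>Gd\<^esub> (j::nat)) h = \<psi> h ^ j"
  by (induction j) (simp_all add: dual_mult_app mult.commute)

lemma dual_gen_pow_app: "(\<chi> [^]\<^bsub>Gd\<^esub> (j::nat)) (g [^] (i::nat)) = \<zeta> ^ (i * j)"
  by (simp add: dual_pow_app dual_gen dual_at_pow mult.commute flip: power_mult)

text \<open>A character sends \<open>g\<close> to an n-th root of unity, hence to a power of
  \<zeta>, and is determined by this value.\<close>

lemma dual_gen_bij: "bij_betw (\<lambda>j::nat. \<chi> [^]\<^bsub>Gd\<^esub> j) {..<n} (carrier Gd)"
  unfolding bij_betw_def
proof (intro conjI equalityI subsetI)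
  show "inj_on (\<lambda>j::nat. \<chi> [^]\<^bsub>Gd\<^esub> j) {..<n}"
  proof (rule inj_onI)
    fix i j assume ij: "i \<in> {..<n}" "j \<in> {..<n}" and eq: "\<chi> [^]\<^bsub>Gd\<^esub> i = \<chi> [^]\<^bsub>Gd\<^esub> j"
    have "\<zeta> ^ i = \<zeta> ^ j" using arg_cong[OF eq, of "\<lambda>\<psi>. \<psi> g"] by (simp add: dual_pow_app dual_gen)
    then show "i = j" using ij by (simp add: \<zeta>_pow_eq_iff)
  qed
next
  fix \<psi> assume \<psi>: "\<psi> \<in> carrier Gd"
  have "\<psi> g ^ n = 1" using dual_at_pow[OF \<psi> g_closed, of n] \<psi> by (simp add: g_pow_n)
  then obtain j where j: "j < n" "\<psi> g = \<zeta> ^ j" using root_of_unity by blast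
  have "\<psi> = \<chi> [^]\<^bsub>Gd\<^esub> j"
    using \<psi> j by (intro dual_ext)
      (auto simp: dual_gen dual_gen_pow_app dual_at_pow power_mult[symmetric] mult.commute elim!: g_pow_exhaust)
  then show "\<psi> \<in> (\<lambda>j::nat. \<chi> [^]\<^bsub>Gd\<^esub> j) ` {..<n}" using j by blast
qed (auto simp: dual_gen)

lemma finite_dual: "finite (carrier Gd)"
  using bij_betw_finite[OF dual_gen_bij] by simp

lemma sum_dual: "(\<Sum>\<psi>\<in>carrier Gd. f \<psi>) = (\<Sum>j<n. f (\<chi> [^]\<^bsub>Gd\<^esub> j))"
  using sum.reindex_bij_betw[OF dual_gen_bij, of f] by simp

lemma sum_group: "(\<Sum>h\<in>carrier G. f h) = (\<Sum>i<n. f (g [^] i))"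
  using sum.reindex_bij_betw[OF g_pow_bij, of f] by simp

lemma char_orthogonality_dual:
  assumes "h \<in> carrier G"
  shows "(\<Sum>\<psi>\<in>carrier Gd. \<psi> h) = (if h = \<one> then of_nat n else 0)"
proof -
  obtain i where i: "i < n" "h = g [^] i" using assms by (rule g_pow_exhaust)
  have "(\<Sum>\<psi>\<in>carrier Gd. \<psi> h) = (\<Sum>j<n. (\<zeta> ^ i) ^ j)"
    by (simp add: sum_dual i dual_gen_pow_app power_mult)
  also have "\<dots> = (if \<zeta> ^ i = 1 then of_nat n else 0)"
    by (rule sum_powers_root) (metis \<zeta>_n mult.commute power_mult power_one)
  also have "\<zeta> ^ i = 1 \<longleftrightarrow> h = \<one>"
    using \<zeta>_pow_eq_iff[of i 0] g_pow_eq_iff[of i 0] i by simp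
  finally show ?thesis .
qed

lemma char_orthogonality:
  assumes "\<psi> \<in> carrier Gd"
  shows "(\<Sum>h\<in>carrier G. \<psi> h) = (if \<psi> = \<one>\<^bsub>Gd\<^esub> then of_nat n else 0)"
proof -
  have "\<psi> g ^ n = 1" using dual_at_pow[OF assms g_closed, of n] assms by (simp add: g_pow_n)
  then have "(\<Sum>h\<in>carrier G. \<psi> h) = (if \<psi> g = 1 then of_nat n else 0)"
    using assms by (simp add: sum_group dual_at_pow sum_powers_root)
  moreover have "\<psi> g = 1 \<longleftrightarrow> \<psi> = \<one>\<^bsub>Gd\<^esub>"
    using assms by (auto intro!: dual_ext simp: dual_at_pow elim!: g_pow_exhaust)
  ultimately show ?thesis by simp
qed

text \<open>This direction produces preimages under \<open>F\<close>: coefficients on characters are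
  chosen so that a prescribed operator results.\<close>

lemma dual_fourier_inversion:
  assumes "h \<in> carrier G" "h' \<in> carrier G"
  shows "(\<Sum>\<psi>\<in>carrier Gd. inverse (of_nat n) * inverse (\<psi> h) * \<psi> h') = (if h = h' then 1 else 0)"
proof -
  have "(\<Sum>\<psi>\<in>carrier Gd. inverse (of_nat n) * inverse (\<psi> h) * \<psi> h')
    = inverse (of_nat n) * (\<Sum>\<psi>\<in>carrier Gd. \<psi> (inv h \<otimes> h'))"
    using assms by (simp add: sum_distrib_left dual_hom dual_at_inv mult.assoc)
  then show ?thesis
    using assms by (auto simp: char_orthogonality_dual dest: G.inv_equality)
qed

text \<open>This direction gives injectivity of \<open>F\<close>: it recovers the coefficients on
  characters from the values of an operator on group elements.\<close>

lemma fourier_inversion: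
  assumes "\<psi> \<in> carrier Gd" "\<phi> \<in> carrier Gd"
  shows "(\<Sum>h\<in>carrier G. inverse (of_nat n) * inverse (\<psi> h) * \<phi> h) = (if \<psi> = \<phi> then 1 else 0)"
proof -
  have app: "(inv\<^bsub>Gd\<^esub> \<psi>) h = inverse (\<psi> h)" if "h \<in> carrier G" for h
    using dual_mult_app[of h "inv\<^bsub>Gd\<^esub> \<psi>" \<psi>] dual_nonzero[of \<psi> h] assms that by (simp add: field_simps)
  have "(\<Sum>h\<in>carrier G. inverse (of_nat n) * inverse (\<psi> h) * \<phi> h)
    = inverse (of_nat n) * (\<Sum>h\<in>carrier G. (inv\<^bsub>Gd\<^esub> \<psi> \<otimes>\<^bsub>Gd\<^esub> \<phi>) h)"
    using assms by (simp add: sum_distrib_left dual_mult_app app mult.assoc)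
  then show ?thesis
    using assms by (auto simp: char_orthogonality dest: Gd.inv_equality)
qed

end

section \<open>Duality for skew group algebras\<close>

text \<open>An abstract model of the vertex idempotents: \<open>e1\<close> and \<open>e2\<close>
  stand for the sums over \<E>' and \<E>''. The axioms say that the translates of \<open>e1\<close>
  are orthogonal, that \<open>e2\<close> is invariant, and that together they decompose 1, which is
  how the two kinds of orbits look from inside the algebra.\<close>

locale skew_duality = kalg_act A G \<rho> + cyclic_char G g n \<zeta>
  for A :: "('k::field, 'x) module" (structure) and G :: "('g, 'm) monoid_scheme" (structure)
    and \<rho> :: "'g \<Rightarrow> 'x \<Rightarrow> 'x" and g :: 'g and n :: nat and \<zeta> :: 'k +
  fixes e1 e2 :: 'x
  assumes e_closed [simp, intro]: "e1 \<in> carrier A" "e2 \<in> carrier A"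
    and e_idem [simp]: "e1 \<otimes> e1 = e1" "e2 \<otimes> e2 = e2"
    and e_orth [simp]: "e1 \<otimes> e2 = \<zero>" "e2 \<otimes> e1 = \<zero>"
    and act_e2 [simp]: "h \<in> carrier G \<Longrightarrow> \<rho> h e2 = e2"
    and act_e1: "h \<in> carrier G \<Longrightarrow> e1 \<otimes> \<rho> h e1 = (if h = \<one>\<^bsub>G\<^esub> then e1 else \<zero>)"
    and e_sum: "(\<Oplus>h\<in>carrier G. \<rho> h e1) \<oplus> e2 = \<one>"
begin

definition e where "e = e1 \<oplus> e2"
definition \<eta> where "\<eta> = skew_tensor A G e (grp_elt \<one>\<^bsub>G\<^esub>)"
text \<open>The element e1 \<otimes> 1 + e2 \<otimes> e_0 in coefficients: e_0 has the coefficient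
  1/n at every group element.\<close>

definition t where "t = (\<lambda>h\<in>carrier G. (if h = \<one>\<^bsub>G\<^esub> then e1 else \<zero>) \<oplus> inverse (of_nat n) \<odot> e2)"
definition w where "w = (\<lambda>h\<in>carrier G. e)"
text \<open>The coefficient of \<open>w\<close> times \<open>a\<close> at \<open>h\<close> has
  e1-part e1 h(a). Pulled back by h^-1 it becomes h^-1(e1) a, and the sum of these over
  \<open>h\<close>, together with e2 a, is \<open>a\<close>. So \<open>P\<close> inverts right
  multiplication of \<open>w\<close> by \<open>inc\<close>.\<close>

definition P where "P x = (\<Oplus>h\<in>carrier G. \<rho> (inv\<^bsub>G\<^esub> h) (e1 \<otimes> x h)) \<oplus> e2 \<otimes> x \<one>\<^bsub>G\<^esub>"
abbreviation inc where "inc a \<equiv> skew_tensor A G a (grp_elt \<one>\<^bsub>G\<^esub>)"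
abbreviation \<delta> where "\<delta> \<equiv> dual_action A G (carrier S)"
abbreviation \<Gamma> where "\<Gamma> \<equiv> corner_alg S \<eta>"
abbreviation \<delta>\<Gamma> where "\<delta>\<Gamma> \<equiv> dual_action A G (carrier \<Gamma>)"
definition T where "T f x = (\<Oplus>\<^bsub>S\<^esub>\<psi>\<in>carrier Gd. f \<psi> \<otimes>\<^bsub>S\<^esub> \<delta> \<psi> x)"
definition F where "F f = P (T f w)"

lemma e_simps [simp]: "e \<in> carrier A" "e1 \<otimes> e = e1" "e \<otimes> e1 = e1" "e2 \<otimes> e = e2" "e \<otimes> e2 = e2"
  "e \<otimes> e = e"
  by (simp_all add: e_def l_distr r_distr)

lemma e_act_simps [simp]:
  assumes [simp]: "h \<in> carrier G"
  shows "e2 \<otimes> \<rho> h e1 = \<zero>" "e2 \<otimes> \<rho> h e = e2" "\<rho> h e \<otimes> e2 = e2"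
    "\<rho> h e1 \<otimes> \<rho> h e = \<rho> h e1" "e \<otimes> \<rho> h e1 = (if h = \<one>\<^bsub>G\<^esub> then e1 else \<zero>)"
proof -
  show *: "e2 \<otimes> \<rho> h e1 = \<zero>" "e2 \<otimes> \<rho> h e = e2" "\<rho> h e \<otimes> e2 = e2" "\<rho> h e1 \<otimes> \<rho> h e = \<rho> h e1"
    using act_mult[of h e2 e1, symmetric] act_mult[of h e2 e, symmetric] act_mult[of h e e2, symmetric]
      act_mult[of h e1 e, symmetric] by simp_all
  show "e \<otimes> \<rho> h e1 = (if h = \<one>\<^bsub>G\<^esub> then e1 else \<zero>)"
    using * by (simp add: e_def l_distr act_e1)
qed

lemma e_sum_inv: "(\<Oplus>h\<in>carrier G. \<rho> (inv\<^bsub>G\<^esub> h) e1) \<oplus> e2 = \<one>"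
proof -
  have "(\<lambda>h. inv\<^bsub>G\<^esub> h) ` carrier G = carrier G"
  proof (intro equalityI subsetI)
    fix h assume "h \<in> carrier G"
    then show "h \<in> (\<lambda>h. inv\<^bsub>G\<^esub> h) ` carrier G" by (intro image_eqI[of _ _ "inv\<^bsub>G\<^esub> h"]) auto
  qed auto
  moreover have "inj_on (\<lambda>h. inv\<^bsub>G\<^esub> h) (carrier G)" by (metis G.inv_inv inj_onI)
  ultimately have "(\<Oplus>h\<in>carrier G. \<rho> h e1) = (\<Oplus>h\<in>carrier G. \<rho> (inv\<^bsub>G\<^esub> h) e1)"
    using finsum_reindex[of "\<lambda>h. \<rho> h e1" "\<lambda>h. inv\<^bsub>G\<^esub> h" "carrier G"] by (simp add: Pi_def)
  then show ?thesis using e_sum by simp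
qed

lemma closed [simp, intro]: "\<eta> \<in> carrier S" "t \<in> carrier S" "w \<in> carrier S" "a \<in> carrier A \<Longrightarrow> inc a \<in> carrier S"
  by (auto simp: \<eta>_def t_def w_def skew_carrier skew_tensor_def)

lemma \<delta>_app: "x \<in> carrier S \<Longrightarrow> h \<in> carrier G \<Longrightarrow> \<delta> \<psi> x h = \<psi> h \<odot> x h"
  by (simp add: dual_action_def)

lemma \<delta>_closed [simp, intro]: "x \<in> carrier S \<Longrightarrow> \<delta> \<psi> x \<in> carrier S"
  by (auto simp: dual_action_def skew_carrier)

lemma grp_elt_app: "grp_elt h x = (if x = h then 1 else 0)"
  by (simp add: grp_elt_def)

lemma inc_app: "h \<in> carrier G \<Longrightarrow> a \<in> carrier A \<Longrightarrow> inc a h = (if h = \<one>\<^bsub>G\<^esub> then a else \<zero>)"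
  by (simp add: skew_tensor_app grp_elt_def)

lemma mult_inc_app: "f \<in> carrier S \<Longrightarrow> a \<in> carrier A \<Longrightarrow> x \<in> carrier G \<Longrightarrow>
  (f \<otimes>\<^bsub>S\<^esub> inc a) x = f x \<otimes> \<rho> x a"
  by (simp add: mult_grp_elt_app)

lemma inc_mult_app: "f \<in> carrier S \<Longrightarrow> a \<in> carrier A \<Longrightarrow> x \<in> carrier G \<Longrightarrow>
  (inc a \<otimes>\<^bsub>S\<^esub> f) x = a \<otimes> f x"
  by (simp add: grp_elt_mult_app)

lemma inc_mult: "a \<in> carrier A \<Longrightarrow> b \<in> carrier A \<Longrightarrow> inc a \<otimes>\<^bsub>S\<^esub> inc b = inc (a \<otimes> b)"
  by (rule skew_ext) (auto simp: inc_mult_app inc_app skew_mult_closed)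

lemma \<delta>_kalg_act: "kalg_act S Gd \<delta>"
proof (intro_locales, unfold kalg_act_axioms_def, safe)
  fix \<psi> x y assume \<psi>: "\<psi> \<in> carrier Gd" and x: "x \<in> carrier S" and y: "y \<in> carrier S"
  show "\<delta> \<psi> (x \<otimes>\<^bsub>S\<^esub> y) = \<delta> \<psi> x \<otimes>\<^bsub>S\<^esub> \<delta> \<psi> y"
  proof (rule skew_ext)
    fix h assume h [simp]: "h \<in> carrier G"
    have "(\<delta> \<psi> x \<otimes>\<^bsub>S\<^esub> \<delta> \<psi> y) h = (\<Oplus>z\<in>carrier G. \<psi> h \<odot> (x z \<otimes> \<rho> z (y (inv\<^bsub>G\<^esub> z \<otimes>\<^bsub>G\<^esub> h))))"
      unfolding skew_mult_app[OF h]
    proof (rule finsum_cong'[OF refl])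
      fix z assume [simp]: "z \<in> carrier G"
      have "\<psi> z * \<psi> (inv\<^bsub>G\<^esub> z \<otimes>\<^bsub>G\<^esub> h) = \<psi> h"
        using \<psi> by (simp flip: dual_hom G.m_assoc)
      then show "\<delta> \<psi> x z \<otimes> \<rho> z (\<delta> \<psi> y (inv\<^bsub>G\<^esub> z \<otimes>\<^bsub>G\<^esub> h)) = \<psi> h \<odot> (x z \<otimes> \<rho> z (y (inv\<^bsub>G\<^esub> z \<otimes>\<^bsub>G\<^esub> h)))"
        using x y by (simp add: \<delta>_app act_smult smult_mult_left smult_mult_right smult_assoc mult.commute)
    qed (use x y in auto)
    also have "\<dots> = \<delta> \<psi> (x \<otimes>\<^bsub>S\<^esub> y) h"
      using x y by (simp add: \<delta>_app skew_mult_closed skew_mult_app smult_finsum Pi_def)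
    finally show "\<delta> \<psi> (x \<otimes>\<^bsub>S\<^esub> y) h = (\<delta> \<psi> x \<otimes>\<^bsub>S\<^esub> \<delta> \<psi> y) h" ..
  qed (use x y in \<open>auto intro: skew_closed\<close>)
next
  fix \<psi> assume \<psi>: "\<psi> \<in> carrier Gd"
  show "\<delta> \<psi> \<one>\<^bsub>S\<^esub> = \<one>\<^bsub>S\<^esub>"
    using \<psi> by (intro skew_ext) (auto simp: \<delta>_app skew_one_closed skew_one_app)
next
  fix \<psi> \<phi> x assume "\<psi> \<in> carrier Gd" "\<phi> \<in> carrier Gd" "x \<in> carrier S"
  then show "\<delta> (\<psi> \<otimes>\<^bsub>Gd\<^esub> \<phi>) x = \<delta> \<psi> (\<delta> \<phi> x)"
    by (intro skew_ext) (auto simp: \<delta>_app dual_mult_app smult_assoc)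
qed (auto intro!: skew_ext simp: finite_dual \<delta>_app skew_closed skew_apps smult_r_distr smult_assoc mult.commute)

sublocale D: kalg_act S Gd \<delta> by (rule \<delta>_kalg_act)

lemma \<delta>_inc [simp]: "\<psi> \<in> carrier Gd \<Longrightarrow> a \<in> carrier A \<Longrightarrow> \<delta> \<psi> (inc a) = inc a"
  by (rule skew_ext) (auto simp: \<delta>_app inc_app)

lemma \<delta>_\<eta> [simp]: "\<psi> \<in> carrier Gd \<Longrightarrow> \<delta> \<psi> \<eta> = \<eta>"
  by (simp add: \<eta>_def)

lemma \<eta>_idem [simp]: "\<eta> \<otimes>\<^bsub>S\<^esub> \<eta> = \<eta>"
  by (simp add: \<eta>_def inc_mult)

lemma \<Gamma>_carrier: "carrier \<Gamma> = {x \<in> carrier S. \<eta> \<otimes>\<^bsub>S\<^esub> x = x \<and> x \<otimes>\<^bsub>S\<^esub> \<eta> = x}"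
  by (rule S.corner(2)) simp_all

lemma \<Gamma>_closed [dest]: "x \<in> carrier \<Gamma> \<Longrightarrow> x \<in> carrier S"
  by (simp add: \<Gamma>_carrier)

lemma \<Gamma>_simps [simp]: "x \<otimes>\<^bsub>\<Gamma>\<^esub> y = x \<otimes>\<^bsub>S\<^esub> y" "x \<oplus>\<^bsub>\<Gamma>\<^esub> y = x \<oplus>\<^bsub>S\<^esub> y" "\<one>\<^bsub>\<Gamma>\<^esub> = \<eta>" "\<zero>\<^bsub>\<Gamma>\<^esub> = \<zero>\<^bsub>S\<^esub>"
  "c \<odot>\<^bsub>\<Gamma>\<^esub> x = c \<odot>\<^bsub>S\<^esub> x"
  by (simp_all add: corner_alg_def)

lemma \<delta>\<Gamma>_eq [simp]: "x \<in> carrier \<Gamma> \<Longrightarrow> \<delta>\<Gamma> \<psi> x = \<delta> \<psi> x"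
  by (simp add: dual_action_def \<Gamma>_closed)

lemma \<delta>_\<Gamma> [simp]: "x \<in> carrier \<Gamma> \<Longrightarrow> \<psi> \<in> carrier Gd \<Longrightarrow> \<delta> \<psi> x \<in> carrier \<Gamma>"
  using D.act_mult[of \<psi> \<eta> x] D.act_mult[of \<psi> x \<eta>] by (simp add: \<Gamma>_carrier)

lemma \<Gamma>_kalg: "kalg \<Gamma>" by (rule S.corner(1)) simp_all

text \<open>The idempotent \<open>\<eta>\<close> is supported at the identity of the group, so every
  character fixes it and the dual action restricts to the corner.\<close>

lemma \<delta>\<Gamma>_kalg_act: "kalg_act \<Gamma> Gd \<delta>\<Gamma>"
proof -
  interpret \<Gamma>: kalg \<Gamma> by (rule \<Gamma>_kalg)
  have [simp]: "x \<oplus>\<^bsub>S\<^esub> y \<in> carrier \<Gamma>" "x \<otimes>\<^bsub>S\<^esub> y \<in> carrier \<Gamma>" "c \<odot>\<^bsub>S\<^esub> x \<in> carrier \<Gamma>" 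
    if "x \<in> carrier \<Gamma>" "y \<in> carrier \<Gamma>" for x y c
    using that \<Gamma>.a_closed[of x y] \<Gamma>.m_closed[of x y] \<Gamma>.smult_closed[of x c] by simp_all
  have [simp]: "\<eta> \<in> carrier \<Gamma>" by (simp add: \<Gamma>_carrier)
  show ?thesis
    by (intro_locales, unfold kalg_act_axioms_def)
      (auto simp: finite_dual D.act_add D.act_mult D.act_smult D.act_comp \<Gamma>_closed)
qed

sublocale R: kalg_act \<Gamma> Gd \<delta>\<Gamma> by (rule \<delta>\<Gamma>_kalg_act)

abbreviation R where "R \<equiv> skew_alg \<Gamma> Gd \<delta>\<Gamma>"

lemma \<Gamma>_finsum: "(\<And>i. i \<in> I \<Longrightarrow> f i \<in> carrier \<Gamma>) \<Longrightarrow> (\<Oplus>\<^bsub>\<Gamma>\<^esub>i\<in>I. f i) = (\<Oplus>\<^bsub>S\<^esub>i\<in>I. f i)"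
  by (rule S.corner_finsum) simp_all

section \<open>The idempotent \<open>t\<close> and the free module of rank one it cuts out\<close>

lemma t_app: "h \<in> carrier G \<Longrightarrow> t h = (if h = \<one>\<^bsub>G\<^esub> then e1 else \<zero>) \<oplus> inverse (of_nat n) \<odot> e2"
  by (simp add: t_def)

lemma w_app [simp]: "h \<in> carrier G \<Longrightarrow> w h = e"
  by (simp add: w_def)

text \<open>Left multiplication by e2 \<otimes> e_0 is averaging over the group followed by
  projection with \<open>e2\<close>.\<close>

lemma t_mult_app:
  assumes [simp]: "x \<in> carrier S" "h \<in> carrier G"
  shows "(t \<otimes>\<^bsub>S\<^esub> x) h = e1 \<otimes> x h \<oplus>
    e2 \<otimes> (\<Oplus>y\<in>carrier G. inverse (of_nat n) \<odot> \<rho> y (x (inv\<^bsub>G\<^esub> y \<otimes>\<^bsub>G\<^esub> h)))"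
proof -
  have "t = inc e1 \<oplus>\<^bsub>S\<^esub> skew_tensor A G e2 (\<lambda>_. inverse (of_nat n))"
    by (rule skew_ext) (auto simp: t_app skew_apps grp_elt_def skew_tensor_app skew_add_closed skew_tensor_closed)
  then have "(t \<otimes>\<^bsub>S\<^esub> x) h = (inc e1 \<otimes>\<^bsub>S\<^esub> x) h \<oplus> (skew_tensor A G e2 (\<lambda>_. inverse (of_nat n)) \<otimes>\<^bsub>S\<^esub> x) h"
    by (simp add: S.l_distr skew_tensor_closed skew_add_app)
  then show ?thesis
    by (simp only: inc_mult_app[OF assms(1) e_closed(1) assms(2)] skew_tensor_mult_app[OF assms(2) e_closed(2) assms(1)])
qed

lemma sum_const:
  assumes "a \<in> carrier A" shows "(\<Oplus>y\<in>carrier G. inverse (of_nat n) \<odot> a) = a"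
  using sum_smult[OF fin assms, of "\<lambda>_. inverse (of_nat n)"] order_n assms by (simp add: order_def)

lemma t_idem [simp]: "t \<otimes>\<^bsub>S\<^esub> t = t"
proof (rule skew_ext)
  fix h assume [simp]: "h \<in> carrier G"
  have "e2 \<otimes> (\<Oplus>y\<in>carrier G. inverse (of_nat n) \<odot> \<rho> y (t (inv\<^bsub>G\<^esub> y \<otimes>\<^bsub>G\<^esub> h)))
    = (\<Oplus>y\<in>carrier G. e2 \<otimes> (inverse (of_nat n) \<odot> \<rho> y (t (inv\<^bsub>G\<^esub> y \<otimes>\<^bsub>G\<^esub> h))))"
    by (rule finsum_rdistr[OF fin]) auto
  also have "\<dots> = (\<Oplus>y\<in>carrier G. inverse (of_nat n) \<odot> (inverse (of_nat n) \<odot> e2))"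
    by (rule finsum_cong') (auto simp: t_app act_add act_smult smult_mult_right r_distr)
  also have "\<dots> = inverse (of_nat n) \<odot> e2"
    by (rule sum_const) simp
  finally show "(t \<otimes>\<^bsub>S\<^esub> t) h = t h"
    by (simp add: t_mult_app) (simp add: t_app r_distr smult_mult_right)
qed (auto simp: skew_mult_closed)

lemma t_w [simp]: "t \<otimes>\<^bsub>S\<^esub> w = w"
proof (rule skew_ext)
  fix h assume [simp]: "h \<in> carrier G"
  have "e2 \<otimes> (\<Oplus>y\<in>carrier G. inverse (of_nat n) \<odot> \<rho> y (w (inv\<^bsub>G\<^esub> y \<otimes>\<^bsub>G\<^esub> h)))
    = (\<Oplus>y\<in>carrier G. e2 \<otimes> (inverse (of_nat n) \<odot> \<rho> y (w (inv\<^bsub>G\<^esub> y \<otimes>\<^bsub>G\<^esub> h))))"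
    by (rule finsum_rdistr[OF fin]) auto
  also have "\<dots> = (\<Oplus>y\<in>carrier G. inverse (of_nat n) \<odot> e2)"
    by (rule finsum_cong') (auto simp: smult_mult_right)
  also have "\<dots> = e2" by (rule sum_const) simp
  finally show "(t \<otimes>\<^bsub>S\<^esub> w) h = w h"
    by (simp add: t_mult_app) (simp add: e_def)
qed (auto simp: skew_mult_closed)

lemma t_\<Gamma> [simp]: "t \<in> carrier \<Gamma>"
proof -
  have "\<eta> \<otimes>\<^bsub>S\<^esub> t = t" unfolding \<eta>_def
    by (rule skew_ext) (auto simp: skew_mult_closed inc_mult_app t_app r_distr smult_mult_right)
  moreover have "t \<otimes>\<^bsub>S\<^esub> \<eta> = t" unfolding \<eta>_def
    by (rule skew_ext) (auto simp: skew_mult_closed mult_inc_app t_app l_distr smult_mult_left)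
  ultimately show ?thesis by (simp add: \<Gamma>_carrier)
qed

lemma P_closed [simp, intro]: "x \<in> carrier S \<Longrightarrow> P x \<in> carrier A"
  by (auto simp: P_def intro!: finsum_closed)

text \<open>Being fixed by \<open>t\<close> does not constrain the e1-part of \<open>x\<close>, and
  forces its e2-part to be a group average. An average is equivariant, so its coefficient at the
  identity determines all others; this is why \<open>P\<close> reads the e2-part only there.\<close>

lemma w_P:
  assumes x [simp]: "x \<in> carrier S" and tx: "t \<otimes>\<^bsub>S\<^esub> x = x"
  shows "w \<otimes>\<^bsub>S\<^esub> inc (P x) = x"
proof (rule skew_ext)
  fix h assume h [simp]: "h \<in> carrier G"
  \<comment> \<open>The group average of \<open>x\<close>. Since \<open>t\<close> fixes
    \<open>x\<close>, its coefficients are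
    \<open>e1 \<otimes> x h \<oplus> e2 \<otimes> m h\<close>.\<close>
  define m where "m h = (\<Oplus>y\<in>carrier G. inverse (of_nat n) \<odot> \<rho> y (x (inv\<^bsub>G\<^esub> y \<otimes>\<^bsub>G\<^esub> h)))" for h
  have m [simp]: "m h \<in> carrier A" if "h \<in> carrier G" for h
    unfolding m_def using that by (auto intro!: finsum_closed)
  have xm: "x h = e1 \<otimes> x h \<oplus> e2 \<otimes> m h" if "h \<in> carrier G" for h
    using t_mult_app[OF x that] tx by (simp add: m_def)
  have e2x: "e2 \<otimes> x h = e2 \<otimes> m h" if "h \<in> carrier G" for h
    by (subst xm[OF that]) (use that in \<open>simp add: r_distr flip: m_assoc\<close>)
  have "\<rho> h (m \<one>\<^bsub>G\<^esub>) = (\<Oplus>y\<in>carrier G. inverse (of_nat n) \<odot> \<rho> (h \<otimes>\<^bsub>G\<^esub> y) (x (inv\<^bsub>G\<^esub> (h \<otimes>\<^bsub>G\<^esub> y) \<otimes>\<^bsub>G\<^esub> h)))"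
    unfolding m_def
    by (subst act_finsum)
      (auto intro!: finsum_cong' simp: act_smult act_comp G.inv_mult_group G.m_assoc)
  also have "\<dots> = (\<Oplus>y\<in>(\<lambda>y. h \<otimes>\<^bsub>G\<^esub> y) ` carrier G. inverse (of_nat n) \<odot> \<rho> y (x (inv\<^bsub>G\<^esub> y \<otimes>\<^bsub>G\<^esub> h)))"
    by (rule finsum_reindex[symmetric]) (auto simp: G.inj_on_cmult G.surj_const_mult)
  finally have m1: "\<rho> h (m \<one>\<^bsub>G\<^esub>) = m h"
    by (simp add: G.surj_const_mult m_def)
  have "e \<otimes> \<rho> h (\<Oplus>y\<in>carrier G. \<rho> (inv\<^bsub>G\<^esub> y) (e1 \<otimes> x y))
    = (\<Oplus>y\<in>carrier G. e \<otimes> \<rho> h (\<rho> (inv\<^bsub>G\<^esub> y) (e1 \<otimes> x y)))"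
    by (simp add: act_finsum finsum_rdistr fin Pi_def)
  \<comment> \<open>The factor \<open>e\<close> meets the translate of \<open>e1\<close> by h y^-1,
    which it annihilates unless y = h.\<close>
  also have "\<dots> = (\<Oplus>y\<in>carrier G. if y = h then e1 \<otimes> x y else \<zero>)"
  proof (rule finsum_cong'[OF refl])
    fix y assume y [simp]: "y \<in> carrier G"
    have "h \<otimes>\<^bsub>G\<^esub> inv\<^bsub>G\<^esub> y = \<one>\<^bsub>G\<^esub> \<longleftrightarrow> y = h"
      using G.inv_equality[of h "inv\<^bsub>G\<^esub> y"] by auto
    then show "e \<otimes> \<rho> h (\<rho> (inv\<^bsub>G\<^esub> y) (e1 \<otimes> x y)) = (if y = h then e1 \<otimes> x y else \<zero>)"
      by (simp add: act_mult flip: act_comp m_assoc)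
  qed auto
  also have "\<dots> = e1 \<otimes> x h" by (rule finsum_delta[OF fin]) auto
  finally have 1: "e \<otimes> \<rho> h (\<Oplus>y\<in>carrier G. \<rho> (inv\<^bsub>G\<^esub> y) (e1 \<otimes> x y)) = e1 \<otimes> x h" .
  have 2: "e \<otimes> \<rho> h (e2 \<otimes> x \<one>\<^bsub>G\<^esub>) = e2 \<otimes> m h"
    by (simp add: e2x) (simp add: act_mult m1 flip: m_assoc)
  have "(w \<otimes>\<^bsub>S\<^esub> inc (P x)) h = e \<otimes> \<rho> h (P x)" by (simp add: mult_inc_app)
  also have "\<dots> = e1 \<otimes> x h \<oplus> e2 \<otimes> m h"
    unfolding P_def using 1 2 by (simp add: act_add r_distr finsum_closed Pi_def)
  finally show "(w \<otimes>\<^bsub>S\<^esub> inc (P x)) h = x h" using xm[OF h] by simp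
qed (auto intro!: skew_mult_closed)

lemma P_w:
  assumes [simp]: "a \<in> carrier A" shows "P (w \<otimes>\<^bsub>S\<^esub> inc a) = a"
proof -
  have "(\<Oplus>h\<in>carrier G. \<rho> (inv\<^bsub>G\<^esub> h) (e1 \<otimes> (w \<otimes>\<^bsub>S\<^esub> inc a) h)) = (\<Oplus>h\<in>carrier G. \<rho> (inv\<^bsub>G\<^esub> h) e1 \<otimes> a)"
    by (rule finsum_cong'[OF refl]) (auto simp: mult_inc_app act_mult simp flip: m_assoc)
  also have "\<dots> = (\<Oplus>h\<in>carrier G. \<rho> (inv\<^bsub>G\<^esub> h) e1) \<otimes> a"
    by (simp add: finsum_ldistr fin Pi_def)
  finally have "P (w \<otimes>\<^bsub>S\<^esub> inc a) = ((\<Oplus>h\<in>carrier G. \<rho> (inv\<^bsub>G\<^esub> h) e1) \<oplus> e2) \<otimes> a"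
    unfolding P_def by (simp add: mult_inc_app l_distr finsum_closed Pi_def flip: m_assoc)
  then show ?thesis by (simp add: e_sum_inv)
qed

section \<open>The operators \<open>T f\<close> and the second corner\<close>

lemma T_closed [simp, intro]:
  "(\<And>\<psi>. \<psi> \<in> carrier Gd \<Longrightarrow> f \<psi> \<in> carrier S) \<Longrightarrow> x \<in> carrier S \<Longrightarrow> T f x \<in> carrier S"
  by (auto simp: T_def intro!: S.finsum_closed)

text \<open>Right linearity over \<Lambda>: characters act trivially on the elements a \<otimes>
  1.\<close>

lemma T_mult_inc:
  assumes f: "\<And>\<psi>. \<psi> \<in> carrier Gd \<Longrightarrow> f \<psi> \<in> carrier S" and [simp]: "x \<in> carrier S" "a \<in> carrier A"
  shows "T f (x \<otimes>\<^bsub>S\<^esub> inc a) = T f x \<otimes>\<^bsub>S\<^esub> inc a"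
  unfolding T_def
  by (subst S.finsum_ldistr)
    (auto simp: f finite_dual D.act_mult S.m_assoc intro!: S.finsum_cong')

lemma T_app:
  assumes f: "\<And>\<psi>. \<psi> \<in> carrier Gd \<Longrightarrow> f \<psi> \<in> carrier S" and [simp]: "x \<in> carrier S" "h \<in> carrier G"
  shows "T f x h = (\<Oplus>\<psi>\<in>carrier Gd. (f \<psi> \<otimes>\<^bsub>S\<^esub> \<delta> \<psi> x) h)"
  unfolding T_def by (rule skew_finsum_app) (auto simp: f skew_mult_closed)

text \<open>The twisted product over the dual group is made for this: moving a character past a
  factor applies the dual action to it. After the substitution of \<phi>\<psi> for \<psi> both sides
  are the same double sum.\<close>

lemma T_mult:
  assumes f: "f \<in> carrier R" and f': "f' \<in> carrier R" and x [simp]: "x \<in> carrier S"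
  shows "T (f \<otimes>\<^bsub>R\<^esub> f') x = T f (T f' x)"
proof -
  have fc [simp]: "f \<psi> \<in> carrier \<Gamma>" "f' \<psi> \<in> carrier \<Gamma>" "f \<psi> \<in> carrier S" "f' \<psi> \<in> carrier S"
    if "\<psi> \<in> carrier Gd" for \<psi>
    using that f f' by (auto simp: R.skew_app \<Gamma>_closed)
  let ?t = "\<lambda>\<phi> \<psi>. f \<phi> \<otimes>\<^bsub>S\<^esub> (\<delta> \<phi> (f' (inv\<^bsub>Gd\<^esub> \<phi> \<otimes>\<^bsub>Gd\<^esub> \<psi>)) \<otimes>\<^bsub>S\<^esub> \<delta> \<psi> x)"
  have "T (f \<otimes>\<^bsub>R\<^esub> f') x = (\<Oplus>\<^bsub>S\<^esub>\<psi>\<in>carrier Gd. \<Oplus>\<^bsub>S\<^esub>\<phi>\<in>carrier Gd. ?t \<phi> \<psi>)"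
    unfolding T_def
  proof (rule S.finsum_cong'[OF refl])
    fix \<psi> assume \<psi> [simp]: "\<psi> \<in> carrier Gd"
    have "(f \<otimes>\<^bsub>R\<^esub> f') \<psi> = (\<Oplus>\<^bsub>S\<^esub>\<phi>\<in>carrier Gd. f \<phi> \<otimes>\<^bsub>S\<^esub> \<delta> \<phi> (f' (inv\<^bsub>Gd\<^esub> \<phi> \<otimes>\<^bsub>Gd\<^esub> \<psi>)))"
      unfolding R.skew_mult_app[OF \<psi>]
      by (subst \<Gamma>_finsum) (auto intro!: S.finsum_cong' R.m_closed[simplified])
    then show "(f \<otimes>\<^bsub>R\<^esub> f') \<psi> \<otimes>\<^bsub>S\<^esub> \<delta> \<psi> x = (\<Oplus>\<^bsub>S\<^esub>\<phi>\<in>carrier Gd. ?t \<phi> \<psi>)"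
      by (simp add: S.finsum_ldistr finite_dual Pi_def)
        (rule S.finsum_cong'[OF refl], auto simp: S.m_assoc)
  qed (auto intro!: S.finsum_closed)
  also have "\<dots> = (\<Oplus>\<^bsub>S\<^esub>\<phi>\<in>carrier Gd. \<Oplus>\<^bsub>S\<^esub>\<psi>\<in>carrier Gd. ?t \<phi> \<psi>)"
    by (rule S.finsum_swap) (auto simp: finite_dual)
  also have "\<dots> = T f (T f' x)"
    unfolding T_def
  proof (rule S.finsum_cong'[OF refl])
    fix \<phi> assume \<phi> [simp]: "\<phi> \<in> carrier Gd"
    have "(\<Oplus>\<^bsub>S\<^esub>\<psi>\<in>carrier Gd. ?t \<phi> \<psi>) = (\<Oplus>\<^bsub>S\<^esub>\<psi>\<in>(\<lambda>\<psi>. \<phi> \<otimes>\<^bsub>Gd\<^esub> \<psi>) ` carrier Gd. ?t \<phi> \<psi>)"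
      by (simp add: Gd.surj_const_mult)
    also have "\<dots> = (\<Oplus>\<^bsub>S\<^esub>\<psi>\<in>carrier Gd. ?t \<phi> (\<phi> \<otimes>\<^bsub>Gd\<^esub> \<psi>))"
      by (rule S.finsum_reindex) (auto simp: Gd.inj_on_cmult)
    also have "\<dots> = (\<Oplus>\<^bsub>S\<^esub>\<psi>\<in>carrier Gd. f \<phi> \<otimes>\<^bsub>S\<^esub> \<delta> \<phi> (f' \<psi> \<otimes>\<^bsub>S\<^esub> \<delta> \<psi> x))"
      by (rule S.finsum_cong'[OF refl]) (auto simp: D.act_comp D.act_mult simp flip: Gd.m_assoc)
    also have "\<dots> = f \<phi> \<otimes>\<^bsub>S\<^esub> \<delta> \<phi> (\<Oplus>\<^bsub>S\<^esub>\<psi>\<in>carrier Gd. f' \<psi> \<otimes>\<^bsub>S\<^esub> \<delta> \<psi> x)"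
      by (simp add: D.act_finsum S.finsum_rdistr finite_dual Pi_def)
    finally show "(\<Oplus>\<^bsub>S\<^esub>\<psi>\<in>carrier Gd. ?t \<phi> \<psi>) = f \<phi> \<otimes>\<^bsub>S\<^esub> \<delta> \<phi> (\<Oplus>\<^bsub>S\<^esub>\<psi>\<in>carrier Gd. f' \<psi> \<otimes>\<^bsub>S\<^esub> \<delta> \<psi> x)" .
  qed (auto intro!: S.finsum_closed)
  finally show ?thesis .
qed

definition \<theta> where "\<theta> = skew_tensor \<Gamma> Gd t (grp_elt \<one>\<^bsub>Gd\<^esub>)"

lemma \<theta>_closed [simp, intro]: "\<theta> \<in> carrier R"
  by (auto simp: \<theta>_def)

lemma R_app [simp]: "f \<in> carrier R \<Longrightarrow> \<psi> \<in> carrier Gd \<Longrightarrow> f \<psi> \<in> carrier S"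
  by (meson R.skew_app \<Gamma>_closed)

lemma \<theta>_mult_app: "f \<in> carrier R \<Longrightarrow> \<psi> \<in> carrier Gd \<Longrightarrow> (\<theta> \<otimes>\<^bsub>R\<^esub> f) \<psi> = t \<otimes>\<^bsub>S\<^esub> f \<psi>"
  unfolding \<theta>_def by (subst R.grp_elt_mult_app) (auto simp: R.skew_app)

lemma mult_\<theta>_app: "f \<in> carrier R \<Longrightarrow> \<psi> \<in> carrier Gd \<Longrightarrow> (f \<otimes>\<^bsub>R\<^esub> \<theta>) \<psi> = f \<psi> \<otimes>\<^bsub>S\<^esub> \<delta> \<psi> t"
  unfolding \<theta>_def by (subst R.mult_grp_elt_app) auto

lemma \<theta>_app: "\<psi> \<in> carrier Gd \<Longrightarrow> \<theta> \<psi> = (if \<psi> = \<one>\<^bsub>Gd\<^esub> then t else \<zero>\<^bsub>S\<^esub>)"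
  unfolding \<theta>_def by (simp add: R.skew_tensor_app grp_elt_def)

lemma \<theta>_idem [simp]: "\<theta> \<otimes>\<^bsub>R\<^esub> \<theta> = \<theta>"
  by (rule R.skew_ext) (auto simp: \<theta>_mult_app \<theta>_app R.skew_mult_closed)

lemma corner_R_carrier:
  "carrier (corner_alg R \<theta>) = {f \<in> carrier R. \<theta> \<otimes>\<^bsub>R\<^esub> f = f \<and> f \<otimes>\<^bsub>R\<^esub> \<theta> = f}"
  by (rule R.S.corner(2)) simp_all

lemma corner_R_app:
  assumes "f \<in> carrier (corner_alg R \<theta>)" "\<psi> \<in> carrier Gd"
  shows "t \<otimes>\<^bsub>S\<^esub> f \<psi> = f \<psi>" "f \<psi> \<otimes>\<^bsub>S\<^esub> \<delta> \<psi> t = f \<psi>"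
  using assms \<theta>_mult_app[of f \<psi>] mult_\<theta>_app[of f \<psi>] by (auto simp: corner_R_carrier)

text \<open>Since \<open>\<theta>\<close> fixes \<open>f\<close> from the left, \<open>T f w\<close>
  lies in the range of \<open>t\<close>, where \<open>w_P\<close> supplies its coordinate.\<close>

lemma T_corner:
  assumes "f \<in> carrier (corner_alg R \<theta>)"
  shows "T f w = w \<otimes>\<^bsub>S\<^esub> inc (F f)"
proof -
  have f: "f \<in> carrier R" using assms by (simp add: corner_R_carrier)
  have "t \<otimes>\<^bsub>S\<^esub> T f w = T f w"
    unfolding T_def
    by (subst S.finsum_rdistr)
      (auto simp: f finite_dual corner_R_app[OF assms] simp flip: S.m_assoc intro!: S.finsum_cong')
  then show ?thesis unfolding F_def using f by (simp add: w_P)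
qed

lemma F_eqI: "a \<in> carrier A \<Longrightarrow> T f w = w \<otimes>\<^bsub>S\<^esub> inc a \<Longrightarrow> F f = a"
  by (simp add: F_def P_w)

lemma T_add:
  assumes [simp]: "f \<in> carrier R" "f' \<in> carrier R" "x \<in> carrier S"
  shows "T (f \<oplus>\<^bsub>R\<^esub> f') x = T f x \<oplus>\<^bsub>S\<^esub> T f' x"
proof -
  have "T (f \<oplus>\<^bsub>R\<^esub> f') x = (\<Oplus>\<^bsub>S\<^esub>\<psi>\<in>carrier Gd. f \<psi> \<otimes>\<^bsub>S\<^esub> \<delta> \<psi> x \<oplus>\<^bsub>S\<^esub> f' \<psi> \<otimes>\<^bsub>S\<^esub> \<delta> \<psi> x)"
    unfolding T_def by (rule S.finsum_cong'[OF refl]) (auto simp: R.skew_add_app S.l_distr)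
  then show ?thesis unfolding T_def by (simp add: S.finsum_addf Pi_def)
qed

lemma T_smult:
  assumes [simp]: "f \<in> carrier R" "x \<in> carrier S"
  shows "T (c \<odot>\<^bsub>R\<^esub> f) x = c \<odot>\<^bsub>S\<^esub> T f x"
proof -
  have "T (c \<odot>\<^bsub>R\<^esub> f) x = (\<Oplus>\<^bsub>S\<^esub>\<psi>\<in>carrier Gd. c \<odot>\<^bsub>S\<^esub> (f \<psi> \<otimes>\<^bsub>S\<^esub> \<delta> \<psi> x))"
    unfolding T_def by (rule S.finsum_cong'[OF refl]) (auto simp: R.skew_smult_app S.smult_mult_left)
  then show ?thesis unfolding T_def by (simp add: S.smult_finsum)
qed

lemma F_closed: "f \<in> carrier R \<Longrightarrow> F f \<in> carrier A"
  by (auto simp: F_def)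

lemma inc_add: "a \<in> carrier A \<Longrightarrow> b \<in> carrier A \<Longrightarrow> inc (a \<oplus> b) = inc a \<oplus>\<^bsub>S\<^esub> inc b"
  by (rule skew_ext) (auto simp: inc_app skew_add_closed skew_add_app)

lemma inc_smult: "a \<in> carrier A \<Longrightarrow> inc (c \<odot> a) = c \<odot>\<^bsub>S\<^esub> inc a"
  by (rule skew_ext) (auto simp: inc_app skew_smult_closed skew_smult_app)

lemma unit_mult:
  assumes [simp]: "h \<in> carrier G"
  shows "skew_tensor A G \<one> (grp_elt h) \<otimes>\<^bsub>S\<^esub> skew_tensor A G \<one> (grp_elt (inv\<^bsub>G\<^esub> h)) = \<one>\<^bsub>S\<^esub>"
proof -
  have "inv\<^bsub>G\<^esub> h \<otimes>\<^bsub>G\<^esub> x = inv\<^bsub>G\<^esub> h \<longleftrightarrow> x = \<one>\<^bsub>G\<^esub>" if "x \<in> carrier G" for x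
    using that G.l_cancel[of "inv\<^bsub>G\<^esub> h" x "\<one>\<^bsub>G\<^esub>"] by simp
  then show ?thesis
    by (intro skew_ext)
      (auto simp: skew_mult_closed skew_one_closed skew_tensor_closed grp_elt_mult_app skew_tensor_app grp_elt_app skew_one_app)
qed

text \<open>On 1 \<otimes> h the operator gives the sum of the f(\<psi>) with weights \<psi>(h),
  times 1 \<otimes> h. Multiplying back by 1 \<otimes> h^-1 leaves a Fourier transform of
  \<open>f\<close>, which is then inverted.\<close>

lemma T_inversion:
  assumes f: "\<And>\<psi>. \<psi> \<in> carrier Gd \<Longrightarrow> f \<psi> \<in> carrier S" and \<phi>: "\<phi> \<in> carrier Gd"
  shows "(\<Oplus>\<^bsub>S\<^esub>h\<in>carrier G. (inverse (of_nat n) * inverse (\<phi> h)) \<odot>\<^bsub>S\<^esub>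
     (T f (skew_tensor A G \<one> (grp_elt h)) \<otimes>\<^bsub>S\<^esub> skew_tensor A G \<one> (grp_elt (inv\<^bsub>G\<^esub> h)))) = f \<phi>"
proof -
  let ?u = "\<lambda>h. skew_tensor A G \<one> (grp_elt h)"
  let ?c = "\<lambda>h. inverse (of_nat n) * inverse (\<phi> h)"
  have u [simp]: "?u h \<in> carrier S" for h by (simp add: skew_tensor_closed)
  have \<delta>u: "\<delta> \<psi> (?u h) = \<psi> h \<odot>\<^bsub>S\<^esub> ?u h" for \<psi> h
    by (intro skew_ext) (auto simp: skew_smult_closed \<delta>_app skew_smult_app skew_tensor_app grp_elt_app)
  have "(\<Oplus>\<^bsub>S\<^esub>h\<in>carrier G. ?c h \<odot>\<^bsub>S\<^esub> (T f (?u h) \<otimes>\<^bsub>S\<^esub> ?u (inv\<^bsub>G\<^esub> h)))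
    = (\<Oplus>\<^bsub>S\<^esub>h\<in>carrier G. \<Oplus>\<^bsub>S\<^esub>\<psi>\<in>carrier Gd. (?c h * \<psi> h) \<odot>\<^bsub>S\<^esub> f \<psi>)"
  proof (rule S.finsum_cong'[OF refl])
    fix h assume h [simp]: "h \<in> carrier G"
    have "T f (?u h) \<otimes>\<^bsub>S\<^esub> ?u (inv\<^bsub>G\<^esub> h) = (\<Oplus>\<^bsub>S\<^esub>\<psi>\<in>carrier Gd. f \<psi> \<otimes>\<^bsub>S\<^esub> \<delta> \<psi> (?u h) \<otimes>\<^bsub>S\<^esub> ?u (inv\<^bsub>G\<^esub> h))"
      unfolding T_def by (rule S.finsum_ldistr) (auto simp: finite_dual f)
    also have "\<dots> = (\<Oplus>\<^bsub>S\<^esub>\<psi>\<in>carrier Gd. \<psi> h \<odot>\<^bsub>S\<^esub> f \<psi>)"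
      by (rule S.finsum_cong'[OF refl])
        (auto simp: f \<delta>u S.m_assoc S.smult_mult_left S.smult_mult_right unit_mult)
    finally show "?c h \<odot>\<^bsub>S\<^esub> (T f (?u h) \<otimes>\<^bsub>S\<^esub> ?u (inv\<^bsub>G\<^esub> h)) = (\<Oplus>\<^bsub>S\<^esub>\<psi>\<in>carrier Gd. (?c h * \<psi> h) \<odot>\<^bsub>S\<^esub> f \<psi>)"
      by (simp add: S.smult_finsum f)
        (rule S.finsum_cong'[OF refl], auto simp: f S.smult_assoc)
  qed (auto intro!: S.finsum_closed simp: f)
  also have "\<dots> = (\<Oplus>\<^bsub>S\<^esub>\<psi>\<in>carrier Gd. \<Oplus>\<^bsub>S\<^esub>h\<in>carrier G. (?c h * \<psi> h) \<odot>\<^bsub>S\<^esub> f \<psi>)"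
    by (rule S.finsum_swap) (auto simp: fin finite_dual f)
  also have "\<dots> = (\<Oplus>\<^bsub>S\<^esub>\<psi>\<in>carrier Gd. if \<psi> = \<phi> then f \<psi> else \<zero>\<^bsub>S\<^esub>)"
    by (rule S.finsum_cong'[OF refl])
      (auto simp: f fin fourier_inversion[OF \<phi>] simp flip: S.sum_smult)
  also have "\<dots> = f \<phi>" by (rule S.finsum_delta) (auto simp: finite_dual f \<phi>)
  finally show ?thesis .
qed

text \<open>Since \<open>\<theta>\<close> fixes \<open>f\<close> from the right, \<open>T f\<close>
  sees only the part of \<open>x\<close> in the range of \<open>t\<close>. That part is a multiple
  of \<open>w\<close>, so by right linearity the single value at \<open>w\<close> determines the
  operator.\<close>

lemma T_eq_on:
  assumes f: "f \<in> carrier (corner_alg R \<theta>)" and x [simp]: "x \<in> carrier S"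
  shows "T f x = T f w \<otimes>\<^bsub>S\<^esub> inc (P (t \<otimes>\<^bsub>S\<^esub> x))"
proof -
  have fR [simp]: "f \<in> carrier R" using f by (simp add: corner_R_carrier)
  have "T f x = T f (t \<otimes>\<^bsub>S\<^esub> x)"
    unfolding T_def
    by (rule S.finsum_cong'[OF refl])
      (auto simp: D.act_mult corner_R_app[OF f] simp flip: S.m_assoc intro: skew_mult_closed)
  also have "t \<otimes>\<^bsub>S\<^esub> x = w \<otimes>\<^bsub>S\<^esub> inc (P (t \<otimes>\<^bsub>S\<^esub> x))"
    by (rule w_P[symmetric]) (simp_all flip: S.m_assoc)
  finally show ?thesis by (simp add: T_mult_inc)
qed

lemma F_inj: "inj_on F (carrier (corner_alg R \<theta>))"
proof (rule inj_onI)
  fix f f' assume f: "f \<in> carrier (corner_alg R \<theta>)" "f' \<in> carrier (corner_alg R \<theta>)" and eq: "F f = F f'"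
  have fR [simp]: "f \<in> carrier R" "f' \<in> carrier R" using f by (simp_all add: corner_R_carrier)
  have "T f x = T f' x" if "x \<in> carrier S" for x
    using T_eq_on[OF f(1) that] T_eq_on[OF f(2) that] T_corner[OF f(1)] T_corner[OF f(2)] eq by simp
  then have "f \<psi> = f' \<psi>" if "\<psi> \<in> carrier Gd" for \<psi>
    using T_inversion[of f \<psi>] T_inversion[of f' \<psi>] that by (simp add: skew_tensor_closed)
  then show "f = f'" by (intro R.skew_ext) auto
qed

text \<open>
  Preimages under \<open>F\<close>: the operator on \<open>\<Lambda>G\<close> attached to \<open>f'\<close> below sends \<open>e \<otimes> k\<close> to the
  part of degree \<open>h = y k\<close> of \<open>w a\<close>, split along \<open>1 = \<Sum>\<^sub>y y(e\<^sub>1) + e\<^sub>2\<close>.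
\<close>

lemma F_surj:
  assumes a [simp]: "a \<in> carrier A"
  shows "\<exists>f\<in>carrier (corner_alg R \<theta>). F f = a"
proof -
  \<comment> \<open>Each \<open>y\<close> receives an equal share of \<open>e2\<close>, so that the
    \<open>d y\<close> sum to 1; moreover \<open>d y\<close> absorbs the translate of
    \<open>e\<close> by \<open>y\<close> from the right.\<close>
  define d where "d y = \<rho> y e1 \<oplus> inverse (of_nat n) \<odot> e2" for y
  define M where "M y k = e \<otimes> (\<rho> (y \<otimes>\<^bsub>G\<^esub> k) a \<otimes> d y)" for y k
  define f' where "f' \<psi> = (\<lambda>y\<in>carrier G. \<Oplus>k\<in>carrier G. (inverse (of_nat n) * inverse (\<psi> k)) \<odot> M y k)" for \<psi> :: "'g \<Rightarrow> 'k"
  have d [simp]: "d y \<in> carrier A" if "y \<in> carrier G" for y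
    using that by (simp add: d_def)
  have M [simp]: "M y k \<in> carrier A" if "y \<in> carrier G" "k \<in> carrier G" for y k
    using that by (simp add: M_def)
  have f' [simp]: "f' \<psi> \<in> carrier S" for \<psi>
    by (auto simp: f'_def skew_carrier intro!: finsum_closed)
  have T': "T f' w = w \<otimes>\<^bsub>S\<^esub> inc a"
  proof (rule skew_ext)
    fix h assume h [simp]: "h \<in> carrier G"
    let ?c = "\<lambda>\<psi> k y. inverse (of_nat n) * inverse (\<psi> k) * \<psi> (inv\<^bsub>G\<^esub> y \<otimes>\<^bsub>G\<^esub> h)"
    have "T f' w h = (\<Oplus>\<psi>\<in>carrier Gd. \<Oplus>y\<in>carrier G. \<Oplus>k\<in>carrier G. ?c \<psi> k y \<odot> (M y k \<otimes> \<rho> y e))"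
      unfolding T_app[OF f' closed(3) h] skew_mult_app[OF h]
    proof (intro finsum_cong'[OF refl])
      fix \<psi> y assume [simp]: "\<psi> \<in> carrier Gd" "y \<in> carrier G"
      have "f' \<psi> y \<otimes> \<rho> y (\<delta> \<psi> w (inv\<^bsub>G\<^esub> y \<otimes>\<^bsub>G\<^esub> h)) =
        (\<Oplus>k\<in>carrier G. (inverse (of_nat n) * inverse (\<psi> k)) \<odot> M y k) \<otimes> (\<psi> (inv\<^bsub>G\<^esub> y \<otimes>\<^bsub>G\<^esub> h) \<odot> \<rho> y e)"
        by (simp add: \<delta>_app f'_def act_smult)
      also have "\<dots> = (\<Oplus>k\<in>carrier G. (inverse (of_nat n) * inverse (\<psi> k)) \<odot> M y k \<otimes> (\<psi> (inv\<^bsub>G\<^esub> y \<otimes>\<^bsub>G\<^esub> h) \<odot> \<rho> y e))"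
        by (rule finsum_ldistr[OF fin]) auto
      also have "\<dots> = (\<Oplus>k\<in>carrier G. ?c \<psi> k y \<odot> (M y k \<otimes> \<rho> y e))"
        by (rule finsum_cong'[OF refl]) (auto simp: smult_mult_left smult_mult_right smult_assoc mult_ac)
      finally show "f' \<psi> y \<otimes> \<rho> y (\<delta> \<psi> w (inv\<^bsub>G\<^esub> y \<otimes>\<^bsub>G\<^esub> h)) = (\<Oplus>k\<in>carrier G. ?c \<psi> k y \<odot> (M y k \<otimes> \<rho> y e))" .
    qed (auto intro!: finsum_closed)
    \<comment> \<open>Summing over the characters first leaves only k = y^-1 h, where
      \<open>M\<close> contains the translate of \<open>a\<close> by \<open>h\<close>.\<close>
    also have "\<dots> = (\<Oplus>y\<in>carrier G. \<Oplus>k\<in>carrier G. \<Oplus>\<psi>\<in>carrier Gd. ?c \<psi> k y \<odot> (M y k \<otimes> \<rho> y e))"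
      by (subst finsum_swap[OF finite_dual fin])
        (auto intro!: finsum_closed finsum_cong' finsum_swap finite_dual fin)
    also have "\<dots> = (\<Oplus>y\<in>carrier G. M y (inv\<^bsub>G\<^esub> y \<otimes>\<^bsub>G\<^esub> h) \<otimes> \<rho> y e)"
    proof (intro finsum_cong'[OF refl])
      fix y assume [simp]: "y \<in> carrier G"
      have "(\<Oplus>k\<in>carrier G. \<Oplus>\<psi>\<in>carrier Gd. ?c \<psi> k y \<odot> (M y k \<otimes> \<rho> y e)) =
        (\<Oplus>k\<in>carrier G. if k = inv\<^bsub>G\<^esub> y \<otimes>\<^bsub>G\<^esub> h then M y k \<otimes> \<rho> y e else \<zero>)"
        by (intro finsum_cong'[OF refl])
          (auto simp: finite_dual dual_fourier_inversion simp flip: sum_smult)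
      also have "\<dots> = M y (inv\<^bsub>G\<^esub> y \<otimes>\<^bsub>G\<^esub> h) \<otimes> \<rho> y e"
        by (rule finsum_delta[OF fin]) auto
      finally show "(\<Oplus>k\<in>carrier G. \<Oplus>\<psi>\<in>carrier Gd. ?c \<psi> k y \<odot> (M y k \<otimes> \<rho> y e)) = M y (inv\<^bsub>G\<^esub> y \<otimes>\<^bsub>G\<^esub> h) \<otimes> \<rho> y e" .
    qed auto
    also have "\<dots> = (\<Oplus>y\<in>carrier G. e \<otimes> \<rho> h a \<otimes> d y)"
      by (intro finsum_cong'[OF refl])
        (auto simp: M_def m_assoc d_def l_distr smult_mult_left simp flip: G.m_assoc)
    also have "\<dots> = e \<otimes> \<rho> h a \<otimes> (\<Oplus>y\<in>carrier G. d y)"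
      by (simp add: finsum_rdistr[OF fin] Pi_def)
    also have "(\<Oplus>y\<in>carrier G. d y) = \<one>"
      unfolding d_def by (simp add: finsum_addf sum_const e_sum Pi_def)
    finally show "T f' w h = (w \<otimes>\<^bsub>S\<^esub> inc a) h" by (simp add: mult_inc_app)
  qed (auto simp: skew_mult_closed)
  \<comment> \<open>The function \<open>f'\<close> need not lie in the corner, so it is cut down by
    \<open>\<theta>\<close> on both sides. This does not change the value at \<open>w\<close>: the
    right factor is absorbed because \<open>t\<close> fixes \<open>w\<close>, and the left one
    because the value is already a multiple of \<open>w\<close>.\<close>
  define f where "f = (\<lambda>\<psi>\<in>carrier Gd. t \<otimes>\<^bsub>S\<^esub> f' \<psi> \<otimes>\<^bsub>S\<^esub> \<delta> \<psi> t)"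
  have t\<eta>: "\<eta> \<otimes>\<^bsub>S\<^esub> t = t" "\<delta> \<psi> t \<otimes>\<^bsub>S\<^esub> \<eta> = \<delta> \<psi> t" "\<delta> \<psi> t \<otimes>\<^bsub>S\<^esub> \<delta> \<psi> t = \<delta> \<psi> t" if "\<psi> \<in> carrier Gd" for \<psi>
    using t_\<Gamma> \<delta>_\<Gamma>[OF t_\<Gamma> that] that by (auto simp: \<Gamma>_carrier simp flip: D.act_mult)
  have f_app: "f \<psi> = t \<otimes>\<^bsub>S\<^esub> f' \<psi> \<otimes>\<^bsub>S\<^esub> \<delta> \<psi> t" if "\<psi> \<in> carrier Gd" for \<psi>
    using that by (simp add: f_def)
  have fR: "f \<in> carrier R"
    unfolding R.skew_carrier f_def
  proof (rule restrict_PiE_iff[THEN iffD2], rule ballI)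
    fix \<psi> assume \<psi>: "\<psi> \<in> carrier Gd"
    have "\<eta> \<otimes>\<^bsub>S\<^esub> (t \<otimes>\<^bsub>S\<^esub> f' \<psi> \<otimes>\<^bsub>S\<^esub> \<delta> \<psi> t) = t \<otimes>\<^bsub>S\<^esub> f' \<psi> \<otimes>\<^bsub>S\<^esub> \<delta> \<psi> t"
      using \<psi> t\<eta>[OF \<psi>] by (simp flip: S.m_assoc)
    moreover have "t \<otimes>\<^bsub>S\<^esub> f' \<psi> \<otimes>\<^bsub>S\<^esub> \<delta> \<psi> t \<otimes>\<^bsub>S\<^esub> \<eta> = t \<otimes>\<^bsub>S\<^esub> f' \<psi> \<otimes>\<^bsub>S\<^esub> \<delta> \<psi> t"
      using \<psi> t\<eta>[OF \<psi>] by (simp add: S.m_assoc)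
    ultimately show "t \<otimes>\<^bsub>S\<^esub> f' \<psi> \<otimes>\<^bsub>S\<^esub> \<delta> \<psi> t \<in> carrier \<Gamma>" using \<psi> by (simp add: \<Gamma>_carrier)
  qed
  have "\<theta> \<otimes>\<^bsub>R\<^esub> f = f"
    by (rule R.skew_ext) (auto simp: fR \<theta>_mult_app f_app R.skew_mult_closed simp flip: S.m_assoc)
  moreover have "f \<otimes>\<^bsub>R\<^esub> \<theta> = f"
    by (rule R.skew_ext) (auto simp: fR mult_\<theta>_app f_app R.skew_mult_closed S.m_assoc t\<eta>)
  ultimately have fc: "f \<in> carrier (corner_alg R \<theta>)" using fR by (simp add: corner_R_carrier)
  have "T f w = (\<Oplus>\<^bsub>S\<^esub>\<psi>\<in>carrier Gd. t \<otimes>\<^bsub>S\<^esub> (f' \<psi> \<otimes>\<^bsub>S\<^esub> \<delta> \<psi> w))"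
    unfolding T_def
    by (rule S.finsum_cong'[OF refl]) (auto simp: f_app S.m_assoc simp flip: D.act_mult)
  also have "\<dots> = t \<otimes>\<^bsub>S\<^esub> T f' w"
    unfolding T_def by (rule S.finsum_rdistr[symmetric]) (auto simp: finite_dual)
  also have "\<dots> = w \<otimes>\<^bsub>S\<^esub> inc a" by (simp add: T' flip: S.m_assoc)
  finally have "F f = a" by (rule F_eqI[OF a])
  with fc show ?thesis by blast
qed

text \<open>\<open>F\<close> respects products in the right order because \<open>T f\<close> is
  right linear: applying \<open>T f\<close> to \<open>w\<close> times \<open>F f'\<close> gives
  \<open>T f w\<close> times \<open>F f'\<close>, that is \<open>w\<close> times \<open>F f\<close>
  times \<open>F f'\<close>.\<close>

theorem F_alg_iso: "F \<in> alg_iso (corner_alg R \<theta>) A"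
proof -
  have c: "f \<in> carrier R" if "f \<in> carrier (corner_alg R \<theta>)" for f
    using that by (simp add: corner_R_carrier)
  have ops: "monoid.mult (corner_alg R \<theta>) = monoid.mult R" "monoid.one (corner_alg R \<theta>) = \<theta>"
    "ring.add (corner_alg R \<theta>) = ring.add R" "module.smult (corner_alg R \<theta>) = module.smult R"
    by (simp_all add: corner_alg_def)
  have "F \<in> ring_hom (corner_alg R \<theta>) A"
  proof (rule ring_hom_memI, unfold ops)
    fix f f' assume f: "f \<in> carrier (corner_alg R \<theta>)" "f' \<in> carrier (corner_alg R \<theta>)"
    note [simp] = c[OF f(1)] c[OF f(2)] F_closed
    show "F (f \<otimes>\<^bsub>R\<^esub> f') = F f \<otimes> F f'"
      by (rule F_eqI)
        (simp_all add: T_mult T_corner[OF f(1)] T_corner[OF f(2)] T_mult_inc S.m_assoc inc_mult)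
    show "F (f \<oplus>\<^bsub>R\<^esub> f') = F f \<oplus> F f'"
      by (rule F_eqI) (simp_all add: T_add T_corner[OF f(1)] T_corner[OF f(2)] inc_add S.r_distr)
  next
    have "T \<theta> w = (\<Oplus>\<^bsub>S\<^esub>\<psi>\<in>carrier Gd. if \<psi> = \<one>\<^bsub>Gd\<^esub> then w else \<zero>\<^bsub>S\<^esub>)"
      unfolding T_def by (rule S.finsum_cong'[OF refl]) (auto simp: \<theta>_app)
    also have "\<dots> = w" by (rule S.finsum_delta) (auto simp: finite_dual)
    also have "w = w \<otimes>\<^bsub>S\<^esub> inc \<one>" by (simp flip: skew_one_eq)
    finally show "F \<theta> = \<one>" by (intro F_eqI) simp_all
  qed (auto simp: c F_closed)
  moreover have "F (a \<odot>\<^bsub>corner_alg R \<theta>\<^esub> f) = a \<odot> F f" if f: "f \<in> carrier (corner_alg R \<theta>)" for a f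
    unfolding ops
    by (rule F_eqI) (use c[OF f] in \<open>simp_all add: T_smult T_corner[OF f] inc_smult S.smult_mult_right F_closed\<close>)
  moreover have "F ` carrier (corner_alg R \<theta>) = carrier A"
    using F_surj c F_closed by (auto simp: image_iff)
  ultimately show ?thesis
    using F_inj by (auto simp: alg_iso_def ring_iso_def bij_betw_def)
qed

end

section \<open>Quotients of algebras with a group action\<close>

locale kalg_quot = kalg A + I: ideal I A for A :: "('k::field, 'x) module" (structure) and I
begin

abbreviation \<pi> where "\<pi> f \<equiv> I +>\<^bsub>A\<^esub> f"
abbreviation B where "B \<equiv> quot_alg A I"

lemma smult_ideal: "x \<in> I \<Longrightarrow> c \<odot> x \<in> I"
  using I.I_l_closed[of x "c \<odot> \<one>"] I.Icarr[of x] by (simp add: smult_mult_left)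

lemma quot_carrier: "carrier B = \<pi> ` carrier A"
  by (auto simp: quot_alg_def FactRing_def A_RCOSETS_def' image_iff)

lemma quot_cases:
  assumes "C \<in> carrier B" obtains f where "f \<in> carrier A" "C = \<pi> f"
  using assms by (auto simp: quot_carrier)

lemma \<pi>_closed [simp, intro]: "f \<in> carrier A \<Longrightarrow> \<pi> f \<in> carrier B"
  by (simp add: quot_carrier)

lemma \<pi>_eq_iff: "f \<in> carrier A \<Longrightarrow> f' \<in> carrier A \<Longrightarrow> \<pi> f = \<pi> f' \<longleftrightarrow> f \<ominus> f' \<in> I"
  using quotient_eq_iff_same_a_r_cos[OF I.ideal_axioms] by blast

lemma quot_ops: "monoid.mult B = monoid.mult (A Quot I)" "monoid.one B = monoid.one (A Quot I)"
  "ring.add B = ring.add (A Quot I)" "ring.zero B = ring.zero (A Quot I)" "carrier B = carrier (A Quot I)"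
  by (simp_all add: quot_alg_def)

lemma \<pi>_hom: "f \<in> carrier A \<Longrightarrow> f' \<in> carrier A \<Longrightarrow> \<pi> (f \<otimes> f') = \<pi> f \<otimes>\<^bsub>B\<^esub> \<pi> f'"
  "f \<in> carrier A \<Longrightarrow> f' \<in> carrier A \<Longrightarrow> \<pi> (f \<oplus> f') = \<pi> f \<oplus>\<^bsub>B\<^esub> \<pi> f'"
  "\<pi> \<one> = \<one>\<^bsub>B\<^esub>"
  unfolding quot_ops
  by (rule ring_hom_mult[OF I.rcos_ring_hom] ring_hom_add[OF I.rcos_ring_hom] ring_hom_one[OF I.rcos_ring_hom]; assumption)+

lemma \<pi>_smult: 
  assumes f: "f \<in> carrier A" shows "c \<odot>\<^bsub>B\<^esub> \<pi> f = \<pi> (c \<odot> f)"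
proof -
  have *: "\<pi> (c \<odot> x) = \<pi> (c \<odot> f)" if x: "x \<in> \<pi> f" for x
  proof -
    obtain i where i: "i \<in> I" "x = i \<oplus> f" using x by (auto simp: a_r_coset_def')
    then have ic: "i \<in> carrier A" by (simp add: I.Icarr)
    have "c \<odot> x \<ominus> c \<odot> f = c \<odot> i"
      using i ic f by (simp add: smult_r_distr a_minus_def a_assoc r_neg)
    then show ?thesis using i ic f by (subst \<pi>_eq_iff) (auto simp: smult_ideal)
  qed
  \<comment> \<open>\<open>quot_alg\<close> defines the scalar multiple as a union over all
    representatives. They give the same coset, but an empty union would not.\<close>
  have "\<pi> f \<noteq> {}" using I.a_rcos_self[OF f] by blast
  have "(\<Union>x\<in>\<pi> f. \<pi> (c \<odot> x)) = (\<Union>x\<in>\<pi> f. \<pi> (c \<odot> f))"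
    by (rule SUP_cong[OF refl *])
  also have "\<dots> = \<pi> (c \<odot> f)" using \<open>\<pi> f \<noteq> {}\<close> by (rule cSUP_const)
  finally show ?thesis by (simp add: quot_alg_def)
qed

lemma quot_ring: "ring B"
proof -
  interpret Q: ring "A Quot I" by (rule I.quotient_is_ring)
  have "abelian_group B"
    by (rule abelian_groupI, unfold quot_ops) (simp_all add: Q.a_assoc Q.a_comm Q.a_lcomm Q.add.l_inv_ex)
  moreover have "Group.monoid B"
    by (rule monoidI, unfold quot_ops) (simp_all add: Q.m_assoc)
  ultimately show ?thesis
    by (rule ringI, unfold quot_ops) (simp_all add: Q.l_distr Q.r_distr)
qed

lemma quot_kalg: "kalg B"
  unfolding kalg_def kalg_axioms_def
  by (intro conjI quot_ring allI impI; elim quot_cases)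
    (simp_all add: \<pi>_smult smult_assoc smult_r_distr smult_l_distr smult_mult_left smult_mult_right flip: \<pi>_hom)

sublocale B: kalg B by (rule quot_kalg)

lemma \<pi>_zero: "\<pi> \<zero> = \<zero>\<^bsub>B\<^esub>"
  using \<pi>_smult[of \<zero> 0] by simp

lemma \<pi>_finsum: "(\<And>i. i \<in> J \<Longrightarrow> f i \<in> carrier A) \<Longrightarrow> \<pi> (\<Oplus>i\<in>J. f i) = (\<Oplus>\<^bsub>B\<^esub>i\<in>J. \<pi> (f i))"
  by (rule additive_finsum[OF abelian_monoid_axioms B.abelian_monoid_axioms])
    (auto simp: \<pi>_hom \<pi>_zero)

definition quot_act :: "('g \<Rightarrow> 'x \<Rightarrow> 'x) \<Rightarrow> 'g \<Rightarrow> 'x set \<Rightarrow> 'x set" where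
  "quot_act \<tau> h = (\<lambda>C\<in>carrier B. \<tau> h ` C)"

text \<open>The image of a coset is a full coset, not only part of one, because the ideal is stable
  under h^-1 as well.\<close>

lemma quot_act_app:
  assumes "kalg_act A G \<tau>" and I: "\<And>h x. h \<in> carrier G \<Longrightarrow> x \<in> I \<Longrightarrow> \<tau> h x \<in> I"
    and h: "h \<in> carrier G" and f: "f \<in> carrier A"
  shows "quot_act \<tau> h (\<pi> f) = \<pi> (\<tau> h f)"
proof -
  interpret act: kalg_act A G \<tau> by fact
  have "\<tau> h ` \<pi> f = \<pi> (\<tau> h f)"
  proof (intro equalityI subsetI)
    fix y assume "y \<in> \<tau> h ` \<pi> f"
    then obtain i where i: "i \<in> I" "y = \<tau> h (i \<oplus> f)" by (auto simp: a_r_coset_def')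
    then have "y = \<tau> h i \<oplus> \<tau> h f" using h f by (simp add: act.act_add I.Icarr)
    then show "y \<in> \<pi> (\<tau> h f)" using I[OF h i(1)] by (auto simp: a_r_coset_def')
  next
    fix y assume "y \<in> \<pi> (\<tau> h f)"
    then obtain i where i: "i \<in> I" "y = i \<oplus> \<tau> h f" by (auto simp: a_r_coset_def')
    then have "y = \<tau> h (\<tau> (inv\<^bsub>G\<^esub> h) i \<oplus> f)" using h f by (simp add: act.act_add I.Icarr)
    moreover have "\<tau> (inv\<^bsub>G\<^esub> h) i \<oplus> f \<in> \<pi> f"
      using I[of "inv\<^bsub>G\<^esub> h" i] i h by (auto simp: a_r_coset_def')
    ultimately show "y \<in> \<tau> h ` \<pi> f" by blast
  qed
  then show ?thesis using f by (simp add: quot_act_def)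
qed

lemma quot_kalg_act:
  assumes act: "kalg_act A G \<tau>" and I: "\<And>h x. h \<in> carrier G \<Longrightarrow> x \<in> I \<Longrightarrow> \<tau> h x \<in> I"
  shows "kalg_act B G (quot_act \<tau>)"
proof -
  interpret act: kalg_act A G \<tau> by fact
  note app [simp] = quot_act_app[OF act I]
  show ?thesis
    by (intro_locales, unfold kalg_act_axioms_def)
      (auto elim!: quot_cases simp: act.fin act.act_add act.act_mult act.act_smult act.act_comp \<pi>_smult simp flip: \<pi>_hom)
qed

end

section \<open>Completed path algebras\<close>

lemma p_simps [simp]: "p_tgt (v, L, w) = v" "p_arrs (v, L, w) = L" "p_src (v, L, w) = w" "p_len (v, L, w) = length L"
  by (simp_all add: p_tgt_def p_arrs_def p_src_def p_len_def)

text \<open>Otherwise quantifiers over paths are split into triples and no longer match path variables.\<close>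

declare split_paired_All [simp del] split_paired_Ex [simp del]

text \<open>The quiver does not determine the coefficient field, so a type witness fixes it.\<close>

locale path_algebra = fin_digraph Q for Q :: "('v, 'a) pre_digraph" +
  fixes ty :: "'k::field itself"
begin

abbreviation A where "A \<equiv> cpath_alg Q :: ('k, ('v, 'a) qpath \<Rightarrow> 'k) module"

lemma qpath_Nil [simp]: "(v, [], w) \<in> qpaths Q \<longleftrightarrow> v = w \<and> v \<in> verts Q"
  by (auto simp: qpaths_def awalk_Nil_iff)

lemma qpath_Cons [simp]:
  "(v, a # L, w) \<in> qpaths Q \<longleftrightarrow> a \<in> arcs Q \<and> head Q a = v \<and> (tail Q a, L, w) \<in> qpaths Q"
proof -
  have "awlast w (rev L) = x" if "awalk w (rev L) x" for x using that by auto
  then show ?thesis by (auto simp: qpaths_def awalk_Cons_iff awalk_Nil_iff)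
qed

text \<open>\<open>mid v L\<close> is the source of a path with target \<open>v\<close> and arrows \<open>L\<close>.\<close>

definition mid :: "'v \<Rightarrow> 'a list \<Rightarrow> 'v" where
  "mid v L = (if L = [] then v else tail Q (last L))"

lemma mid_append: "mid v (L @ M) = mid (mid v L) M"
  by (simp add: mid_def)

lemma qpath_append:
  "(v, L @ M, w) \<in> qpaths Q \<longleftrightarrow> (v, L, mid v L) \<in> qpaths Q \<and> (mid v L, M, w) \<in> qpaths Q"
proof (induction L arbitrary: v)
  case Nil
  have "(v, M, w) \<in> qpaths Q \<Longrightarrow> v \<in> verts Q" by (cases M) auto
  then show ?case by (auto simp: mid_def)
next
  case (Cons a L)
  have "mid v (a # L) = mid (tail Q a) L" by (simp add: mid_def)
  then show ?case using Cons by auto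
qed

lemma qpath_mid: "(v, L, w) \<in> qpaths Q \<Longrightarrow> w = mid v L"
  by (induction L arbitrary: v) (auto simp: mid_def)

lemma qpath_src: "(v, L, w) \<in> qpaths Q \<Longrightarrow> v \<in> verts Q \<and> w \<in> verts Q \<and> set L \<subseteq> arcs Q"
  by (induction L arbitrary: v) auto

definition pre :: "('v, 'a) qpath \<Rightarrow> nat \<Rightarrow> ('v, 'a) qpath" where
  "pre p k = (p_tgt p, take k (p_arrs p), mid (p_tgt p) (take k (p_arrs p)))"
definition suf :: "('v, 'a) qpath \<Rightarrow> nat \<Rightarrow> ('v, 'a) qpath" where
  "suf p k = (mid (p_tgt p) (take k (p_arrs p)), drop k (p_arrs p), p_src p)"

lemma pre_suf_qpath: "p \<in> qpaths Q \<Longrightarrow> pre p k \<in> qpaths Q \<and> suf p k \<in> qpaths Q"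
  using qpath_append[of "p_tgt p" "take k (p_arrs p)" "drop k (p_arrs p)" "p_src p"]
  by (cases p) (simp add: pre_def suf_def)

lemma pre_pre: "j \<le> k \<Longrightarrow> pre (pre p k) j = pre p j"
  by (simp add: pre_def min_absorb1)

lemma suf_suf: "suf (suf p j) i = suf p (i + j)"
  by (cases p) (simp add: suf_def mid_append[symmetric] take_add[symmetric] add.commute)

lemma suf_pre: "j \<le> k \<Longrightarrow> suf (pre p k) j = pre (suf p j) (k - j)"
proof (cases p)
  case (fields v L w)
  assume jk: "j \<le> k"
  have "take k L = take j L @ take (k - j) (drop j L)"
    using jk take_add[of j "k - j" L] by simp
  then have "mid v (take k L) = mid (mid v (take j L)) (take (k - j) (drop j L))"
    by (metis mid_append)
  then show ?thesis
    unfolding fields using jk by (simp add: suf_def pre_def min_absorb1 drop_take)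
qed

lemma p_len_pre: "k \<le> p_len p \<Longrightarrow> p_len (pre p k) = k"
  and p_len_suf: "p_len (suf p k) = p_len p - k"
  by (cases p; simp add: pre_def suf_def)+

lemma suf_0: "suf p 0 = p" by (cases p) (simp add: suf_def mid_def)
lemma pre_len: "p \<in> qpaths Q \<Longrightarrow> pre p (p_len p) = p"
  using qpath_mid[of "p_tgt p" "p_arrs p" "p_src p"] by (cases p) (simp add: pre_def)

lemma A_carrier: "f \<in> carrier A \<longleftrightarrow> (\<forall>p. p \<notin> qpaths Q \<longrightarrow> f p = 0)"
  by (simp add: cpath_alg_def)

lemma A_ops: "(f \<oplus>\<^bsub>A\<^esub> h) p = f p + h p" "\<zero>\<^bsub>A\<^esub> p = 0" "(c \<odot>\<^bsub>A\<^esub> f) p = c * f p"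
  "\<one>\<^bsub>A\<^esub> p = (if p \<in> qpaths Q \<and> p_len p = 0 then 1 else 0)"
  by (simp_all add: cpath_alg_def)

text \<open>A factorisation of a path is the same as a place to cut it, since \<open>mid\<close>
  determines the intermediate vertex. This replaces a sum over pairs of paths by one over
  lengths.\<close>

lemma mult_app:
  assumes p: "p \<in> qpaths Q"
  shows "(f \<otimes>\<^bsub>A\<^esub> h) p = (\<Sum>k=0..p_len p. f (pre p k) * h (suf p k))"
proof -
  have "(\<Sum>(q, r) | q \<in> qpaths Q \<and> r \<in> qpaths Q \<and> p_src q = p_tgt r \<and>
      p = (p_tgt q, p_arrs q @ p_arrs r, p_src r). f q * h r)
    = (\<Sum>k=0..p_len p. f (pre p k) * h (suf p k))"
  proof (rule sum.reindex_bij_witness[where i = "\<lambda>k. (pre p k, suf p k)" and j = "\<lambda>(q, r). p_len q"])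
    fix x assume x: "x \<in> {(q, r). q \<in> qpaths Q \<and> r \<in> qpaths Q \<and> p_src q = p_tgt r \<and>
      p = (p_tgt q, p_arrs q @ p_arrs r, p_src r)}"
    obtain v L u M w where x': "x = ((v, L, u), (u, M, w))" "(v, L, u) \<in> qpaths Q" "p = (v, L @ M, w)"
      using x by (cases x) auto
    have u: "mid v L = u" using x'(2) qpath_mid by blast
    then show "(pre p (case x of (q, r) \<Rightarrow> p_len q), suf p (case x of (q, r) \<Rightarrow> p_len q)) = x" 
      and "(case x of (q, r) \<Rightarrow> p_len q) \<in> {0..p_len p}"
      and "f (pre p (case x of (q, r) \<Rightarrow> p_len q)) * h (suf p (case x of (q, r) \<Rightarrow> p_len q)) =
         (case x of (q, r) \<Rightarrow> f q * h r)"
      using x' by (simp_all add: pre_def suf_def)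
  next
    fix k assume k: "k \<in> {0..p_len p}"
    show "(case (pre p k, suf p k) of (q, r) \<Rightarrow> p_len q) = k" using k by (simp add: p_len_pre)
    show "(pre p k, suf p k) \<in> {(q, r). q \<in> qpaths Q \<and> r \<in> qpaths Q \<and> p_src q = p_tgt r \<and>
      p = (p_tgt q, p_arrs q @ p_arrs r, p_src r)}"
      using pre_suf_qpath[OF p, of k] by (cases p) (simp add: pre_def suf_def)
  qed
  then show ?thesis by (simp add: cpath_alg_def)
qed

lemma mult_app_out:
  assumes p: "p \<notin> qpaths Q"
  shows "(f \<otimes>\<^bsub>A\<^esub> h) p = 0"
proof -
  have "p \<in> qpaths Q" if "q \<in> qpaths Q" "r \<in> qpaths Q" "p_src q = p_tgt r" "p = (p_tgt q, p_arrs q @ p_arrs r, p_src r)" for q r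
  proof -
    obtain v L u where q: "q = (v, L, u)" by (cases q)
    obtain u' M w where r: "r = (u', M, w)" by (cases r)
    have "mid v L = u" using that(1) qpath_mid unfolding q by metis
    then show ?thesis using that by (simp add: q r qpath_append)
  qed
  then have "{(q, r). q \<in> qpaths Q \<and> r \<in> qpaths Q \<and> p_src q = p_tgt r \<and>
      p = (p_tgt q, p_arrs q @ p_arrs r, p_src r)} = {}" using p by blast
  then have "(\<Sum>(q, r) | q \<in> qpaths Q \<and> r \<in> qpaths Q \<and> p_src q = p_tgt r \<and>
      p = (p_tgt q, p_arrs q @ p_arrs r, p_src r). f q * h r) = 0" by (simp only: sum.empty)
  then show ?thesis by (simp add: cpath_alg_def)
qed

lemma A_ext:
  assumes "f \<in> carrier A" "h \<in> carrier A" "\<And>p. p \<in> qpaths Q \<Longrightarrow> f p = h p"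
  shows "f = h"
proof
  fix p show "f p = h p" using assms by (cases "p \<in> qpaths Q") (auto simp: A_carrier)
qed

lemma A_closed:
  "f \<otimes>\<^bsub>A\<^esub> h \<in> carrier A"
  "f \<in> carrier A \<Longrightarrow> h \<in> carrier A \<Longrightarrow> f \<oplus>\<^bsub>A\<^esub> h \<in> carrier A"
  "\<zero>\<^bsub>A\<^esub> \<in> carrier A" "\<one>\<^bsub>A\<^esub> \<in> carrier A" "f \<in> carrier A \<Longrightarrow> c \<odot>\<^bsub>A\<^esub> f \<in> carrier A"
  by (auto simp: A_carrier A_ops mult_app_out)

lemma A_mult_assoc: "(f \<otimes>\<^bsub>A\<^esub> h) \<otimes>\<^bsub>A\<^esub> k = f \<otimes>\<^bsub>A\<^esub> (h \<otimes>\<^bsub>A\<^esub> k)"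
proof (rule A_ext)
  fix p assume p: "p \<in> qpaths Q"
  let ?s = "\<lambda>j i m. f (pre p j) * h (pre (suf p j) i) * k (suf p (j + i))"
  have "((f \<otimes>\<^bsub>A\<^esub> h) \<otimes>\<^bsub>A\<^esub> k) p = (\<Sum>m=0..p_len p. \<Sum>j=0..m. ?s j (m - j) (p_len p - m))"
    using p by (auto simp: mult_app pre_suf_qpath p_len_pre sum_distrib_right pre_pre suf_pre intro!: sum.cong)
  \<comment> \<open>The triangle of double cuts is reindexed exactly as for products of formal power
    series.\<close>
  also have "\<dots> = (\<Sum>j=0..p_len p. \<Sum>i=0..p_len p - j. ?s j i (p_len p - j - i))"
    by (rule fps_mult_assoc_lemma)
  also have "\<dots> = (f \<otimes>\<^bsub>A\<^esub> (h \<otimes>\<^bsub>A\<^esub> k)) p"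
    using p by (simp add: mult_app pre_suf_qpath p_len_suf sum_distrib_left suf_suf add.commute mult.assoc)
  finally show "((f \<otimes>\<^bsub>A\<^esub> h) \<otimes>\<^bsub>A\<^esub> k) p = (f \<otimes>\<^bsub>A\<^esub> (h \<otimes>\<^bsub>A\<^esub> k)) p" .
qed (auto intro: A_closed)

lemma A_one_mult: "f \<in> carrier A \<Longrightarrow> \<one>\<^bsub>A\<^esub> \<otimes>\<^bsub>A\<^esub> f = f"
proof (rule A_ext)
  fix p assume f: "f \<in> carrier A" and p: "p \<in> qpaths Q"
  have "(\<one>\<^bsub>A\<^esub> \<otimes>\<^bsub>A\<^esub> f) p = (\<Sum>k=0..p_len p. if k = 0 then f p else 0)"
    unfolding mult_app[OF p] by (rule sum.cong) (use p in \<open>auto simp: A_ops pre_suf_qpath p_len_pre suf_0\<close>)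
  then show "(\<one>\<^bsub>A\<^esub> \<otimes>\<^bsub>A\<^esub> f) p = f p" by simp
qed (auto intro: A_closed)

lemma A_mult_one: "f \<in> carrier A \<Longrightarrow> f \<otimes>\<^bsub>A\<^esub> \<one>\<^bsub>A\<^esub> = f"
proof (rule A_ext)
  fix p assume f: "f \<in> carrier A" and p: "p \<in> qpaths Q"
  have "(f \<otimes>\<^bsub>A\<^esub> \<one>\<^bsub>A\<^esub>) p = (\<Sum>k=0..p_len p. if k = p_len p then f p else 0)"
    unfolding mult_app[OF p] by (rule sum.cong) (use p in \<open>auto simp: A_ops pre_suf_qpath p_len_suf pre_len\<close>)
  then show "(f \<otimes>\<^bsub>A\<^esub> \<one>\<^bsub>A\<^esub>) p = f p" by simp
qed (auto intro: A_closed)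

lemma A_kalg: "kalg A"
proof -
  have ag: "abelian_group A"
  proof (rule abelian_groupI)
    fix f assume "f \<in> carrier A"
    then show "\<exists>h\<in>carrier A. h \<oplus>\<^bsub>A\<^esub> f = \<zero>\<^bsub>A\<^esub>"
      by (intro bexI[of _ "\<lambda>p. - f p"]) (auto simp: A_ops fun_eq_iff A_carrier)
  qed (auto intro: A_closed simp: A_ops fun_eq_iff)
  have mon: "Group.monoid A"
    by (rule monoidI) (auto intro: A_closed A_mult_assoc simp: A_one_mult A_mult_one)
  have "ring A"
    by (rule ringI[OF ag mon])
      (auto intro!: A_ext A_closed simp: mult_app A_ops distrib_left distrib_right sum.distrib)
  moreover have "kalg_axioms A"
    by unfold_locales
      (auto intro!: A_ext A_closed simp: mult_app A_ops distrib_left distrib_right sum_distrib_left mult_ac)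
  ultimately show ?thesis by (simp add: kalg_def)
qed

sublocale A: kalg A by (rule A_kalg)

lemma A_minus_app:
  assumes "f \<in> carrier A" "h \<in> carrier A" shows "(f \<ominus>\<^bsub>A\<^esub> h) p = f p - h p"
proof -
  have "\<ominus>\<^bsub>A\<^esub> h = (\<lambda>p. - h p)"
    using assms(2) by (intro A.minus_equality) (auto simp: A_carrier A_ops fun_eq_iff)
  then show ?thesis by (simp add: a_minus_def A_ops)
qed

lemma A_finsum_app:
  assumes "\<And>i. i \<in> I \<Longrightarrow> f i \<in> carrier A"
  shows "(\<Oplus>\<^bsub>A\<^esub>i\<in>I. f i) p = (\<Sum>i\<in>I. f i p)"
  using assms
  by (induction I rule: infinite_finite_induct) (auto simp: A_ops A.finsum_insert A.finsum_infinite Pi_def)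

text \<open>Congruence modulo the part of the completion supported on paths of length at least
  \<open>m\<close>.\<close>

definition agree :: "nat \<Rightarrow> (('v, 'a) qpath \<Rightarrow> 'k) \<Rightarrow> (('v, 'a) qpath \<Rightarrow> 'k) \<Rightarrow> bool" where
  "agree m f h \<longleftrightarrow> (\<forall>p. p_len p < m \<longrightarrow> f p = h p)"

text \<open>The factors of a path are no longer than the path. This is the continuity of
  multiplication behind the closure of an ideal being an ideal.\<close>

lemma agree_mult:
  assumes "agree m f f'" "agree m h h'" shows "agree m (f \<otimes>\<^bsub>A\<^esub> h) (f' \<otimes>\<^bsub>A\<^esub> h')"
  unfolding agree_def
proof safe
  fix p :: "('v, 'a) qpath" assume m: "p_len p < m"
  show "(f \<otimes>\<^bsub>A\<^esub> h) p = (f' \<otimes>\<^bsub>A\<^esub> h') p"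
  proof (cases "p \<in> qpaths Q")
    case True
    with assms m show ?thesis
      by (auto simp: mult_app agree_def p_len_pre p_len_suf intro!: sum.cong)
  qed (simp add: mult_app_out)
qed

lemma closure_iff: "f \<in> adic_closure Q I \<longleftrightarrow> f \<in> carrier A \<and> (\<forall>m. \<exists>s\<in>I. agree m f s)"
  by (simp add: adic_closure_def agree_def)

lemma closure_ideal:
  assumes "ideal I A" shows "ideal (adic_closure Q I) A"
proof -
  interpret I: ideal I A by fact
  show ?thesis
  proof (rule idealI)
    show "ring A" by (rule A.ring_axioms)
    show "subgroup (adic_closure Q I) (add_monoid A)"
    proof (rule A.add.subgroupI)
      show "adic_closure Q I \<subseteq> carrier A" by (auto simp: closure_iff)
      have "\<zero>\<^bsub>A\<^esub> \<in> adic_closure Q I"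
        using additive_subgroup.zero_closed[OF I.additive_subgroup_axioms]
        by (auto simp: closure_iff agree_def)
      then show "adic_closure Q I \<noteq> {}" by blast
    next
      fix f assume f: "f \<in> adic_closure Q I"
      have "\<exists>s\<in>I. agree m (\<ominus>\<^bsub>A\<^esub> f) s" for m
      proof -
        obtain s where s: "s \<in> I" "agree m f s" using f by (auto simp: closure_iff)
        then have "agree m (\<ominus>\<^bsub>A\<^esub> f) (\<ominus>\<^bsub>A\<^esub> s)"
          using f A_minus_app[of "\<zero>\<^bsub>A\<^esub>" f] A_minus_app[of "\<zero>\<^bsub>A\<^esub>" s] I.Icarr[of s]
          by (auto simp: agree_def a_minus_def closure_iff A_ops)
        then show ?thesis using s by (metis I.a_inv_closed)
      qed
      then show "\<ominus>\<^bsub>A\<^esub> f \<in> adic_closure Q I" using f by (simp add: closure_iff)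
    next
      fix f h assume f: "f \<in> adic_closure Q I" "h \<in> adic_closure Q I"
      have "\<exists>s\<in>I. agree m (f \<oplus>\<^bsub>A\<^esub> h) s" for m
      proof -
        obtain s where "s \<in> I" "agree m f s" using f(1) unfolding closure_iff by blast
        moreover obtain s' where "s' \<in> I" "agree m h s'" using f(2) unfolding closure_iff by blast
        ultimately have s: "s \<in> I" "agree m f s" "s' \<in> I" "agree m h s'" by simp_all
        then have "agree m (f \<oplus>\<^bsub>A\<^esub> h) (s \<oplus>\<^bsub>A\<^esub> s')" by (auto simp: agree_def A_ops)
        then show ?thesis using s by blast
      qed
      then show "f \<oplus>\<^bsub>A\<^esub> h \<in> adic_closure Q I" using f by (simp add: closure_iff)
    qed
  next
    fix f x assume f: "f \<in> adic_closure Q I" and x: "x \<in> carrier A"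
    have "\<exists>s\<in>I. agree m (x \<otimes>\<^bsub>A\<^esub> f) s" "\<exists>s\<in>I. agree m (f \<otimes>\<^bsub>A\<^esub> x) s" for m
    proof -
      obtain s where s: "s \<in> I" "agree m f s" using f by (auto simp: closure_iff)
      have "agree m x x" by (simp add: agree_def)
      with s show "\<exists>s\<in>I. agree m (x \<otimes>\<^bsub>A\<^esub> f) s" "\<exists>s\<in>I. agree m (f \<otimes>\<^bsub>A\<^esub> x) s"
        using agree_mult x I.I_l_closed I.I_r_closed by metis+
    qed
    then show "x \<otimes>\<^bsub>A\<^esub> f \<in> adic_closure Q I" "f \<otimes>\<^bsub>A\<^esub> x \<in> adic_closure Q I"
      using f x by (simp_all add: closure_iff A_closed)
  qed
qed

lemma path_elt_closed [simp, intro]: "p \<in> qpaths Q \<Longrightarrow> path_elt p \<in> carrier A"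
  by (auto simp: A_carrier path_elt_def)

lemma path_elt_mult:
  assumes "(v, L, u) \<in> qpaths Q" "(u', M, w) \<in> qpaths Q"
  shows "path_elt (v, L, u) \<otimes>\<^bsub>A\<^esub> path_elt (u', M, w) =
    (if u = u' then path_elt (v, L @ M, w) else \<zero>\<^bsub>A\<^esub>)"
proof (rule A_ext)
  have u: "u = mid v L" using qpath_mid assms(1) by blast
  then show "(if u = u' then path_elt (v, L @ M, w) else \<zero>\<^bsub>A\<^esub>) \<in> carrier A"
    using assms by (auto simp: qpath_append)
  fix p assume p: "p \<in> qpaths Q"
  have *: "pre p k = (v, L, u) \<and> suf p k = (u', M, w) \<longleftrightarrow> k = length L \<and> u = u' \<and> p = (v, L @ M, w)"
    if "k \<le> p_len p" for k
    using that u by (cases p) (auto simp: pre_def suf_def min_absorb2)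
  have "(path_elt (v, L, u) \<otimes>\<^bsub>A\<^esub> path_elt (u', M, w)) p =
     (\<Sum>k=0..p_len p. if k = length L \<and> u = u' \<and> p = (v, L @ M, w) then 1 else 0)"
    unfolding mult_app[OF p]
    by (rule sum.cong) (use * in \<open>auto simp: path_elt_def\<close>)
  also have "\<dots> = (if u = u' then path_elt (v, L @ M, w) else \<zero>\<^bsub>A\<^esub>) p"
    by (auto simp: A_ops path_elt_def)
  finally show "(path_elt (v, L, u) \<otimes>\<^bsub>A\<^esub> path_elt (u', M, w)) p =
    (if u = u' then path_elt (v, L @ M, w) else \<zero>\<^bsub>A\<^esub>) p" .
qed (rule A_closed)

lemma vertex_elt_mult:
  assumes "u \<in> verts Q" "v \<in> verts Q"
  shows "vertex_elt u \<otimes>\<^bsub>A\<^esub> vertex_elt v = (if u = v then vertex_elt u else \<zero>\<^bsub>A\<^esub>)"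
  using assms path_elt_mult[of u "[]" u v "[]" v] by (simp add: vertex_elt_def)

lemma arrow_qpath [simp]: "a \<in> arcs Q \<Longrightarrow> (head Q a, [a], tail Q a) \<in> qpaths Q"
  by simp

lemma vertex_arrow_mult:
  assumes "u \<in> verts Q" "a \<in> arcs Q"
  shows "vertex_elt u \<otimes>\<^bsub>A\<^esub> arrow_elt Q a = (if u = head Q a then arrow_elt Q a else \<zero>\<^bsub>A\<^esub>)"
    "arrow_elt Q a \<otimes>\<^bsub>A\<^esub> vertex_elt u = (if u = tail Q a then arrow_elt Q a else \<zero>\<^bsub>A\<^esub>)"
  using assms path_elt_mult[of u "[]" u "head Q a" "[a]" "tail Q a"]
    path_elt_mult[of "head Q a" "[a]" "tail Q a" u "[]" u]
  by (auto simp: vertex_elt_def arrow_elt_def)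

lemma elt_closed [simp, intro]: "v \<in> verts Q \<Longrightarrow> vertex_elt v \<in> carrier A" "a \<in> arcs Q \<Longrightarrow> arrow_elt Q a \<in> carrier A"
  by (auto simp: vertex_elt_def arrow_elt_def)

lemma sum_vertex_elt: "(\<Oplus>\<^bsub>A\<^esub>v\<in>verts Q. vertex_elt v) = \<one>\<^bsub>A\<^esub>"
proof (rule A_ext)
  fix p assume p: "p \<in> qpaths Q"
  obtain v L w where [simp]: "p = (v, L, w)" by (cases p)
  have "(\<Oplus>\<^bsub>A\<^esub>v\<in>verts Q. vertex_elt v) p = (\<Sum>u\<in>verts Q. vertex_elt u p)"
    by (rule A_finsum_app) auto
  also have "\<dots> = (\<Sum>u\<in>verts Q. if u = v then if L = [] then 1 else 0 else 0)"
    by (rule sum.cong) (use p in \<open>auto simp: vertex_elt_def path_elt_def\<close>)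
  finally show "(\<Oplus>\<^bsub>A\<^esub>v\<in>verts Q. vertex_elt v) p = \<one>\<^bsub>A\<^esub> p"
    using p qpath_src[of v L w] by (auto simp: A_ops)
qed (auto intro!: A.finsum_closed A_closed)

end

section \<open>Cyclic derivatives\<close>

lemma (in path_algebra) rotate_cycle:
  "(v, x # M, v) \<in> qpaths Q \<longleftrightarrow> (tail Q x, M @ [x], tail Q x) \<in> qpaths Q \<and> head Q x = v"
proof
  assume *: "(v, x # M, v) \<in> qpaths Q"
  then have "mid (tail Q x) M = v" using qpath_mid by auto
  with * show "(tail Q x, M @ [x], tail Q x) \<in> qpaths Q \<and> head Q x = v"
    using qpath_src[of v "x # M" v] by (auto simp: qpath_append)
next
  assume "(tail Q x, M @ [x], tail Q x) \<in> qpaths Q \<and> head Q x = v"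
  then show "(v, x # M, v) \<in> qpaths Q" by (auto simp: qpath_append)
qed

context path_algebra
begin

text \<open>For a nonempty list the end vertices are determined by the arrows, so rotating a cycle
  becomes rotating a list.\<close>

definition cyc :: "'a list \<Rightarrow> ('v, 'a) qpath" where
  "cyc L = (head Q (hd L), L, tail Q (last L))"

lemma qpath_eq_cyc: "p \<in> qpaths Q \<Longrightarrow> p_arrs p \<noteq> [] \<Longrightarrow> p = cyc (p_arrs p)"
proof (cases p)
  case (fields v L w)
  assume "p \<in> qpaths Q" "p_arrs p \<noteq> []"
  then show ?thesis using qpath_mid[of v L w] by (cases L) (auto simp: fields cyc_def mid_def)
qed

lemma p_arrs_cyc [simp]: "p_arrs (cyc L) = L" "p_len (cyc L) = length L"
  by (simp_all add: cyc_def)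

lemma cycle_eq_cyc:
  assumes "(v, L, v) \<in> qpaths Q" "L \<noteq> []" shows "(v, L, v) = cyc L" "cyc L \<in> qcycles Q"
proof -
  show eq: "(v, L, v) = cyc L" using qpath_eq_cyc[OF assms(1)] assms(2) by simp
  have "(v, L, v) \<in> qcycles Q" using assms by (cases L) (simp_all add: qcycles_def del: qpath_Cons)
  then show "cyc L \<in> qcycles Q" using eq by simp
qed

lemma cyc_rotate1:
  assumes "L \<noteq> []" shows "cyc L \<in> qcycles Q \<longleftrightarrow> cyc (rotate1 L) \<in> qcycles Q"
proof -
  obtain x M where L: "L = x # M" using assms by (cases L) auto
  have "cyc L \<in> qcycles Q \<longleftrightarrow> (head Q x, x # M, head Q x) \<in> qpaths Q"
  proof
    assume "cyc L \<in> qcycles Q"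
    then show "(head Q x, x # M, head Q x) \<in> qpaths Q"
      by (auto simp: qcycles_def cyc_def L split: if_splits)
  next
    assume "(head Q x, x # M, head Q x) \<in> qpaths Q"
    then show "cyc L \<in> qcycles Q" unfolding L by (rule cycle_eq_cyc(2)) simp
  qed
  also have "\<dots> \<longleftrightarrow> (tail Q x, M @ [x], tail Q x) \<in> qpaths Q"
    by (simp only: rotate_cycle simp_thms)
  also have "\<dots> \<longleftrightarrow> cyc (rotate1 L) \<in> qcycles Q"
  proof
    assume "(tail Q x, M @ [x], tail Q x) \<in> qpaths Q"
    then have "cyc (M @ [x]) \<in> qcycles Q" by (rule cycle_eq_cyc(2)) simp
    then show "cyc (rotate1 L) \<in> qcycles Q" by (simp add: L)
  next
    assume "cyc (rotate1 L) \<in> qcycles Q"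
    then show "(tail Q x, M @ [x], tail Q x) \<in> qpaths Q"
      by (auto simp: qcycles_def cyc_def L)
  qed
  finally show ?thesis .
qed

lemma cyc_rotate: "L \<noteq> [] \<Longrightarrow> cyc (rotate i L) \<in> qcycles Q \<longleftrightarrow> cyc L \<in> qcycles Q"
  by (induction i) (simp_all flip: cyc_rotate1)

text \<open>Rotation by the full length is the identity, so a shift of the exponent moves one term
  from the start of the sum to its end.\<close>

lemma sum_rotate_shift: "(\<Sum>i<length N. h (rotate (i + s) N)) = (\<Sum>i<length N. h (rotate i N))"
  for h :: "'a list \<Rightarrow> 'k"
proof (induction s)
  case (Suc s)
  have "(\<Sum>i<length N. h (rotate (Suc (i + s)) N)) = (\<Sum>i<length N. h (rotate (i + s) N))"
  proof (cases N)
    case (Cons x M)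
    let ?g = "\<lambda>i. h (rotate (i + s) N)"
    have "?g (length N) = ?g 0"
      using rotate_rotate[of s "length N" N] by (simp add: add.commute)
    then show ?thesis
      using sum.lessThan_Suc_shift[of ?g "length M"] sum.lessThan_Suc[of ?g "length M"]
        sum.lessThan_Suc[of "\<lambda>i. ?g (Suc i)" "length M"]
      by (simp add: Cons add.commute)
  qed simp
  then show ?case using Suc by simp
qed simp

section \<open>Cyclic derivatives as sums over rotations, and their trace property\<close>

definition deriv_dom :: "'a \<Rightarrow> ('v, 'a) qpath \<Rightarrow> bool" where
  "deriv_dom a p \<longleftrightarrow> p \<in> qpaths Q \<and> p_tgt p = tail Q a \<and> p_src p = head Q a \<and> a \<in> arcs Q"

lemma deriv_dom_cyc:
  assumes "deriv_dom a p" shows "cyc (a # p_arrs p) \<in> qcycles Q"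
  using assms cycle_eq_cyc(2)[of "head Q a" "a # p_arrs p"] by (cases p) (auto simp: deriv_dom_def)

text \<open>A cycle with \<open>a\<close> at position m whose remainder is p is the rotation of a p
  by l - m, where l is its length. So the coefficient is a sum over all rotations of one word, and
  periodic words repeat a cycle once for each suitable position. This form makes rotation invariance
  manifest.\<close>

lemma cyc_deriv_app:
  fixes W :: "('v, 'a) qpath \<Rightarrow> 'k"
  shows "cyc_deriv Q a W p =
    (if deriv_dom a p then \<Sum>i<Suc (p_len p). W (cyc (rotate i (a # p_arrs p))) else 0)"
proof -
  obtain v L w where p: "p = (v, L, w)" by (cases p)
  let ?S = "{(c, m). c \<in> qcycles Q \<and> m < p_len c \<and> p_arrs c ! m = a \<and>
     (v, L, w) = (tail Q a, drop (Suc m) (p_arrs c) @ take m (p_arrs c), head Q a)}"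
  let ?N = "a # L" and ?l = "Suc (length L)"
  have rot: "rotate m (p_arrs c) = ?N" "p_len c = ?l" if "(c, m) \<in> ?S" for c m
    using that by (auto simp: rotate_drop_take Cons_nth_drop_Suc p_len_def)
  show ?thesis
  proof (cases "deriv_dom a p")
    case True
    have cN: "cyc ?N \<in> qcycles Q" using deriv_dom_cyc[OF True] by (simp add: p)
    have ends: "v = tail Q a" "w = head Q a" using True by (auto simp: deriv_dom_def p)
    have "(\<Sum>(c, m)\<in>?S. W c) = (\<Sum>m<?l. W (cyc (rotate (?l - m) ?N)))"
    proof (rule sum.reindex_bij_witness[where i = "\<lambda>m. (cyc (rotate (?l - m) ?N), m)" and j = snd])
      fix x assume x: "x \<in> ?S"
      obtain c m where xcm: "x = (c, m)" by (cases x)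
      have cm: "(c, m) \<in> ?S" using x unfolding xcm .
      have c: "c \<in> qcycles Q" "m < p_len c" using cm by auto
      have "rotate (?l - m) ?N = rotate (?l - m) (rotate m (p_arrs c))" by (simp only: rot(1)[OF cm])
      also have "\<dots> = rotate (p_len c - m + m) (p_arrs c)" by (simp only: rot(2)[OF cm] rotate_rotate)
      also have "\<dots> = p_arrs c" using c by (simp add: p_len_def)
      also have "cyc (p_arrs c) = c"
        using c by (intro qpath_eq_cyc[symmetric]) (auto simp: qcycles_def p_len_def)
      finally have *: "cyc (rotate (?l - m) ?N) = c" .
      show "(cyc (rotate (?l - snd x) ?N), snd x) = x" "snd x \<in> {..<?l}"
        "W (cyc (rotate (?l - snd x) ?N)) = (case x of (c, m) \<Rightarrow> W c)"
        using * rot(2)[OF cm] c by (auto simp: xcm)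
    next
      fix m assume m: "m \<in> {..<?l}"
      let ?c = "rotate (?l - m) ?N"
      have "m + (?l - m) = length ?N" using m by simp
      then have "rotate m ?c = rotate (length ?N) ?N" by (simp only: rotate_rotate)
      also have "\<dots> = ?N" by (rule rotate_id) simp
      finally have "rotate m ?c = ?N" .
      then have "drop m ?c @ take m ?c = ?N" using m by (simp add: rotate_drop_take)
      then have "?c ! m # drop (Suc m) ?c @ take m ?c = ?N"
        using m by (metis Cons_nth_drop_Suc append_Cons length_Cons length_rotate lessThan_iff)
      moreover have "cyc ?c \<in> qcycles Q" using cN cyc_rotate[of ?N] by blast
      ultimately show "(cyc ?c, m) \<in> ?S" using m ends by simp
    qed simp
    \<comment> \<open>The exponents l - m run from 1 to l rather than from 0 to l - 1. They are
      written as l - (m + 1) + 1 so that the order of summation can be reversed; the remaining shift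
      by one is removed by \<open>sum_rotate_shift\<close>.\<close>
    also have "\<dots> = (\<Sum>m<?l. W (cyc (rotate (?l - Suc m + 1) ?N)))"
    proof (rule sum.cong[OF refl])
      fix m assume "m \<in> {..<?l}"
      then have "?l - m = ?l - Suc m + 1" by simp
      then show "W (cyc (rotate (?l - m) ?N)) = W (cyc (rotate (?l - Suc m + 1) ?N))" by (simp only:)
    qed
    also have "\<dots> = (\<Sum>i<?l. W (cyc (rotate (i + 1) ?N)))"
      by (rule sum.nat_diff_reindex)
    also have "\<dots> = (\<Sum>i<?l. W (cyc (rotate i ?N)))"
      using sum_rotate_shift[where h = "\<lambda>L. W (cyc L)" and s = 1 and N = ?N] by simp
    finally show ?thesis using True by (simp add: cyc_deriv_def p)
  next
    case False
    have "deriv_dom a p" if x: "(c, m) \<in> ?S" for c m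
    proof -
      have c: "c \<in> qcycles Q" "m < p_len c" using x by auto
      have "c = cyc (p_arrs c)"
        using c by (intro qpath_eq_cyc) (auto simp: qcycles_def p_len_def)
      then have "cyc (p_arrs c) \<in> qcycles Q" using c by simp
      then have "cyc (rotate m (p_arrs c)) \<in> qcycles Q"
        using c by (subst cyc_rotate) (auto simp: p_len_def)
      then have "cyc ?N \<in> qcycles Q" using rot[OF x] by simp
      then show ?thesis using x by (auto simp: qcycles_def cyc_def deriv_dom_def p split: if_splits)
    qed
    then have "?S = {}" using False by blast
    then have "(\<Sum>(c, m)\<in>?S. W c) = 0" by (simp only: sum.empty)
    then show ?thesis using False by (simp add: cyc_deriv_def p)
  qed
qed

lemma cyc_deriv_closed [simp, intro]: "cyc_deriv Q a f \<in> carrier A"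
proof -
  have "cyc_deriv Q a f p = 0" if "p \<notin> qpaths Q" for p
    using that by (simp add: cyc_deriv_app deriv_dom_def)
  then show ?thesis by (simp add: A_carrier)
qed

lemma cyc_deriv_add: "cyc_deriv Q a (f \<oplus>\<^bsub>A\<^esub> h) = cyc_deriv Q a f \<oplus>\<^bsub>A\<^esub> cyc_deriv Q a h"
proof
  fix p show "cyc_deriv Q a (f \<oplus>\<^bsub>A\<^esub> h) p = (cyc_deriv Q a f \<oplus>\<^bsub>A\<^esub> cyc_deriv Q a h) p"
    by (simp add: A_ops cyc_deriv_app sum.distrib del: sum.lessThan_Suc)
qed

lemma cyc_deriv_minus:
  assumes "f \<in> carrier A" "h \<in> carrier A"
  shows "cyc_deriv Q a (f \<ominus>\<^bsub>A\<^esub> h) = cyc_deriv Q a f \<ominus>\<^bsub>A\<^esub> cyc_deriv Q a h"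
proof
  fix p show "cyc_deriv Q a (f \<ominus>\<^bsub>A\<^esub> h) p = (cyc_deriv Q a f \<ominus>\<^bsub>A\<^esub> cyc_deriv Q a h) p"
    using assms by (simp add: A_minus_app cyc_deriv_app sum_subtractf del: sum.lessThan_Suc)
qed

text \<open>Cutting a cycle after k arrows and swapping the two pieces is cutting its rotation by k
  after the remaining arrows. This is the combinatorial core of the vanishing on
  commutators.\<close>

lemma cyc_mult_split:
  assumes c: "cyc M \<in> qcycles Q" and k: "k \<le> length M"
  shows "suf (cyc M) k = pre (cyc (rotate k M)) (length M - k)"
    "pre (cyc M) k = suf (cyc (rotate k M)) (length M - k)"
proof -
  have M: "M \<noteq> []" using c by (auto simp: qcycles_def)
  have rot: "rotate k M = drop k M @ take k M"
    using k by (cases "k = length M") (auto simp: rotate_drop_take)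
  have c': "cyc (rotate k M) \<in> qcycles Q" using cyc_rotate[OF M] c by blast
  have q: "cyc M \<in> qpaths Q" "p_src (cyc M) = p_tgt (cyc M)" "cyc (rotate k M) \<in> qpaths Q"
    "p_src (cyc (rotate k M)) = p_tgt (cyc (rotate k M))"
    using c c' by (auto simp: qcycles_def)
  have eq: "p = p'" if "p \<in> qpaths Q" "p' \<in> qpaths Q" "p_arrs p = p_arrs p'" "p_arrs p \<noteq> []" for p p'
    using that qpath_eq_cyc by metis
  have arr: "p_arrs (suf (cyc M) k) = drop k M" "p_arrs (pre (cyc M) k) = take k M"
    "p_arrs (pre (cyc (rotate k M)) (length M - k)) = drop k M"
    "p_arrs (suf (cyc (rotate k M)) (length M - k)) = take k M"
    by (simp_all add: suf_def pre_def rot)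
  show "suf (cyc M) k = pre (cyc (rotate k M)) (length M - k)"
  \<comment> \<open>A piece without arrows is not determined by its arrow list, so its vertex has to
    be compared separately.\<close>
  proof (cases "k = length M")
    case True
    then show ?thesis using q(2) qpath_mid[of "p_tgt (cyc M)" M "p_src (cyc M)"] q(1) M
      by (simp add: suf_def pre_def mid_def cyc_def)
  next
    case False
    then show ?thesis using arr k pre_suf_qpath[OF q(1)] pre_suf_qpath[OF q(3)] by (intro eq) auto
  qed
  show "pre (cyc M) k = suf (cyc (rotate k M)) (length M - k)"
  proof (cases "k = 0")
    case True
    then show ?thesis using q(2) M
      by (simp add: suf_def pre_def mid_def cyc_def)
  next
    case False
    then show ?thesis using arr M pre_suf_qpath[OF q(1)] pre_suf_qpath[OF q(3)] by (intro eq) auto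
  qed
qed

text \<open>Both sides sum over the rotations of the cycle a p and over the cuts of each rotation. A
  cut after k arrows for the product y x, at rotation i, is a cut after l - k arrows for x y, at
  rotation i + k. Summing over all rotations removes the shift by k.\<close>

lemma cyc_deriv_commute: "cyc_deriv Q a (x \<otimes>\<^bsub>A\<^esub> y) = cyc_deriv Q a (y \<otimes>\<^bsub>A\<^esub> x)"
proof
  fix p :: "('v, 'a) qpath"
  let ?N = "a # p_arrs p" and ?l = "Suc (p_len p)"
  have l: "length ?N = ?l" by (simp add: p_len_def)
  show "cyc_deriv Q a (x \<otimes>\<^bsub>A\<^esub> y) p = cyc_deriv Q a (y \<otimes>\<^bsub>A\<^esub> x) p"
  proof (cases "deriv_dom a p")
    case True
    from deriv_dom_cyc[OF this]
    have cyc: "cyc (rotate i ?N) \<in> qcycles Q" for i using cyc_rotate[of ?N] by blast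
    then have path: "cyc (rotate i ?N) \<in> qpaths Q" for i by (simp add: qcycles_def)
    let ?h = "\<lambda>k M. x (pre (cyc M) (?l - k)) * y (suf (cyc M) (?l - k))"
    have "(\<Sum>i<?l. (y \<otimes>\<^bsub>A\<^esub> x) (cyc (rotate i ?N))) = (\<Sum>i<?l. \<Sum>k=0..?l. ?h k (rotate (i + k) ?N))"
    proof (intro sum.cong refl)
      fix i
      have "(y \<otimes>\<^bsub>A\<^esub> x) (cyc (rotate i ?N)) =
        (\<Sum>k=0..?l. y (pre (cyc (rotate i ?N)) k) * x (suf (cyc (rotate i ?N)) k))"
        using mult_app[OF path] l by simp
      also have "\<dots> = (\<Sum>k=0..?l. ?h k (rotate (i + k) ?N))"
      proof (intro sum.cong refl)
        fix k assume k: "k \<in> {0..?l}"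
        have "rotate k (rotate i ?N) = rotate (i + k) ?N"
          by (simp only: rotate_rotate add.commute)
        then have "suf (cyc (rotate i ?N)) k = pre (cyc (rotate (i + k) ?N)) (?l - k)"
          "pre (cyc (rotate i ?N)) k = suf (cyc (rotate (i + k) ?N)) (?l - k)"
          using cyc_mult_split[OF cyc[of i], of k] k by (simp_all only: length_rotate l atLeastAtMost_iff)
        then show "y (pre (cyc (rotate i ?N)) k) * x (suf (cyc (rotate i ?N)) k) = ?h k (rotate (i + k) ?N)"
          by (simp only: mult.commute)
      qed
      finally show "(y \<otimes>\<^bsub>A\<^esub> x) (cyc (rotate i ?N)) = (\<Sum>k=0..?l. ?h k (rotate (i + k) ?N))" .
    qed
    also have "\<dots> = (\<Sum>k=0..?l. \<Sum>i<?l. ?h k (rotate (i + k) ?N))" by (rule sum.swap)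
    also have "\<dots> = (\<Sum>k=0..?l. \<Sum>i<?l. ?h k (rotate i ?N))"
    proof (rule sum.cong[OF refl])
      fix k
      show "(\<Sum>i<?l. ?h k (rotate (i + k) ?N)) = (\<Sum>i<?l. ?h k (rotate i ?N))"
        using sum_rotate_shift[where N = ?N and h = "?h k" and s = k] unfolding l .
    qed
    also have "\<dots> = (\<Sum>i<?l. \<Sum>k=0..?l. ?h k (rotate i ?N))" by (rule sum.swap)
    also have "\<dots> = (\<Sum>i<?l. (x \<otimes>\<^bsub>A\<^esub> y) (cyc (rotate i ?N)))"
    proof (intro sum.cong refl)
      fix i
      have "(x \<otimes>\<^bsub>A\<^esub> y) (cyc (rotate i ?N)) =
        (\<Sum>k=0..?l. x (pre (cyc (rotate i ?N)) k) * y (suf (cyc (rotate i ?N)) k))"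
        using mult_app[OF path] l by simp
      also have "\<dots> = (\<Sum>k=0..?l. ?h k (rotate i ?N))"
        by (rule sum.reindex_bij_witness[where i = "\<lambda>k. ?l - k" and j = "\<lambda>k. ?l - k"]) auto
      finally show "(\<Sum>k=0..?l. ?h k (rotate i ?N)) = (x \<otimes>\<^bsub>A\<^esub> y) (cyc (rotate i ?N))" ..
    qed
    finally show ?thesis using True by (simp only: cyc_deriv_app if_True)
  qed (auto simp: cyc_deriv_app)
qed

lemma cyc_deriv_generate:
  assumes "s \<in> generate (add_monoid A)
        {x \<otimes>\<^bsub>A\<^esub> y \<ominus>\<^bsub>A\<^esub> y \<otimes>\<^bsub>A\<^esub> x | x y. x \<in> carrier A \<and> y \<in> carrier A}"
  shows "s \<in> carrier A \<and> cyc_deriv Q a s = \<zero>\<^bsub>A\<^esub>"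
  using assms
proof (induction s rule: generate.induct)
  case one
  have "cyc_deriv Q a \<zero>\<^bsub>A\<^esub> p = \<zero>\<^bsub>A\<^esub> p" for p
    by (simp add: A_ops cyc_deriv_app)
  then show ?case by auto
next
  case (incl s)
  then obtain x y where s: "x \<in> carrier A" "y \<in> carrier A" "s = x \<otimes>\<^bsub>A\<^esub> y \<ominus>\<^bsub>A\<^esub> y \<otimes>\<^bsub>A\<^esub> x" by blast
  then show ?case using cyc_deriv_commute[of a x y] by (simp add: cyc_deriv_minus A.r_right_minus_eq)
next
  case (inv s)
  then obtain x y where s: "x \<in> carrier A" "y \<in> carrier A" "s = x \<otimes>\<^bsub>A\<^esub> y \<ominus>\<^bsub>A\<^esub> y \<otimes>\<^bsub>A\<^esub> x" by blast
  then have "inv\<^bsub>add_monoid A\<^esub> s = y \<otimes>\<^bsub>A\<^esub> x \<ominus>\<^bsub>A\<^esub> x \<otimes>\<^bsub>A\<^esub> y"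
    by (simp add: A.minus_add A.a_comm a_minus_def flip: a_inv_def)
  then show ?case using s cyc_deriv_commute[of a x y] by (simp add: cyc_deriv_minus A.r_right_minus_eq)
next
  case (eng s s')
  then show ?case by (simp add: cyc_deriv_add)
qed

lemma cyc_deriv_com_closure:
  assumes "f \<in> com_closure Q" shows "cyc_deriv Q a f = \<zero>\<^bsub>A\<^esub>"
proof
  fix p :: "('v, 'a) qpath"
  \<comment> \<open>The derivative at \<open>p\<close> reads coefficients of cycles with one arrow
    more than \<open>p\<close>, so agreement below length \<open>p_len p\<close> + 2 is
    enough.\<close>
  obtain s where s: "s \<in> generate (add_monoid A)
        {x \<otimes>\<^bsub>A\<^esub> y \<ominus>\<^bsub>A\<^esub> y \<otimes>\<^bsub>A\<^esub> x | x y. x \<in> carrier A \<and> y \<in> carrier A}"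
    and "agree (Suc (Suc (p_len p))) f s"
    using assms unfolding com_closure_def closure_iff by blast
  then have "cyc_deriv Q a f p = cyc_deriv Q a s p"
    by (auto simp: cyc_deriv_app agree_def p_len_def[of p] intro!: sum.cong simp del: sum.lessThan_Suc)
  then show "cyc_deriv Q a f p = \<zero>\<^bsub>A\<^esub> p" using cyc_deriv_generate[OF s] by simp
qed

end

section \<open>Actions permuting the arrows up to scalars\<close>

text \<open>The combinatorial data of such an action: \<open>sv\<close> and \<open>sa\<close> act on
  the quiver, and \<open>sc\<close> is a multiplicative cocycle for the action on arrows.\<close>

locale monomial_action = path_algebra Q ty + G: group G
  for Q :: "('v, 'a) pre_digraph" and ty :: "'k::field itself" and G :: "('g, 'm) monoid_scheme" +
  fixes sv :: "'g \<Rightarrow> 'v \<Rightarrow> 'v" and sa :: "'g \<Rightarrow> 'a \<Rightarrow> 'a" and sc :: "'g \<Rightarrow> 'a \<Rightarrow> 'k"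
  assumes fin_G: "finite (carrier G)"
    and sv_closed [simp, intro]: "h \<in> carrier G \<Longrightarrow> v \<in> verts Q \<Longrightarrow> sv h v \<in> verts Q"
    and sa_closed [simp, intro]: "h \<in> carrier G \<Longrightarrow> a \<in> arcs Q \<Longrightarrow> sa h a \<in> arcs Q"
    and sc_nonzero [simp]: "h \<in> carrier G \<Longrightarrow> a \<in> arcs Q \<Longrightarrow> sc h a \<noteq> 0"
    and sa_ends [simp]: "h \<in> carrier G \<Longrightarrow> a \<in> arcs Q \<Longrightarrow> tail Q (sa h a) = sv h (tail Q a)"
      "h \<in> carrier G \<Longrightarrow> a \<in> arcs Q \<Longrightarrow> head Q (sa h a) = sv h (head Q a)"
    and sv_one [simp]: "v \<in> verts Q \<Longrightarrow> sv \<one>\<^bsub>G\<^esub> v = v"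
    and sa_one [simp]: "a \<in> arcs Q \<Longrightarrow> sa \<one>\<^bsub>G\<^esub> a = a"
    and sc_one [simp]: "a \<in> arcs Q \<Longrightarrow> sc \<one>\<^bsub>G\<^esub> a = 1"
    and sv_mult: "h \<in> carrier G \<Longrightarrow> h' \<in> carrier G \<Longrightarrow> v \<in> verts Q \<Longrightarrow> sv (h \<otimes>\<^bsub>G\<^esub> h') v = sv h (sv h' v)"
    and sa_mult: "h \<in> carrier G \<Longrightarrow> h' \<in> carrier G \<Longrightarrow> a \<in> arcs Q \<Longrightarrow> sa (h \<otimes>\<^bsub>G\<^esub> h') a = sa h (sa h' a)"
    and sc_mult: "h \<in> carrier G \<Longrightarrow> h' \<in> carrier G \<Longrightarrow> a \<in> arcs Q \<Longrightarrow>
      sc (h \<otimes>\<^bsub>G\<^esub> h') a = sc h' a * sc h (sa h' a)"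
begin

definition sp :: "'g \<Rightarrow> ('v, 'a) qpath \<Rightarrow> ('v, 'a) qpath" where
  "sp h p = (sv h (p_tgt p), map (sa h) (p_arrs p), sv h (p_src p))"

definition spc :: "'g \<Rightarrow> 'a list \<Rightarrow> 'k" where
  "spc h L = prod_list (map (sc h) L)"

text \<open>Linear and continuous extension of the map sending a path p to
  \<open>spc h (p_arrs p)\<close> times \<open>sp h p\<close>. Each path has exactly one preimage
  under \<open>sp h\<close>, so the coefficient is a single product even for infinite sums of
  paths.\<close>

definition \<tau> :: "'g \<Rightarrow> (('v, 'a) qpath \<Rightarrow> 'k) \<Rightarrow> ('v, 'a) qpath \<Rightarrow> 'k" where
  "\<tau> h f = (\<lambda>q. if q \<in> qpaths Q then spc h (p_arrs (sp (inv\<^bsub>G\<^esub> h) q)) * f (sp (inv\<^bsub>G\<^esub> h) q) else 0)"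

lemma sp_qpath [simp]: "h \<in> carrier G \<Longrightarrow> p \<in> qpaths Q \<Longrightarrow> sp h p \<in> qpaths Q"
proof (cases p)
  case (fields v L w)
  assume h: "h \<in> carrier G" "p \<in> qpaths Q"
  have "(v, L, w) \<in> qpaths Q \<Longrightarrow> (sv h v, map (sa h) L, sv h w) \<in> qpaths Q"
    using h(1) by (induction L arbitrary: v) auto
  with h show ?thesis by (simp add: fields sp_def)
qed

lemma sp_len [simp]: "p_len (sp h p) = p_len p"
  by (simp add: sp_def p_len_def)

lemma qpathD: "p \<in> qpaths Q \<Longrightarrow> p_tgt p \<in> verts Q \<and> p_src p \<in> verts Q \<and> set (p_arrs p) \<subseteq> arcs Q"
  using qpath_src[of "p_tgt p" "p_arrs p" "p_src p"] by (cases p) simp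

lemma sp_mult: "h \<in> carrier G \<Longrightarrow> h' \<in> carrier G \<Longrightarrow> p \<in> qpaths Q \<Longrightarrow> sp (h \<otimes>\<^bsub>G\<^esub> h') p = sp h (sp h' p)"
  using qpathD[of p] by (auto simp: sp_def sv_mult sa_mult subset_iff)

lemma sp_one [simp]: "p \<in> qpaths Q \<Longrightarrow> sp \<one>\<^bsub>G\<^esub> p = p"
  using qpathD[of p] by (cases p) (auto simp: sp_def subset_iff intro!: map_idI)

lemma sp_inv [simp]: "h \<in> carrier G \<Longrightarrow> p \<in> qpaths Q \<Longrightarrow> sp h (sp (inv\<^bsub>G\<^esub> h) p) = p"
  "h \<in> carrier G \<Longrightarrow> p \<in> qpaths Q \<Longrightarrow> sp (inv\<^bsub>G\<^esub> h) (sp h p) = p"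
  by (simp_all flip: sp_mult)

lemma spc_append: "spc h (L @ M) = spc h L * spc h M"
  by (simp add: spc_def)

lemma spc_mult: "h \<in> carrier G \<Longrightarrow> h' \<in> carrier G \<Longrightarrow> set L \<subseteq> arcs Q \<Longrightarrow>
  spc (h \<otimes>\<^bsub>G\<^esub> h') L = spc h' L * spc h (map (sa h') L)"
  by (induction L) (simp_all add: spc_def sc_mult)

lemma spc_one: "set L \<subseteq> arcs Q \<Longrightarrow> spc \<one>\<^bsub>G\<^esub> L = 1"
  by (induction L) (simp_all add: spc_def)

lemma spc_rotate: "spc h (rotate i L) = spc h L"
proof (induction i)
  case (Suc i)
  have "spc h (rotate1 M) = spc h M" for M by (cases M) (simp_all add: spc_def mult.commute)
  then show ?case using Suc by simp
qed simp

lemma \<tau>_closed: "\<tau> h f \<in> carrier A"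
  by (simp add: \<tau>_def A_carrier)

lemma \<tau>_app: "h \<in> carrier G \<Longrightarrow> p \<in> qpaths Q \<Longrightarrow> \<tau> h f (sp h p) = spc h (p_arrs p) * f p"
  by (simp add: \<tau>_def)

lemma \<tau>_ext:
  assumes "h \<in> carrier G" "x \<in> carrier A" "y \<in> carrier A" "\<And>p. p \<in> qpaths Q \<Longrightarrow> x (sp h p) = y (sp h p)"
  shows "x = y"
proof (rule A_ext[OF assms(2,3)])
  fix p assume "p \<in> qpaths Q"
  then show "x p = y p" using assms(4)[of "sp (inv\<^bsub>G\<^esub> h) p"] assms(1) by simp
qed

lemma sv_mid: "h \<in> carrier G \<Longrightarrow> set L \<subseteq> arcs Q \<Longrightarrow> mid (sv h v) (map (sa h) L) = sv h (mid v L)"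
  by (auto simp: mid_def last_map) (use last_in_set in fastforce)

lemma sp_pre_suf:
  assumes "h \<in> carrier G" "p \<in> qpaths Q"
  shows "pre (sp h p) k = sp h (pre p k)" "suf (sp h p) k = sp h (suf p k)"
proof -
  have "set (take k (p_arrs p)) \<subseteq> arcs Q" using qpathD[OF assms(2)] set_take_subset by fastforce
  then show "pre (sp h p) k = sp h (pre p k)" "suf (sp h p) k = sp h (suf p k)"
    using assms(1) by (simp_all add: pre_def suf_def sp_def sv_mid take_map drop_map)
qed

lemma \<tau>_mult:
  assumes h: "h \<in> carrier G"
  shows "\<tau> h (x \<otimes>\<^bsub>A\<^esub> y) = \<tau> h x \<otimes>\<^bsub>A\<^esub> \<tau> h y"
proof (rule \<tau>_ext[OF h])
  fix p assume p: "p \<in> qpaths Q"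
  have "(\<tau> h x \<otimes>\<^bsub>A\<^esub> \<tau> h y) (sp h p) = (\<Sum>k=0..p_len p. \<tau> h x (sp h (pre p k)) * \<tau> h y (sp h (suf p k)))"
    using h p by (simp add: mult_app sp_pre_suf)
  also have "\<dots> = (\<Sum>k=0..p_len p. spc h (p_arrs p) * (x (pre p k) * y (suf p k)))"
  proof (intro sum.cong refl)
    fix k
    have "spc h (p_arrs p) = spc h (p_arrs (pre p k)) * spc h (p_arrs (suf p k))"
      by (simp add: pre_def suf_def flip: spc_append)
    then show "\<tau> h x (sp h (pre p k)) * \<tau> h y (sp h (suf p k)) = spc h (p_arrs p) * (x (pre p k) * y (suf p k))"
      using h p pre_suf_qpath[OF p, of k] by (simp add: \<tau>_app)
  qed
  also have "\<dots> = \<tau> h (x \<otimes>\<^bsub>A\<^esub> y) (sp h p)"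
    using h p by (simp add: \<tau>_app mult_app sum_distrib_left)
  finally show "\<tau> h (x \<otimes>\<^bsub>A\<^esub> y) (sp h p) = (\<tau> h x \<otimes>\<^bsub>A\<^esub> \<tau> h y) (sp h p)" ..
qed (auto intro: \<tau>_closed A_closed)

lemma \<tau>_kalg_act: "kalg_act A G \<tau>"
proof (intro_locales, unfold kalg_act_axioms_def, safe)
  fix h x y c assume h: "h \<in> carrier G"
  show "\<tau> h (x \<oplus>\<^bsub>A\<^esub> y) = \<tau> h x \<oplus>\<^bsub>A\<^esub> \<tau> h y"
    using h by (intro \<tau>_ext[OF h]) (auto intro: \<tau>_closed A_closed simp: \<tau>_app A_ops distrib_left)
  show "\<tau> h (x \<otimes>\<^bsub>A\<^esub> y) = \<tau> h x \<otimes>\<^bsub>A\<^esub> \<tau> h y" by (rule \<tau>_mult[OF h])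
  show "\<tau> h (c \<odot>\<^bsub>A\<^esub> x) = c \<odot>\<^bsub>A\<^esub> \<tau> h x"
    using h by (intro \<tau>_ext[OF h]) (auto intro: \<tau>_closed A_closed simp: \<tau>_app A_ops)
  have "p_len p = 0 \<Longrightarrow> spc h (p_arrs p) = 1" for p :: "('v, 'a) qpath"
    by (simp add: spc_def p_len_def)
  then show "\<tau> h \<one>\<^bsub>A\<^esub> = \<one>\<^bsub>A\<^esub>"
    using h by (intro \<tau>_ext[OF h]) (auto intro: \<tau>_closed A_closed simp: \<tau>_app A_ops)
next
  fix h h' x assume h: "h \<in> carrier G" "h' \<in> carrier G"
  show "\<tau> (h \<otimes>\<^bsub>G\<^esub> h') x = \<tau> h (\<tau> h' x)"
  proof (rule \<tau>_ext[of "h \<otimes>\<^bsub>G\<^esub> h'"])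
    fix p assume p: "p \<in> qpaths Q"
    have "\<tau> h (\<tau> h' x) (sp (h \<otimes>\<^bsub>G\<^esub> h') p) = spc h (p_arrs (sp h' p)) * (spc h' (p_arrs p) * x p)"
      using h p by (simp add: sp_mult \<tau>_app)
    also have "\<dots> = \<tau> (h \<otimes>\<^bsub>G\<^esub> h') x (sp (h \<otimes>\<^bsub>G\<^esub> h') p)"
      using h p qpathD[OF p] by (simp add: \<tau>_app spc_mult) (simp add: sp_def)
    finally show "\<tau> (h \<otimes>\<^bsub>G\<^esub> h') x (sp (h \<otimes>\<^bsub>G\<^esub> h') p) = \<tau> h (\<tau> h' x) (sp (h \<otimes>\<^bsub>G\<^esub> h') p)" ..
  qed (use h in \<open>auto intro: \<tau>_closed\<close>)
next
  fix x assume "x \<in> carrier A"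
  then show "\<tau> \<one>\<^bsub>G\<^esub> x = x"
    by (rule A_ext[OF \<tau>_closed]) (simp add: \<tau>_def spc_one qpathD)
qed (auto simp: fin_G intro: \<tau>_closed)

sublocale T: kalg_act A G \<tau> by (rule \<tau>_kalg_act)

lemma \<tau>_path_elt:
  assumes h: "h \<in> carrier G" and p: "p \<in> qpaths Q"
  shows "\<tau> h (path_elt p) = spc h (p_arrs p) \<odot>\<^bsub>A\<^esub> path_elt (sp h p)"
proof (rule \<tau>_ext[OF h])
  fix q assume q: "q \<in> qpaths Q"
  have "sp h q = sp h p \<longleftrightarrow> q = p" using sp_inv(2)[OF h q] sp_inv(2)[OF h p] by metis
  then show "\<tau> h (path_elt p) (sp h q) = (spc h (p_arrs p) \<odot>\<^bsub>A\<^esub> path_elt (sp h p)) (sp h q)"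
    using h q by (simp add: \<tau>_app A_ops path_elt_def)
qed (use h p in \<open>auto intro: \<tau>_closed A_closed\<close>)

lemma \<tau>_vertex: "h \<in> carrier G \<Longrightarrow> v \<in> verts Q \<Longrightarrow> \<tau> h (vertex_elt v) = vertex_elt (sv h v)"
  using \<tau>_path_elt[of h "(v, [], v)"] by (simp add: vertex_elt_def spc_def sp_def)

lemma \<tau>_arrow: "h \<in> carrier G \<Longrightarrow> a \<in> arcs Q \<Longrightarrow> \<tau> h (arrow_elt Q a) = sc h a \<odot>\<^bsub>A\<^esub> arrow_elt Q (sa h a)"
  using \<tau>_path_elt[of h "(head Q a, [a], tail Q a)"] by (simp add: arrow_elt_def spc_def sp_def)

lemma sv_inj: "h \<in> carrier G \<Longrightarrow> u \<in> verts Q \<Longrightarrow> v \<in> verts Q \<Longrightarrow> sv h u = sv h v \<Longrightarrow> u = v"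
  using sv_mult[of "inv\<^bsub>G\<^esub> h" h u] sv_mult[of "inv\<^bsub>G\<^esub> h" h v] by simp

text \<open>The scalar attached to the cycle a p is the product of \<open>sc h a\<close> and the
  scalar of p. The latter is part of \<tau> applied to the derivative, so \<open>sc h a\<close>
  remains outside; rotating the cycle does not change its scalar.\<close>

lemma cyc_deriv_\<tau>:
  assumes h: "h \<in> carrier G" and a: "a \<in> arcs Q"
  shows "cyc_deriv Q (sa h a) (\<tau> h f) = sc h a \<odot>\<^bsub>A\<^esub> \<tau> h (cyc_deriv Q a f)"
proof (rule \<tau>_ext[OF h])
  fix p assume p: "p \<in> qpaths Q"
  let ?L = "p_arrs p"
  let ?N = "a # ?L"
  have L: "set ?L \<subseteq> arcs Q" using qpathD[OF p] by auto
  have "deriv_dom (sa h a) (sp h p) \<longleftrightarrow> p_tgt (sp h p) = sv h (tail Q a) \<and> p_src (sp h p) = sv h (head Q a)"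
    using h a p by (simp add: deriv_dom_def)
  also have "\<dots> \<longleftrightarrow> p_tgt p = tail Q a \<and> p_src p = head Q a"
    using sv_inj[OF h] qpathD[OF p] a by (auto simp: sp_def)
  finally have iff: "deriv_dom (sa h a) (sp h p) \<longleftrightarrow> deriv_dom a p"
    using p a by (simp add: deriv_dom_def)
  show "cyc_deriv Q (sa h a) (\<tau> h f) (sp h p) = (sc h a \<odot>\<^bsub>A\<^esub> \<tau> h (cyc_deriv Q a f)) (sp h p)"
  proof (cases "deriv_dom a p")
    case True
    have cyc: "cyc (rotate i ?N) \<in> qpaths Q" for i
      using deriv_dom_cyc[OF True] cyc_rotate[of ?N i] by (simp add: qcycles_def)
    have "\<tau> h f (cyc (rotate i (sa h a # map (sa h) ?L))) = sc h a * spc h ?L * f (cyc (rotate i ?N))" for i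
    proof -
      have "rotate i ?N \<noteq> []" "set (rotate i ?N) \<subseteq> arcs Q" using L a by auto
      then have "hd (rotate i ?N) \<in> arcs Q" "last (rotate i ?N) \<in> arcs Q" 
        by (meson hd_in_set last_in_set subsetD)+
      then have "cyc (map (sa h) (rotate i ?N)) = sp h (cyc (rotate i ?N))"
        using h \<open>rotate i ?N \<noteq> []\<close> by (simp add: cyc_def sp_def hd_map last_map del: rotate_is_Nil_conv)
      moreover have "rotate i (sa h a # map (sa h) ?L) = map (sa h) (rotate i ?N)"
        by (simp add: rotate_map[symmetric])
      ultimately show ?thesis
        using \<tau>_app[OF h cyc, of f i] by (simp add: spc_rotate) (simp add: spc_def)
    qed
    then have "cyc_deriv Q (sa h a) (\<tau> h f) (sp h p) = (\<Sum>i<Suc (p_len p). sc h a * spc h ?L * f (cyc (rotate i ?N)))"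
      unfolding cyc_deriv_app using True iff by (simp add: sp_def p_len_def[of p] del: sum.lessThan_Suc)
    then show ?thesis
      using True h p by (simp add: A_ops \<tau>_app cyc_deriv_app sum_distrib_left mult.assoc del: sum.lessThan_Suc)
  next
    case False
    then show ?thesis
      using h p iff by (simp add: A_ops \<tau>_app cyc_deriv_app)
  qed
qed (auto intro: \<tau>_closed A_closed)

lemma jacobian_ideal_ideal: "ideal (jacobian_ideal Q W) A"
  unfolding jacobian_ideal_def by (intro closure_ideal A.genideal_ideal) auto

lemma \<tau>_jacobian:
  assumes h: "h \<in> carrier G" and inv: "\<tau> h W \<ominus>\<^bsub>A\<^esub> W \<in> com_closure Q" and W: "W \<in> carrier A"
    and f: "f \<in> jacobian_ideal Q W"
  shows "\<tau> h f \<in> jacobian_ideal Q W"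
proof -
  define gens where "gens = {cyc_deriv Q a W | a. a \<in> arcs Q}"
  have gens: "gens \<subseteq> carrier A" by (auto simp: gens_def)
  interpret I: ideal "Idl\<^bsub>A\<^esub> gens" A by (rule A.genideal_ideal[OF gens])
  \<comment> \<open>The preimage of the ideal under \<open>\<tau> h\<close> is itself an ideal, so
    it suffices to find the generators in it.\<close>
  let ?J = "{x \<in> carrier A. \<tau> h x \<in> Idl\<^bsub>A\<^esub> gens}"
  have "gens \<subseteq> ?J"
  proof (clarsimp simp: gens_def)
    fix a assume a: "a \<in> arcs Q"
    \<comment> \<open>\<open>W\<close> and its translate differ by an element of the closed
      commutator space, hence have the same derivatives. Equivariance then turns a translated
      generator into a scalar multiple of another generator.\<close>
    have "cyc_deriv Q (sa h a) (\<tau> h W) \<ominus>\<^bsub>A\<^esub> cyc_deriv Q (sa h a) W = \<zero>\<^bsub>A\<^esub>"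
      using cyc_deriv_com_closure[OF inv] W by (simp add: cyc_deriv_minus \<tau>_closed)
    then have "cyc_deriv Q (sa h a) W = sc h a \<odot>\<^bsub>A\<^esub> \<tau> h (cyc_deriv Q a W)"
      using cyc_deriv_\<tau>[OF h a, of W] by (simp add: A.r_right_minus_eq \<tau>_closed A_closed)
    then have "\<tau> h (cyc_deriv Q a W) = (inverse (sc h a) \<odot>\<^bsub>A\<^esub> \<one>\<^bsub>A\<^esub>) \<otimes>\<^bsub>A\<^esub> cyc_deriv Q (sa h a) W"
      using h a by (simp add: A.smult_mult_left A.smult_assoc)
    moreover have "cyc_deriv Q (sa h a) W \<in> Idl\<^bsub>A\<^esub> gens"
      using A.genideal_self[OF gens] h a by (auto simp: gens_def)
    ultimately have "\<tau> h (cyc_deriv Q a W) \<in> Idl\<^bsub>A\<^esub> gens" using I.I_l_closed by simp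
    then show "\<tau> h (cyc_deriv Q a W) \<in> Idl\<^bsub>A\<^esub> {cyc_deriv Q a W |a. a \<in> arcs Q}" by (simp add: gens_def)
  qed
  moreover have "ideal ?J A"
  proof (rule idealI)
    show "subgroup ?J (add_monoid A)"
    proof (rule A.add.subgroupI)
      have "\<zero>\<^bsub>A\<^esub> \<in> ?J" using h additive_subgroup.zero_closed[OF I.additive_subgroup_axioms] by simp
      then show "?J \<noteq> {}" by blast
    next
      fix x assume x: "x \<in> ?J"
      have "\<tau> h (\<ominus>\<^bsub>A\<^esub> x) = \<ominus>\<^bsub>A\<^esub> \<tau> h x"
        using h x T.act_add[OF h, of "\<ominus>\<^bsub>A\<^esub> x" x] by (intro A.minus_equality[symmetric]) (auto simp: A.l_neg)
      then show "\<ominus>\<^bsub>A\<^esub> x \<in> ?J" using x I.a_inv_closed by simp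
    qed (use h in \<open>auto simp: T.act_add\<close>)
  qed (use h in \<open>auto simp: T.act_mult A.ring_axioms I.I_l_closed I.I_r_closed\<close>)
  ultimately have J: "Idl\<^bsub>A\<^esub> gens \<subseteq> ?J" by (intro A.genideal_minimal)
  \<comment> \<open>\<open>\<tau> h\<close> preserves the length of paths and thus congruence up to
    length m, so stability passes to the closure.\<close>
  have "\<exists>s\<in>Idl\<^bsub>A\<^esub> gens. agree m (\<tau> h f) s" for m
  proof -
    obtain s where s: "s \<in> Idl\<^bsub>A\<^esub> gens" "agree m f s"
      using f unfolding jacobian_ideal_def closure_iff gens_def[symmetric] by blast
    then have "agree m (\<tau> h f) (\<tau> h s)" using h by (simp add: agree_def \<tau>_def)
    moreover have "\<tau> h s \<in> Idl\<^bsub>A\<^esub> gens" using J s by blast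
    ultimately show ?thesis by blast
  qed
  then show ?thesis
    unfolding jacobian_ideal_def closure_iff gens_def[symmetric] by (simp add: \<tau>_closed)
qed

end

section \<open>The action on the Jacobian algebra\<close>

lemma (in kalg_act) kalg_act_cong:
  assumes "\<And>h x. h \<in> carrier G \<Longrightarrow> x \<in> carrier A \<Longrightarrow> \<rho>' h x = \<rho> h x"
  shows "kalg_act A G \<rho>'"
  by (intro_locales, unfold kalg_act_axioms_def)
    (simp add: assms fin act_add act_mult act_smult act_comp)

context cyclic_qp_action
begin

sublocale path_algebra Q "TYPE('k)"
  using quiver(1) by (simp add: path_algebra_def)

sublocale G: group G by (rule cyclic_group(1))

section \<open>The given action as a monomial action\<close>

lemma path_alg_carrier: "f \<in> carrier (path_alg Q) \<longleftrightarrow> f \<in> carrier A \<and> finite {p. f p \<noteq> 0}"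
  by (simp add: path_alg_def)

lemma path_alg_ops: "monoid.mult (path_alg Q) = monoid.mult A" "ring.add (path_alg Q) = ring.add A"
  "module.smult (path_alg Q) = module.smult A"
  by (simp_all add: path_alg_def)

lemma path_alg_smult: "f \<in> carrier (path_alg Q) \<Longrightarrow> c \<odot>\<^bsub>A\<^esub> f \<in> carrier (path_alg Q)"
  by (auto simp: path_alg_carrier A_closed A_ops intro: finite_subset[of _ "{p. f p \<noteq> 0}"])

lemma path_elt_path_alg [simp, intro]: "p \<in> qpaths Q \<Longrightarrow> (path_elt p :: ('v, 'a) qpath \<Rightarrow> 'k) \<in> carrier (path_alg Q)"
proof -
  have "{q. path_elt p q \<noteq> (0::'k)} = {p}" by (auto simp: path_elt_def)
  then show "p \<in> qpaths Q \<Longrightarrow> (path_elt p :: ('v, 'a) qpath \<Rightarrow> 'k) \<in> carrier (path_alg Q)" by (simp add: path_alg_carrier)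
qed

lemma elt_path_alg [simp, intro]:
  "v \<in> verts Q \<Longrightarrow> (vertex_elt v :: ('v, 'a) qpath \<Rightarrow> 'k) \<in> carrier (path_alg Q)"
  "a \<in> arcs Q \<Longrightarrow> (arrow_elt Q a :: ('v, 'a) qpath \<Rightarrow> 'k) \<in> carrier (path_alg Q)"
  by (auto simp: vertex_elt_def arrow_elt_def)

lemma \<rho>_group_action: "group_action G (carrier (path_alg Q)) \<rho>"
  using action by (simp add: algebra_action_def)

lemma \<rho>_hom:
  assumes "h \<in> carrier G"
  shows "f \<in> carrier (path_alg Q) \<Longrightarrow> \<rho> h f \<in> carrier (path_alg Q)"
    "f \<in> carrier (path_alg Q) \<Longrightarrow> f' \<in> carrier (path_alg Q) \<Longrightarrow> \<rho> h (f \<otimes>\<^bsub>A\<^esub> f') = \<rho> h f \<otimes>\<^bsub>A\<^esub> \<rho> h f'"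
    "f \<in> carrier (path_alg Q) \<Longrightarrow> f' \<in> carrier (path_alg Q) \<Longrightarrow> \<rho> h (f \<oplus>\<^bsub>A\<^esub> f') = \<rho> h f \<oplus>\<^bsub>A\<^esub> \<rho> h f'"
    "f \<in> carrier (path_alg Q) \<Longrightarrow> \<rho> h (c \<odot>\<^bsub>A\<^esub> f) = c \<odot>\<^bsub>A\<^esub> \<rho> h f"
proof -
  have hom: "\<rho> h \<in> ring_hom (path_alg Q) (path_alg Q)"
    and sm: "\<forall>c. \<forall>x\<in>carrier (path_alg Q). \<rho> h (c \<odot>\<^bsub>path_alg Q\<^esub> x) = c \<odot>\<^bsub>path_alg Q\<^esub> \<rho> h x"
    using action assms by (auto simp: algebra_action_def alg_iso_def ring_iso_def)
  show "f \<in> carrier (path_alg Q) \<Longrightarrow> \<rho> h f \<in> carrier (path_alg Q)"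
    "f \<in> carrier (path_alg Q) \<Longrightarrow> f' \<in> carrier (path_alg Q) \<Longrightarrow> \<rho> h (f \<otimes>\<^bsub>A\<^esub> f') = \<rho> h f \<otimes>\<^bsub>A\<^esub> \<rho> h f'"
    "f \<in> carrier (path_alg Q) \<Longrightarrow> f' \<in> carrier (path_alg Q) \<Longrightarrow> \<rho> h (f \<oplus>\<^bsub>A\<^esub> f') = \<rho> h f \<oplus>\<^bsub>A\<^esub> \<rho> h f'"
    using ring_hom_closed[OF hom] ring_hom_mult[OF hom] ring_hom_add[OF hom] by (simp_all add: path_alg_ops)
  show "f \<in> carrier (path_alg Q) \<Longrightarrow> \<rho> h (c \<odot>\<^bsub>A\<^esub> f) = c \<odot>\<^bsub>A\<^esub> \<rho> h f"
    using sm by (simp add: path_alg_ops)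
qed

lemma \<rho>_comp: "h \<in> carrier G \<Longrightarrow> h' \<in> carrier G \<Longrightarrow> f \<in> carrier (path_alg Q) \<Longrightarrow> \<rho> (h \<otimes>\<^bsub>G\<^esub> h') f = \<rho> h (\<rho> h' f)"
  using group_action.composition_rule[OF \<rho>_group_action] by blast

lemma \<rho>_one: "f \<in> carrier (path_alg Q) \<Longrightarrow> \<rho> \<one>\<^bsub>G\<^esub> f = f"
  using group_action.id_eq_one[OF \<rho>_group_action] by (metis restrict_apply')

lemma \<rho>_inj: "h \<in> carrier G \<Longrightarrow> f \<in> carrier (path_alg Q) \<Longrightarrow> f' \<in> carrier (path_alg Q) \<Longrightarrow> \<rho> h f = \<rho> h f' \<Longrightarrow> f = f'"
  using group_action.inj_prop[OF \<rho>_group_action] by (meson inj_onD)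

lemma path_elt_inj: "(path_elt p :: ('v, 'a) qpath \<Rightarrow> 'k) = path_elt q \<Longrightarrow> p = q"
  by (drule fun_cong[of _ _ p]) (simp add: path_elt_def split: if_splits)

lemma vertex_elt_inj: "(vertex_elt u :: ('v, 'a) qpath \<Rightarrow> 'k) = vertex_elt v \<Longrightarrow> u = v"
  using path_elt_inj by (auto simp: vertex_elt_def)

lemma smult_arrow_inj:
  assumes "c \<odot>\<^bsub>A\<^esub> arrow_elt Q a = c' \<odot>\<^bsub>A\<^esub> arrow_elt Q b" "c \<noteq> 0" shows "a = b \<and> c = c'"
  using fun_cong[OF assms(1), of "(head Q a, [a], tail Q a)"] assms(2)
  by (auto simp: A_ops arrow_elt_def path_elt_def split: if_splits)

abbreviation sv where "sv \<equiv> act_v Q \<rho>"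
abbreviation sa where "sa \<equiv> act_a Q \<rho>"
abbreviation sc where "sc \<equiv> act_c Q \<rho>"

lemma act_v:
  assumes "h \<in> carrier G" "v \<in> verts Q"
  shows "sv h v \<in> verts Q" "\<rho> h (vertex_elt v) = vertex_elt (sv h v)"
proof -
  have "\<exists>!w. w \<in> verts Q \<and> \<rho> h (vertex_elt v) = vertex_elt w"
    using A2(1)[OF assms] vertex_elt_inj by metis
  from theI'[OF this] show "sv h v \<in> verts Q" "\<rho> h (vertex_elt v) = vertex_elt (sv h v)"
    by (simp_all add: act_v_def)
qed

lemma act_v_eqI:
  assumes "h \<in> carrier G" "v \<in> verts Q" "\<rho> h (vertex_elt v) = vertex_elt w" shows "sv h v = w"
  using act_v[OF assms(1,2)] assms(3) vertex_elt_inj by metis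

lemma \<rho>_zero:
  assumes h: "h \<in> carrier G" shows "\<rho> h \<zero>\<^bsub>A\<^esub> = \<zero>\<^bsub>A\<^esub>"
proof -
  have z: "\<zero>\<^bsub>A\<^esub> \<in> carrier (path_alg Q)" by (simp add: path_alg_carrier A_ops)
  then have "\<rho> h \<zero>\<^bsub>A\<^esub> \<in> carrier A" using \<rho>_hom(1)[OF h] path_alg_carrier by blast
  then show ?thesis using \<rho>_hom(4)[OF h z, of 0] by simp
qed

lemma smult_arrow_nonzero:
  assumes "c \<noteq> 0" shows "c \<odot>\<^bsub>A\<^esub> arrow_elt Q a \<noteq> \<zero>\<^bsub>A\<^esub>"
proof
  assume "c \<odot>\<^bsub>A\<^esub> arrow_elt Q a = \<zero>\<^bsub>A\<^esub>"
  from fun_cong[OF this, of "(head Q a, [a], tail Q a)"] assms show False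
    by (simp add: A_ops arrow_elt_def path_elt_def)
qed

lemma \<rho>_arrow_nonzero:
  assumes h: "h \<in> carrier G" and a: "a \<in> arcs Q" and eq: "\<rho> h (arrow_elt Q a) = c \<odot>\<^bsub>A\<^esub> arrow_elt Q b"
    and b: "b \<in> arcs Q"
  shows "c \<noteq> 0"
proof
  assume "c = 0"
  then have "\<rho> h (arrow_elt Q a) = \<rho> h \<zero>\<^bsub>A\<^esub>"
    using eq b h by (simp add: \<rho>_zero)
  moreover have "\<zero>\<^bsub>A\<^esub> \<in> carrier (path_alg Q)" by (simp add: path_alg_carrier A_ops)
  ultimately have "arrow_elt Q a = \<zero>\<^bsub>A\<^esub>"
    using \<rho>_inj[OF h elt_path_alg(2)[OF a]] by blast
  then show False using smult_arrow_nonzero[of 1 a] a by simp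
qed

text \<open>The definite descriptions in \<open>act_a\<close> and \<open>act_c\<close> have unique
  solutions only because the scalar is nonzero: a zero scalar would fit every arrow. It is nonzero
  since the group acts by injective maps.\<close>

lemma act_a_ex:
  assumes h: "h \<in> carrier G" and a: "a \<in> arcs Q"
  shows "sa h a \<in> arcs Q \<and> \<rho> h (arrow_elt Q a) = sc h a \<odot>\<^bsub>A\<^esub> arrow_elt Q (sa h a) \<and> sc h a \<noteq> 0"
proof -
  obtain b c where b: "b \<in> arcs Q" "\<rho> h (arrow_elt Q a) = c \<odot>\<^bsub>A\<^esub> arrow_elt Q b"
    using A2(2)[OF assms] by (auto simp: path_alg_ops)
  have c: "c \<noteq> 0" using \<rho>_arrow_nonzero[OF h a b(2,1)] .
  have sa: "sa h a = b"
    unfolding act_a_def path_alg_ops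
  proof (rule the_equality)
    fix b' assume "b' \<in> arcs Q \<and> (\<exists>c. \<rho> h (arrow_elt Q a) = c \<odot>\<^bsub>A\<^esub> arrow_elt Q b')"
    then obtain c' where "c \<odot>\<^bsub>A\<^esub> arrow_elt Q b = c' \<odot>\<^bsub>A\<^esub> arrow_elt Q b'" using b(2) by metis
    from smult_arrow_inj[OF this c] show "b' = b" by simp
  qed (use b in blast)
  have "sc h a = c"
    unfolding act_c_def path_alg_ops sa
  proof (rule the_equality)
    fix c' assume "\<rho> h (arrow_elt Q a) = c' \<odot>\<^bsub>A\<^esub> arrow_elt Q b"
    then have "c \<odot>\<^bsub>A\<^esub> arrow_elt Q b = c' \<odot>\<^bsub>A\<^esub> arrow_elt Q b" using b(2) by metis
    from smult_arrow_inj[OF this c] show "c' = c" by simp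
  qed (use b in blast)
  with b c sa show ?thesis by simp
qed

lemma act_a:
  assumes "h \<in> carrier G" "a \<in> arcs Q"
  shows "sa h a \<in> arcs Q" "\<rho> h (arrow_elt Q a) = sc h a \<odot>\<^bsub>A\<^esub> arrow_elt Q (sa h a)" "sc h a \<noteq> 0"
  using act_a_ex[OF assms] by simp_all

lemma act_a_eqI:
  assumes "h \<in> carrier G" "a \<in> arcs Q" "\<rho> h (arrow_elt Q a) = c \<odot>\<^bsub>A\<^esub> arrow_elt Q b"
  shows "sa h a = b" "sc h a = c"
proof -
  have "sc h a \<odot>\<^bsub>A\<^esub> arrow_elt Q (sa h a) = c \<odot>\<^bsub>A\<^esub> arrow_elt Q b" using act_a(2)[OF assms(1,2)] assms(3) by simp
  from smult_arrow_inj[OF this act_a(3)[OF assms(1,2)]] show "sa h a = b" "sc h a = c" by simp_all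
qed

text \<open>Apply the action to the identities saying that an arrow is fixed by the idempotents of
  its ends. A wrong end would make the product zero, but the image is nonzero.\<close>

lemma act_a_ends:
  assumes h: "h \<in> carrier G" and a: "a \<in> arcs Q"
  shows "tail Q (sa h a) = sv h (tail Q a)" "head Q (sa h a) = sv h (head Q a)"
proof -
  note aa = act_a[OF h a]
  have nz: "sc h a \<odot>\<^bsub>A\<^esub> arrow_elt Q (sa h a) \<noteq> \<zero>\<^bsub>A\<^esub>" by (rule smult_arrow_nonzero[OF aa(3)])
  have "\<rho> h (vertex_elt (head Q a) \<otimes>\<^bsub>A\<^esub> arrow_elt Q a) = \<rho> h (arrow_elt Q a)"
    using a by (simp add: vertex_arrow_mult)
  then have "vertex_elt (sv h (head Q a)) \<otimes>\<^bsub>A\<^esub> (sc h a \<odot>\<^bsub>A\<^esub> arrow_elt Q (sa h a)) = sc h a \<odot>\<^bsub>A\<^esub> arrow_elt Q (sa h a)"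
    using a h by (simp add: \<rho>_hom(2) act_v aa)
  then show "head Q (sa h a) = sv h (head Q a)"
    using a h nz aa act_v(1) by (auto simp: A.smult_mult_right vertex_arrow_mult split: if_splits)
  have "\<rho> h (arrow_elt Q a \<otimes>\<^bsub>A\<^esub> vertex_elt (tail Q a)) = \<rho> h (arrow_elt Q a)"
    using a by (simp add: vertex_arrow_mult)
  then have "(sc h a \<odot>\<^bsub>A\<^esub> arrow_elt Q (sa h a)) \<otimes>\<^bsub>A\<^esub> vertex_elt (sv h (tail Q a)) = sc h a \<odot>\<^bsub>A\<^esub> arrow_elt Q (sa h a)"
    using a h by (simp add: \<rho>_hom(2) act_v aa)
  then show "tail Q (sa h a) = sv h (tail Q a)"
    using a h nz aa act_v(1) by (auto simp: A.smult_mult_left vertex_arrow_mult split: if_splits)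
qed

lemma act_a_comp:
  assumes h: "h \<in> carrier G" "h' \<in> carrier G" and a: "a \<in> arcs Q"
  shows "sa (h \<otimes>\<^bsub>G\<^esub> h') a = sa h (sa h' a)" "sc (h \<otimes>\<^bsub>G\<^esub> h') a = sc h' a * sc h (sa h' a)"
proof -
  note aa = act_a[OF h(2) a]
  have "\<rho> (h \<otimes>\<^bsub>G\<^esub> h') (arrow_elt Q a) = (sc h' a * sc h (sa h' a)) \<odot>\<^bsub>A\<^esub> arrow_elt Q (sa h (sa h' a))"
    using h a aa by (simp add: \<rho>_comp \<rho>_hom(4) act_a(2)[OF h(1) aa(1)] A.smult_assoc act_a(1))
  then show "sa (h \<otimes>\<^bsub>G\<^esub> h') a = sa h (sa h' a)" "sc (h \<otimes>\<^bsub>G\<^esub> h') a = sc h' a * sc h (sa h' a)"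
    using h a by (auto intro: act_a_eqI)
qed

sublocale monomial_action Q "TYPE('k)" G sv sa sc
proof unfold_locales
  show "finite (carrier G)" by (rule cyclic_group(2))
  show "sv \<one>\<^bsub>G\<^esub> v = v" if "v \<in> verts Q" for v using that by (intro act_v_eqI) (simp_all add: \<rho>_one)
  show "sa \<one>\<^bsub>G\<^esub> a = a" "sc \<one>\<^bsub>G\<^esub> a = 1" if "a \<in> arcs Q" for a
    using that act_a_eqI[of "\<one>\<^bsub>G\<^esub>" a 1 a] by (simp_all add: \<rho>_one)
  show "sv (h \<otimes>\<^bsub>G\<^esub> h') v = sv h (sv h' v)" if "h \<in> carrier G" "h' \<in> carrier G" "v \<in> verts Q" for h h' v
    using that act_v(2)[of h' v] act_v(2)[of h "sv h' v"] act_v(1)[of h' v]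
    by (intro act_v_eqI) (simp_all add: \<rho>_comp)
qed (simp_all add: act_v act_a act_a_ends act_a_comp)

lemma \<rho>_path_elt:
  assumes h: "h \<in> carrier G" and p: "p \<in> qpaths Q"
  shows "\<rho> h (path_elt p) = \<tau> h (path_elt p)"
proof -
  have "\<rho> h (path_elt (v, L, w)) = \<tau> h (path_elt (v, L, w))" if "(v, L, w) \<in> qpaths Q" for v L w
    using that
  proof (induction L arbitrary: v)
    case Nil
    then have v: "v \<in> verts Q" "w = v" by auto
    then show ?case using act_v(2)[OF h v(1)] \<tau>_vertex[OF h v(1)] by (simp add: vertex_elt_def)
  next
    case (Cons a L)
    then have a: "a \<in> arcs Q" "v = head Q a" and L: "(tail Q a, L, w) \<in> qpaths Q" by auto
    have eq: "path_elt (v, a # L, w) = arrow_elt Q a \<otimes>\<^bsub>A\<^esub> path_elt (tail Q a, L, w)"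
      using path_elt_mult[OF arrow_qpath[OF a(1)] L] a by (simp add: arrow_elt_def)
    show ?case
      unfolding eq using Cons.IH[OF L] a L h by (simp add: \<rho>_hom(2) T.act_mult act_a \<tau>_arrow)
  qed
  then show ?thesis using p by (cases p) simp
qed

text \<open>Both are linear and multiplicative and agree on vertices and arrows; the induction
  strips one path at a time off a finite support.\<close>

lemma \<rho>_eq_\<tau>:
  assumes h: "h \<in> carrier G" and f: "f \<in> carrier (path_alg Q)"
  shows "\<rho> h f = \<tau> h f"
proof -
  have "\<rho> h f = \<tau> h f" if "finite Y" "Y \<subseteq> qpaths Q" "{p. f p \<noteq> 0} \<subseteq> Y" for Y f
    using that
  proof (induction Y arbitrary: f rule: finite_induct)
    case empty
    then have f0: "f = \<zero>\<^bsub>A\<^esub>" by (auto simp: A_ops fun_eq_iff)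
    show ?case using h by (simp add: f0 \<rho>_zero)
  next
    case (insert p Y)
    define f' where "f' = f(p := 0)"
    have f': "{q. f' q \<noteq> 0} \<subseteq> Y" using insert.prems by (auto simp: f'_def)
    have p: "p \<in> qpaths Q" using insert.prems by simp
    have "f' \<in> carrier A" using f' insert.prems by (auto simp: A_carrier)
    moreover have "finite {q. f' q \<noteq> 0}" using f' insert.hyps(1) by (rule finite_subset)
    ultimately have c: "f' \<in> carrier (path_alg Q)" "f' \<in> carrier A" by (simp_all add: path_alg_carrier)
    have eq: "f = f' \<oplus>\<^bsub>A\<^esub> f p \<odot>\<^bsub>A\<^esub> path_elt p" by (auto simp: A_ops path_elt_def fun_eq_iff f'_def)
    have IH: "\<rho> h f' = \<tau> h f'" using insert.prems f' by (intro insert.IH) auto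
    have "\<rho> h f = \<rho> h f' \<oplus>\<^bsub>A\<^esub> f p \<odot>\<^bsub>A\<^esub> \<rho> h (path_elt p)"
      using c h p by (subst eq) (simp add: \<rho>_hom path_alg_smult)
    also have "\<dots> = \<tau> h f' \<oplus>\<^bsub>A\<^esub> f p \<odot>\<^bsub>A\<^esub> \<tau> h (path_elt p)"
      by (simp only: IH \<rho>_path_elt[OF h p])
    also have "\<dots> = \<tau> h (f' \<oplus>\<^bsub>A\<^esub> f p \<odot>\<^bsub>A\<^esub> path_elt p)"
      using c h p by (simp add: T.act_add T.act_smult A_closed)
    also note eq[symmetric]
    finally show ?case .
  qed
  from this[of "{p. f p \<noteq> 0}" f] f show ?thesis by (auto simp: path_alg_carrier A_carrier)
qed

text \<open>Makes the truncations in \<open>completed_action\<close> finite sums of paths, to which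
  the original action applies.\<close>

lemma finite_short_paths: "finite {p \<in> qpaths Q. p_len p \<le> m}"
proof (rule finite_subset)
  show "{p \<in> qpaths Q. p_len p \<le> m} \<subseteq> verts Q \<times> {L. set L \<subseteq> arcs Q \<and> length L \<le> m} \<times> verts Q"
    using qpath_src by auto
  show "finite (verts Q \<times> {L. set L \<subseteq> arcs Q \<and> length L \<le> m} \<times> verts Q)"
    by (intro finite_cartesian_product finite_lists_length_le) auto
qed

lemma completed_action_eq:
  assumes h: "h \<in> carrier G" and f: "f \<in> carrier A"
  shows "completed_action Q \<rho> h f = \<tau> h f"
proof
  fix q :: "('v, 'a) qpath"
  let ?f = "\<lambda>p. if p_len p \<le> p_len q then f p else 0"
  have "{p. ?f p \<noteq> 0} \<subseteq> {p \<in> qpaths Q. p_len p \<le> p_len q}"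
    using f by (auto simp: A_carrier split: if_splits)
  then have "finite {p. ?f p \<noteq> 0}" using finite_short_paths by (rule finite_subset)
  moreover have "?f \<in> carrier A" using f by (simp add: A_carrier)
  ultimately have "?f \<in> carrier (path_alg Q)" unfolding path_alg_carrier by blast
  then have "completed_action Q \<rho> h f q = \<tau> h ?f q"
    using f h by (simp add: completed_action_def \<rho>_eq_\<tau>)
  \<comment> \<open>The coefficient of \<open>\<tau> h f\<close> at \<open>q\<close> involves only a
    path of the same length as \<open>q\<close>, so the truncation is invisible there.\<close>
  then show "completed_action Q \<rho> h f q = \<tau> h f q" by (simp add: \<tau>_def)
qed

section \<open>Passage to the Jacobian algebra\<close>

sublocale J: kalg_quot A "jacobian_ideal Q W"
  by (simp add: kalg_quot_def A.kalg_axioms jacobian_ideal_ideal)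

abbreviation \<Lambda> where "\<Lambda> \<equiv> jacobian_alg Q W"
abbreviation \<rho>\<Lambda> where "\<rho>\<Lambda> \<equiv> jacobian_action Q W \<rho>"

lemma J_alg: "quot_alg A (jacobian_ideal Q W) = \<Lambda>"
  by (simp add: jacobian_alg_def)

lemma W_carrier: "W \<in> carrier (path_alg Q)"
  using potential by (auto simp: finite_potential_def path_alg_carrier A_carrier qcycles_def)

lemma \<tau>_preserves:
  assumes "h \<in> carrier G" "f \<in> jacobian_ideal Q W" shows "\<tau> h f \<in> jacobian_ideal Q W"
  using \<tau>_jacobian[OF assms(1) _ _ assms(2)] A4[OF assms(1)] W_carrier
  by (simp add: \<rho>_eq_\<tau>[OF assms(1)] path_alg_carrier)

lemma jacobian_action_app:
  assumes "h \<in> carrier G" "f \<in> carrier A"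
  shows "\<rho>\<Lambda> h (J.\<pi> f) = J.\<pi> (\<tau> h f)"
proof -
  have "J.\<pi> f \<subseteq> carrier A" using assms(2) by (rule A.a_r_coset_subset_G[OF J.I.a_subset])
  then have "completed_action Q \<rho> h ` J.\<pi> f = \<tau> h ` J.\<pi> f"
    using completed_action_eq[OF assms(1)] by (intro image_cong) auto
  moreover have "J.\<pi> f \<in> carrier \<Lambda>" using J.\<pi>_closed[OF assms(2)] by (simp add: J_alg)
  ultimately have "\<rho>\<Lambda> h (J.\<pi> f) = J.quot_act \<tau> h (J.\<pi> f)"
    using assms by (simp add: jacobian_action_def J.quot_act_def J_alg)
  then show ?thesis
    using J.quot_act_app[OF \<tau>_kalg_act \<tau>_preserves assms] by simp
qed

lemma \<rho>\<Lambda>_kalg_act: "kalg_act \<Lambda> G \<rho>\<Lambda>"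
proof -
  interpret q: kalg_act \<Lambda> G "J.quot_act \<tau>"
    using J.quot_kalg_act[OF \<tau>_kalg_act \<tau>_preserves] by (simp add: J_alg)
  show ?thesis
  proof (rule q.kalg_act_cong)
    fix h x assume "h \<in> carrier G" "x \<in> carrier \<Lambda>"
    then show "\<rho>\<Lambda> h x = J.quot_act \<tau> h x"
      by (auto elim!: J.quot_cases[unfolded J_alg]
          simp: jacobian_action_app J.quot_act_app[OF \<tau>_kalg_act \<tau>_preserves])
  qed
qed

sublocale L: kalg_act \<Lambda> G \<rho>\<Lambda> by (rule \<rho>\<Lambda>_kalg_act)

abbreviation rv where "rv v \<equiv> jac_class Q W (vertex_elt v)"
abbreviation ra where "ra a \<equiv> jac_class Q W (arrow_elt Q a)"

lemmas J_hom = J.\<pi>_hom[unfolded J_alg] J.\<pi>_smult[unfolded J_alg] J.\<pi>_zero[unfolded J_alg]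

lemma rv_closed [simp, intro]: "v \<in> verts Q \<Longrightarrow> rv v \<in> carrier \<Lambda>"
  and ra_closed [simp, intro]: "a \<in> arcs Q \<Longrightarrow> ra a \<in> carrier \<Lambda>"
  by (simp_all add: jac_class_def J.\<pi>_closed[unfolded J_alg])

lemma rv_mult: "u \<in> verts Q \<Longrightarrow> v \<in> verts Q \<Longrightarrow>
    rv u \<otimes>\<^bsub>\<Lambda>\<^esub> rv v = (if u = v then rv u else \<zero>\<^bsub>\<Lambda>\<^esub>)"
  by (simp add: jac_class_def vertex_elt_mult J_hom flip: J_hom(1))

lemma rv_ra_mult: "u \<in> verts Q \<Longrightarrow> a \<in> arcs Q \<Longrightarrow>
    rv u \<otimes>\<^bsub>\<Lambda>\<^esub> ra a = (if u = head Q a then ra a else \<zero>\<^bsub>\<Lambda>\<^esub>)"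
  "u \<in> verts Q \<Longrightarrow> a \<in> arcs Q \<Longrightarrow>
    ra a \<otimes>\<^bsub>\<Lambda>\<^esub> rv u = (if u = tail Q a then ra a else \<zero>\<^bsub>\<Lambda>\<^esub>)"
  by (simp_all add: jac_class_def vertex_arrow_mult J_hom flip: J_hom(1))

lemma \<rho>\<Lambda>_rv: "h \<in> carrier G \<Longrightarrow> v \<in> verts Q \<Longrightarrow> \<rho>\<Lambda> h (rv v) = rv (sv h v)"
  by (simp add: jac_class_def jacobian_action_app \<tau>_vertex)

lemma \<rho>\<Lambda>_ra: "h \<in> carrier G \<Longrightarrow> a \<in> arcs Q \<Longrightarrow> \<rho>\<Lambda> h (ra a) = sc h a \<odot>\<^bsub>\<Lambda>\<^esub> ra (sa h a)"
  by (simp add: jac_class_def jacobian_action_app \<tau>_arrow J_hom)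

lemma sum_rv: "(\<Oplus>\<^bsub>\<Lambda>\<^esub>v\<in>verts Q. rv v) = \<one>\<^bsub>\<Lambda>\<^esub>"
  using J.\<pi>_finsum[of "verts Q" vertex_elt] by (simp add: jac_class_def J_alg sum_vertex_elt J_hom)

section \<open>Idempotents attached to sets of vertices\<close>

definition vsum :: "'v set \<Rightarrow> (('v, 'a) qpath \<Rightarrow> 'k) set" where
  "vsum U = (\<Oplus>\<^bsub>\<Lambda>\<^esub>v\<in>U. rv v)"

lemma vsum_closed [simp, intro]: "U \<subseteq> verts Q \<Longrightarrow> vsum U \<in> carrier \<Lambda>"
  by (auto simp: vsum_def intro!: L.finsum_closed)

lemma vsum_empty [simp]: "vsum {} = \<zero>\<^bsub>\<Lambda>\<^esub>"
  by (simp add: vsum_def)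

lemma vsum_mult_left:
  assumes U: "U \<subseteq> verts Q" and x: "x \<in> carrier \<Lambda>" and v: "v \<in> verts Q"
    and orth: "\<And>u. u \<in> verts Q \<Longrightarrow> rv u \<otimes>\<^bsub>\<Lambda>\<^esub> x = (if u = v then x else \<zero>\<^bsub>\<Lambda>\<^esub>)"
  shows "vsum U \<otimes>\<^bsub>\<Lambda>\<^esub> x = (if v \<in> U then x else \<zero>\<^bsub>\<Lambda>\<^esub>)"
proof -
  have fin: "finite U" using U by (rule finite_subset) simp
  have "vsum U \<otimes>\<^bsub>\<Lambda>\<^esub> x = (\<Oplus>\<^bsub>\<Lambda>\<^esub>u\<in>U. rv u \<otimes>\<^bsub>\<Lambda>\<^esub> x)"
    unfolding vsum_def using U x fin by (intro L.finsum_ldistr) auto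
  also have "\<dots> = (\<Oplus>\<^bsub>\<Lambda>\<^esub>u\<in>U. if u = v then x else \<zero>\<^bsub>\<Lambda>\<^esub>)"
    using U x orth by (intro L.finsum_cong'[OF refl]) auto
  also have "\<dots> = (if v \<in> U then x else \<zero>\<^bsub>\<Lambda>\<^esub>)"
  proof (cases "v \<in> U")
    case True
    then show ?thesis using L.finsum_delta[OF fin, of v "\<lambda>_. x"] x by simp
  next
    case False
    then have "(\<Oplus>\<^bsub>\<Lambda>\<^esub>u\<in>U. if u = v then x else \<zero>\<^bsub>\<Lambda>\<^esub>) = (\<Oplus>\<^bsub>\<Lambda>\<^esub>u\<in>U. \<zero>\<^bsub>\<Lambda>\<^esub>)"
      by (intro L.finsum_cong'[OF refl]) auto
    then show ?thesis using False by simp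
  qed
  finally show ?thesis .
qed

lemma vsum_mult_right:
  assumes U: "U \<subseteq> verts Q" and x: "x \<in> carrier \<Lambda>" and v: "v \<in> verts Q"
    and orth: "\<And>u. u \<in> verts Q \<Longrightarrow> x \<otimes>\<^bsub>\<Lambda>\<^esub> rv u = (if u = v then x else \<zero>\<^bsub>\<Lambda>\<^esub>)"
  shows "x \<otimes>\<^bsub>\<Lambda>\<^esub> vsum U = (if v \<in> U then x else \<zero>\<^bsub>\<Lambda>\<^esub>)"
proof -
  have fin: "finite U" using U by (rule finite_subset) simp
  have "x \<otimes>\<^bsub>\<Lambda>\<^esub> vsum U = (\<Oplus>\<^bsub>\<Lambda>\<^esub>u\<in>U. x \<otimes>\<^bsub>\<Lambda>\<^esub> rv u)"
    unfolding vsum_def using U x fin by (intro L.finsum_rdistr) auto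
  also have "\<dots> = (\<Oplus>\<^bsub>\<Lambda>\<^esub>u\<in>U. if u = v then x else \<zero>\<^bsub>\<Lambda>\<^esub>)"
    using U x orth by (intro L.finsum_cong'[OF refl]) auto
  also have "\<dots> = (if v \<in> U then x else \<zero>\<^bsub>\<Lambda>\<^esub>)"
  proof (cases "v \<in> U")
    case True
    then show ?thesis using L.finsum_delta[OF fin, of v "\<lambda>_. x"] x by simp
  next
    case False
    then have "(\<Oplus>\<^bsub>\<Lambda>\<^esub>u\<in>U. if u = v then x else \<zero>\<^bsub>\<Lambda>\<^esub>) = (\<Oplus>\<^bsub>\<Lambda>\<^esub>u\<in>U. \<zero>\<^bsub>\<Lambda>\<^esub>)"
      by (intro L.finsum_cong'[OF refl]) auto
    then show ?thesis using False by simp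
  qed
  finally show ?thesis .
qed

lemma vsum_rv:
  assumes "U \<subseteq> verts Q" "v \<in> verts Q"
  shows "vsum U \<otimes>\<^bsub>\<Lambda>\<^esub> rv v = (if v \<in> U then rv v else \<zero>\<^bsub>\<Lambda>\<^esub>)"
    "rv v \<otimes>\<^bsub>\<Lambda>\<^esub> vsum U = (if v \<in> U then rv v else \<zero>\<^bsub>\<Lambda>\<^esub>)"
  by (rule vsum_mult_left vsum_mult_right; use assms in \<open>simp add: rv_mult split: if_split\<close>)+

lemma vsum_ra:
  assumes "U \<subseteq> verts Q" "a \<in> arcs Q"
  shows "vsum U \<otimes>\<^bsub>\<Lambda>\<^esub> ra a = (if head Q a \<in> U then ra a else \<zero>\<^bsub>\<Lambda>\<^esub>)"
    "ra a \<otimes>\<^bsub>\<Lambda>\<^esub> vsum U = (if tail Q a \<in> U then ra a else \<zero>\<^bsub>\<Lambda>\<^esub>)"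
  by (rule vsum_mult_left vsum_mult_right; use assms in \<open>simp add: rv_ra_mult\<close>)+

lemma vsum_mult:
  assumes "U \<subseteq> verts Q" "V \<subseteq> verts Q"
  shows "vsum U \<otimes>\<^bsub>\<Lambda>\<^esub> vsum V = vsum (U \<inter> V)"
proof -
  have fin: "finite V" using assms(2) by (rule finite_subset) simp
  have "vsum U \<otimes>\<^bsub>\<Lambda>\<^esub> vsum V = (\<Oplus>\<^bsub>\<Lambda>\<^esub>v\<in>V. vsum U \<otimes>\<^bsub>\<Lambda>\<^esub> rv v)"
    unfolding vsum_def[of V] using assms fin by (intro L.finsum_rdistr) auto
  also have "\<dots> = (\<Oplus>\<^bsub>\<Lambda>\<^esub>v\<in>U \<inter> V. rv v)"
    using assms fin by (intro L.add.finprod_mono_neutral_cong_right[simplified]) (auto simp: vsum_rv)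
  finally show ?thesis by (simp add: vsum_def)
qed

lemma vsum_Un: "U \<subseteq> verts Q \<Longrightarrow> V \<subseteq> verts Q \<Longrightarrow> U \<inter> V = {} \<Longrightarrow> vsum (U \<union> V) = vsum U \<oplus>\<^bsub>\<Lambda>\<^esub> vsum V"
  unfolding vsum_def by (intro L.finsum_Un_disjoint) (auto intro: finite_subset)

lemma \<rho>\<Lambda>_vsum:
  assumes "h \<in> carrier G" "U \<subseteq> verts Q"
  shows "\<rho>\<Lambda> h (vsum U) = vsum (sv h ` U)"
proof -
  have "\<rho>\<Lambda> h (vsum U) = (\<Oplus>\<^bsub>\<Lambda>\<^esub>v\<in>U. \<rho>\<Lambda> h (rv v))"
    unfolding vsum_def using assms by (intro L.act_finsum) auto
  also have "\<dots> = (\<Oplus>\<^bsub>\<Lambda>\<^esub>v\<in>U. rv (sv h v))"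
    using assms by (intro L.finsum_cong'[OF refl]) (simp_all add: \<rho>\<Lambda>_rv subset_iff Pi_def)
  also have "\<dots> = vsum (sv h ` U)"
    unfolding vsum_def using assms sv_inj[OF assms(1)]
    by (intro L.finsum_reindex[symmetric]) (auto simp: inj_on_def)
  finally show ?thesis .
qed

end

section \<open>Idempotents of the group algebras as operators\<close>

context cyclic_char
begin

text \<open>The coefficients of e_\<mu> form the character \<chi>^\<mu> up to 1/n, so
  multiplicativity of characters becomes available for them.\<close>

lemma grp_idem_app:
  assumes "h \<in> carrier G"
  shows "grp_idem G g n \<zeta> \<mu> h = inverse (of_nat n) * (\<chi> [^]\<^bsub>Gd\<^esub> \<mu>) h"
proof -
  obtain k where k: "k < n" "h = g [^] k" using assms by (rule g_pow_exhaust)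
  have "(\<Sum>i<n. \<zeta> ^ (i * \<mu>) * grp_elt (g [^] i) h) = (\<Sum>i<n. if i = k then \<zeta> ^ (i * \<mu>) else 0)"
    using k g_pow_eq_iff by (intro sum.cong) (auto simp: grp_elt_def)
  then show ?thesis using k by (simp add: grp_idem_def dual_gen_pow_app)
qed

lemma grp_idem_dual_app:
  assumes "j < n"
  shows "grp_idem Gd \<chi> n \<zeta> \<nu> (\<chi> [^]\<^bsub>Gd\<^esub> j) = inverse (of_nat n) * \<zeta> ^ (j * \<nu>)"
proof -
  have "(\<Sum>i<n. \<zeta> ^ (i * \<nu>) * grp_elt (\<chi> [^]\<^bsub>Gd\<^esub> i) (\<chi> [^]\<^bsub>Gd\<^esub> j)) = (\<Sum>i<n. if i = j then \<zeta> ^ (i * \<nu>) else 0)"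
    using assms dual_gen_bij by (intro sum.cong) (auto simp: grp_elt_def bij_betw_def inj_on_def)
  then show ?thesis using assms by (simp add: grp_idem_def)
qed

text \<open>In the operator picture a character scales the component of degree h by its value there.
  So the idempotent of the dual group with index \<nu> is the projection to degree g^-\<nu>.\<close>

lemma sum_grp_idem_dual:
  assumes "h \<in> carrier G"
  shows "(\<Sum>\<psi>\<in>carrier Gd. grp_idem Gd \<chi> n \<zeta> \<nu> \<psi> * \<psi> h) = (if h = inv (g [^] \<nu>) then 1 else 0)"
proof -
  obtain m where m: "m < n" "h = g [^] m" using assms by (rule g_pow_exhaust)
  have "(\<Sum>\<psi>\<in>carrier Gd. grp_idem Gd \<chi> n \<zeta> \<nu> \<psi> * \<psi> h) = (\<Sum>j<n. inverse (of_nat n) * (\<zeta> ^ (\<nu> + m)) ^ j)"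
    unfolding sum_dual
    by (intro sum.cong)
      (auto simp: grp_idem_dual_app m dual_gen_pow_app power_add power_mult_distrib mult.commute simp flip: power_mult)
  also have "\<dots> = inverse (of_nat n) * (if \<zeta> ^ (\<nu> + m) = 1 then of_nat n else 0)"
    by (subst sum_powers_root[symmetric]) (simp_all add: sum_distrib_left, metis \<zeta>_n mult.commute power_mult power_one)
  also have "\<zeta> ^ (\<nu> + m) = 1 \<longleftrightarrow> h = inv (g [^] \<nu>)"
  proof -
    have "\<zeta> ^ (\<nu> + m) = 1 \<longleftrightarrow> g [^] (\<nu> + m) = \<one>"
      using \<zeta>_pow_eq_iff[of "\<nu> + m" 0] g_pow_eq_iff[of "\<nu> + m" 0] by simp
    also have "\<dots> \<longleftrightarrow> h \<otimes> g [^] \<nu> = \<one>" by (simp add: m G.nat_pow_mult add.commute)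
    also have "\<dots> \<longleftrightarrow> h = inv (g [^] \<nu>)" using assms G.inv_equality[of h "g [^] \<nu>"] by auto
    finally show ?thesis .
  qed
  finally show ?thesis by simp
qed

end

context skew_duality
begin

lemma restrict_closed: "(\<And>h. h \<in> carrier G \<Longrightarrow> k h \<in> carrier A) \<Longrightarrow> (\<lambda>h\<in>carrier G. k h) \<in> carrier S"
  by (simp add: skew_carrier)

text \<open>An element of the dual group algebra acts diagonally on the components of degree h,
  through its Fourier transform; \<open>a\<close> then multiplies the result.\<close>

lemma T_tensor:
  assumes [simp]: "a \<in> carrier S" "z \<in> carrier S"
  shows "T (skew_tensor \<Gamma> Gd a u) z = a \<otimes>\<^bsub>S\<^esub> (\<lambda>h\<in>carrier G. (\<Sum>\<psi>\<in>carrier Gd. u \<psi> * \<psi> h) \<odot> z h)"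
proof -
  have "T (skew_tensor \<Gamma> Gd a u) z = (\<Oplus>\<^bsub>S\<^esub>\<psi>\<in>carrier Gd. a \<otimes>\<^bsub>S\<^esub> (u \<psi> \<odot>\<^bsub>S\<^esub> \<delta> \<psi> z))"
    unfolding T_def
    by (rule S.finsum_cong'[OF refl]) (auto simp: R.skew_tensor_app S.smult_mult_left S.smult_mult_right)
  also have "\<dots> = a \<otimes>\<^bsub>S\<^esub> (\<Oplus>\<^bsub>S\<^esub>\<psi>\<in>carrier Gd. u \<psi> \<odot>\<^bsub>S\<^esub> \<delta> \<psi> z)"
    by (rule S.finsum_rdistr[symmetric]) (auto simp: finite_dual)
  also have "(\<Oplus>\<^bsub>S\<^esub>\<psi>\<in>carrier Gd. u \<psi> \<odot>\<^bsub>S\<^esub> \<delta> \<psi> z) = (\<lambda>h\<in>carrier G. (\<Sum>\<psi>\<in>carrier Gd. u \<psi> * \<psi> h) \<odot> z h)"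
  proof (rule skew_ext)
    fix h assume h: "h \<in> carrier G"
    have "(\<Oplus>\<^bsub>S\<^esub>\<psi>\<in>carrier Gd. u \<psi> \<odot>\<^bsub>S\<^esub> \<delta> \<psi> z) h = (\<Oplus>\<psi>\<in>carrier Gd. (u \<psi> \<odot>\<^bsub>S\<^esub> \<delta> \<psi> z) h)"
      using h by (intro skew_finsum_app) auto
    also have "\<dots> = (\<Oplus>\<psi>\<in>carrier Gd. (u \<psi> * \<psi> h) \<odot> z h)"
      using h by (intro finsum_cong'[OF refl]) (auto simp: skew_smult_app \<delta>_app smult_assoc)
    finally show "(\<Oplus>\<^bsub>S\<^esub>\<psi>\<in>carrier Gd. u \<psi> \<odot>\<^bsub>S\<^esub> \<delta> \<psi> z) h = (\<lambda>h\<in>carrier G. (\<Sum>\<psi>\<in>carrier Gd. u \<psi> * \<psi> h) \<odot> z h) h"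
      using h by (simp add: sum_smult finite_dual)
  qed (auto intro!: S.finsum_closed restrict_closed)
  finally show ?thesis .
qed

lemma sum_grp_elt_dual:
  assumes "\<psi> \<in> carrier Gd" shows "(\<Sum>\<phi>\<in>carrier Gd. grp_elt \<psi> \<phi> * \<phi> h) = \<psi> h"
proof -
  have "(\<Sum>\<phi>\<in>carrier Gd. grp_elt \<psi> \<phi> * \<phi> h) = (\<Sum>\<phi>\<in>carrier Gd. if \<phi> = \<psi> then \<phi> h else 0)"
    by (rule sum.cong) (auto simp: grp_elt_def)
  then show ?thesis using assms by (simp add: finite_dual)
qed

text \<open>Serves fixed vertices, with \<mu> = 0, and arrows of type (4), with \<mu> = b(\<alpha>).
  In the convolution the values of \<chi>^\<mu> at y and y^-1 x multiply to its value at x, so n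
  equal terms cancel the factor 1/n.\<close>

lemma T_idem_char:
  assumes a [simp]: "a \<in> carrier A" and ae: "\<And>y. y \<in> carrier G \<Longrightarrow> a \<otimes> \<rho> y e = a"
  shows "T (skew_tensor \<Gamma> Gd (skew_tensor A G a (grp_idem G g n \<zeta> \<mu>)) (grp_elt (\<chi> [^]\<^bsub>Gd\<^esub> \<mu>))) w
    = (\<lambda>x\<in>carrier G. (\<chi> [^]\<^bsub>Gd\<^esub> \<mu>) x \<odot> a)"
proof (rule skew_ext)
  let ?\<psi> = "\<chi> [^]\<^bsub>Gd\<^esub> \<mu>"
  have \<psi>: "?\<psi> \<in> carrier Gd" by (simp add: dual_gen)
  let ?v = "\<lambda>h\<in>carrier G. ?\<psi> h \<odot> e"
  have v: "?v \<in> carrier S" by (rule restrict_closed) simp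
  have T: "T (skew_tensor \<Gamma> Gd (skew_tensor A G a (grp_idem G g n \<zeta> \<mu>)) (grp_elt ?\<psi>)) w
    = skew_tensor A G a (grp_idem G g n \<zeta> \<mu>) \<otimes>\<^bsub>S\<^esub> ?v"
    by (subst T_tensor) (auto simp: sum_grp_elt_dual \<psi> skew_tensor_closed intro!: arg_cong2[where f = "monoid.mult S"])
  then show "T (skew_tensor \<Gamma> Gd (skew_tensor A G a (grp_idem G g n \<zeta> \<mu>)) (grp_elt ?\<psi>)) w \<in> carrier S"
    using v by (simp add: skew_mult_closed skew_tensor_closed)
  fix x assume x [simp]: "x \<in> carrier G"
  have "(skew_tensor A G a (grp_idem G g n \<zeta> \<mu>) \<otimes>\<^bsub>S\<^esub> ?v) x =
    (\<Oplus>y\<in>carrier G. inverse (of_nat n) \<odot> (?\<psi> x \<odot> a))"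
    unfolding skew_mult_app[OF x]
  proof (rule finsum_cong'[OF refl])
    fix y assume y [simp]: "y \<in> carrier G"
    have \<psi>x: "?\<psi> y * ?\<psi> (inv\<^bsub>G\<^esub> y \<otimes>\<^bsub>G\<^esub> x) = ?\<psi> x" using \<psi> by (simp flip: dual_hom G.m_assoc)
    have "skew_tensor A G a (grp_idem G g n \<zeta> \<mu>) y \<otimes> \<rho> y (?v (inv\<^bsub>G\<^esub> y \<otimes>\<^bsub>G\<^esub> x)) =
      (?\<psi> (inv\<^bsub>G\<^esub> y \<otimes>\<^bsub>G\<^esub> x) * (inverse (of_nat n) * ?\<psi> y)) \<odot> a"
      by (simp add: skew_tensor_app grp_idem_app act_smult smult_mult_left smult_mult_right smult_assoc ae)
    also have "\<dots> = (inverse (of_nat n) * (?\<psi> y * ?\<psi> (inv\<^bsub>G\<^esub> y \<otimes>\<^bsub>G\<^esub> x))) \<odot> a"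
      by (simp only: mult_ac)
    also have "\<dots> = inverse (of_nat n) \<odot> (?\<psi> x \<odot> a)"
      by (simp only: \<psi>x smult_assoc[OF a])
    finally show "skew_tensor A G a (grp_idem G g n \<zeta> \<mu>) y \<otimes> \<rho> y (?v (inv\<^bsub>G\<^esub> y \<otimes>\<^bsub>G\<^esub> x)) =
      inverse (of_nat n) \<odot> (?\<psi> x \<odot> a)" .
  qed simp
  also have "\<dots> = ?\<psi> x \<odot> a" by (rule sum_const) simp
  finally show "T (skew_tensor \<Gamma> Gd (skew_tensor A G a (grp_idem G g n \<zeta> \<mu>)) (grp_elt ?\<psi>)) w x =
    (\<lambda>x\<in>carrier G. ?\<psi> x \<odot> a) x" by (simp add: T)
qed (auto intro!: restrict_closed)

lemma T_idem_tensor: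
  assumes "a \<in> carrier S" "z \<in> carrier S"
  shows "T (skew_tensor \<Gamma> Gd a (grp_idem Gd \<chi> n \<zeta> \<nu>)) z =
    a \<otimes>\<^bsub>S\<^esub> (\<lambda>h\<in>carrier G. if h = inv\<^bsub>G\<^esub> (g [^]\<^bsub>G\<^esub> \<nu>) then z h else \<zero>)"
  using assms
  by (subst T_tensor) (auto simp: sum_grp_idem_dual intro!: arg_cong2[where f = "monoid.mult S"])

text \<open>Serves free vertices, with \<open>z\<close> the identity, and arrows of type (1), with
  \<open>z\<close> a power of \<open>g\<close>. The dual idempotent keeps the component of
  \<open>w\<close> in degree g^-\<nu>, and \<open>z\<close> moves it to degree z g^-\<nu>.\<close>

lemma T_elt_idem:
  assumes a [simp]: "a \<in> carrier A" "z \<in> carrier G" "x \<in> carrier G"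
  shows "T (skew_tensor \<Gamma> Gd (skew_tensor A G a (grp_elt z)) (grp_idem Gd \<chi> n \<zeta> \<nu>)) w x
    = (if inv\<^bsub>G\<^esub> z \<otimes>\<^bsub>G\<^esub> x = inv\<^bsub>G\<^esub> (g [^]\<^bsub>G\<^esub> \<nu>) then a \<otimes> \<rho> z e else \<zero>)"
proof -
  have "(\<lambda>h\<in>carrier G. if h = inv\<^bsub>G\<^esub> (g [^]\<^bsub>G\<^esub> \<nu>) then w h else \<zero>) \<in> carrier S"
    by (rule restrict_closed) simp
  then show ?thesis
    by (simp add: T_idem_tensor skew_tensor_closed grp_elt_mult_app)
qed

lemma \<eta>_mult_app: "f \<in> carrier S \<Longrightarrow> x \<in> carrier G \<Longrightarrow> (\<eta> \<otimes>\<^bsub>S\<^esub> f) x = e \<otimes> f x"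
  by (simp add: \<eta>_def inc_mult_app)

text \<open>Serves arrows of type (3), which have type (2) for the dual group, so the projection is
  applied after the arrow. The averaging by e_0 still acts on the whole of \<open>w\<close>, and its
  factor 1/n cancels.\<close>

lemma T_mult_idem_elt:
  assumes a [simp]: "a \<in> carrier A" "x \<in> carrier G" and ae: "\<And>y. y \<in> carrier G \<Longrightarrow> a \<otimes> \<rho> y e = a"
    and a\<Gamma>: "skew_tensor A G a (grp_idem G g n \<zeta> 0) \<in> carrier \<Gamma>"
  shows "T (skew_tensor \<Gamma> Gd \<one>\<^bsub>\<Gamma>\<^esub> (grp_idem Gd \<chi> n \<zeta> \<nu>) \<otimes>\<^bsub>R\<^esub>
      skew_tensor \<Gamma> Gd (skew_tensor A G a (grp_idem G g n \<zeta> 0)) (grp_elt \<one>\<^bsub>Gd\<^esub>)) w x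
    = (if x = inv\<^bsub>G\<^esub> (g [^]\<^bsub>G\<^esub> \<nu>) then e \<otimes> a else \<zero>)"
proof -
  have one: "T (skew_tensor \<Gamma> Gd (skew_tensor A G a (grp_idem G g n \<zeta> 0)) (grp_elt \<one>\<^bsub>Gd\<^esub>)) w = (\<lambda>x\<in>carrier G. a)"
    using T_idem_char[OF a(1) ae, of 0] by (auto simp: restrict_def)
  have c: "(\<lambda>x\<in>carrier G. a) \<in> carrier S" "(\<lambda>h\<in>carrier G. if h = inv\<^bsub>G\<^esub> (g [^]\<^bsub>G\<^esub> \<nu>) then (\<lambda>x\<in>carrier G. a) h else \<zero>) \<in> carrier S"
    by (auto intro!: restrict_closed)
  have "\<eta> \<in> carrier \<Gamma>" by (simp add: \<Gamma>_carrier)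
  then show ?thesis
    using c a\<Gamma> by (subst T_mult) (auto simp: one T_idem_tensor \<eta>_mult_app R.skew_tensor_closed)
qed

text \<open>Serves arrows of type (2). Here the projection comes first and leaves a single component
  of \<open>w\<close>, so the averaging by e_0 has only one term and its factor 1/n
  survives.\<close>

lemma T_idem_mult:
  assumes a [simp]: "a \<in> carrier A" "x \<in> carrier G"
  shows "T (skew_tensor \<Gamma> Gd (skew_tensor A G \<one> (grp_idem G g n \<zeta> 0) \<otimes>\<^bsub>S\<^esub> skew_tensor A G a (grp_elt \<one>\<^bsub>G\<^esub>))
      (grp_idem Gd \<chi> n \<zeta> \<nu>)) w x
    = inverse (of_nat n) \<odot> \<rho> (x \<otimes>\<^bsub>G\<^esub> g [^]\<^bsub>G\<^esub> \<nu>) (a \<otimes> e)"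
proof -
  let ?v = "\<lambda>h\<in>carrier G. if h = inv\<^bsub>G\<^esub> (g [^]\<^bsub>G\<^esub> \<nu>) then w h else \<zero>"
  have v [simp]: "?v \<in> carrier S" by (rule restrict_closed) simp
  have eq: "inv\<^bsub>G\<^esub> y \<otimes>\<^bsub>G\<^esub> x = inv\<^bsub>G\<^esub> (g [^]\<^bsub>G\<^esub> \<nu>) \<longleftrightarrow> y = x \<otimes>\<^bsub>G\<^esub> g [^]\<^bsub>G\<^esub> \<nu>" if y: "y \<in> carrier G" for y
  proof
    assume *: "inv\<^bsub>G\<^esub> y \<otimes>\<^bsub>G\<^esub> x = inv\<^bsub>G\<^esub> (g [^]\<^bsub>G\<^esub> \<nu>)"
    then have "y \<otimes>\<^bsub>G\<^esub> (inv\<^bsub>G\<^esub> y \<otimes>\<^bsub>G\<^esub> x) \<otimes>\<^bsub>G\<^esub> g [^]\<^bsub>G\<^esub> \<nu> = y" using y by (simp add: G.m_assoc)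
    then show "y = x \<otimes>\<^bsub>G\<^esub> g [^]\<^bsub>G\<^esub> \<nu>" using y by (simp flip: G.m_assoc)
  next
    assume "y = x \<otimes>\<^bsub>G\<^esub> g [^]\<^bsub>G\<^esub> \<nu>"
    then show "inv\<^bsub>G\<^esub> y \<otimes>\<^bsub>G\<^esub> x = inv\<^bsub>G\<^esub> (g [^]\<^bsub>G\<^esub> \<nu>)" by (simp add: G.inv_mult_group G.m_assoc)
  qed
  have "T (skew_tensor \<Gamma> Gd (skew_tensor A G \<one> (grp_idem G g n \<zeta> 0) \<otimes>\<^bsub>S\<^esub> inc a) (grp_idem Gd \<chi> n \<zeta> \<nu>)) w x
    = (skew_tensor A G \<one> (grp_idem G g n \<zeta> 0) \<otimes>\<^bsub>S\<^esub> (inc a \<otimes>\<^bsub>S\<^esub> ?v)) x"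
    by (simp add: T_idem_tensor skew_mult_closed skew_tensor_closed skew_mult_assoc)
  also have "\<dots> = (\<Oplus>y\<in>carrier G. inverse (of_nat n) \<odot> \<rho> y ((inc a \<otimes>\<^bsub>S\<^esub> ?v) (inv\<^bsub>G\<^esub> y \<otimes>\<^bsub>G\<^esub> x)))"
    by (subst skew_tensor_mult_app)
      (auto simp: skew_mult_closed finsum_closed grp_idem_app intro!: finsum_cong')
  also have "\<dots> = (\<Oplus>y\<in>carrier G. if y = x \<otimes>\<^bsub>G\<^esub> g [^]\<^bsub>G\<^esub> \<nu> then inverse (of_nat n) \<odot> \<rho> y (a \<otimes> e) else \<zero>)"
    by (rule finsum_cong'[OF refl]) (auto simp: inc_mult_app eq)
  also have "\<dots> = inverse (of_nat n) \<odot> \<rho> (x \<otimes>\<^bsub>G\<^esub> g [^]\<^bsub>G\<^esub> \<nu>) (a \<otimes> e)"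
    by (rule finsum_delta[OF fin]) auto
  finally show ?thesis .
qed

text \<open>The right-hand side is the coefficient at \<open>x\<close> of \<open>w\<close> times
  \<open>a\<close>, so a value of \<open>F\<close> can be verified without computing
  \<open>P\<close>.\<close>

lemma F_eqI_app:
  assumes "a \<in> carrier A" "T f w \<in> carrier S" "\<And>x. x \<in> carrier G \<Longrightarrow> T f w x = e \<otimes> \<rho> x a"
  shows "F f = a"
proof (rule F_eqI[OF assms(1)])
  show "T f w = w \<otimes>\<^bsub>S\<^esub> inc a"
  proof (rule skew_ext[OF assms(2)])
    show "w \<otimes>\<^bsub>S\<^esub> inc a \<in> carrier S" using assms(1) by (simp add: skew_mult_closed)
    fix x assume x: "x \<in> carrier G"
    show "T f w x = (w \<otimes>\<^bsub>S\<^esub> inc a) x"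
      unfolding assms(3)[OF x] using assms(1) x by (simp add: mult_inc_app)
  qed
qed

end

section \<open>Orbits of vertices\<close>

context cyclic_qp_action
begin

definition E1 where "E1 = {\<epsilon> \<in> \<E>. \<exists>h\<in>carrier G. sv h \<epsilon> \<noteq> \<epsilon>}"
definition E2 where "E2 = {\<epsilon> \<in> \<E>. \<forall>h\<in>carrier G. sv h \<epsilon> = \<epsilon>}"

lemma E_verts: "E1 \<subseteq> verts Q" "E2 \<subseteq> verts Q" "E1 \<inter> E2 = {}" "E1 \<subseteq> \<E>" "E2 \<subseteq> \<E>"
  using representatives(1) by (auto simp: E1_def E2_def)

lemma E_vertsD [simp]: "v \<in> E1 \<Longrightarrow> v \<in> verts Q" "v \<in> E2 \<Longrightarrow> v \<in> verts Q"
  using E_verts by auto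

lemma E_fin [simp]: "finite E1" "finite E2"
  using E_verts finite_verts by (auto intro: finite_subset)

lemma E_unique:
  assumes "u \<in> \<E>" "v \<in> \<E>" "h \<in> carrier G" "h' \<in> carrier G" "sv h u = sv h' v" shows "u = v"
proof -
  have "sv h u \<in> verts Q" using assms representatives(1) by auto
  then show ?thesis using representatives(2) assms by metis
qed

text \<open>An orbit with as many elements as the group has an injective orbit map, so a vertex of
  \<open>E1\<close> has trivial stabiliser.\<close>

lemma E1_free:
  assumes "u \<in> E1" "v \<in> E1" "h \<in> carrier G" "h' \<in> carrier G" "sv h u = sv h' v"
  shows "u = v \<and> h = h'"
proof -
  have "u \<in> \<E>" "v \<in> \<E>" "u \<in> verts Q" and "\<exists>h\<in>carrier G. sv h u \<noteq> u"
    using assms(1,2) E_verts by (auto simp: E1_def)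
  then have uv: "u = v" using E_unique assms(3-5) by metis
  have "card ((\<lambda>h. sv h u) ` carrier G) = card (carrier G)"
    using A3[OF \<open>u \<in> verts Q\<close> \<open>\<exists>h\<in>carrier G. sv h u \<noteq> u\<close>] cyclic_group(3) by (simp add: order_def)
  then have "inj_on (\<lambda>h. sv h u) (carrier G)" by (rule eq_card_imp_inj_on[OF cyclic_group(2)])
  then show ?thesis using assms uv by (auto dest: inj_onD)
qed

lemma E2_fixed [simp]: "v \<in> E2 \<Longrightarrow> h \<in> carrier G \<Longrightarrow> sv h v = v"
  by (simp add: E2_def)

lemma vert_cases:
  assumes "v \<in> verts Q"
  obtains (fixed) "v \<in> E2" | (free) \<epsilon> h where "\<epsilon> \<in> E1" "h \<in> carrier G" "v = sv h \<epsilon>"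
proof -
  obtain \<epsilon> h where *: "\<epsilon> \<in> \<E>" "h \<in> carrier G" "v = sv h \<epsilon>" using representatives(2)[OF assms] by blast
  show ?thesis
  proof (cases "\<epsilon> \<in> E1")
    case True
    then show ?thesis using * free by blast
  next
    case False
    then have "\<epsilon> \<in> E2" using *(1) unfolding E1_def E2_def by blast
    then show ?thesis using * by (intro fixed) simp
  qed
qed

lemma sv_E1_not_E2: "\<epsilon> \<in> E1 \<Longrightarrow> h \<in> carrier G \<Longrightarrow> sv h \<epsilon> \<notin> E2"
proof
  assume *: "\<epsilon> \<in> E1" "h \<in> carrier G" "sv h \<epsilon> \<in> E2"
  have "sv h (sv h \<epsilon>) = sv h \<epsilon>" by (rule E2_fixed[OF *(3,2)])
  then have "sv h \<epsilon> = \<epsilon>"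
    by (rule sv_inj[OF *(2) E_vertsD(2)[OF *(3)] E_vertsD(1)[OF *(1)]])
  then have "\<epsilon> \<in> E2" using *(3) by (simp only:)
  then show False using *(1) E_verts(3) by blast
qed

text \<open>A fixed vertex is alone in its orbit, hence its own representative.\<close>

lemma fixed_iff: "v \<in> verts Q \<Longrightarrow> (\<forall>h\<in>carrier G. sv h v = v) \<longleftrightarrow> v \<in> E2"
proof
  assume v: "v \<in> verts Q" "\<forall>h\<in>carrier G. sv h v = v"
  show "v \<in> E2" using v(1)
  proof (cases rule: vert_cases)
    case (free \<epsilon> h)
    have "sv (inv\<^bsub>G\<^esub> h) v = \<epsilon>" unfolding free(3) using free(1,2) by (simp flip: sv_mult)
    moreover have "sv (inv\<^bsub>G\<^esub> h) v = v" using v(2) G.inv_closed[OF free(2)] by blast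
    ultimately have "v \<in> E1" using free(1) by (simp only:)
    then show ?thesis using v(2) unfolding E1_def by blast
  qed
qed simp

lemma sv_E2_iff: "h \<in> carrier G \<Longrightarrow> v \<in> verts Q \<Longrightarrow> sv h v \<in> E2 \<longleftrightarrow> v \<in> E2"
  by (metis E2_fixed sv_inj sv_closed E_vertsD(2))

lemma sv_image_E2: "h \<in> carrier G \<Longrightarrow> sv h ` E2 = E2"
  by (auto simp: image_iff)

lemma E1_inter_sv: "h \<in> carrier G \<Longrightarrow> E1 \<inter> sv h ` E1 = (if h = \<one>\<^bsub>G\<^esub> then E1 else {})"
proof -
  assume h: "h \<in> carrier G"
  have "u = v \<and> \<one>\<^bsub>G\<^esub> = h" if "u \<in> E1" "v \<in> E1" "u = sv h v" for u v
    using E1_free[of u v "\<one>\<^bsub>G\<^esub>" h] that h by simp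
  then show ?thesis by (auto simp: image_iff)
qed

text \<open>The translates of \<open>E1\<close> are disjoint and, together with \<open>E2\<close>,
  exhaust the vertices. This is the decomposition of 1 required for
  \<open>skew_duality\<close>.\<close>

lemma sum_orbits: "(\<Oplus>\<^bsub>\<Lambda>\<^esub>h\<in>carrier G. \<rho>\<Lambda> h (vsum E1)) \<oplus>\<^bsub>\<Lambda>\<^esub> vsum E2 = \<one>\<^bsub>\<Lambda>\<^esub>"
proof -
  let ?U = "\<Union>h\<in>carrier G. sv h ` E1"
  have sub: "?U \<subseteq> verts Q" using E_verts by auto
  have "(\<Oplus>\<^bsub>\<Lambda>\<^esub>h\<in>carrier G. \<rho>\<Lambda> h (vsum E1)) = (\<Oplus>\<^bsub>\<Lambda>\<^esub>h\<in>carrier G. vsum (sv h ` E1))"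
    using E_verts sub by (intro L.finsum_cong'[OF refl]) (auto simp: \<rho>\<Lambda>_vsum intro!: vsum_closed)
  also have "\<dots> = vsum ?U"
    unfolding vsum_def using sub E1_free
    by (intro L.add.finprod_UN_disjoint[symmetric, simplified]) (auto simp: cyclic_group(2) pairwise_def disjnt_iff)
  also have "vsum ?U \<oplus>\<^bsub>\<Lambda>\<^esub> vsum E2 = vsum (?U \<union> E2)"
    using sub E_verts sv_E1_not_E2 by (intro vsum_Un[symmetric]) auto
  also have "?U \<union> E2 = verts Q"
  proof (intro equalityI subsetI)
    fix v assume "v \<in> verts Q"
    then show "v \<in> ?U \<union> E2" by (cases rule: vert_cases) blast+
  qed (use sub E_verts in blast)
  finally show ?thesis using sum_rv by (simp add: vsum_def)
qed

sublocale DD: skew_duality \<Lambda> G \<rho>\<Lambda> g n \<zeta> "vsum E1" "vsum E2"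
proof unfold_locales
  show "vsum E1 \<otimes>\<^bsub>\<Lambda>\<^esub> vsum E1 = vsum E1" "vsum E2 \<otimes>\<^bsub>\<Lambda>\<^esub> vsum E2 = vsum E2"
    "vsum E1 \<otimes>\<^bsub>\<Lambda>\<^esub> vsum E2 = \<zero>\<^bsub>\<Lambda>\<^esub>" "vsum E2 \<otimes>\<^bsub>\<Lambda>\<^esub> vsum E1 = \<zero>\<^bsub>\<Lambda>\<^esub>"
    using E_verts by (simp_all add: vsum_mult Int_commute)
  show "\<rho>\<Lambda> h (vsum E2) = vsum E2" if "h \<in> carrier G" for h
    using that E_verts by (simp add: \<rho>\<Lambda>_vsum sv_image_E2)
  show "vsum E1 \<otimes>\<^bsub>\<Lambda>\<^esub> \<rho>\<Lambda> h (vsum E1) = (if h = \<one>\<^bsub>G\<^esub> then vsum E1 else \<zero>\<^bsub>\<Lambda>\<^esub>)" if h: "h \<in> carrier G" for h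
  proof -
    have "sv h ` E1 \<subseteq> verts Q" using h by auto
    then show ?thesis using h E_verts by (simp add: \<rho>\<Lambda>_vsum vsum_mult E1_inter_sv)
  qed
qed (use E_verts cyclic_group A1 sum_orbits in auto)

lemma DD_e: "DD.e = vsum (E1 \<union> E2)"
  unfolding DD.e_def using E_verts by (intro vsum_Un[symmetric]) auto

end

section \<open>The isomorphism of quivers\<close>

lemma nat_diff_mod_eq_0_iff:
  assumes "(\<kappa>::nat) < n" "b < n"
  shows "nat ((int \<kappa> - int b) mod int n) = 0 \<longleftrightarrow> \<kappa> = b"
proof -
  have "nat ((int \<kappa> - int b) mod int n) = 0 \<longleftrightarrow> (int \<kappa> - int b) mod int n = 0"
    using assms by (simp add: order_antisym_conv)
  also have "\<dots> \<longleftrightarrow> int \<kappa> mod int n = int b mod int n"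
    by (simp add: mod_eq_dvd_iff mod_eq_0_iff_dvd)
  finally show ?thesis using assms by simp
qed

lemma nat_diff_mod_add:
  assumes "0 < n" shows "(nat ((int \<nu> - int t) mod int n) + t) mod n = \<nu> mod n"
proof -
  have "int ((nat ((int \<nu> - int t) mod int n) + t) mod n) = ((int \<nu> - int t) mod int n + int t) mod int n"
    using assms by (simp add: zmod_int)
  also have "\<dots> = int (\<nu> mod n)" by (simp add: mod_simps zmod_int)
  finally show ?thesis by simp
qed

context skew_duality
begin

text \<open>On the right \<open>\<eta>\<close> meets the component of degree x as the translate of
  \<open>e\<close> by \<open>x\<close>, so the condition is imposed only where the coefficient is
  nonzero. Arrows of type (1) satisfy it only in this weaker form.\<close>

lemma tensor_\<Gamma>:
  assumes a [simp]: "a \<in> carrier A" and ea: "e \<otimes> a = a"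
    and ae: "\<And>x. x \<in> carrier G \<Longrightarrow> u x \<noteq> 0 \<Longrightarrow> a \<otimes> \<rho> x e = a"
  shows "skew_tensor A G a u \<in> carrier \<Gamma>"
proof -
  have c: "skew_tensor A G a u \<in> carrier S" by (simp add: skew_tensor_closed)
  have "\<eta> \<otimes>\<^bsub>S\<^esub> skew_tensor A G a u = skew_tensor A G a u"
    using c by (intro skew_ext) (auto simp: skew_mult_closed \<eta>_mult_app skew_tensor_app smult_mult_right ea)
  moreover have "skew_tensor A G a u \<otimes>\<^bsub>S\<^esub> \<eta> = skew_tensor A G a u"
  proof (rule skew_ext)
    fix x assume x: "x \<in> carrier G"
    show "(skew_tensor A G a u \<otimes>\<^bsub>S\<^esub> \<eta>) x = skew_tensor A G a u x"
      unfolding \<eta>_def using c x ae[OF x]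
      by (cases "u x = 0") (simp_all add: mult_inc_app skew_tensor_app smult_mult_left)
  qed (use c in \<open>simp_all add: skew_mult_closed\<close>)
  ultimately show ?thesis using c by (simp add: \<Gamma>_carrier)
qed

lemma T_tensor_closed: "a \<in> carrier S \<Longrightarrow> T (skew_tensor \<Gamma> Gd a u) w \<in> carrier S"
  by (rule T_closed) (simp_all add: R.skew_tensor_app)

lemma sum_grp_idem:
  assumes "h \<in> carrier G"
  shows "(\<Sum>\<kappa><n. grp_idem G g n \<zeta> \<kappa> h) = (if h = \<one>\<^bsub>G\<^esub> then 1 else 0)"
  using assms
  by (simp add: grp_idem_app char_orthogonality_dual flip: sum_distrib_left sum_dual[of "\<lambda>\<psi>. \<psi> h"])

end

context cyclic_qp_action
begin

abbreviation D where "D \<equiv> gquiver_of Q G g \<rho> \<E>"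
abbreviation DG where "DG \<equiv> skew_gquiver n \<zeta> D"
abbreviation DGG where "DGG \<equiv> skew_gquiver n \<zeta> DG"
abbreviation Q1 where "Q1 \<equiv> skew_quiver n \<zeta> D"
abbreviation Q2 where "Q2 \<equiv> skew_quiver n \<zeta> DG"
abbreviation gp where "gp i \<equiv> g [^]\<^bsub>G\<^esub> (i::nat)"

lemma D_simps [simp]: "quiver D = Q" "gen_v D = sv g" "gen_a D = sa g" "gen_c D = sc g"
  "reps_free D = E1" "reps_fixed D = E2"
  unfolding gquiver_of_def E1_def E2_def by (simp_all only: gquiver.select_convs)

lemma DG_simps [simp]: "quiver DG = Q1" "reps_free DG = {EtaMu \<epsilon> 0 | \<epsilon>. \<epsilon> \<in> E2}" "reps_fixed DG = Eta ` E1"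
  "quiver DGG = Q2"
  "gen_v DG (Eta \<epsilon>) = Eta \<epsilon>" "gen_v DG (EtaMu \<epsilon> \<kappa>) = EtaMu \<epsilon> (Suc \<kappa> mod n)"
  "gen_c DG (Til a) = \<zeta> ^ t_ind n D a"
  by (simp_all add: skew_gquiver_def)

lemma gp_closed [simp]: "gp i \<in> carrier G"
  using DD.g_closed by simp

lemma sv_pow: "v \<in> verts Q \<Longrightarrow> (sv g ^^ i) v = sv (gp i) v"
  by (induction i) (simp_all add: sv_mult[symmetric] G.nat_pow_Suc2[symmetric] del: G.nat_pow_Suc)

lemma sa_pow: "a \<in> arcs Q \<Longrightarrow> (sa g ^^ i) a = sa (gp i) a"
  by (induction i) (simp_all add: sa_mult[symmetric] G.nat_pow_Suc2[symmetric] del: G.nat_pow_Suc)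

lemma gp_inj: "i < n \<Longrightarrow> j < n \<Longrightarrow> gp i = gp j \<Longrightarrow> i = j"
  using DD.g_pow_eq_iff by simp

lemma src_index_iff: "src_index n D a \<epsilon> t \<longleftrightarrow> \<epsilon> \<in> E1 \<and> t < n \<and> tail Q a = sv (gp t) \<epsilon>"
  by (auto simp: src_index_def sv_pow)

lemma src_index_unique: "src_index n D a \<epsilon> t \<Longrightarrow> src_index n D a \<epsilon>' t' \<Longrightarrow> \<epsilon> = \<epsilon>' \<and> t = t'"
  unfolding src_index_iff using E1_free gp_inj gp_closed by metis

lemma src_index_the: "src_index n D a \<epsilon> t \<Longrightarrow> t_ind n D a = t \<and> src_rep n D a = \<epsilon>"
proof -
  assume *: "src_index n D a \<epsilon> t"
  have "t_ind n D a = t" unfolding t_ind_def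
    by (rule the_equality) (use * src_index_unique in blast)+
  moreover have "src_rep n D a = \<epsilon>" unfolding src_rep_def
    by (rule the_equality) (use * src_index_unique in blast)+
  ultimately show "t_ind n D a = t \<and> src_rep n D a = \<epsilon>" ..
qed

lemma arr2_iff: "a \<in> arr2 D \<longleftrightarrow> a \<in> arcs Q \<and> tail Q a \<in> E1 \<and> head Q a \<in> E2"
  and arr3_iff: "a \<in> arr3 D \<longleftrightarrow> a \<in> arcs Q \<and> tail Q a \<in> E2 \<and> head Q a \<in> E1"
  and arr4_iff: "a \<in> arr4 D \<longleftrightarrow> a \<in> arcs Q \<and> tail Q a \<in> E2 \<and> head Q a \<in> E2"
  by (auto simp: arr2_def arr3_def arr4_def)

lemma not_E1_E2: "v \<in> E1 \<Longrightarrow> v \<in> E2 \<Longrightarrow> False"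
  using E_verts(3) by blast

lemma arr1_iff: "a \<in> arr1 n D \<longleftrightarrow> a \<in> arcs Q \<and> tail Q a \<notin> E2 \<and> head Q a \<in> E1"
proof
  assume "a \<in> arr1 n D"
  then show "a \<in> arcs Q \<and> tail Q a \<notin> E2 \<and> head Q a \<in> E1"
    using sv_E1_not_E2 by (auto simp: arr1_def src_index_iff)
next
  assume a: "a \<in> arcs Q \<and> tail Q a \<notin> E2 \<and> head Q a \<in> E1"
  then have "tail Q a \<in> verts Q" by simp
  then obtain \<epsilon> h where "\<epsilon> \<in> E1" "h \<in> carrier G" "tail Q a = sv h \<epsilon>" using a by (elim vert_cases) auto
  moreover then obtain t where "t < n" "h = gp t" using DD.g_pow_exhaust by metis
  ultimately have "src_index n D a \<epsilon> t" by (simp add: src_index_iff)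
  then show "a \<in> arr1 n D" using a by (auto simp: arr1_def)
qed

lemma arr1_src:
  assumes "a \<in> arr1 n D"
  shows "src_rep n D a \<in> E1" "t_ind n D a < n" "tail Q a = sv (gp (t_ind n D a)) (src_rep n D a)"
proof -
  obtain \<epsilon> t where *: "src_index n D a \<epsilon> t" using assms by (auto simp: arr1_def)
  from src_index_the[OF *] * show "src_rep n D a \<in> E1" "t_ind n D a < n"
    "tail Q a = sv (gp (t_ind n D a)) (src_rep n D a)"
    by (simp_all add: src_index_iff)
qed

lemma arr4_act:
  assumes "a \<in> arr4 D"
  shows "sa g a = a" "b_ind n \<zeta> D a < n" "sc g a = \<zeta> ^ b_ind n \<zeta> D a"
proof -
  have a: "a \<in> arcs Q" "tail Q a \<in> E2" "head Q a \<in> E2" using assms by (auto simp: arr4_iff)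
  have "\<forall>h\<in>carrier G. sv h (tail Q a) = tail Q a" "\<forall>h\<in>carrier G. sv h (head Q a) = head Q a"
    using a(2,3) E2_fixed by blast+
  from A5[OF a(1) this] obtain b where b: "\<rho> g (arrow_elt Q a) = \<zeta> ^ b \<odot>\<^bsub>A\<^esub> arrow_elt Q a"
    unfolding path_alg_ops by blast
  from act_a_eqI(1)[OF DD.g_closed a(1) b] show "sa g a = a" .
  from act_a_eqI(2)[OF DD.g_closed a(1) b] have c: "sc g a = \<zeta> ^ b" .
  have "\<exists>!b. b < n \<and> gen_c D a = \<zeta> ^ b"
  proof (rule ex1I[of _ "b mod n"])
    show "b mod n < n \<and> gen_c D a = \<zeta> ^ (b mod n)" using DD.n_pos c by (simp add: DD.\<zeta>_pow_mod)
    show "b' = b mod n" if "b' < n \<and> gen_c D a = \<zeta> ^ b'" for b'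
      using that c DD.\<zeta>_pow_eq_iff[of b b'] by simp
  qed
  from theI'[OF this] show "b_ind n \<zeta> D a < n" "sc g a = \<zeta> ^ b_ind n \<zeta> D a"
    by (simp_all add: b_ind_def)
qed

lemma arr4_act_pow:
  assumes "a \<in> arr4 D"
  shows "sa (gp m) a = a \<and> sc (gp m) a = \<zeta> ^ (m * b_ind n \<zeta> D a)"
proof (induction m)
  case (Suc m)
  have "a \<in> arcs Q" using assms by (simp add: arr4_iff)
  then show ?case
    using Suc arr4_act[OF assms] DD.g_closed by (simp add: sa_mult sc_mult power_add)
qed (use assms in \<open>simp add: arr4_iff\<close>)

lemma sc_free:
  assumes "a \<in> arcs Q" "tail Q a \<notin> E2 \<or> head Q a \<notin> E2" "h \<in> carrier G"
  shows "sc h a = 1"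
proof -
  have "tail Q a \<in> verts Q" "head Q a \<in> verts Q" using assms(1) by simp_all
  then have "\<exists>h'\<in>carrier G. sv h' (tail Q a) \<noteq> tail Q a \<or> sv h' (head Q a) \<noteq> head Q a"
    using assms(2) fixed_iff by blast
  from A6[OF assms(3,1) this] obtain b where b: "b \<in> arcs Q" "\<rho> h (arrow_elt Q a) = arrow_elt Q b" by blast
  then have "\<rho> h (arrow_elt Q a) = 1 \<odot>\<^bsub>A\<^esub> arrow_elt Q b" by simp
  from act_a_eqI(2)[OF assms(3,1) this] show ?thesis .
qed

lemma Q1_simps [simp]:
  "verts Q1 = Eta ` E1 \<union> {EtaMu \<epsilon> \<kappa> | \<epsilon> \<kappa>. \<epsilon> \<in> E2 \<and> \<kappa> < n}"
  "arcs Q1 = Til ` arr1 n D \<union> {TilMu a \<kappa> | a \<kappa>. a \<in> arr2 D \<union> arr3 D \<union> arr4 D \<and> \<kappa> < n}"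
  "tail Q1 (Til a) = Eta (src_rep n D a)" "head Q1 (Til a) = Eta (head Q a)"
  by (simp_all add: skew_quiver_def)

lemma Q1_ends:
  "a \<in> arr2 D \<Longrightarrow> tail Q1 (TilMu a \<kappa>) = Eta (tail Q a) \<and> head Q1 (TilMu a \<kappa>) = EtaMu (head Q a) \<kappa>"
  "a \<in> arr3 D \<Longrightarrow> tail Q1 (TilMu a \<kappa>) = EtaMu (tail Q a) \<kappa> \<and> head Q1 (TilMu a \<kappa>) = Eta (head Q a)"
  "a \<in> arr4 D \<Longrightarrow> tail Q1 (TilMu a \<kappa>) = EtaMu (tail Q a) \<kappa> \<and>
    head Q1 (TilMu a \<kappa>) = EtaMu (head Q a) (nat ((int \<kappa> - int (b_ind n \<zeta> D a)) mod int n))"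
  using not_E1_E2 by (auto simp: skew_quiver_def arr2_iff arr3_iff arr4_iff)

lemma Q1_arc_cases:
  assumes "y \<in> arcs Q1"
  obtains (1) a where "a \<in> arr1 n D" "y = Til a"
  | (2) a \<kappa> where "a \<in> arr2 D" "\<kappa> < n" "y = TilMu a \<kappa>"
  | (3) a \<kappa> where "a \<in> arr3 D" "\<kappa> < n" "y = TilMu a \<kappa>"
  | (4) a \<kappa> where "a \<in> arr4 D" "\<kappa> < n" "y = TilMu a \<kappa>"
  using assms by auto

section \<open>Types of arrows in the second construction\<close>

lemma gen_v_DG_pow: "t < n \<Longrightarrow> (gen_v DG ^^ t) (EtaMu \<epsilon> 0) = EtaMu \<epsilon> t"
  by (induction t) auto

lemma src_index_DG:
  "src_index n DG y x t \<longleftrightarrow> (\<exists>\<epsilon>\<in>E2. x = EtaMu \<epsilon> 0 \<and> t < n \<and> tail Q1 y = EtaMu \<epsilon> t)"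
  using gen_v_DG_pow by (auto simp: src_index_def)

text \<open>The head of the arrow with index \<kappa> has index \<kappa> - b(\<alpha>), and the
  chosen representatives have index 0. This forces \<kappa> = b(\<alpha>).\<close>

lemma arr1_DG: "arr1 n DG = (\<lambda>a. TilMu a (b_ind n \<zeta> D a)) ` arr4 D"
proof (intro equalityI subsetI)
  fix y assume y: "y \<in> arr1 n DG"
  then have "y \<in> arcs Q1" and t: "\<exists>\<epsilon> t. tail Q1 y = EtaMu \<epsilon> t" and h: "\<exists>\<epsilon>. head Q1 y = EtaMu \<epsilon> 0"
    by (auto simp: arr1_def src_index_DG)
  then show "y \<in> (\<lambda>a. TilMu a (b_ind n \<zeta> D a)) ` arr4 D"
  proof (cases rule: Q1_arc_cases)
    case (4 a \<kappa>)
    then have "nat ((int \<kappa> - int (b_ind n \<zeta> D a)) mod int n) = 0" using h Q1_ends(3)[OF 4(1), of \<kappa>] by auto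
    then have "\<kappa> = b_ind n \<zeta> D a" using nat_diff_mod_eq_0_iff[OF 4(2) arr4_act(2)[OF 4(1)]] by simp
    then show ?thesis using 4 by blast
  qed (use t h Q1_ends in auto)
next
  fix y assume "y \<in> (\<lambda>a. TilMu a (b_ind n \<zeta> D a)) ` arr4 D"
  then obtain a where a: "a \<in> arr4 D" "y = TilMu a (b_ind n \<zeta> D a)" by blast
  note b = arr4_act(2)[OF a(1)]
  have "tail Q1 y = EtaMu (tail Q a) (b_ind n \<zeta> D a)" "head Q1 y = EtaMu (head Q a) 0"
    using Q1_ends(3)[OF a(1), of "b_ind n \<zeta> D a"] a(2) by simp_all
  moreover have "tail Q a \<in> E2" "head Q a \<in> E2" using a(1) by (simp_all add: arr4_iff)
  moreover have "y \<in> arcs Q1" using a b by auto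
  ultimately show "y \<in> arr1 n DG" using b by (auto simp: arr1_def src_index_DG)
qed

text \<open>Dualising exchanges the two kinds of vertices: a fixed one splits into a free orbit and
  a free orbit collapses to a fixed vertex. Hence types (2) and (3) trade places, as do (1) and
  (4).\<close>

lemma arr2_DG: "arr2 DG = (\<lambda>a. TilMu a 0) ` arr3 D"
proof (intro equalityI subsetI)
  fix y assume y: "y \<in> arr2 DG"
  then have "y \<in> arcs Q1" and t: "\<exists>\<epsilon>. tail Q1 y = EtaMu \<epsilon> 0" and h: "\<exists>\<epsilon>. head Q1 y = Eta \<epsilon>"
    by (auto simp: arr2_def)
  then show "y \<in> (\<lambda>a. TilMu a 0) ` arr3 D"
    by (cases rule: Q1_arc_cases) (use t h Q1_ends in auto)
next
  fix y assume "y \<in> (\<lambda>a. TilMu a 0) ` arr3 D"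
  then obtain a where a: "a \<in> arr3 D" "y = TilMu a 0" by blast
  then show "y \<in> arr2 DG"
    using Q1_ends(2)[OF a(1), of 0] DD.n_pos by (auto simp: arr2_def arr3_iff)
qed

lemma arr3_DG: "arr3 DG = (\<lambda>a. TilMu a 0) ` arr2 D"
proof (intro equalityI subsetI)
  fix y assume y: "y \<in> arr3 DG"
  then have "y \<in> arcs Q1" and t: "\<exists>\<epsilon>. head Q1 y = EtaMu \<epsilon> 0" and h: "\<exists>\<epsilon>. tail Q1 y = Eta \<epsilon>"
    by (auto simp: arr3_def)
  then show "y \<in> (\<lambda>a. TilMu a 0) ` arr2 D"
    by (cases rule: Q1_arc_cases) (use t h Q1_ends in auto)
next
  fix y assume "y \<in> (\<lambda>a. TilMu a 0) ` arr2 D"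
  then obtain a where a: "a \<in> arr2 D" "y = TilMu a 0" by blast
  then show "y \<in> arr3 DG"
    using Q1_ends(1)[OF a(1), of 0] DD.n_pos by (auto simp: arr3_def arr2_iff)
qed

lemma arr4_DG: "arr4 DG = Til ` arr1 n D"
proof (intro equalityI subsetI)
  fix y assume y: "y \<in> arr4 DG"
  then have "y \<in> arcs Q1" and t: "\<exists>\<epsilon>. head Q1 y = Eta \<epsilon>" and h: "\<exists>\<epsilon>. tail Q1 y = Eta \<epsilon>"
    by (auto simp: arr4_def)
  then show "y \<in> Til ` arr1 n D"
    by (cases rule: Q1_arc_cases) (use t h Q1_ends in auto)
next
  fix y assume "y \<in> Til ` arr1 n D"
  then obtain a where a: "a \<in> arr1 n D" "y = Til a" by blast
  then show "y \<in> arr4 DG"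
    using arr1_src(1)[OF a(1)] by (auto simp: arr4_def arr1_iff)
qed

lemma src_DG:
  assumes "a \<in> arr4 D"
  shows "t_ind n DG (TilMu a (b_ind n \<zeta> D a)) = b_ind n \<zeta> D a"
    "src_rep n DG (TilMu a (b_ind n \<zeta> D a)) = EtaMu (tail Q a) 0"
proof -
  have *: "src_index n DG (TilMu a (b_ind n \<zeta> D a)) x t \<longleftrightarrow> x = EtaMu (tail Q a) 0 \<and> t = b_ind n \<zeta> D a" for x t
    using Q1_ends(3)[OF assms, of "b_ind n \<zeta> D a"] arr4_act(2)[OF assms] assms
    by (auto simp: src_index_DG arr4_iff)
  show "t_ind n DG (TilMu a (b_ind n \<zeta> D a)) = b_ind n \<zeta> D a"
    "src_rep n DG (TilMu a (b_ind n \<zeta> D a)) = EtaMu (tail Q a) 0"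
    unfolding t_ind_def src_rep_def * by simp_all
qed

lemma b_ind_DG:
  assumes "a \<in> arr1 n D" shows "b_ind n \<zeta> DG (Til a) = t_ind n D a"
  unfolding b_ind_def
proof (rule the_equality)
  show "t_ind n D a < n \<and> gen_c DG (Til a) = \<zeta> ^ t_ind n D a" using arr1_src(2)[OF assms] by simp
  show "b = t_ind n D a" if "b < n \<and> gen_c DG (Til a) = \<zeta> ^ b" for b
    using that arr1_src(2)[OF assms] DD.\<zeta>_pow_eq_iff[of "t_ind n D a" b] by simp
qed

lemma Q2_verts: "verts Q2 = (\<lambda>\<epsilon>. Eta (EtaMu \<epsilon> 0)) ` E2 \<union> (\<lambda>(\<epsilon>, \<nu>). EtaMu (Eta \<epsilon>) \<nu>) ` (E1 \<times> {..<n})"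
  by (auto simp: skew_quiver_def[of n \<zeta> DG])

lemma Q2_arcs: "y \<in> arcs Q2 \<longleftrightarrow> (\<exists>a\<in>arr4 D. y = Til (TilMu a (b_ind n \<zeta> D a))) \<or>
    (\<exists>a\<in>arr3 D \<union> arr2 D. \<exists>\<nu><n. y = TilMu (TilMu a 0) \<nu>) \<or>
    (\<exists>a\<in>arr1 n D. \<exists>\<nu><n. y = TilMu (Til a) \<nu>)"
proof -
  have "arcs Q2 = Til ` arr1 n DG \<union> {TilMu y \<nu> | y \<nu>. y \<in> arr2 DG \<union> arr3 DG \<union> arr4 DG \<and> \<nu> < n}"
    by (simp add: skew_quiver_def[of n \<zeta> DG])
  then have "y \<in> arcs Q2 \<longleftrightarrow> (\<exists>x\<in>arr1 n DG. y = Til x) \<or> (\<exists>x\<in>arr2 DG. \<exists>\<nu><n. y = TilMu x \<nu>) \<or>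
    (\<exists>x\<in>arr3 DG. \<exists>\<nu><n. y = TilMu x \<nu>) \<or> (\<exists>x\<in>arr4 DG. \<exists>\<nu><n. y = TilMu x \<nu>)"
    by blast
  then show ?thesis unfolding arr1_DG arr2_DG arr3_DG arr4_DG bex_simps bex_Un by blast
qed

lemma Q2_arc_cases:
  assumes "y \<in> arcs Q2"
  obtains (4) a where "a \<in> arr4 D" "y = Til (TilMu a (b_ind n \<zeta> D a))"
  | (3) a \<nu> where "a \<in> arr3 D" "\<nu> < n" "y = TilMu (TilMu a 0) \<nu>"
  | (2) a \<nu> where "a \<in> arr2 D" "\<nu> < n" "y = TilMu (TilMu a 0) \<nu>"
  | (1) a \<nu> where "a \<in> arr1 n D" "\<nu> < n" "y = TilMu (Til a) \<nu>"
  using assms unfolding Q2_arcs by blast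

lemma TilMu_in_DG:
  "TilMu a 0 \<in> arr2 DG \<longleftrightarrow> a \<in> arr3 D" "TilMu a 0 \<in> arr3 DG \<longleftrightarrow> a \<in> arr2 D"
  "Til a \<notin> arr2 DG" "Til a \<notin> arr3 DG"
  by (auto simp: arr2_DG arr3_DG)

section \<open>Bijectivity on vertices and arrows\<close>

definition sub :: "nat \<Rightarrow> nat \<Rightarrow> nat" where
  "sub \<nu> t = nat ((int \<nu> - int t) mod int n)"

lemma Q2_tail [simp]: "tail Q2 (Til y) = Eta (src_rep n DG y)"
    "tail Q2 (TilMu y \<nu>) = (if y \<in> arr2 DG then Eta (tail Q1 y) else EtaMu (tail Q1 y) \<nu>)"
  and Q2_head [simp]: "head Q2 (Til y) = Eta (head Q1 y)"
    "head Q2 (TilMu y \<nu>) = (if y \<in> arr2 DG then EtaMu (head Q1 y) \<nu>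
      else if y \<in> arr3 DG then Eta (head Q1 y)
      else EtaMu (head Q1 y) (sub \<nu> (b_ind n \<zeta> DG y)))"
  by (simp_all add: skew_quiver_def[of n \<zeta> DG] sub_def)

lemma sub_less: "sub \<nu> t < n"
  using DD.n_pos by (simp add: nat_less_iff sub_def)

lemma gp_sub: "gp (sub \<nu> t) \<otimes>\<^bsub>G\<^esub> gp t = gp \<nu>" "gp t \<otimes>\<^bsub>G\<^esub> gp (sub \<nu> t) = gp \<nu>"
proof -
  have "gp (sub \<nu> t + t) = gp \<nu>" using nat_diff_mod_add[OF DD.n_pos] by (simp only: DD.g_pow_eq_iff sub_def)
  then show "gp (sub \<nu> t) \<otimes>\<^bsub>G\<^esub> gp t = gp \<nu>" "gp t \<otimes>\<^bsub>G\<^esub> gp (sub \<nu> t) = gp \<nu>"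
    using DD.g_closed by (simp_all add: G.nat_pow_mult add.commute)
qed

lemma sub_inj: "\<nu> < n \<Longrightarrow> \<nu>' < n \<Longrightarrow> sub \<nu> t = sub \<nu>' t \<Longrightarrow> \<nu> = \<nu>'"
  using gp_sub(1) gp_inj by metis

lemma phi_v_simps: "\<epsilon> \<in> E1 \<Longrightarrow> phi_v D (EtaMu (Eta \<epsilon>) \<nu>) = sv (gp \<nu>) \<epsilon>"
  by (simp add: sv_pow)

lemma phi_a_simps:
  "a \<in> arcs Q \<Longrightarrow> phi_a n D (TilMu (TilMu a \<kappa>) \<nu>) = sa (gp \<nu>) a"
  "a \<in> arcs Q \<Longrightarrow> phi_a n D (TilMu (Til a) \<nu>) = sa (gp (sub \<nu> (t_ind n D a))) a"
  by (simp_all add: sa_pow sub_def)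

lemma phi_v_bij: "bij_betw (phi_v D) (verts Q2) (verts Q)"
  unfolding bij_betw_def
proof
  show "inj_on (phi_v D) (verts Q2)"
  proof (rule inj_onI)
    fix x y assume x: "x \<in> verts Q2" and y: "y \<in> verts Q2" and eq: "phi_v D x = phi_v D y"
    have *: "(\<exists>\<epsilon>\<in>E2. z = Eta (EtaMu \<epsilon> 0) \<and> phi_v D z = \<epsilon>) \<or>
      (\<exists>\<epsilon>\<in>E1. \<exists>\<nu><n. z = EtaMu (Eta \<epsilon>) \<nu> \<and> phi_v D z = sv (gp \<nu>) \<epsilon>)" if "z \<in> verts Q2" for z
      using that by (auto simp: Q2_verts sv_pow)
    from *[OF x] *[OF y] show "x = y"
      using eq sv_E1_not_E2 E1_free gp_inj gp_closed by metis
  qed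
  show "phi_v D ` verts Q2 = verts Q"
  proof (intro equalityI subsetI)
    fix v assume "v \<in> phi_v D ` verts Q2"
    then show "v \<in> verts Q" by (auto simp: Q2_verts sv_pow)
  next
    fix v assume "v \<in> verts Q"
    then show "v \<in> phi_v D ` verts Q2"
    proof (cases rule: vert_cases)
      case fixed
      then show ?thesis by (intro image_eqI[of _ _ "Eta (EtaMu v 0)"]) (auto simp: Q2_verts)
    next
      case (free \<epsilon> h)
      then obtain \<nu> where "\<nu> < n" "h = gp \<nu>" using DD.g_pow_exhaust by metis
      then show ?thesis using free
        by (intro image_eqI[of _ _ "EtaMu (Eta \<epsilon>) \<nu>"]) (auto simp: Q2_verts sv_pow)
    qed
  qed
qed

lemma sa_inj: "h \<in> carrier G \<Longrightarrow> a \<in> arcs Q \<Longrightarrow> b \<in> arcs Q \<Longrightarrow> sa h a = sa h b \<Longrightarrow> a = b"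
  using sa_mult[of "inv\<^bsub>G\<^esub> h" h a] sa_mult[of "inv\<^bsub>G\<^esub> h" h b] by simp

text \<open>A common end in \<open>E1\<close> pins down the group element, since free vertices have
  trivial stabilisers and one representative per orbit.\<close>

lemma sa_orbit:
  assumes "a \<in> arcs Q" "b \<in> arcs Q" "h \<in> carrier G" "h' \<in> carrier G" "sa h a = sa h' b"
    "(tail Q a \<in> E1 \<and> tail Q b \<in> E1) \<or> (head Q a \<in> E1 \<and> head Q b \<in> E1)"
  shows "a = b \<and> h = h'"
proof -
  have "sv h (tail Q a) = sv h' (tail Q b)" "sv h (head Q a) = sv h' (head Q b)"
    using arg_cong[OF assms(5), of "tail Q"] arg_cong[OF assms(5), of "head Q"] assms(1-4) by simp_all
  then have "h = h'" using assms(3,4,6) E1_free by blast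
  then show ?thesis using assms sa_inj by blast
qed

lemma phi_a_ends:
  assumes "y \<in> arcs Q2"
  shows "phi_a n D y \<in> arcs Q" "tail Q (phi_a n D y) = phi_v D (tail Q2 y)" "head Q (phi_a n D y) = phi_v D (head Q2 y)"
proof -
  from assms have "phi_a n D y \<in> arcs Q \<and> tail Q (phi_a n D y) = phi_v D (tail Q2 y) \<and> head Q (phi_a n D y) = phi_v D (head Q2 y)"
  proof (cases rule: Q2_arc_cases)
    case (4 a)
    then show ?thesis using Q1_ends(3)[OF 4(1), of "b_ind n \<zeta> D a"] src_DG[OF 4(1)] by (simp add: arr4_iff)
  next
    case (3 a \<nu>)
    then have "a \<in> arcs Q" "tail Q a \<in> E2" "head Q a \<in> E1" by (simp_all add: arr3_iff)
    then show ?thesis using Q1_ends(2)[OF 3(1), of 0] 3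
      by (simp add: TilMu_in_DG phi_v_simps phi_a_simps del: phi_a.simps phi_v.simps(2))
  next
    case (2 a \<nu>)
    then have a: "a \<in> arcs Q" "tail Q a \<in> E1" "head Q a \<in> E2" by (simp_all add: arr2_iff)
    then have "a \<notin> arr3 D" using not_E1_E2 by (auto simp: arr3_iff)
    then show ?thesis using Q1_ends(1)[OF 2(1), of 0] 2 a
      by (simp add: TilMu_in_DG phi_v_simps phi_a_simps del: phi_a.simps phi_v.simps(2))
  next
    case (1 a \<nu>)
    let ?k = "sub \<nu> (t_ind n D a)"
    have a: "a \<in> arcs Q" "head Q a \<in> E1" using 1 by (simp_all add: arr1_iff)
    note s = arr1_src[OF 1(1)]
    \<comment> \<open>The source of \<alpha> is already g^t applied to its representative, with t =
      t(\<alpha>). The shift by -t in \<phi> compensates for this.\<close>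
    have "sv (gp ?k) (tail Q a) = sv (gp \<nu>) (src_rep n D a)"
      using s by (simp add: gp_sub flip: sv_mult)
    then show ?thesis using 1 a s
      by (simp add: TilMu_in_DG phi_v_simps phi_a_simps b_ind_DG del: phi_a.simps phi_v.simps(2))
  qed
  then show "phi_a n D y \<in> arcs Q" "tail Q (phi_a n D y) = phi_v D (tail Q2 y)" "head Q (phi_a n D y) = phi_v D (head Q2 y)"
    by simp_all
qed

lemma phi_a_inj: "inj_on (phi_a n D) (arcs Q2)"
proof (rule inj_onI)
  fix x y assume x: "x \<in> arcs Q2" and y: "y \<in> arcs Q2" and eq: "phi_a n D x = phi_a n D y"
  have ends: "tail Q (sa (gp k) a) \<in> E2 \<longleftrightarrow> tail Q a \<in> E2" "head Q (sa (gp k) a) \<in> E2 \<longleftrightarrow> head Q a \<in> E2"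
    if "a \<in> arcs Q" for a k
    using that by (simp_all add: sv_E2_iff)
  \<comment> \<open>The type of an arrow can be read off from which ends of its image are fixed, so
    only arrows of the same type can collide.\<close>
  have shape: "(\<exists>a\<in>arr4 D. z = Til (TilMu a (b_ind n \<zeta> D a)) \<and> phi_a n D z = a \<and>
        tail Q (phi_a n D z) \<in> E2 \<and> head Q (phi_a n D z) \<in> E2) \<or>
      (\<exists>a\<in>arr3 D. \<exists>\<nu><n. z = TilMu (TilMu a 0) \<nu> \<and> phi_a n D z = sa (gp \<nu>) a \<and>
        tail Q (phi_a n D z) \<in> E2 \<and> head Q (phi_a n D z) \<notin> E2) \<or>
      (\<exists>a\<in>arr2 D. \<exists>\<nu><n. z = TilMu (TilMu a 0) \<nu> \<and> phi_a n D z = sa (gp \<nu>) a \<and>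
        tail Q (phi_a n D z) \<notin> E2 \<and> head Q (phi_a n D z) \<in> E2) \<or>
      (\<exists>a\<in>arr1 n D. \<exists>\<nu><n. z = TilMu (Til a) \<nu> \<and> phi_a n D z = sa (gp (sub \<nu> (t_ind n D a))) a \<and>
        tail Q (phi_a n D z) \<notin> E2 \<and> head Q (phi_a n D z) \<notin> E2)"
    (is "?s4 z \<or> ?s3 z \<or> ?s2 z \<or> ?s1 z") if "z \<in> arcs Q2" for z
    using that
  proof (cases rule: Q2_arc_cases)
    case (4 a)
    then have "?s4 z" by (auto simp: arr4_iff)
    then show ?thesis by blast
  next
    case (3 a \<nu>)
    then have a: "a \<in> arcs Q" "tail Q a \<in> E2" "head Q a \<notin> E2" using not_E1_E2 by (auto simp: arr3_iff)
    have "?s3 z" using 3 ends[OF a(1)] a by (intro bexI[of _ a] exI[of _ \<nu>]) (simp_all only: phi_a_simps simp_thms)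
    then show ?thesis by blast
  next
    case (2 a \<nu>)
    then have a: "a \<in> arcs Q" "tail Q a \<notin> E2" "head Q a \<in> E2" using not_E1_E2 by (auto simp: arr2_iff)
    have "?s2 z" using 2 ends[OF a(1)] a by (intro bexI[of _ a] exI[of _ \<nu>]) (simp_all only: phi_a_simps simp_thms)
    then show ?thesis by blast
  next
    case (1 a \<nu>)
    then have a: "a \<in> arcs Q" "tail Q a \<notin> E2" "head Q a \<notin> E2" using not_E1_E2 by (auto simp: arr1_iff)
    have "?s1 z" using 1 ends[OF a(1)] a by (intro bexI[of _ a] exI[of _ \<nu>]) (simp_all only: phi_a_simps simp_thms)
    then show ?thesis by blast
  qed
  consider "?s4 x" "?s4 y" | "?s3 x" "?s3 y" | "?s2 x" "?s2 y" | "?s1 x" "?s1 y"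
    using shape[OF x] shape[OF y] unfolding eq by blast
  then show "x = y"
  proof cases
    case 1
    then obtain a b where "x = Til (TilMu a (b_ind n \<zeta> D a))" "phi_a n D x = a"
      "y = Til (TilMu b (b_ind n \<zeta> D b))" "phi_a n D y = b" by blast
    then show ?thesis using eq by simp
  next
    case 2
    then obtain a b \<nu> \<nu>' where *: "x = TilMu (TilMu a 0) \<nu>" "phi_a n D x = sa (gp \<nu>) a" "a \<in> arr3 D" "\<nu> < n"
      "y = TilMu (TilMu b 0) \<nu>'" "phi_a n D y = sa (gp \<nu>') b" "b \<in> arr3 D" "\<nu>' < n" by blast
    then have "a = b \<and> gp \<nu> = gp \<nu>'" using eq by (intro sa_orbit) (simp_all add: arr3_iff)
    then show ?thesis using * gp_inj by blast
  next
    case 3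
    then obtain a b \<nu> \<nu>' where *: "x = TilMu (TilMu a 0) \<nu>" "phi_a n D x = sa (gp \<nu>) a" "a \<in> arr2 D" "\<nu> < n"
      "y = TilMu (TilMu b 0) \<nu>'" "phi_a n D y = sa (gp \<nu>') b" "b \<in> arr2 D" "\<nu>' < n" by blast
    then have "a = b \<and> gp \<nu> = gp \<nu>'" using eq by (intro sa_orbit) (simp_all add: arr2_iff)
    then show ?thesis using * gp_inj by blast
  next
    case 4
    then obtain a b \<nu> \<nu>' where *: "x = TilMu (Til a) \<nu>" "phi_a n D x = sa (gp (sub \<nu> (t_ind n D a))) a"
      "a \<in> arr1 n D" "\<nu> < n" "y = TilMu (Til b) \<nu>'" "phi_a n D y = sa (gp (sub \<nu>' (t_ind n D b))) b"
      "b \<in> arr1 n D" "\<nu>' < n" by blast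
    then have ab: "a = b \<and> gp (sub \<nu> (t_ind n D a)) = gp (sub \<nu>' (t_ind n D b))"
      using eq by (intro sa_orbit) (simp_all add: arr1_iff)
    then have "sub \<nu> (t_ind n D a) = sub \<nu>' (t_ind n D a)" using gp_inj sub_less by metis
    then have "\<nu> = \<nu>'" using sub_inj * by blast
    then show ?thesis using * ab by blast
  qed
qed

lemma sa_inv: "h \<in> carrier G \<Longrightarrow> a \<in> arcs Q \<Longrightarrow> sa h (sa (inv\<^bsub>G\<^esub> h) a) = a"
  by (simp flip: sa_mult)

lemma phi_a_surj: "phi_a n D ` arcs Q2 = arcs Q"
proof (intro equalityI subsetI)
  fix a assume "a \<in> phi_a n D ` arcs Q2"
  then show "a \<in> arcs Q" using phi_a_ends(1) by blast
next
  fix a assume a: "a \<in> arcs Q"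
  have v: "tail Q a \<in> verts Q" "head Q a \<in> verts Q" using a by simp_all
  have rep: "\<exists>\<epsilon>\<in>E1. \<exists>\<nu><n. v = sv (gp \<nu>) \<epsilon> \<and> sv (inv\<^bsub>G\<^esub> (gp \<nu>)) v = \<epsilon>" if v: "v \<in> verts Q" "v \<notin> E2" for v
    using v(1)
  proof (cases rule: vert_cases)
    case (free \<epsilon> h)
    then obtain \<nu> where \<nu>: "\<nu> < n" "h = gp \<nu>" using DD.g_pow_exhaust by metis
    have "sv (inv\<^bsub>G\<^esub> (gp \<nu>)) (sv (gp \<nu>) \<epsilon>) = \<epsilon>" using free(1) by (simp flip: sv_mult)
    then show ?thesis using free \<nu> by blast
  qed (use v in simp)
  consider "tail Q a \<in> E2" "head Q a \<in> E2" | "tail Q a \<in> E2" "head Q a \<notin> E2"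
    | "tail Q a \<notin> E2" "head Q a \<in> E2" | "tail Q a \<notin> E2" "head Q a \<notin> E2" by blast
  then show "a \<in> phi_a n D ` arcs Q2"
  proof cases
    case 1
    then have "a \<in> arr4 D" using a by (simp add: arr4_iff)
    then have "Til (TilMu a (b_ind n \<zeta> D a)) \<in> arcs Q2" by (auto simp: Q2_arcs)
    then show ?thesis by (intro image_eqI[of _ _ "Til (TilMu a (b_ind n \<zeta> D a))"]) simp_all
  next
    case 2
    then obtain \<epsilon> \<nu> where \<epsilon>: "\<epsilon> \<in> E1" "\<nu> < n" "sv (inv\<^bsub>G\<^esub> (gp \<nu>)) (head Q a) = \<epsilon>" using rep[OF v(2)] by blast
    \<comment> \<open>Move the free end to its representative, which makes the arrow one of those
      used to build the first quiver; the index \<nu> records the way back. The remaining cases do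
      the same.\<close>
    let ?b = "sa (inv\<^bsub>G\<^esub> (gp \<nu>)) a"
    have "?b \<in> arr3 D" using a \<epsilon> 2 by (simp add: arr3_iff)
    then have "TilMu (TilMu ?b 0) \<nu> \<in> arcs Q2" using \<epsilon> by (auto simp: Q2_arcs)
    then show ?thesis using a
      by (intro image_eqI[of _ _ "TilMu (TilMu ?b 0) \<nu>"]) (simp_all add: phi_a_simps sa_inv del: phi_a.simps)
  next
    case 3
    then obtain \<epsilon> \<nu> where \<epsilon>: "\<epsilon> \<in> E1" "\<nu> < n" "sv (inv\<^bsub>G\<^esub> (gp \<nu>)) (tail Q a) = \<epsilon>" using rep[OF v(1)] by blast
    let ?b = "sa (inv\<^bsub>G\<^esub> (gp \<nu>)) a"
    have "?b \<in> arr2 D" using a \<epsilon> 3 by (simp add: arr2_iff)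
    then have "TilMu (TilMu ?b 0) \<nu> \<in> arcs Q2" using \<epsilon> by (auto simp: Q2_arcs)
    then show ?thesis using a
      by (intro image_eqI[of _ _ "TilMu (TilMu ?b 0) \<nu>"]) (simp_all add: phi_a_simps sa_inv del: phi_a.simps)
  next
    case 4
    then obtain \<epsilon> \<nu> where \<epsilon>: "\<epsilon> \<in> E1" "\<nu> < n" "sv (inv\<^bsub>G\<^esub> (gp \<nu>)) (head Q a) = \<epsilon>" using rep[OF v(2)] by blast
    let ?b = "sa (inv\<^bsub>G\<^esub> (gp \<nu>)) a"
    let ?t = "t_ind n D ?b"
    have b: "?b \<in> arr1 n D" using a \<epsilon> 4 v by (simp add: arr1_iff sv_E2_iff)
    \<comment> \<open>For type (1) the map subtracts t from the index, so t is added beforehand to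
      return with exponent \<nu>.\<close>
    let ?\<nu> = "(\<nu> + ?t) mod n"
    have "gp (sub ?\<nu> ?t) \<otimes>\<^bsub>G\<^esub> gp ?t = gp \<nu> \<otimes>\<^bsub>G\<^esub> gp ?t"
      using DD.g_closed by (simp add: gp_sub(1) DD.g_pow_mod G.nat_pow_mult)
    then have "gp (sub ?\<nu> ?t) = gp \<nu>" by (simp add: G.r_cancel)
    then have "phi_a n D (TilMu (Til ?b) ?\<nu>) = a" using a by (simp add: phi_a_simps sa_inv del: phi_a.simps)
    moreover have "TilMu (Til ?b) ?\<nu> \<in> arcs Q2" using b DD.n_pos by (auto simp: Q2_arcs)
    ultimately show ?thesis by (metis image_eqI)
  qed
qed

lemma phi_quiver_iso: "quiver_iso Q2 Q (phi_v D) (phi_a n D)"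
  using phi_v_bij phi_a_inj phi_a_surj phi_a_ends by (simp add: quiver_iso_def bij_betw_def)

end

section \<open>Values of the isomorphism on vertices and arrows\<close>

context cyclic_qp_action
begin

abbreviation vG where "vG \<equiv> skew_vert_elt \<Lambda> G g n \<zeta> rv"
abbreviation aG where "aG \<equiv> skew_arr_elt \<Lambda> G \<rho>\<Lambda> g n \<zeta> D ra"
abbreviation vGG where "vGG \<equiv> skew_vert_elt DD.\<Gamma> DD.Gd DD.\<chi> n \<zeta> vG"
abbreviation aGG where "aGG \<equiv> skew_arr_elt DD.\<Gamma> DD.Gd DD.\<delta>\<Gamma> DD.\<chi> n \<zeta> DG aG"

lemma sv_image_E: "h \<in> carrier G \<Longrightarrow> sv h ` (E1 \<union> E2) \<subseteq> verts Q" "E1 \<union> E2 \<subseteq> verts Q"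
  by auto

lemma E2_in_image: "v \<in> E2 \<Longrightarrow> h \<in> carrier G \<Longrightarrow> v \<in> sv h ` (E1 \<union> E2)"
  by (rule image_eqI[of _ _ v]) simp_all

lemma e_rv: "v \<in> verts Q \<Longrightarrow> DD.e \<otimes>\<^bsub>\<Lambda>\<^esub> rv v = (if v \<in> E1 \<union> E2 then rv v else \<zero>\<^bsub>\<Lambda>\<^esub>)"
  "v \<in> verts Q \<Longrightarrow> rv v \<otimes>\<^bsub>\<Lambda>\<^esub> DD.e = (if v \<in> E1 \<union> E2 then rv v else \<zero>\<^bsub>\<Lambda>\<^esub>)"
  unfolding DD_e by (rule vsum_rv[OF sv_image_E(2)]; assumption)+

lemma e_ra: "a \<in> arcs Q \<Longrightarrow> DD.e \<otimes>\<^bsub>\<Lambda>\<^esub> ra a = (if head Q a \<in> E1 \<union> E2 then ra a else \<zero>\<^bsub>\<Lambda>\<^esub>)"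
  "a \<in> arcs Q \<Longrightarrow> ra a \<otimes>\<^bsub>\<Lambda>\<^esub> DD.e = (if tail Q a \<in> E1 \<union> E2 then ra a else \<zero>\<^bsub>\<Lambda>\<^esub>)"
  unfolding DD_e by (rule vsum_ra[OF sv_image_E(2)]; assumption)+

lemma rv_act_e: "v \<in> E2 \<Longrightarrow> h \<in> carrier G \<Longrightarrow> rv v \<otimes>\<^bsub>\<Lambda>\<^esub> \<rho>\<Lambda> h DD.e = rv v"
  unfolding DD_e \<rho>\<Lambda>_vsum[OF _ sv_image_E(2)]
  using vsum_rv(2)[OF sv_image_E(1), of h v] E2_in_image[of v h] by simp

lemma ra_act_e: "a \<in> arcs Q \<Longrightarrow> tail Q a \<in> E2 \<Longrightarrow> h \<in> carrier G \<Longrightarrow> ra a \<otimes>\<^bsub>\<Lambda>\<^esub> \<rho>\<Lambda> h DD.e = ra a"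
  unfolding DD_e \<rho>\<Lambda>_vsum[OF _ sv_image_E(2)]
  using vsum_ra(2)[OF sv_image_E(1), of h a] E2_in_image[of "tail Q a" h] by simp

text \<open>Consequently \<open>e\<close> annihilates every proper translate of a vertex of
  \<open>E1\<close>. This matches the single surviving component in the formulas for
  \<open>T\<close>.\<close>

lemma sv_E1_in_E:
  assumes "\<epsilon> \<in> E1" "h \<in> carrier G" shows "sv h \<epsilon> \<in> E1 \<union> E2 \<longleftrightarrow> h = \<one>\<^bsub>G\<^esub>"
proof
  assume "sv h \<epsilon> \<in> E1 \<union> E2"
  then have "sv h \<epsilon> \<in> E1" using sv_E1_not_E2[OF assms] by blast
  then show "h = \<one>\<^bsub>G\<^esub>" using E1_free[of "sv h \<epsilon>" \<epsilon> "\<one>\<^bsub>G\<^esub>" h] assms by simp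
qed (use assms in simp)

lemma e_rv_orbit:
  assumes "\<epsilon> \<in> E1" "h \<in> carrier G"
  shows "DD.e \<otimes>\<^bsub>\<Lambda>\<^esub> rv (sv h \<epsilon>) = (if h = \<one>\<^bsub>G\<^esub> then rv \<epsilon> else \<zero>\<^bsub>\<Lambda>\<^esub>)"
  using assms e_rv(1)[of "sv h \<epsilon>"] sv_E1_in_E[OF assms] by simp

lemma e_ra_orbit:
  assumes "a \<in> arcs Q" "head Q a \<in> E1" "h \<in> carrier G"
  shows "DD.e \<otimes>\<^bsub>\<Lambda>\<^esub> ra (sa h a) = (if h = \<one>\<^bsub>G\<^esub> then ra a else \<zero>\<^bsub>\<Lambda>\<^esub>)"
  using assms e_ra(1)[of "sa h a"] sv_E1_in_E[OF assms(2,3)] by simp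

lemma vG_simps:
  "vG (Eta \<epsilon>) = skew_tensor \<Lambda> G (rv \<epsilon>) (grp_elt \<one>\<^bsub>G\<^esub>)"
  "vG (EtaMu \<epsilon> \<kappa>) = skew_tensor \<Lambda> G (rv \<epsilon>) (grp_idem G g n \<zeta> \<kappa>)"
  by (simp_all add: skew_vert_elt_def)

lemma vG_\<Gamma>: "\<epsilon> \<in> E1 \<Longrightarrow> vG (Eta \<epsilon>) \<in> carrier DD.\<Gamma>" "\<epsilon> \<in> E2 \<Longrightarrow> vG (EtaMu \<epsilon> \<kappa>) \<in> carrier DD.\<Gamma>"
  unfolding vG_simps
  by (rule DD.tensor_\<Gamma>; simp add: e_rv rv_act_e grp_elt_def split: if_splits)+

lemma finsum_rv_smult: "U \<subseteq> verts Q \<Longrightarrow> (\<Oplus>\<^bsub>\<Lambda>\<^esub>\<epsilon>\<in>U. c \<odot>\<^bsub>\<Lambda>\<^esub> rv \<epsilon>) = c \<odot>\<^bsub>\<Lambda>\<^esub> vsum U"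
  unfolding vsum_def by (rule L.smult_finsum[symmetric]) auto

text \<open>At each fixed vertex the n idempotents e_\<kappa> sum to 1, so the sum over the vertices
  of the first quiver collapses to e \<otimes> 1.\<close>

lemma sum_vG_eta: "(\<Oplus>\<^bsub>L.S\<^esub>x\<in>verts Q1. vG x) = DD.\<eta>"
proof (rule L.skew_ext)
  have c: "vG x \<in> carrier L.S" if "x \<in> verts Q1" for x
    using that by (auto simp: vG_simps L.skew_tensor_closed)
  then show "(\<Oplus>\<^bsub>L.S\<^esub>x\<in>verts Q1. vG x) \<in> carrier L.S" by (auto intro!: L.S.finsum_closed)
  fix h assume h: "h \<in> carrier G"
  let ?c = "if h = \<one>\<^bsub>G\<^esub> then 1 else 0 :: 'k"
  let ?B = "\<lambda>\<epsilon>. EtaMu \<epsilon> ` {..<n}"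
  have split: "verts Q1 = Eta ` E1 \<union> (\<Union>\<epsilon>\<in>E2. ?B \<epsilon>)" by auto
  have vc: "vG x h \<in> carrier \<Lambda>" if "x \<in> verts Q1" for x using c[OF that] h by auto
  have "(\<Oplus>\<^bsub>L.S\<^esub>x\<in>verts Q1. vG x) h = (\<Oplus>\<^bsub>\<Lambda>\<^esub>x\<in>verts Q1. vG x h)"
    by (rule L.skew_finsum_app[OF h c])
  also have "\<dots> = (\<Oplus>\<^bsub>\<Lambda>\<^esub>x\<in>Eta ` E1. vG x h) \<oplus>\<^bsub>\<Lambda>\<^esub> (\<Oplus>\<^bsub>\<Lambda>\<^esub>x\<in>(\<Union>\<epsilon>\<in>E2. ?B \<epsilon>). vG x h)"
    unfolding split using vc by (intro L.finsum_Un_disjoint) auto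
  also have "(\<Oplus>\<^bsub>\<Lambda>\<^esub>x\<in>Eta ` E1. vG x h) = (\<Oplus>\<^bsub>\<Lambda>\<^esub>\<epsilon>\<in>E1. vG (Eta \<epsilon>) h)"
    using vc by (intro L.finsum_reindex) (auto simp: inj_on_def)
  also have "\<dots> = (\<Oplus>\<^bsub>\<Lambda>\<^esub>\<epsilon>\<in>E1. ?c \<odot>\<^bsub>\<Lambda>\<^esub> rv \<epsilon>)"
    using h by (intro L.finsum_cong'[OF refl]) (simp_all add: vG_simps L.skew_tensor_app grp_elt_def)
  also have "\<dots> = ?c \<odot>\<^bsub>\<Lambda>\<^esub> vsum E1" by (rule finsum_rv_smult[OF E_verts(1)])
  also have "(\<Oplus>\<^bsub>\<Lambda>\<^esub>x\<in>(\<Union>\<epsilon>\<in>E2. ?B \<epsilon>). vG x h) = (\<Oplus>\<^bsub>\<Lambda>\<^esub>\<epsilon>\<in>E2. \<Oplus>\<^bsub>\<Lambda>\<^esub>x\<in>?B \<epsilon>. vG x h)"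
    using vc by (intro L.add.finprod_UN_disjoint) (auto simp: pairwise_def disjnt_iff)
  also have "\<dots> = (\<Oplus>\<^bsub>\<Lambda>\<^esub>\<epsilon>\<in>E2. ?c \<odot>\<^bsub>\<Lambda>\<^esub> rv \<epsilon>)"
  proof (rule L.finsum_cong'[OF refl])
    fix \<epsilon> assume \<epsilon>: "\<epsilon> \<in> E2"
    have "(\<Oplus>\<^bsub>\<Lambda>\<^esub>x\<in>?B \<epsilon>. vG x h) = (\<Oplus>\<^bsub>\<Lambda>\<^esub>\<kappa>\<in>{..<n}. vG (EtaMu \<epsilon> \<kappa>) h)"
      using vc \<epsilon> by (intro L.finsum_reindex) (auto simp: inj_on_def)
    also have "\<dots> = (\<Oplus>\<^bsub>\<Lambda>\<^esub>\<kappa>\<in>{..<n}. grp_idem G g n \<zeta> \<kappa> h \<odot>\<^bsub>\<Lambda>\<^esub> rv \<epsilon>)"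
      using h \<epsilon> by (intro L.finsum_cong'[OF refl]) (simp_all add: vG_simps L.skew_tensor_app)
    also have "\<dots> = (\<Sum>\<kappa><n. grp_idem G g n \<zeta> \<kappa> h) \<odot>\<^bsub>\<Lambda>\<^esub> rv \<epsilon>"
      using \<epsilon> by (intro L.sum_smult[symmetric]) simp_all
    finally show "(\<Oplus>\<^bsub>\<Lambda>\<^esub>x\<in>?B \<epsilon>. vG x h) = ?c \<odot>\<^bsub>\<Lambda>\<^esub> rv \<epsilon>" by (simp only: DD.sum_grp_idem[OF h])
  qed simp
  also have "\<dots> = ?c \<odot>\<^bsub>\<Lambda>\<^esub> vsum E2" by (rule finsum_rv_smult[OF E_verts(2)])
  also have "?c \<odot>\<^bsub>\<Lambda>\<^esub> vsum E1 \<oplus>\<^bsub>\<Lambda>\<^esub> ?c \<odot>\<^bsub>\<Lambda>\<^esub> vsum E2 = DD.\<eta> h"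
    unfolding DD.\<eta>_def using h E_verts
    by (simp add: L.skew_tensor_app grp_elt_def DD.e_def L.smult_r_distr del: if_split_asm)
  finally show "(\<Oplus>\<^bsub>L.S\<^esub>x\<in>verts Q1. vG x) h = DD.\<eta> h" .
qed simp

lemma sum_vG_t: "(\<Oplus>\<^bsub>L.S\<^esub>s\<in>reps_free DG \<union> reps_fixed DG. vG s) = DD.t"
proof (rule L.skew_ext)
  let ?I = "(\<lambda>\<epsilon>. EtaMu \<epsilon> 0) ` E2 \<union> Eta ` E1"
  have I: "reps_free DG \<union> reps_fixed DG = ?I" by auto
  have c: "vG x \<in> carrier L.S" if "x \<in> ?I" for x
    using that by (auto simp: vG_simps L.skew_tensor_closed)
  then show "(\<Oplus>\<^bsub>L.S\<^esub>s\<in>reps_free DG \<union> reps_fixed DG. vG s) \<in> carrier L.S"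
    unfolding I by (auto intro!: L.S.finsum_closed)
  fix h assume h: "h \<in> carrier G"
  let ?c = "if h = \<one>\<^bsub>G\<^esub> then 1 else 0 :: 'k"
  have vc: "vG x h \<in> carrier \<Lambda>" if "x \<in> ?I" for x using c[OF that] h by auto
  have "(\<Oplus>\<^bsub>L.S\<^esub>s\<in>?I. vG s) h = (\<Oplus>\<^bsub>\<Lambda>\<^esub>x\<in>?I. vG x h)"
    by (rule L.skew_finsum_app[OF h c])
  also have "\<dots> = (\<Oplus>\<^bsub>\<Lambda>\<^esub>x\<in>(\<lambda>\<epsilon>. EtaMu \<epsilon> 0) ` E2. vG x h) \<oplus>\<^bsub>\<Lambda>\<^esub> (\<Oplus>\<^bsub>\<Lambda>\<^esub>x\<in>Eta ` E1. vG x h)"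
    using vc by (intro L.finsum_Un_disjoint) auto
  also have "(\<Oplus>\<^bsub>\<Lambda>\<^esub>x\<in>Eta ` E1. vG x h) = (\<Oplus>\<^bsub>\<Lambda>\<^esub>\<epsilon>\<in>E1. vG (Eta \<epsilon>) h)"
    using vc by (intro L.finsum_reindex) (auto simp: inj_on_def)
  also have "\<dots> = (\<Oplus>\<^bsub>\<Lambda>\<^esub>\<epsilon>\<in>E1. ?c \<odot>\<^bsub>\<Lambda>\<^esub> rv \<epsilon>)"
    using h by (intro L.finsum_cong'[OF refl]) (simp_all add: vG_simps L.skew_tensor_app grp_elt_def)
  also have "\<dots> = ?c \<odot>\<^bsub>\<Lambda>\<^esub> vsum E1" by (rule finsum_rv_smult[OF E_verts(1)])
  also have "(\<Oplus>\<^bsub>\<Lambda>\<^esub>x\<in>(\<lambda>\<epsilon>. EtaMu \<epsilon> 0) ` E2. vG x h) = (\<Oplus>\<^bsub>\<Lambda>\<^esub>\<epsilon>\<in>E2. vG (EtaMu \<epsilon> 0) h)"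
    using vc by (intro L.finsum_reindex) (auto simp: inj_on_def)
  also have "\<dots> = (\<Oplus>\<^bsub>\<Lambda>\<^esub>\<epsilon>\<in>E2. inverse (of_nat n) \<odot>\<^bsub>\<Lambda>\<^esub> rv \<epsilon>)"
    using h by (intro L.finsum_cong'[OF refl]) (simp_all add: vG_simps L.skew_tensor_app DD.grp_idem_app)
  also have "\<dots> = inverse (of_nat n) \<odot>\<^bsub>\<Lambda>\<^esub> vsum E2" by (rule finsum_rv_smult[OF E_verts(2)])
  also have "\<dots> \<oplus>\<^bsub>\<Lambda>\<^esub> ?c \<odot>\<^bsub>\<Lambda>\<^esub> vsum E1 = DD.t h"
    using h E_verts by (simp add: DD.t_app L.a_comm)
  finally show "(\<Oplus>\<^bsub>L.S\<^esub>s\<in>reps_free DG \<union> reps_fixed DG. vG s) h = DD.t h" unfolding I .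
qed simp

lemma sum_vG_theta:
  "(\<Oplus>\<^bsub>DD.R\<^esub>s\<in>reps_free DG \<union> reps_fixed DG. skew_tensor DD.\<Gamma> DD.Gd (vG s) (grp_elt \<one>\<^bsub>DD.Gd\<^esub>)) = DD.\<theta>"
proof (rule DD.R.skew_ext)
  let ?I = "reps_free DG \<union> reps_fixed DG"
  have \<Gamma>: "vG s \<in> carrier DD.\<Gamma>" if "s \<in> ?I" for s
    using that vG_\<Gamma> by auto
  then have S: "vG s \<in> carrier L.S" if "s \<in> ?I" for s using that DD.\<Gamma>_closed by blast
  have c: "skew_tensor DD.\<Gamma> DD.Gd (vG s) (grp_elt \<one>\<^bsub>DD.Gd\<^esub>) \<in> carrier DD.R" if "s \<in> ?I" for s
    using \<Gamma>[OF that] by (rule DD.R.skew_tensor_closed)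
  then show "(\<Oplus>\<^bsub>DD.R\<^esub>s\<in>?I. skew_tensor DD.\<Gamma> DD.Gd (vG s) (grp_elt \<one>\<^bsub>DD.Gd\<^esub>)) \<in> carrier DD.R"
    by (auto intro!: DD.R.S.finsum_closed)
  fix \<psi> assume \<psi>: "\<psi> \<in> carrier DD.Gd"
  let ?c = "if \<psi> = \<one>\<^bsub>DD.Gd\<^esub> then 1 else 0 :: 'k"
  have "(\<Oplus>\<^bsub>DD.R\<^esub>s\<in>?I. skew_tensor DD.\<Gamma> DD.Gd (vG s) (grp_elt \<one>\<^bsub>DD.Gd\<^esub>)) \<psi> =
    (\<Oplus>\<^bsub>DD.\<Gamma>\<^esub>s\<in>?I. skew_tensor DD.\<Gamma> DD.Gd (vG s) (grp_elt \<one>\<^bsub>DD.Gd\<^esub>) \<psi>)"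
    by (rule DD.R.skew_finsum_app[OF \<psi> c])
  also have "\<dots> = (\<Oplus>\<^bsub>L.S\<^esub>s\<in>?I. skew_tensor DD.\<Gamma> DD.Gd (vG s) (grp_elt \<one>\<^bsub>DD.Gd\<^esub>) \<psi>)"
    by (rule DD.\<Gamma>_finsum) (rule DD.R.skew_app[OF c \<psi>])
  also have "\<dots> = (\<Oplus>\<^bsub>L.S\<^esub>s\<in>?I. ?c \<odot>\<^bsub>L.S\<^esub> vG s)"
    using \<psi> S by (intro L.S.finsum_cong'[OF refl]) (simp_all add: DD.R.skew_tensor_app grp_elt_def Pi_def del: DG_simps)
  also have "\<dots> = ?c \<odot>\<^bsub>L.S\<^esub> DD.t"
    unfolding sum_vG_t[symmetric] using S by (intro L.S.smult_finsum[symmetric]) blast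
  also have "\<dots> = DD.\<theta> \<psi>" using \<psi> by (simp add: DD.\<theta>_app)
  finally show "(\<Oplus>\<^bsub>DD.R\<^esub>s\<in>?I. skew_tensor DD.\<Gamma> DD.Gd (vG s) (grp_elt \<one>\<^bsub>DD.Gd\<^esub>)) \<psi> = DD.\<theta> \<psi>" .
qed simp

section \<open>Images of the vertices and arrows of the second quiver\<close>

lemma inv_eq_iff: "h \<in> carrier G \<Longrightarrow> x \<in> carrier G \<Longrightarrow> x = inv\<^bsub>G\<^esub> h \<longleftrightarrow> x \<otimes>\<^bsub>G\<^esub> h = \<one>\<^bsub>G\<^esub>"
  using G.inv_equality[of x h] by auto

lemma \<rho>\<Lambda>_rv_pow: "v \<in> verts Q \<Longrightarrow> x \<in> carrier G \<Longrightarrow> \<rho>\<Lambda> x (rv (sv (gp \<nu>) v)) = rv (sv (x \<otimes>\<^bsub>G\<^esub> gp \<nu>) v)"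
  by (simp add: \<rho>\<Lambda>_rv sv_mult)

lemma \<rho>\<Lambda>_ra_pow:
  assumes "a \<in> arcs Q" "x \<in> carrier G" "tail Q a \<notin> E2 \<or> head Q a \<notin> E2"
  shows "\<rho>\<Lambda> x (ra (sa (gp \<nu>) a)) = ra (sa (x \<otimes>\<^bsub>G\<^esub> gp \<nu>) a)"
proof -
  have "tail Q (sa (gp \<nu>) a) \<notin> E2 \<or> head Q (sa (gp \<nu>) a) \<notin> E2"
    using assms by (simp add: sv_E2_iff)
  then have "sc x (sa (gp \<nu>) a) = 1" using assms by (intro sc_free) simp_all
  then show ?thesis using assms by (simp add: \<rho>\<Lambda>_ra sa_mult)
qed

lemma \<chi>_pow_0: "DD.\<chi> [^]\<^bsub>DD.Gd\<^esub> (0::nat) = \<one>\<^bsub>DD.Gd\<^esub>"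
  by simp

lemma F_vGG:
  assumes "x \<in> verts Q2"
  shows "DD.F (vGG x) = rv (phi_v D x)"
proof -
  from assms consider (fixed) \<epsilon> where "\<epsilon> \<in> E2" "x = Eta (EtaMu \<epsilon> 0)"
    | (free) \<epsilon> \<nu> where "\<epsilon> \<in> E1" "\<nu> < n" "x = EtaMu (Eta \<epsilon>) \<nu>"
    unfolding Q2_verts by auto
  then show ?thesis
  proof cases
    case fixed
    \<comment> \<open>The trivial character is written as the power \<chi>^0 to fit
      \<open>T_idem_char\<close> with \<mu> = 0.\<close>
    have x: "vGG x = skew_tensor DD.\<Gamma> DD.Gd (skew_tensor \<Lambda> G (rv \<epsilon>) (grp_idem G g n \<zeta> 0)) (grp_elt (DD.\<chi> [^]\<^bsub>DD.Gd\<^esub> (0::nat)))"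
      unfolding fixed(2) \<chi>_pow_0 by (simp add: skew_vert_elt_def)
    show ?thesis
    proof (rule DD.F_eqI_app)
      show "DD.T (vGG x) DD.w \<in> carrier L.S"
        unfolding x using fixed by (intro DD.T_tensor_closed L.skew_tensor_closed) simp
      fix y assume y: "y \<in> carrier G"
      have "DD.T (vGG x) DD.w y = rv \<epsilon>"
        unfolding x using fixed y by (subst DD.T_idem_char) (simp_all add: rv_act_e)
      then show "DD.T (vGG x) DD.w y = DD.e \<otimes>\<^bsub>\<Lambda>\<^esub> \<rho>\<Lambda> y (rv (phi_v D x))"
        using fixed y by (simp add: \<rho>\<Lambda>_rv e_rv)
    qed (use fixed in simp)
  next
    case free
    have x: "vGG x = skew_tensor DD.\<Gamma> DD.Gd (skew_tensor \<Lambda> G (rv \<epsilon>) (grp_elt \<one>\<^bsub>G\<^esub>)) (grp_idem DD.Gd DD.\<chi> n \<zeta> \<nu>)"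
      unfolding free(3) by (simp add: skew_vert_elt_def)
    have phi: "phi_v D x = sv (gp \<nu>) \<epsilon>" using phi_v_simps[OF free(1)] free(3) by simp
    show ?thesis unfolding phi
    proof (rule DD.F_eqI_app)
      show "DD.T (vGG x) DD.w \<in> carrier L.S"
        unfolding x using free by (intro DD.T_tensor_closed L.skew_tensor_closed) simp
      fix y assume y: "y \<in> carrier G"
      have "DD.T (vGG x) DD.w y = (if y = inv\<^bsub>G\<^esub> (gp \<nu>) then rv \<epsilon> else \<zero>\<^bsub>\<Lambda>\<^esub>)"
        unfolding x using free(1) y by (subst DD.T_elt_idem) (simp_all add: e_rv)
      also have "\<dots> = DD.e \<otimes>\<^bsub>\<Lambda>\<^esub> rv (sv (y \<otimes>\<^bsub>G\<^esub> gp \<nu>) \<epsilon>)"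
        using e_rv_orbit[OF free(1), of "y \<otimes>\<^bsub>G\<^esub> gp \<nu>"] y inv_eq_iff[of "gp \<nu>" y] by simp
      also have "\<dots> = DD.e \<otimes>\<^bsub>\<Lambda>\<^esub> \<rho>\<Lambda> y (rv (sv (gp \<nu>) \<epsilon>))"
        using \<rho>\<Lambda>_rv_pow[of \<epsilon> y \<nu>] free(1) y by simp
      finally show "DD.T (vGG x) DD.w y = DD.e \<otimes>\<^bsub>\<Lambda>\<^esub> \<rho>\<Lambda> y (rv (sv (gp \<nu>) \<epsilon>))" .
    qed (use free in simp)
  qed
qed

lemma aG_simps:
  "aG (Til a) = skew_tensor \<Lambda> G (ra a) (grp_elt (gp (t_ind n D a)))"
  "a \<in> arr2 D \<Longrightarrow> aG (TilMu a \<kappa>) =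
    skew_tensor \<Lambda> G \<one>\<^bsub>\<Lambda>\<^esub> (grp_idem G g n \<zeta> \<kappa>) \<otimes>\<^bsub>L.S\<^esub> skew_tensor \<Lambda> G (ra a) (grp_elt \<one>\<^bsub>G\<^esub>)"
  "a \<notin> arr2 D \<Longrightarrow> aG (TilMu a \<kappa>) = skew_tensor \<Lambda> G (ra a) (grp_idem G g n \<zeta> \<kappa>)"
  by (simp_all add: skew_arr_elt_def)

lemma aGG_simps:
  "aGG (Til y) = skew_tensor DD.\<Gamma> DD.Gd (aG y) (grp_elt (DD.\<chi> [^]\<^bsub>DD.Gd\<^esub> t_ind n DG y))"
  "y \<in> arr2 DG \<Longrightarrow> aGG (TilMu y \<nu>) =
    skew_tensor DD.\<Gamma> DD.Gd \<one>\<^bsub>DD.\<Gamma>\<^esub> (grp_idem DD.Gd DD.\<chi> n \<zeta> \<nu>) \<otimes>\<^bsub>DD.R\<^esub>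
    skew_tensor DD.\<Gamma> DD.Gd (aG y) (grp_elt \<one>\<^bsub>DD.Gd\<^esub>)"
  "y \<notin> arr2 DG \<Longrightarrow> aGG (TilMu y \<nu>) = skew_tensor DD.\<Gamma> DD.Gd (aG y) (grp_idem DD.Gd DD.\<chi> n \<zeta> \<nu>)"
  by (simp_all add: skew_arr_elt_def)

lemma F_aGG_4:
  assumes a: "a \<in> arr4 D"
  shows "DD.F (aGG (Til (TilMu a (b_ind n \<zeta> D a)))) = ra a"
proof -
  let ?b = "b_ind n \<zeta> D a"
  have a': "a \<in> arcs Q" "tail Q a \<in> E2" "head Q a \<in> E2" using a by (simp_all add: arr4_iff)
  have "a \<notin> arr2 D" using a'(2) not_E1_E2 by (auto simp: arr2_iff)
  then have eq: "aGG (Til (TilMu a ?b)) =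
    skew_tensor DD.\<Gamma> DD.Gd (skew_tensor \<Lambda> G (ra a) (grp_idem G g n \<zeta> ?b)) (grp_elt (DD.\<chi> [^]\<^bsub>DD.Gd\<^esub> ?b))"
    by (simp only: aGG_simps aG_simps src_DG[OF a] simp_thms)
  show ?thesis unfolding eq
  proof (rule DD.F_eqI_app)
    let ?f = "skew_tensor DD.\<Gamma> DD.Gd (skew_tensor \<Lambda> G (ra a) (grp_idem G g n \<zeta> ?b)) (grp_elt (DD.\<chi> [^]\<^bsub>DD.Gd\<^esub> ?b))"
    show "DD.T ?f DD.w \<in> carrier L.S"
      using a' by (intro DD.T_tensor_closed L.skew_tensor_closed) simp
    fix y assume y: "y \<in> carrier G"
    then obtain m where m: "y = gp m" using DD.g_pow_exhaust by metis
    \<comment> \<open>The value of \<chi>^b at g^m, with b = b(\<alpha>), is exactly the scalar by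
      which g^m acts on the arrow. This is why the index b(\<alpha>) gives the correct
      image.\<close>
    have "DD.T ?f DD.w y = \<zeta> ^ (m * ?b) \<odot>\<^bsub>\<Lambda>\<^esub> ra a"
      using a' y by (subst DD.T_idem_char) (simp_all add: ra_act_e m DD.dual_gen_pow_app)
    then show "DD.T ?f DD.w y = DD.e \<otimes>\<^bsub>\<Lambda>\<^esub> \<rho>\<Lambda> y (ra a)"
      using a' arr4_act_pow[OF a, of m] by (simp add: m \<rho>\<Lambda>_ra L.smult_mult_right e_ra)
  qed (use a' in simp)
qed

lemma F_aGG_3:
  assumes a: "a \<in> arr3 D" and \<nu>: "\<nu> < n"
  shows "DD.F (aGG (TilMu (TilMu a 0) \<nu>)) = ra (sa (gp \<nu>) a)"
proof -
  have a': "a \<in> arcs Q" "tail Q a \<in> E2" "head Q a \<in> E1" using a by (simp_all add: arr3_iff)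
  have "a \<notin> arr2 D" using a'(2) not_E1_E2 by (auto simp: arr2_iff)
  let ?u = "skew_tensor \<Lambda> G (ra a) (grp_idem G g n \<zeta> 0)"
  let ?f = "skew_tensor DD.\<Gamma> DD.Gd \<one>\<^bsub>DD.\<Gamma>\<^esub> (grp_idem DD.Gd DD.\<chi> n \<zeta> \<nu>) \<otimes>\<^bsub>DD.R\<^esub>
    skew_tensor DD.\<Gamma> DD.Gd ?u (grp_elt \<one>\<^bsub>DD.Gd\<^esub>)"
  have eq: "aGG (TilMu (TilMu a 0) \<nu>) = ?f"
    using \<open>a \<notin> arr2 D\<close> TilMu_in_DG(1)[of a] a by (simp only: aGG_simps aG_simps simp_thms)
  have u: "?u \<in> carrier DD.\<Gamma>"
    using a' by (intro DD.tensor_\<Gamma>) (simp_all add: ra_act_e e_ra)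
  have "\<one>\<^bsub>DD.\<Gamma>\<^esub> \<in> carrier DD.\<Gamma>" using DD.R.one_closed .
  then have fR: "?f \<in> carrier DD.R"
    using u by (intro DD.R.skew_mult_closed DD.R.skew_tensor_closed)
  show ?thesis unfolding eq
  proof (rule DD.F_eqI_app)
    show "DD.T ?f DD.w \<in> carrier L.S"
      by (rule DD.T_closed[OF DD.R_app[OF fR] DD.closed(3)])
    fix y assume y: "y \<in> carrier G"
    have "DD.T ?f DD.w y = (if y = inv\<^bsub>G\<^esub> (gp \<nu>) then DD.e \<otimes>\<^bsub>\<Lambda>\<^esub> ra a else \<zero>\<^bsub>\<Lambda>\<^esub>)"
      by (rule DD.T_mult_idem_elt) (use a' y u ra_act_e in simp_all)
    also have "\<dots> = DD.e \<otimes>\<^bsub>\<Lambda>\<^esub> ra (sa (y \<otimes>\<^bsub>G\<^esub> gp \<nu>) a)"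
      using e_ra_orbit[OF a'(1,3), of "y \<otimes>\<^bsub>G\<^esub> gp \<nu>"] y inv_eq_iff[of "gp \<nu>" y] a' by (simp add: e_ra)
    also have "\<dots> = DD.e \<otimes>\<^bsub>\<Lambda>\<^esub> \<rho>\<Lambda> y (ra (sa (gp \<nu>) a))"
      using \<rho>\<Lambda>_ra_pow[OF a'(1) y] not_E1_E2 a' by (metis (no_types))
    finally show "DD.T ?f DD.w y = DD.e \<otimes>\<^bsub>\<Lambda>\<^esub> \<rho>\<Lambda> y (ra (sa (gp \<nu>) a))" .
  qed (use a' in simp)
qed

text \<open>The head is fixed, so \<open>e\<close> keeps every translate of the arrow and both sides
  have the same form at all group elements. By \<open>A6\<close> the action contributes no scalar,
  which leaves the 1/n of \<open>T_idem_mult\<close>.\<close>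

lemma F_aGG_2:
  assumes a: "a \<in> arr2 D" and \<nu>: "\<nu> < n"
  shows "DD.F (aGG (TilMu (TilMu a 0) \<nu>)) = inverse (of_nat n) \<odot>\<^bsub>\<Lambda>\<^esub> ra (sa (gp \<nu>) a)"
proof -
  have a': "a \<in> arcs Q" "tail Q a \<in> E1" "head Q a \<in> E2" using a by (simp_all add: arr2_iff)
  have a3: "a \<notin> arr3 D" using a'(2) not_E1_E2 by (auto simp: arr3_iff)
  let ?u = "skew_tensor \<Lambda> G \<one>\<^bsub>\<Lambda>\<^esub> (grp_idem G g n \<zeta> 0) \<otimes>\<^bsub>L.S\<^esub> skew_tensor \<Lambda> G (ra a) (grp_elt \<one>\<^bsub>G\<^esub>)"
  let ?f = "skew_tensor DD.\<Gamma> DD.Gd ?u (grp_idem DD.Gd DD.\<chi> n \<zeta> \<nu>)"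
  have eq: "aGG (TilMu (TilMu a 0) \<nu>) = ?f"
    using a3 TilMu_in_DG(1)[of a] a by (simp only: aGG_simps aG_simps simp_thms)
  show ?thesis unfolding eq
  proof (rule DD.F_eqI_app)
    show "DD.T ?f DD.w \<in> carrier L.S"
      using a' by (intro DD.T_tensor_closed L.skew_mult_closed L.skew_tensor_closed) simp_all
    fix y assume y: "y \<in> carrier G"
    have ra_pow: "\<rho>\<Lambda> y (ra (sa (gp \<nu>) a)) = ra (sa (y \<otimes>\<^bsub>G\<^esub> gp \<nu>) a)"
      using a' y not_E1_E2 by (intro \<rho>\<Lambda>_ra_pow) auto
    have "sc (y \<otimes>\<^bsub>G\<^esub> gp \<nu>) a = 1" using a' y not_E1_E2 by (intro sc_free) auto
    then have "DD.T ?f DD.w y = inverse (of_nat n) \<odot>\<^bsub>\<Lambda>\<^esub> ra (sa (y \<otimes>\<^bsub>G\<^esub> gp \<nu>) a)"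
      using a' y by (simp add: DD.T_idem_mult e_ra \<rho>\<Lambda>_ra)
    also have "\<dots> = DD.e \<otimes>\<^bsub>\<Lambda>\<^esub> \<rho>\<Lambda> y (inverse (of_nat n) \<odot>\<^bsub>\<Lambda>\<^esub> ra (sa (gp \<nu>) a))"
      using a' y by (simp add: L.act_smult ra_pow L.smult_mult_right e_ra)
    finally show "DD.T ?f DD.w y = DD.e \<otimes>\<^bsub>\<Lambda>\<^esub> \<rho>\<Lambda> y (inverse (of_nat n) \<odot>\<^bsub>\<Lambda>\<^esub> ra (sa (gp \<nu>) a))" .
  qed (use a' in simp)
qed

lemma F_aGG_1:
  assumes a: "a \<in> arr1 n D" and \<nu>: "\<nu> < n"
  shows "DD.F (aGG (TilMu (Til a) \<nu>)) = ra (sa (gp (sub \<nu> (t_ind n D a))) a)"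
proof -
  have a': "a \<in> arcs Q" "tail Q a \<notin> E2" "head Q a \<in> E1" using a by (simp_all add: arr1_iff)
  let ?t = "t_ind n D a" and ?k = "sub \<nu> (t_ind n D a)"
  let ?f = "skew_tensor DD.\<Gamma> DD.Gd (skew_tensor \<Lambda> G (ra a) (grp_elt (gp ?t))) (grp_idem DD.Gd DD.\<chi> n \<zeta> \<nu>)"
  have eq: "aGG (TilMu (Til a) \<nu>) = ?f"
    using TilMu_in_DG(3)[of a] by (simp only: aGG_simps aG_simps simp_thms)
  note src = arr1_src[OF a]
  have "vsum (sv (gp ?t) ` (E1 \<union> E2)) = \<rho>\<Lambda> (gp ?t) DD.e"
    unfolding DD_e using \<rho>\<Lambda>_vsum[OF gp_closed sv_image_E(2)] by simp
  moreover have "tail Q a \<in> sv (gp ?t) ` (E1 \<union> E2)" using src by blast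
  ultimately have ae: "ra a \<otimes>\<^bsub>\<Lambda>\<^esub> \<rho>\<Lambda> (gp ?t) DD.e = ra a"
    using vsum_ra(2)[OF sv_image_E(1)[OF gp_closed] a'(1), of ?t] by simp
  show ?thesis unfolding eq
  proof (rule DD.F_eqI_app)
    show "DD.T ?f DD.w \<in> carrier L.S"
      using a' by (intro DD.T_tensor_closed L.skew_tensor_closed) simp
    fix y assume y: "y \<in> carrier G"
    \<comment> \<open>The left condition locates the one component of \<open>T f w\<close> that
      survives; the right one says that \<open>y\<close> undoes the translation by g^(\<nu>-t), so
      that \<open>e\<close> keeps the arrow. They coincide, which identifies the image.\<close>
    have "inv\<^bsub>G\<^esub> (gp ?t) \<otimes>\<^bsub>G\<^esub> y = inv\<^bsub>G\<^esub> (gp \<nu>) \<longleftrightarrow> y \<otimes>\<^bsub>G\<^esub> gp ?k = \<one>\<^bsub>G\<^esub>"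
    proof -
      have "inv\<^bsub>G\<^esub> (gp \<nu>) = inv\<^bsub>G\<^esub> (gp ?t) \<otimes>\<^bsub>G\<^esub> inv\<^bsub>G\<^esub> (gp ?k)"
        using G.inv_mult_group[OF gp_closed gp_closed, of ?k ?t] unfolding gp_sub(1) .
      then have "inv\<^bsub>G\<^esub> (gp ?t) \<otimes>\<^bsub>G\<^esub> y = inv\<^bsub>G\<^esub> (gp \<nu>) \<longleftrightarrow> y = inv\<^bsub>G\<^esub> (gp ?k)"
        using y by (simp add: G.l_cancel)
      then show ?thesis using y inv_eq_iff[of "gp ?k" y] by simp
    qed
    then have "DD.T ?f DD.w y = (if y \<otimes>\<^bsub>G\<^esub> gp ?k = \<one>\<^bsub>G\<^esub> then ra a else \<zero>\<^bsub>\<Lambda>\<^esub>)"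
      using a' y ae by (simp add: DD.T_elt_idem)
    also have "\<dots> = DD.e \<otimes>\<^bsub>\<Lambda>\<^esub> ra (sa (y \<otimes>\<^bsub>G\<^esub> gp ?k) a)"
      using e_ra_orbit[OF a'(1,3), of "y \<otimes>\<^bsub>G\<^esub> gp ?k"] y by simp
    also have "\<dots> = DD.e \<otimes>\<^bsub>\<Lambda>\<^esub> \<rho>\<Lambda> y (ra (sa (gp ?k) a))"
      using \<rho>\<Lambda>_ra_pow[OF a'(1) y] a' by (metis (no_types))
    finally show "DD.T ?f DD.w y = DD.e \<otimes>\<^bsub>\<Lambda>\<^esub> \<rho>\<Lambda> y (ra (sa (gp ?k) a))" .
  qed (use a' in simp)
qed

lemma F_aGG:
  assumes "y \<in> arcs Q2"
  shows "DD.F (aGG y) = phi_scale n D y \<odot>\<^bsub>\<Lambda>\<^esub> ra (phi_a n D y)"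
  using assms
proof (cases rule: Q2_arc_cases)
  case (4 a)
  then have "a \<in> arcs Q" by (simp add: arr4_iff)
  then show ?thesis using 4 F_aGG_4[OF 4(1)] by simp
next
  case (3 a \<nu>)
  then have a: "a \<in> arcs Q" "a \<notin> arr2 D" using not_E1_E2 by (auto simp: arr3_iff arr2_iff)
  then show ?thesis using 3 F_aGG_3[OF 3(1,2)] by (simp add: phi_a_simps del: phi_a.simps)
next
  case (2 a \<nu>)
  then have a: "a \<in> arcs Q" by (simp add: arr2_iff)
  then show ?thesis using 2 F_aGG_2[OF 2(1,2)] by (simp add: phi_a_simps del: phi_a.simps)
next
  case (1 a \<nu>)
  then have a: "a \<in> arcs Q" by (simp add: arr1_iff)
  then show ?thesis using 1 F_aGG_1[OF 1(1,2)] by (simp add: phi_a_simps del: phi_a.simps)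
qed

end

theorem corollary5p4:
  fixes Q :: "('v, 'a) pre_digraph"
    and W :: "('v, 'a) qpath \<Rightarrow> 'k::field"
    and G :: "('g, 'm) monoid_scheme"
    and g :: 'g
    and n :: nat
    and \<rho> :: "'g \<Rightarrow> (('v, 'a) qpath \<Rightarrow> 'k) \<Rightarrow> (('v, 'a) qpath \<Rightarrow> 'k)"
    and \<zeta> :: 'k
    and \<E> :: "'v set"
  defines "\<Lambda> \<equiv> jacobian_alg Q W"
    and "\<Lambda>G \<equiv> skew_alg (jacobian_alg Q W) G (jacobian_action Q W \<rho>)"
  defines "D \<equiv> gquiver_of Q G g \<rho> \<E>"
  defines "DG \<equiv> skew_gquiver n \<zeta> D"
  defines "DGG \<equiv> skew_gquiver n \<zeta> DG"
  defines "vG \<equiv> skew_vert_elt \<Lambda> G g n \<zeta> (\<lambda>v. jac_class Q W (vertex_elt v))"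
    and "aG \<equiv> skew_arr_elt \<Lambda> G (jacobian_action Q W \<rho>) g n \<zeta> D (\<lambda>\<alpha>. jac_class Q W (arrow_elt Q \<alpha>))"
  defines "\<eta> \<equiv> \<Oplus>\<^bsub>\<Lambda>G\<^esub>x\<in>verts (quiver DG). vG x"
  defines "\<Gamma> \<equiv> corner_alg \<Lambda>G \<eta>"
  defines "Gd \<equiv> dual_group G"
    and "\<chi> \<equiv> dual_gen G g \<zeta>"
    and "\<rho>d \<equiv> dual_action \<Lambda> G (carrier \<Gamma>)"
  defines "\<Gamma>Gd \<equiv> skew_alg \<Gamma> Gd \<rho>d"
  defines "vGG \<equiv> skew_vert_elt \<Gamma> Gd \<chi> n \<zeta> vG"
    and "aGG \<equiv> skew_arr_elt \<Gamma> Gd \<rho>d \<chi> n \<zeta> DG aG"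
  defines "\<theta> \<equiv> \<Oplus>\<^bsub>\<Gamma>Gd\<^esub>s\<in>reps_free DG \<union> reps_fixed DG. skew_tensor \<Gamma> Gd (vG s) (grp_elt \<one>\<^bsub>Gd\<^esub>)"
  assumes "cyclic_qp_action Q W G g n \<rho> \<zeta> \<E>"
    and "admissible_ideal Q (Idl\<^bsub>path_alg Q\<^esub> {cyc_deriv Q \<alpha> W | \<alpha>. \<alpha> \<in> arcs Q})"
  shows "quiver_iso (quiver DGG) Q (phi_v D) (phi_a n D) \<and>
    (\<exists>F \<in> alg_iso (corner_alg \<Gamma>Gd \<theta>) \<Lambda>.
       (\<forall>x\<in>verts (quiver DGG). F (vGG x) = jac_class Q W (vertex_elt (phi_v D x))) \<and>
       (\<forall>y\<in>arcs (quiver DGG).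
          F (aGG y) = phi_scale n D y \<odot>\<^bsub>\<Lambda>\<^esub> jac_class Q W (arrow_elt Q (phi_a n D y))))"
proof -
  interpret cyclic_qp_action Q W G g n \<rho> \<zeta> \<E> by fact
  \<comment> \<open>The idempotents of the statement are sums over vertices. Once they are
    identified with e \<otimes> 1 and t \<otimes> 1, all structures of the statement coincide with
    those of \<open>skew_duality\<close>.\<close>
  have \<eta>: "\<eta> = DD.\<eta>"
    unfolding \<eta>_def \<Lambda>G_def DG_def D_def vG_def \<Lambda>_def by (simp only: DG_simps sum_vG_eta)
  have \<Gamma>: "\<Gamma> = DD.\<Gamma>" unfolding \<Gamma>_def \<Lambda>G_def \<eta> ..
  have \<Gamma>Gd: "\<Gamma>Gd = DD.R" unfolding \<Gamma>Gd_def Gd_def \<rho>d_def \<Lambda>_def \<Gamma> ..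
  have \<theta>: "\<theta> = DD.\<theta>"
    unfolding \<theta>_def \<Gamma>Gd Gd_def DG_def D_def vG_def \<Lambda>_def \<Gamma> by (rule sum_vG_theta)
  have vGG: "vGG = skew_vert_elt DD.\<Gamma> DD.Gd DD.\<chi> n \<zeta> (skew_vert_elt (jacobian_alg Q W) G g n \<zeta> (\<lambda>v. jac_class Q W (vertex_elt v)))"
    unfolding vGG_def vG_def Gd_def \<chi>_def \<Lambda>_def \<Gamma> ..
  have aGG: "aGG = skew_arr_elt DD.\<Gamma> DD.Gd DD.\<delta>\<Gamma> DD.\<chi> n \<zeta>
      (skew_gquiver n \<zeta> (gquiver_of Q G g \<rho> \<E>)) (skew_arr_elt (jacobian_alg Q W) G (jacobian_action Q W \<rho>) g n \<zeta>
        (gquiver_of Q G g \<rho> \<E>) (\<lambda>\<alpha>. jac_class Q W (arrow_elt Q \<alpha>)))"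
    unfolding aGG_def aG_def Gd_def \<chi>_def \<rho>d_def DG_def D_def \<Lambda>_def \<Gamma> ..
  have "DD.F \<in> alg_iso (corner_alg \<Gamma>Gd \<theta>) \<Lambda>"
    unfolding \<Gamma>Gd \<theta> \<Lambda>_def by (rule DD.F_alg_iso)
  moreover have "DD.F (vGG x) = jac_class Q W (vertex_elt (phi_v D x))" if "x \<in> verts (quiver DGG)" for x
  proof -
    have "x \<in> verts (skew_quiver n \<zeta> (skew_gquiver n \<zeta> (gquiver_of Q G g \<rho> \<E>)))"
      using that unfolding DGG_def DG_def D_def DG_simps .
    from F_vGG[OF this] show ?thesis unfolding vGG D_def .
  qed
  moreover have "DD.F (aGG y) = phi_scale n D y \<odot>\<^bsub>\<Lambda>\<^esub> jac_class Q W (arrow_elt Q (phi_a n D y))"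
    if "y \<in> arcs (quiver DGG)" for y
  proof -
    have "y \<in> arcs (skew_quiver n \<zeta> (skew_gquiver n \<zeta> (gquiver_of Q G g \<rho> \<E>)))"
      using that unfolding DGG_def DG_def D_def DG_simps .
    from F_aGG[OF this] show ?thesis unfolding aGG D_def \<Lambda>_def .
  qed
  moreover have "quiver_iso (quiver DGG) Q (phi_v D) (phi_a n D)"
    using phi_quiver_iso unfolding DGG_def DG_def D_def DG_simps .
  ultimately show ?thesis by blast
qed


end
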